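(* Fix any $0<p_2<p_1<1$. For all $s,d\in\mathbb{N}$ and every threshold $r>s$, there exists a data structure for data-dependent hashing over $\mathsf{EMD}_s(\{0,1\}^d)$ with an $(r,cr,p_1,p_2)$-sensitive family, where $$c=\tilde O\!\left(\frac{1}{1-p_1}\cdot\log\!\left(\frac{1}{p_2}\right)\cdot\log\!\left(\frac{sd}{p_2}\right)\right).$$ The data structure has initialization time $I_{\mathsf h}(n)\le n\cdot\mathrm{poly}(sd/((1-p_1)p_2))$ and query time $\mathrm{poly}(sd)$.
   Context: $\mathsf{EMD}_s(\{0,1\}^d)$ is the metric space of multisets of $s$ vectors in $\{0,1\}^d$ with $\mathsf{EMD}(x,y)=\min_{\pi}\sum_{i=1}^s\|x_i-y_{\pi(i)}\|_1$ over bijections $\pi:[s]\to[s]$ (Hamming ground distance). For a metric $(Y,d_Y)$, distribution $\mu$ on $Y$, $r>0$, $c\ge 1$, a distribution $\mathcal{D}$ over maps $h:Y\to U$ is $(r,cr,p_1,p_2)$-sensitive for $\mu$ if (1) $\Pr_{h\sim\mathcal D}[h(x)=h(y)]\ge p_1$ whenever $d_Y(x,y)\le r$, and (2) for every $x\in Y$, $\Pr_{h\sim\mathcal D,y\sim\mu}[d_Y(x,y)>cr\text{ and }h(x)=h(y)]\le p_2$. A data structure for data-dependent hashing with an $(r,cr,p_1,p_2)$-sensitive family preprocesses the description of any distribution $\mu$ on $Y$ and maintains a draw of $h$ from a family that is $(r,cr,p_1,p_2)$-sensitive for $\mu$; on query $q\in Y$ it outputs $h(q)$. $I_{\mathsf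 h}(n)$ is the time to initialize it with a distribution supported on $n$ points; the query time is worst case. $\tilde O(f)$ hides factors polylogarithmic in $f$. *)

theory Defs
  imports "HOL-Analysis.Analysis" "HOL-Probability.Probability"
begin

section \<open>The Earth Mover's Distance over the hypercube\<close>

text \<open>A vector of the hypercube is a \<^typ>\<open>bool list\<close> of length \<open>d\<close>, a point is a multiset of
  \<open>s\<close> such vectors.\<close>

type_synonym point = "bool list multiset"

definition l1_dist :: "bool list \<Rightarrow> bool list \<Rightarrow> real" where
  "l1_dist x y = (\<Sum>k<length x. \<bar>of_bool (x ! k) - of_bool (y ! k)\<bar>)"

definition EMD_points :: "nat \<Rightarrow> nat \<Rightarrow> point set" where
  "EMD_points s d = {X. size X = s \<and> (\<forall>v\<in>#X. length v = d)}"

definition matching_cost :: "bool list list \<Rightarrow> bool list list \<Rightarrow> (nat \<Rightarrow> nat) \<Rightarrow> real" where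
  "matching_cost xs ys \<pi> = (\<Sum>i<length xs. l1_dist (xs ! i) (ys ! \<pi> i))"

text \<open>The minimum also ranges over the enumerations of the two multisets; by \<open>emd_mset\<close> below, it
  is attained in every fixed pair of enumerations.\<close>

definition emd :: "point \<Rightarrow> point \<Rightarrow> real" where
  "emd X Y = Min {matching_cost xs ys \<pi> | xs ys \<pi>.
                    mset xs = X \<and> mset ys = Y \<and> \<pi> permutes {..<size X}}"

lemma emd_costs_eq:
  assumes "length xs = length ys"
  shows "{matching_cost xs' ys' \<pi> | xs' ys' \<pi>.
            mset xs' = mset xs \<and> mset ys' = mset ys \<and> \<pi> permutes {..<size (mset xs)}}
       = matching_cost xs ys ` {\<pi>. \<pi> permutes {..<length xs}}" (is "?L = ?R")
proof
  show "?R \<subseteq> ?L" by auto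
next
  show "?L \<subseteq> ?R"
  proof
    fix c assume "c \<in> ?L"
    then obtain xs' ys' \<pi> where c: "c = matching_cost xs' ys' \<pi>"
      and mx: "mset xs' = mset xs" and my: "mset ys' = mset ys"
      and p: "\<pi> permutes {..<length xs}" by auto
    obtain f where f: "f permutes {..<length xs}" "permute_list f xs = xs'"
      using mset_eq_permutation[OF mx] by blast
    obtain g where g: "g permutes {..<length ys}" "permute_list g ys = ys'"
      using mset_eq_permutation[OF my] by blast
    have g': "g permutes {..<length xs}" using g assms by simp
    let ?q = "g \<circ> \<pi> \<circ> inv f"
    have q: "?q permutes {..<length xs}"
      by (intro permutes_compose permutes_inv f p g')
    have l: "length xs' = length xs" using f by auto
    have "c = (\<Sum>i<length xs. l1_dist (xs ! f i) (ys ! g (\<pi> i)))"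
      unfolding c matching_cost_def l
    proof (rule sum.cong[OF refl])
      fix i assume i: "i \<in> {..<length xs}"
      have "\<pi> i \<in> {..<length ys}" using i permutes_in_image[OF p] assms by auto
      then show "l1_dist (xs' ! i) (ys' ! \<pi> i) = l1_dist (xs ! f i) (ys ! g (\<pi> i))"
        using i f g permute_list_nth by (metis lessThan_iff)
    qed
    also have "\<dots> = (\<Sum>i<length xs. l1_dist (xs ! f i) (ys ! ?q (f i)))"
      using permutes_inverses[OF f(1)] by simp
    also have "\<dots> = matching_cost xs ys ?q"
      unfolding matching_cost_def
      using sum.permute[OF f(1), of "\<lambda>i. l1_dist (xs ! i) (ys ! ?q i)"] by (simp add: o_def)
    finally show "c \<in> ?R" using q by blast
  qed
qed

lemma emd_mset:
  assumes "length xs = length ys"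
  shows "emd (mset xs) (mset ys) = Min (matching_cost xs ys ` {\<pi>. \<pi> permutes {..<length xs}})"
  unfolding emd_def emd_costs_eq[OF assms] ..

lemma emd_le:
  assumes "length xs = length ys" "\<pi> permutes {..<length xs}"
  shows "emd (mset xs) (mset ys) \<le> matching_cost xs ys \<pi>"
  unfolding emd_mset[OF assms(1)] using assms
  by (intro Min_le finite_imageI finite_permutations) auto

lemma emd_attained:
  assumes "length xs = length ys"
  obtains \<pi> where "\<pi> permutes {..<length xs}" "emd (mset xs) (mset ys) = matching_cost xs ys \<pi>"
proof -
  have "id permutes {..<length xs}" by (rule permutes_id)
  then have "{\<pi>. \<pi> permutes {..<length xs}} \<noteq> {}" by blast
  then have "emd (mset xs) (mset ys) \<in> matching_cost xs ys ` {\<pi>. \<pi> permutes {..<length xs}}"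
    unfolding emd_mset[OF assms] by (intro Min_in finite_imageI finite_permutations) auto
  then show ?thesis using that by blast
qed

lemma l1_dist_nonneg: "0 \<le> l1_dist x y"
  by (simp add: l1_dist_def sum_nonneg)

lemma l1_dist_commute: "length x = length y \<Longrightarrow> l1_dist x y = l1_dist y x"
  by (simp add: l1_dist_def abs_minus_commute)

lemma l1_dist_refl: "l1_dist x x = 0"
  by (simp add: l1_dist_def)

lemma l1_dist_zeroD: "length x = length y \<Longrightarrow> l1_dist x y = 0 \<Longrightarrow> x = y"
  by (rule nth_equalityI) (auto simp: l1_dist_def sum_nonneg_eq_0_iff of_bool_eq_iff)

lemma l1_dist_triangle:
  "length x = length y \<Longrightarrow> l1_dist x z \<le> l1_dist x y + l1_dist y z"
  unfolding l1_dist_def by (simp add: sum.distrib[symmetric]) (intro sum_mono, linarith)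

lemma Metric_space_EMD:
  "Metric_space (EMD_points s d)
     (\<lambda>X Y. if X \<in> EMD_points s d \<and> Y \<in> EMD_points s d then emd X Y else 0)"
proof -
  have nonneg: "0 \<le> matching_cost xs ys \<pi>" for xs ys \<pi>
    by (simp add: matching_cost_def sum_nonneg l1_dist_nonneg)
  have repr: "\<exists>xs. mset xs = X \<and> length xs = s \<and> (\<forall>i<s. length (xs ! i) = d)"
    if X: "X \<in> EMD_points s d" for X
  proof -
    obtain xs where "mset xs = X" using ex_mset by blast
    with X show ?thesis by (intro exI[of _ xs]) (auto simp: EMD_points_def)
  qed
  have le: "emd Y X \<le> emd X Y" if XY: "X \<in> EMD_points s d" "Y \<in> EMD_points s d" for X Y
  proof -
    obtain xs where xs: "mset xs = X" "length xs = s" "\<forall>i<s. length (xs ! i) = d"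
      using repr[OF XY(1)] by blast
    obtain ys where ys: "mset ys = Y" "length ys = s" "\<forall>i<s. length (ys ! i) = d"
      using repr[OF XY(2)] by blast
    obtain \<pi> where p: "\<pi> permutes {..<s}" "emd X Y = matching_cost xs ys \<pi>"
      using emd_attained[of xs ys] xs ys by metis
    have "matching_cost ys xs (inv \<pi>) = (\<Sum>i<s. l1_dist (ys ! \<pi> i) (xs ! inv \<pi> (\<pi> i)))"
      unfolding matching_cost_def ys
      using sum.permute[OF p(1), of "\<lambda>i. l1_dist (ys ! i) (xs ! inv \<pi> i)"] by (simp add: o_def)
    also have "\<dots> = (\<Sum>i<s. l1_dist (xs ! i) (ys ! \<pi> i))"
    proof (rule sum.cong[OF refl])
      fix i assume "i \<in> {..<s}"
      moreover from this have "\<pi> i < s" using permutes_in_image[OF p(1)] by auto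
      ultimately show "l1_dist (ys ! \<pi> i) (xs ! inv \<pi> (\<pi> i)) = l1_dist (xs ! i) (ys ! \<pi> i)"
        using xs ys permutes_inverses[OF p(1)] by (simp add: l1_dist_commute)
    qed
    also have "\<dots> = emd X Y" using p xs by (simp add: matching_cost_def)
    finally show ?thesis
      using emd_le[of ys xs "inv \<pi>"] xs ys permutes_inv[OF p(1)] by simp
  qed
  show ?thesis
  proof
    fix X Y
    show "0 \<le> (if X \<in> EMD_points s d \<and> Y \<in> EMD_points s d then emd X Y else 0)"
    proof (cases "X \<in> EMD_points s d \<and> Y \<in> EMD_points s d")
      case True
      obtain xs ys where "mset xs = X" "mset ys = Y" by (meson ex_mset)
      then have "0 \<le> emd X Y"
        using emd_attained[of xs ys] nonneg True
        by (metis (mono_tags, lifting) EMD_points_def mem_Collect_eq size_mset)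
      then show ?thesis by simp
    qed auto
  next
    fix X Y
    show "(if X \<in> EMD_points s d \<and> Y \<in> EMD_points s d then emd X Y else 0)
        = (if Y \<in> EMD_points s d \<and> X \<in> EMD_points s d then emd Y X else 0)"
      using le by (auto intro: antisym)
  next
    fix X Y assume XY: "X \<in> EMD_points s d" "Y \<in> EMD_points s d"
    obtain xs where xs: "mset xs = X" "length xs = s" "\<forall>i<s. length (xs ! i) = d"
      using repr[OF XY(1)] by blast
    obtain ys where ys: "mset ys = Y" "length ys = s" "\<forall>i<s. length (ys ! i) = d"
      using repr[OF XY(2)] by blast
    obtain \<pi> where p: "\<pi> permutes {..<s}" "emd X Y = matching_cost xs ys \<pi>"
      using emd_attained[of xs ys] xs ys by metis
    have "emd X Y = 0 \<longleftrightarrow> X = Y"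
    proof
      assume "emd X Y = 0"
      then have *: "\<forall>i<s. l1_dist (xs ! i) (ys ! \<pi> i) = 0"
        using p xs by (simp add: matching_cost_def sum_nonneg_eq_0_iff l1_dist_nonneg)
      have pi: "\<pi> i < s" if "i < s" for i using permutes_in_image[OF p(1)] that by auto
      have "xs = permute_list \<pi> ys"
        using * xs ys p pi by (intro nth_equalityI l1_dist_zeroD) (simp_all add: permute_list_nth)
      then show "X = Y" using xs ys p by (metis mset_permute_list)
    next
      assume eq: "X = Y"
      have "matching_cost xs xs id = 0" by (simp add: matching_cost_def l1_dist_refl)
      then have "emd X X \<le> 0" using emd_le[of xs xs id] xs permutes_id by metis
      then show "emd X Y = 0" using p nonneg[of xs ys \<pi>] eq by simp
    qed
    then show "(if X \<in> EMD_points s d \<and> Y \<in> EMD_points s d then emd X Y else 0) = 0 \<longleftrightarrow> X = Y"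
      using XY by simp
  next
    fix X Y Z
    assume XYZ: "X \<in> EMD_points s d" "Y \<in> EMD_points s d" "Z \<in> EMD_points s d"
    obtain xs where xs: "mset xs = X" "length xs = s" "\<forall>i<s. length (xs ! i) = d"
      using repr[OF XYZ(1)] by blast
    obtain ys where ys: "mset ys = Y" "length ys = s" "\<forall>i<s. length (ys ! i) = d"
      using repr[OF XYZ(2)] by blast
    obtain zs where zs: "mset zs = Z" "length zs = s" "\<forall>i<s. length (zs ! i) = d"
      using repr[OF XYZ(3)] by blast
    obtain p where p: "p permutes {..<s}" "emd X Y = matching_cost xs ys p"
      using emd_attained[of xs ys] xs ys by metis
    obtain q where q: "q permutes {..<s}" "emd Y Z = matching_cost ys zs q"
      using emd_attained[of ys zs] ys zs by metis
    have pi: "p i < s" if "i < s" for i using permutes_in_image[OF p(1)] that by auto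
    have "emd X Z \<le> matching_cost xs zs (q \<circ> p)"
      using emd_le[of xs zs "q \<circ> p"] xs zs permutes_compose[OF p(1) q(1)] by simp
    also have "\<dots> \<le> (\<Sum>i<s. l1_dist (xs ! i) (ys ! p i) + l1_dist (ys ! p i) (zs ! q (p i)))"
      unfolding matching_cost_def xs using xs ys pi
      by (auto intro!: sum_mono l1_dist_triangle)
    also have "\<dots> = matching_cost xs ys p + (\<Sum>i<s. l1_dist (ys ! p i) (zs ! q (p i)))"
      by (simp add: matching_cost_def sum.distrib xs)
    also have "(\<Sum>i<s. l1_dist (ys ! p i) (zs ! q (p i))) = matching_cost ys zs q"
      unfolding matching_cost_def ys
      using sum.permute[OF p(1), of "\<lambda>i. l1_dist (ys ! i) (zs ! q i)"] by (simp add: o_def)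
    finally have "emd X Z \<le> emd X Y + emd Y Z" using p q by simp
    then show "(if X \<in> EMD_points s d \<and> Z \<in> EMD_points s d then emd X Z else 0)
        \<le> (if X \<in> EMD_points s d \<and> Y \<in> EMD_points s d then emd X Y else 0)
          + (if Y \<in> EMD_points s d \<and> Z \<in> EMD_points s d then emd Y Z else 0)"
      using XYZ by simp
  qed
qed

section \<open>Data-dependent sensitive families\<close>

text \<open>The metric spaces of interest are finite and hash values are natural numbers, so that every
  distribution over maps is a \<^type>\<open>pmf\<close>.\<close>

definition sensitive ::
  "'y set \<Rightarrow> ('y \<Rightarrow> 'y \<Rightarrow> real) \<Rightarrow> 'y pmf \<Rightarrow> real \<Rightarrow> real \<Rightarrow> real \<Rightarrow> real \<Rightarrow> ('y \<Rightarrow> 'u) pmf \<Rightarrow> bool"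
where
  "sensitive Y \<delta> \<mu> r R p\<^sub>1 p\<^sub>2 D \<longleftrightarrow>
     (\<forall>x\<in>Y. \<forall>y\<in>Y. \<delta> x y \<le> r \<longrightarrow> measure_pmf.prob D {h. h x = h y} \<ge> p\<^sub>1) \<and>
     (\<forall>x\<in>Y. measure_pmf.prob (pair_pmf D \<mu>) {(h, y). \<delta> x y > R \<and> h x = h y} \<le> p\<^sub>2)"

section \<open>The machine model\<close>

text \<open>
  A randomized real RAM with structured control.  Memory consists of natural-number cells and real
  cells; there are two read-only input tapes, one of each kind.  Every instruction and every
  evaluation of a test costs one unit.  The natural-number arithmetic is that of the
  unit-cost RAM with addition and (truncated) subtraction: there is no unit-cost multiplication of
  naturals, and no floor function or other cast from reals to naturals, either of which would make
  unit cost unreasonable.  Real cells are needed since the weights of a distribution are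
  arbitrary reals.  The only source of randomness is the uniform choice from \<open>{0..<m}\<close>.
\<close>

type_synonym memory = "(nat \<Rightarrow> nat) \<times> (nat \<Rightarrow> real)"
type_synonym input = "nat list \<times> real list"

text \<open>The arguments of instructions and tests are addresses of cells, except for the second
  argument of \<open>Const\<close>; the target comes first (for \<open>Store\<close> and \<open>RStore\<close>: the cell that contains
  the target address).\<close>

datatype instr =
    Const nat nat | Load nat nat | Store nat nat | Input nat nat
  | Add nat nat nat | Sub nat nat nat | Random nat nat
  | Cast nat nat | RLoad nat nat | RStore nat nat | RInput nat nat
  | RAdd nat nat nat | RSub nat nat nat | RMul nat nat nat | RDiv nat nat nat

datatype test = Less nat nat | RLess nat nat

datatype com = Instr instr | If test "com list" "com list" | While test "com list"

type_synonym program = "com list"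

definition tape :: "'a::zero list \<Rightarrow> nat \<Rightarrow> 'a" where
  "tape xs i = (if i < length xs then xs ! i else 0)"

definition uniform_below :: "nat \<Rightarrow> nat pmf" where
  "uniform_below m = (if m = 0 then return_pmf 0 else pmf_of_set {..<m})"

fun exec :: "input \<Rightarrow> instr \<Rightarrow> memory \<Rightarrow> memory pmf" where
  "exec (I, J) (Const a n) (M, R) = return_pmf (M(a := n), R)"
| "exec (I, J) (Load a b) (M, R) = return_pmf (M(a := M (M b)), R)"
| "exec (I, J) (Store a b) (M, R) = return_pmf (M(M a := M b), R)"
| "exec (I, J) (Input a b) (M, R) = return_pmf (M(a := tape I (M b)), R)"
| "exec (I, J) (Add a b c) (M, R) = return_pmf (M(a := M b + M c), R)"
| "exec (I, J) (Sub a b c) (M, R) = return_pmf (M(a := M b - M c), R)"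
| "exec (I, J) (Random a b) (M, R) = map_pmf (\<lambda>v. (M(a := v), R)) (uniform_below (M b))"
| "exec (I, J) (Cast a b) (M, R) = return_pmf (M, R(a := real (M b)))"
| "exec (I, J) (RLoad a b) (M, R) = return_pmf (M, R(a := R (M b)))"
| "exec (I, J) (RStore a b) (M, R) = return_pmf (M, R(M a := R b))"
| "exec (I, J) (RInput a b) (M, R) = return_pmf (M, R(a := tape J (M b)))"
| "exec (I, J) (RAdd a b c) (M, R) = return_pmf (M, R(a := R b + R c))"
| "exec (I, J) (RSub a b c) (M, R) = return_pmf (M, R(a := R b - R c))"
| "exec (I, J) (RMul a b c) (M, R) = return_pmf (M, R(a := R b * R c))"
| "exec (I, J) (RDiv a b c) (M, R) = return_pmf (M, R(a := R b / R c))"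

fun holds :: "test \<Rightarrow> memory \<Rightarrow> bool" where
  "holds (Less a b) (M, R) \<longleftrightarrow> M a < M b"
| "holds (RLess a b) (M, R) \<longleftrightarrow> R a < R b"

text \<open>A configuration consists of the commands that remain to be executed and the memory.\<close>

fun step :: "input \<Rightarrow> program \<times> memory \<Rightarrow> (program \<times> memory) pmf" where
  "step \<iota> ([], \<sigma>) = return_pmf ([], \<sigma>)"
| "step \<iota> (Instr i # cs, \<sigma>) = map_pmf (\<lambda>\<tau>. (cs, \<tau>)) (exec \<iota> i \<sigma>)"
| "step \<iota> (If b as bs # cs, \<sigma>) = return_pmf ((if holds b \<sigma> then as else bs) @ cs, \<sigma>)"
| "step \<iota> (While b as # cs, \<sigma>) =
     return_pmf (if holds b \<sigma> then as @ While b as # cs else cs, \<sigma>)"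

fun run :: "input \<Rightarrow> nat \<Rightarrow> program \<times> memory \<Rightarrow> (program \<times> memory) pmf" where
  "run \<iota> 0 \<kappa> = return_pmf \<kappa>"
| "run \<iota> (Suc t) \<kappa> = bind_pmf (step \<iota> \<kappa>) (run \<iota> t)"

definition halts_within :: "nat \<Rightarrow> input \<Rightarrow> program \<Rightarrow> memory \<Rightarrow> bool" where
  "halts_within T \<iota> P \<sigma> \<longleftrightarrow> (\<forall>\<kappa>\<in>set_pmf (run \<iota> T (P, \<sigma>)). fst \<kappa> = [])"

definition final_memory :: "nat \<Rightarrow> input \<Rightarrow> program \<Rightarrow> memory \<Rightarrow> memory pmf" where
  "final_memory T \<iota> P \<sigma> = map_pmf snd (run \<iota> T (P, \<sigma>))"

definition empty_memory :: memory where
  "empty_memory = (\<lambda>_. 0, \<lambda>_. 0)"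

definition hash_output :: "memory \<Rightarrow> nat" where
  "hash_output \<sigma> = fst \<sigma> 0"

section \<open>Data structures for data-dependent hashing over EMD\<close>

text \<open>A point is presented to a program by the coordinates of its vectors, enumerated in any
  order; a distribution by its support points together with their probabilities.  The parameters are
  part of the input of the initialization, so that a single pair of programs serves all of them.
  A query reads only the query point and the memory.\<close>

definition encode_point :: "bool list list \<Rightarrow> nat list" where
  "encode_point xs = map of_bool (concat xs)"

definition describes :: "(bool list list \<times> real) list \<Rightarrow> point pmf \<Rightarrow> bool" where
  "describes zs \<mu> \<longleftrightarrow>
     distinct (map (\<lambda>(xs, w). mset xs) zs) \<and>
     (\<lambda>(xs, w). mset xs) ` set zs = set_pmf \<mu> \<and>
     (\<forall>(xs, w)\<in>set zs. w = pmf \<mu> (mset xs))"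

definition init_input ::
  "nat \<Rightarrow> nat \<Rightarrow> real \<Rightarrow> real \<Rightarrow> real \<Rightarrow> (bool list list \<times> real) list \<Rightarrow> input" where
  "init_input s d r p\<^sub>1 p\<^sub>2 zs =
     ([s, d, length zs] @ concat (map (\<lambda>(xs, w). encode_point xs) zs),
      [r, p\<^sub>1, p\<^sub>2] @ map snd zs)"

definition query_input :: "bool list list \<Rightarrow> input" where
  "query_input xs = (encode_point xs, [])"

text \<open>In memory \<open>\<sigma>\<close> the data structure maintains the hash function \<open>h\<close>: any sequence of queries is
  answered according to \<open>h\<close>, where each query leaves the data structure in a memory in which this
  is still the case.\<close>

definition maintains ::
  "nat \<Rightarrow> nat \<Rightarrow> program \<Rightarrow> nat \<Rightarrow> (point \<Rightarrow> nat) \<Rightarrow> memory \<Rightarrow> bool" where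
  "maintains s d Query T h \<sigma> \<longleftrightarrow>
     (\<exists>Inv. \<sigma> \<in> Inv \<and>
        (\<forall>\<tau>\<in>Inv. \<forall>xs. mset xs \<in> EMD_points s d \<longrightarrow>
           halts_within T (query_input xs) Query \<tau> \<and>
           (\<forall>\<tau>'\<in>set_pmf (final_memory T (query_input xs) Query \<tau>).
              \<tau>' \<in> Inv \<and> hash_output \<tau>' = h (mset xs))))"

text \<open>\<open>H\<close> assigns to the memory after initialization the hash function that it represents, so that
  the family is the distribution of \<open>H\<close> over the random choices of the initialization.
  Initialization with a distribution supported on \<open>n\<close> points takes at most \<open>TI n\<close> steps, a query
  at most \<open>TQ\<close> steps, in the worst case.\<close>

definition data_dependent_hashing ::
  "nat \<Rightarrow> nat \<Rightarrow> real \<Rightarrow> real \<Rightarrow> real \<Rightarrow> real \<Rightarrow> program \<Rightarrow> program \<Rightarrow> (nat \<Rightarrow> nat) \<Rightarrow> nat \<Rightarrow> bool"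
where
  "data_dependent_hashing s d r c p\<^sub>1 p\<^sub>2 Init Query TI TQ \<longleftrightarrow>
     (\<forall>\<mu> zs. set_pmf \<mu> \<subseteq> EMD_points s d \<and> describes zs \<mu> \<longrightarrow>
        (let \<iota> = init_input s d r p\<^sub>1 p\<^sub>2 zs;
             S = final_memory (TI (length zs)) \<iota> Init empty_memory
         in halts_within (TI (length zs)) \<iota> Init empty_memory \<and>
            (\<exists>H. (\<forall>\<sigma>\<in>set_pmf S. maintains s d Query TQ (H \<sigma>) \<sigma>) \<and>
                 sensitive (EMD_points s d) emd \<mu> r (c * r) p\<^sub>1 p\<^sub>2 (map_pmf H S))))"

section \<open>Asymptotic bounds\<close>

text \<open>As usual in asymptotic notation, a quantity inside \<open>O\<close>-tilde is read as being at least 1.  For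
  the bound on \<open>c\<close> this only matters up to constants, unless \<open>s = d = 1\<close> and \<open>p\<^sub>2\<close> is close to 1,
  where the expression tends to 0 whereas \<open>c \<ge> 1\<close>.\<close>

definition soft_O_bound :: "real \<Rightarrow> nat \<Rightarrow> real \<Rightarrow> real" where
  "soft_O_bound C k f = C * max 1 f * (1 + ln (max 1 f)) ^ k"

definition poly_bound :: "real \<Rightarrow> nat \<Rightarrow> real \<Rightarrow> real" where
  "poly_bound C k x = C * x ^ k"

end

theory Submission imports Defs
begin

text \<open>The coordinates of a vector are revealed in blocks \<open>j < J\<close>, where block \<open>j\<close> reveals each coordinate with
  probability about \<open>2^j / d\<close>; the revealed bits place the vector in a tree.  A node of the tree is represented by
  the first of \<open>N\<close> samples from the average marginal of \<open>\<mu>\<close> that reaches it, and a point is mapped to the multiset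
  of all pairs of a node and a coordinate in which the representative of the node differs from that of its
  predecessor, one block earlier.  If two points share no node without a sample, which is unlikely when one of
  them is drawn from \<open>\<mu>\<close>, then their multisets differ in at least as many elements as their distance.
  Conversely, the expected difference is at most \<open>O(J + log N)\<close> times the distance: a coordinate revealed in
  block \<open>j\<close> costs the distance from the vector to the representative of its node, and up to \<open>O(1)\<close> per block
  this is paid for by the decrease of \<open>ln (1 + N \<nu>(A))\<close>, where \<open>\<nu>(A)\<close> is the mass of the node.  The hash value of
  a point is the set of those elements of its multiset that survive a sampling with rate \<open>1 / G\<close>.\<close>

section \<open>Trees of samples\<close>

text \<open>What shapes the estimate is that a single block may cost about \<open>ln N\<close>, so
  bounding each block separately would give the product of \<open>J\<close> and \<open>ln N\<close>.
  Charging all blocks to the decrease of one potential, which lies between 0 and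
  \<open>ln (1 + N)\<close>, turns the product into a sum. A second obstacle is dependence: a
  coordinate is charged only when it is revealed, but its revelation also changes the node that
  fixes the charge.

  The factor \<open>c\<close> is the quotient of two demands on \<open>G\<close>: near points must
  differ in at most \<open>(1 - p\<^sub>1) * G\<close> expected elements, far ones in at least
  \<open>2 * G * ln (1 / p\<^sub>2)\<close>. Both \<open>J\<close> and \<open>ln N\<close> are
  bounded by multiples of the number of doublings that produce \<open>N\<close>, which is how the
  machine gets by without logarithms.

  The query time must not depend on \<open>p\<^sub>1\<close> and \<open>p\<^sub>2\<close> although
  \<open>N\<close> does. A query therefore never searches the samples; it uses node codes as
  addresses in memory, and it obtains a set of cells as a sum of distinct powers of two. Thresholds
  \<open>r \<ge> s * d\<close> are met by a constant hash function.\<close>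

definition dm :: "'a multiset \<Rightarrow> 'a multiset \<Rightarrow> nat" where
  "dm A B = size (A - B) + size (B - A)"

lemma dm_refl [simp]: "dm A A = 0"
  by (simp add: dm_def)

lemma dm_cancel [simp]: "dm (A + C) (B + C) = dm A B" "dm (C + A) (C + B) = dm A B"
  by (simp_all add: dm_def)

lemma dm_le_size: "dm A B \<le> size A + size B"
  unfolding dm_def by (intro add_mono size_mset_mono) auto

lemma dm_disjoint:
  assumes "set_mset A \<inter> set_mset B = {}"
  shows "dm A B = size A + size B"
proof -
  have *: "count A x = 0 \<or> count B x = 0" for x
    using assms by (metis disjoint_iff not_in_iff)
  have "A - B = A" "B - A = B"
    using * by (auto intro!: multiset_eqI) (metis diff_zero diff_0_eq_0)+
  then show ?thesis by (simp add: dm_def)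
qed

lemma dm_add_le: "dm (A + B) (A' + B') \<le> dm A A' + dm B B'"
proof -
  have "(A + B) - (A' + B') \<subseteq># (A - A') + (B - B')"
    and "(A' + B') - (A + B) \<subseteq># (A' - A) + (B' - B)"
    by (auto simp: subseteq_mset_def)
  from this[THEN size_mset_mono] show ?thesis by (simp add: dm_def)
qed

lemma dm_add_separate:
  assumes "(set_mset A \<union> set_mset A') \<inter> (set_mset B \<union> set_mset B') = {}"
  shows "dm (A + B) (A' + B') = dm A A' + dm B B'"
proof -
  have *: "(A + B) - (A' + B') = (A - A') + (B - B')"
    if "(set_mset A \<union> set_mset A') \<inter> (set_mset B \<union> set_mset B') = {}" for A A' B B' :: "'a multiset"
  proof (rule multiset_eqI)
    fix x
    have "x \<notin># A \<and> x \<notin># A' \<or> x \<notin># B \<and> x \<notin># B'" using that by blast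
    then show "count ((A + B) - (A' + B')) x = count ((A - A') + (B - B')) x"
      by (auto simp: not_in_iff)
  qed
  have "(set_mset A' \<union> set_mset A) \<inter> (set_mset B' \<union> set_mset B) = {}" using assms by blast
  from *[OF assms] *[OF this] show ?thesis by (simp add: dm_def)
qed

lemma dm_sum_le: "dm (\<Sum>i\<in>I. A i) (\<Sum>i\<in>I. B i) \<le> (\<Sum>i\<in>I. dm (A i) (B i))"
proof (induction I rule: infinite_finite_induct)
  case (insert x F)
  then show ?case using dm_add_le[of "A x" "sum A F" "B x" "sum B F"] by simp
qed auto

lemma dm_sum_mset_le:
  "dm (\<Sum>z\<in>#M. A z) (\<Sum>z\<in>#M. B z) \<le> (\<Sum>z\<in>#M. dm (A z) (B z))"
proof (induction M)
  case (add z M)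
  then show ?case using dm_add_le[of "A z" "\<Sum>z\<in>#M. A z" "B z" "\<Sum>z\<in>#M. B z"] by simp
qed auto

section \<open>Hamming distances as cardinalities and couplings as multisets of pairs\<close>

lemma l1_dist_card:
  assumes "length x = d"
  shows "l1_dist x y = card {k. k < d \<and> x ! k \<noteq> y ! k}"
proof -
  have "l1_dist x y = (\<Sum>k<d. of_bool (x ! k \<noteq> y ! k))"
    unfolding l1_dist_def assms by (intro sum.cong) auto
  also have "\<dots> = card {k. k < d \<and> x ! k \<noteq> y ! k}"
    by (simp add: Int_def)
  finally show ?thesis .
qed

text \<open>A coupling is a multiset of pairs with the two points as projections. Any enumeration of
  it lists both points in matching order, so the identity permutation has exactly its cost.\<close>

lemma emd_le_coupling:
  assumes "image_mset fst M = X" "image_mset snd M = Y"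
  shows "emd X Y \<le> (\<Sum>z\<in>#M. l1_dist (fst z) (snd z))"
proof -
  obtain zs where zs: "mset zs = M" using ex_mset by blast
  have "emd (mset (map fst zs)) (mset (map snd zs)) \<le> matching_cost (map fst zs) (map snd zs) id"
    by (rule emd_le) (auto simp: permutes_id)
  also have "\<dots> = (\<Sum>i<length zs. l1_dist (fst (zs ! i)) (snd (zs ! i)))"
    unfolding matching_cost_def by simp
  also have "\<dots> = (\<Sum>z\<leftarrow>zs. l1_dist (fst z) (snd z))"
    by (simp add: sum_list_sum_nth atLeast0LessThan)
  also have "\<dots> = (\<Sum>z\<in>#M. l1_dist (fst z) (snd z))"
    by (simp flip: zs add: sum_mset_sum_list flip: mset_map)
  finally show ?thesis using assms zs by simp
qed

lemma emd_coupling: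
  assumes "X \<in> EMD_points s d" "Y \<in> EMD_points s d"
  obtains M where "image_mset fst M = X" "image_mset snd M = Y"
    "emd X Y = (\<Sum>z\<in>#M. l1_dist (fst z) (snd z))"
proof -
  obtain xs where xs: "mset xs = X" using ex_mset by blast
  obtain ys where ys: "mset ys = Y" using ex_mset by blast
  have l: "length xs = length ys"
    using assms xs ys by (auto simp: EMD_points_def)
  obtain p where p: "p permutes {..<length xs}" "emd (mset xs) (mset ys) = matching_cost xs ys p"
    using emd_attained[OF l] by blast
  let ?zs = "zip xs (permute_list p ys)"
  have "mset (permute_list p ys) = Y" using p l ys by simp
  moreover have "map fst ?zs = xs" "map snd ?zs = permute_list p ys" using l by simp_all
  ultimately have 1: "image_mset fst (mset ?zs) = X" "image_mset snd (mset ?zs) = Y"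
    using xs by (simp_all only: mset_map[symmetric])
  have "(\<Sum>z\<in>#mset ?zs. l1_dist (fst z) (snd z)) = (\<Sum>i<length xs. l1_dist (xs ! i) (ys ! p i))"
    using l p by (subst mset_map[symmetric], subst sum_mset_sum_list,
        simp add: sum_list_sum_nth atLeast0LessThan permute_list_nth)
  then show ?thesis using that[OF 1] p xs ys by (simp add: matching_cost_def)
qed

section \<open>The tree cut out by the revealed bits\<close>

locale trie =
  fixes d N :: nat and u :: "nat \<Rightarrow> nat" and b :: "nat \<Rightarrow> bool list"
begin

text \<open>Position \<open>l * d + k\<close> stands for coordinate \<open>k\<close> in block \<open>l\<close>, which is revealed iff \<open>u (l * d + k) < 2 ^ l\<close>.
  A hidden coordinate contributes the bit \<^const>\<open>False\<close>, so that nodes are plain bit strings.\<close>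

definition bitat :: "bool list \<Rightarrow> nat \<Rightarrow> bool" where
  "bitat a m \<longleftrightarrow> u m < 2 ^ (m div d) \<and> a ! (m mod d)"

definition pre :: "nat \<Rightarrow> bool list \<Rightarrow> bool list" where
  "pre m a = map (bitat a) [0..<m]"

definition occ :: "bool list \<Rightarrow> bool" where
  "occ w \<longleftrightarrow> (\<exists>i<N. pre (length w) (b i) = w)"

definition ix :: "bool list \<Rightarrow> nat" where
  "ix w = (LEAST i. i < N \<and> pre (length w) (b i) = w)"

text \<open>A path stops at the first node that no sample reaches; from there on, the vector represents itself.\<close>

primrec nd :: "nat \<Rightarrow> bool list \<Rightarrow> bool list" where
  "nd 0 a = []"
| "nd (Suc m) a = (if occ (nd m a) then nd m a @ [bitat a m] else nd m a)"

definition rp :: "nat \<Rightarrow> bool list \<Rightarrow> bool list" where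
  "rp m a = (if occ (nd m a) then b (ix (nd m a)) else a)"

definition diffs :: "nat \<Rightarrow> bool list \<Rightarrow> nat set" where
  "diffs j a = {k. k < d \<and> rp (j * d) a ! k \<noteq> rp (Suc j * d) a ! k}"

definition feats :: "nat \<Rightarrow> bool list \<Rightarrow> (bool list \<times> nat) multiset" where
  "feats j a = image_mset (Pair (nd (Suc j * d) a)) (mset_set (diffs j a))"

definition vfeats :: "nat \<Rightarrow> bool list \<Rightarrow> (bool list \<times> nat) multiset" where
  "vfeats J a = (\<Sum>j<J. feats j a)"

definition pfeats :: "nat \<Rightarrow> point \<Rightarrow> (bool list \<times> nat) multiset" where
  "pfeats J X = (\<Sum>a\<in>#X. vfeats J a)"

lemma length_pre [simp]: "length (pre m a) = m"
  by (simp add: pre_def)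

lemma take_pre: "m \<le> n \<Longrightarrow> take m (pre n a) = pre m a"
  by (simp add: pre_def take_map)

lemma pre_Suc: "pre (Suc m) a = pre m a @ [bitat a m]"
  by (simp add: pre_def)

lemma length_nd_le: "length (nd m a) \<le> m"
  by (induction m) auto

lemma length_nd: "occ (nd m a) \<Longrightarrow> length (nd m a) = m"
  by (induction m) (auto split: if_splits)

lemma nth_nd: "i < length (nd m a) \<Longrightarrow> nd m a ! i = bitat a i"
proof (induction m)
  case (Suc m)
  then show ?case using length_nd[of m a] by (auto simp: nth_append less_Suc_eq split: if_splits)
qed simp

lemma nd_facts: "nd m a = pre (length (nd m a)) a" "length (nd m a) \<le> m"
    "occ (nd m a) \<Longrightarrow> length (nd m a) = m"
  by (rule nth_equalityI) (simp_all add: length_nd_le length_nd nth_nd pre_def)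

lemma nd_eq_pre: "occ (nd m a) \<Longrightarrow> nd m a = pre m a"
  using nd_facts(1,3)[of m a] by metis

lemma nd_stop: "m \<le> n \<Longrightarrow> \<not> occ (nd m a) \<Longrightarrow> nd n a = nd m a"
  by (induction n rule: dec_induct) auto

lemma occ_mono: "m \<le> n \<Longrightarrow> occ (pre n a) \<Longrightarrow> occ (pre m a)"
  unfolding occ_def by (metis take_pre length_pre)

text \<open>Occupancy is inherited by prefixes, so a path that is still alive at position
  \<open>m\<close> has not been truncated. This allows the probabilistic part to work with
  \<open>pre\<close>, which does not depend on the samples.\<close>

lemma occ_nd_iff: "occ (nd m a) \<longleftrightarrow> occ (pre m a)"
proof
  assume "occ (nd m a)"
  then show "occ (pre m a)" using nd_eq_pre by metis
next
  assume *: "occ (pre m a)"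
  have "nd m a = pre m a" using *
  proof (induction m)
    case 0 show ?case by (simp add: pre_def)
  next
    case (Suc m)
    then have "occ (pre m a)" using occ_mono[of m "Suc m"] by simp
    with Suc show ?case by (simp add: pre_Suc)
  qed
  with * show "occ (nd m a)" by simp
qed

lemma rp_stop: "m \<le> n \<Longrightarrow> \<not> occ (nd m a) \<Longrightarrow> rp n a = a"
  using nd_stop[of m n a] by (simp add: rp_def)

lemma rp_eq: "rp m a = (if occ (pre m a) then b (ix (pre m a)) else a)"
  using nd_eq_pre[of m a] by (auto simp: rp_def occ_nd_iff)

lemma ix_props: assumes "occ w" shows "ix w < N" "pre (length w) (b (ix w)) = w"
  using LeastI_ex[OF assms[unfolded occ_def]] unfolding ix_def by auto

lemma length_rp:
  assumes "\<And>i. i < N \<Longrightarrow> length (b i) = d" "length a = d"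
  shows "length (rp m a) = d"
  using assms ix_props(1)[of "nd m a"] by (simp add: rp_def)

lemma finite_diffs [simp]: "finite (diffs j a)"
  by (simp add: diffs_def)

lemma size_feats:
  assumes "\<And>i. i < N \<Longrightarrow> length (b i) = d" "length a = d"
  shows "size (feats j a) = l1_dist (rp (j * d) a) (rp (Suc j * d) a)"
  using l1_dist_card[OF length_rp[OF assms], of "j * d"] by (simp add: feats_def diffs_def)

text \<open>Blocks own disjoint ranges of node lengths, hence features of different blocks never
  coincide. If the path had stopped by position \<open>j * d\<close>, both representatives would be
  the vector itself and no coordinate would differ. So block \<open>j\<close> starts at an occupied
  node, and its end node is longer than \<open>j * d\<close> even if the path stops inside the
  block.\<close>

lemma feats_nonempty_length:
  assumes "z \<in># feats j a" shows "j * d < length (fst z)" "length (fst z) \<le> Suc j * d" "snd z < d"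
    "occ (nd (j * d) a)"
proof -
  have z: "fst z = nd (Suc j * d) a" "snd z \<in> diffs j a" using assms by (auto simp: feats_def)
  have o: "occ (nd (j * d) a)"
  proof (rule ccontr)
    assume "\<not> occ (nd (j * d) a)"
    then have "rp (j * d) a = a" "rp (Suc j * d) a = a" by (auto intro: rp_stop[of "j * d"])
    then show False using z by (simp add: diffs_def)
  qed
  then show "occ (nd (j * d) a)" .
  have d: "0 < d" using z(2) by (auto simp: diffs_def)
  show "snd z < d" using z by (simp add: diffs_def)
  show "length (fst z) \<le> Suc j * d" using z nd_facts(2)[of "Suc j * d" a] by simp
  show "j * d < length (fst z)"
  proof (rule ccontr)
    assume "\<not> j * d < length (fst z)"
    then have le: "length (nd (Suc j * d) a) \<le> j * d" using z by simp
    then have "\<not> occ (nd (Suc j * d) a)" using nd_facts(3)[of "Suc j * d" a] d by auto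
    then have "\<not> occ (pre (length (nd (Suc j * d) a)) a)" using nd_facts(1)[of "Suc j * d" a] by metis
    then show False using o occ_mono[OF le] by (simp add: occ_nd_iff)
  qed
qed

lemma vfeats_Suc: "vfeats (Suc J) a = vfeats J a + feats J a"
  by (simp add: vfeats_def)

lemma pfeats_Suc: "pfeats (Suc J) X = pfeats J X + (\<Sum>a\<in>#X. feats J a)"
  by (simp add: pfeats_def vfeats_Suc sum_mset.distrib)

lemma vfeats_length: "z \<in># vfeats J a \<Longrightarrow> length (fst z) \<le> J * d"
proof (induction J)
  case (Suc J)
  then show ?case using feats_nonempty_length(2)[of z J a] by (auto simp: vfeats_Suc)
qed (simp add: vfeats_def)

section \<open>Lower bound: the features separate distant points\<close>

lemma node_eq:
  assumes "nd n a = nd n a'" "occ (nd n a)" "m \<le> n"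
  shows "nd m a = nd m a'" "occ (nd m a)"
proof -
  have p: "pre n a = pre n a'" "occ (pre n a)" "occ (pre n a')" using assms nd_eq_pre by metis+
  have "occ (pre m a)" "occ (pre m a')" using occ_mono[OF assms(3)] p by auto
  then show "nd m a = nd m a'" "occ (nd m a)"
    using p(1) assms(3) by (metis occ_nd_iff nd_eq_pre take_pre)+
qed

text \<open>An occupied node determines its ancestors, which are occupied as well, and therefore
  every representative on the path; the vector itself never enters.\<close>

lemma vfeats_eq:
  assumes "nd (J * d) a = nd (J * d) a'" "occ (nd (J * d) a)"
  shows "vfeats J a = vfeats J a'"
  unfolding vfeats_def
proof (rule sum.cong[OF refl])
  fix j assume "j \<in> {..<J}"
  then have j: "Suc j \<le> J" by simp
  have le: "j * d \<le> J * d" "Suc j * d \<le> J * d" using j by (auto intro!: mult_right_mono simp del: mult_Suc)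
  note e = node_eq[OF assms le(1)] node_eq[OF assms le(2)]
  have "diffs j a = diffs j a'" using e by (simp add: diffs_def rp_def)
  then show "feats j a = feats j a'" using e by (simp add: feats_def)
qed

text \<open>Every draw is below \<open>d \<le> 2 ^ (J - 1)\<close>, so the last block reveals all
  coordinates.\<close>

lemma nd_full_eq:
  assumes "length a = d" "length a' = d" "1 \<le> J" "d \<le> 2 ^ (J - 1)" "\<And>m. m < J * d \<Longrightarrow> u m < d"
    "pre (J * d) a = pre (J * d) a'"
  shows "a = a'"
proof (rule nth_equalityI)
  fix k assume "k < length a"
  then have k: "k < d" using assms by simp
  let ?m = "(J - 1) * d + k"
  have m: "?m < J * d" using k assms(3) by (cases J) auto
  have "bitat a ?m = bitat a' ?m" using assms(6) m by (auto simp: pre_def)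
  moreover have "?m div d = J - 1" "?m mod d = k" using k by auto
  moreover have "u ?m < 2 ^ (J - 1)" using assms(4,5) m by (meson less_le_trans)
  ultimately show "a ! k = a' ! k" by (simp add: bitat_def)
qed (use assms in simp)

text \<open>Induction on blocks, and within a block on the size of the points. If a vector of
  \<open>X\<close> and one of \<open>Y\<close> share the node at the end of block \<open>j\<close>,
  they are matched at cost 0: the node is occupied by \<open>good\<close>, so they have the same
  representative and the same features, which cancel. If no node is shared, the features of block
  \<open>j\<close> are disjoint, so the symmetric difference grows by the total distance that all
  representatives move in this block; by the triangle inequality this pays for keeping the coupling
  of the preceding block.\<close>

lemma coupling_le_dm:
  assumes len: "\<And>i. i < N \<Longrightarrow> length (b i) = d" and N: "0 < N"
    and XY: "\<forall>a\<in>#X. length a = d" "\<forall>a\<in>#Y. length a = d" "size X = size Y"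
    and good: "\<And>a a' m. a \<in># X \<Longrightarrow> a' \<in># Y \<Longrightarrow> m \<le> J * d \<Longrightarrow> nd m a = nd m a' \<Longrightarrow> occ (nd m a)"
  shows "j \<le> J \<Longrightarrow> \<exists>M. image_mset fst M = X \<and> image_mset snd M = Y \<and>
    (\<Sum>z\<in>#M. l1_dist (rp (j * d) (fst z)) (rp (j * d) (snd z))) \<le> dm (pfeats j X) (pfeats j Y)"
  using XY good
proof (induction j arbitrary: X Y)
  case 0
  obtain xs ys where xy: "mset xs = X" "mset ys = Y" by (meson ex_mset)
  then have l: "length xs = length ys" using 0 by auto
  \<comment> \<open>Some sample reaches the root, so all vectors have the same representative there
    and every pairing is free.\<close>
  have "occ []" using N by (auto simp: occ_def pre_def)
  then have "(\<Sum>z\<in>#mset (zip xs ys). l1_dist (rp (0 * d) (fst z)) (rp (0 * d) (snd z))) = 0"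
    by (simp add: rp_def l1_dist_refl)
  moreover have "image_mset fst (mset (zip xs ys)) = X" "image_mset snd (mset (zip xs ys)) = Y"
    using map_fst_zip[OF l] map_snd_zip[OF l] xy by (metis mset_map)+
  ultimately show ?case by (intro exI[of _ "mset (zip xs ys)"]) simp
next
  case (Suc j)
  note outer = Suc.IH
  have j: "j \<le> J" "Suc j * d \<le> J * d" using Suc.prems(1) by (auto intro!: mult_right_mono simp del: mult_Suc)
  show ?case using Suc.prems(2-)
  proof (induction "size X" arbitrary: X Y rule: less_induct)
    case less
    show ?case
    proof (cases "\<exists>a\<in>#X. \<exists>a'\<in>#Y. nd (Suc j * d) a = nd (Suc j * d) a'")
      case True
      then obtain a a' where a: "a \<in># X" "a' \<in># Y" "nd (Suc j * d) a = nd (Suc j * d) a'" by blast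
      then have o: "occ (nd (Suc j * d) a)" using less.prems(4) j by blast
      obtain X' where X': "X = add_mset a X'" using a by (metis multi_member_split)
      obtain Y' where Y': "Y = add_mset a' Y'" using a by (metis multi_member_split)
      have "\<exists>M. image_mset fst M = X' \<and> image_mset snd M = Y' \<and>
         (\<Sum>z\<in>#M. l1_dist (rp (Suc j * d) (fst z)) (rp (Suc j * d) (snd z)))
         \<le> dm (pfeats (Suc j) X') (pfeats (Suc j) Y')"
        by (rule less.hyps) (use less.prems X' Y' in auto)
      then obtain M where M: "image_mset fst M = X'" "image_mset snd M = Y'"
         "(\<Sum>z\<in>#M. l1_dist (rp (Suc j * d) (fst z)) (rp (Suc j * d) (snd z)))
         \<le> dm (pfeats (Suc j) X') (pfeats (Suc j) Y')" by blast
      have "rp (Suc j * d) a = rp (Suc j * d) a'" using a o by (simp add: rp_def)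
      moreover have "pfeats (Suc j) X = vfeats (Suc j) a + pfeats (Suc j) X'"
        "pfeats (Suc j) Y = vfeats (Suc j) a + pfeats (Suc j) Y'"
        using vfeats_eq[OF a(3) o] by (simp_all add: pfeats_def X' Y')
      ultimately show ?thesis using M X' Y'
        by (intro exI[of _ "add_mset (a, a') M"]) (simp add: l1_dist_refl)
    next
      case False
      have "\<exists>M. image_mset fst M = X \<and> image_mset snd M = Y \<and>
        (\<Sum>z\<in>#M. l1_dist (rp (j * d) (fst z)) (rp (j * d) (snd z))) \<le> dm (pfeats j X) (pfeats j Y)"
        by (rule outer) (use less.prems j in auto)
      then obtain M where M: "image_mset fst M = X" "image_mset snd M = Y"
        "(\<Sum>z\<in>#M. l1_dist (rp (j * d) (fst z)) (rp (j * d) (snd z))) \<le> dm (pfeats j X) (pfeats j Y)"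
        by blast
      let ?E = "\<lambda>X. \<Sum>a\<in>#X. feats j a"
      have in_E: "z \<in># ?E X \<Longrightarrow> \<exists>a\<in>#X. z \<in># feats j a" for z X by (induction X) auto
      have in_p: "z \<in># pfeats j X \<Longrightarrow> length (fst z) \<le> j * d" for z X
        unfolding pfeats_def by (induction X) (auto dest: vfeats_length)
      have "set_mset (?E X) \<inter> set_mset (?E Y) = {}"
      proof -
        have "fst z = nd (Suc j * d) a" if "z \<in># feats j a" for z a
          using that by (auto simp: feats_def)
        then show ?thesis using False in_E by (metis disjoint_iff)
      qed
      then have dE: "dm (?E X) (?E Y) = size (?E X) + size (?E Y)" by (rule dm_disjoint)
      have sz: "real (size (?E Z)) = (\<Sum>a\<in>#Z. l1_dist (rp (j * d) a) (rp (Suc j * d) a))"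
        if "\<forall>a\<in>#Z. length a = d" for Z
        using that size_feats[OF len] by (induction Z) auto
      have "dm (pfeats (Suc j) X) (pfeats (Suc j) Y) = dm (pfeats j X) (pfeats j Y) + dm (?E X) (?E Y)"
        unfolding pfeats_Suc
      proof (rule dm_add_separate)
        have "length (fst z) > j * d" if "z \<in># ?E X" for z X
          using in_E[OF that] feats_nonempty_length(1) by blast
        then show "(set_mset (pfeats j X) \<union> set_mset (pfeats j Y)) \<inter> (set_mset (?E X) \<union> set_mset (?E Y)) = {}"
          using in_p by (force simp: disjoint_iff)
      qed
      moreover have "(\<Sum>z\<in>#M. l1_dist (rp (Suc j * d) (fst z)) (rp (Suc j * d) (snd z)))
        \<le> (\<Sum>z\<in>#M. l1_dist (rp (j * d) (fst z)) (rp (Suc j * d) (fst z))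
           + l1_dist (rp (j * d) (fst z)) (rp (j * d) (snd z))
           + l1_dist (rp (j * d) (snd z)) (rp (Suc j * d) (snd z)))"
      proof (rule sum_mset_mono)
        fix z assume z: "z \<in># M"
        then have "fst z \<in># X" "snd z \<in># Y" using M by force+
        then have l: "length (rp m (fst z)) = d" "length (rp m (snd z)) = d" for m
          using less.prems(1,2) length_rp[OF len] by auto
        show "l1_dist (rp (Suc j * d) (fst z)) (rp (Suc j * d) (snd z)) \<le>
          l1_dist (rp (j * d) (fst z)) (rp (Suc j * d) (fst z))
           + l1_dist (rp (j * d) (fst z)) (rp (j * d) (snd z))
           + l1_dist (rp (j * d) (snd z)) (rp (Suc j * d) (snd z))"
          using l1_dist_triangle[of "rp (Suc j * d) (fst z)" "rp (j * d) (fst z)" "rp (Suc j * d) (snd z)"]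
           l1_dist_triangle[of "rp (j * d) (fst z)" "rp (j * d) (snd z)" "rp (Suc j * d) (snd z)"]
           l1_dist_commute[of "rp (Suc j * d) (fst z)" "rp (j * d) (fst z)"] l
          by (simp del: mult_Suc)
      qed
      moreover have "\<dots> = real (size (?E X)) + (\<Sum>z\<in>#M. l1_dist (rp (j * d) (fst z)) (rp (j * d) (snd z)))
         + real (size (?E Y))"
        unfolding sz[OF less.prems(1)] sz[OF less.prems(2)] unfolding M(1,2)[symmetric]
        by (simp add: sum_mset.distrib image_mset.compositionality o_def del: mult_Suc)
      ultimately show ?thesis using M dE by (intro exI[of _ M]) (simp del: mult_Suc)
    qed
  qed
qed

theorem emd_le_dm:
  assumes len: "\<And>i. i < N \<Longrightarrow> length (b i) = d" and N: "0 < N"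
    and J: "1 \<le> J" "d \<le> 2 ^ (J - 1)" "\<And>m. m < J * d \<Longrightarrow> u m < d"
    and XY: "X \<in> EMD_points s d" "Y \<in> EMD_points s d"
    and good: "\<And>a a' m. a \<in># X \<Longrightarrow> a' \<in># Y \<Longrightarrow> m \<le> J * d \<Longrightarrow> pre m a = pre m a' \<Longrightarrow> occ (pre m a)"
  shows "emd X Y \<le> dm (pfeats J X) (pfeats J Y)"
proof -
  \<comment> \<open>A path may stop before position \<open>m\<close>; the hypothesis is used at the
    length at which it stopped.\<close>
  have good': "occ (nd m a)" if a: "a \<in># X" "a' \<in># Y" "m \<le> J * d" "nd m a = nd m a'" for a a' m
    using a nd_facts(1)[of m a] nd_facts(1)[of m a'] nd_facts(2)[of m a] good[OF a(1,2), of "length (nd m a)"]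
    by (metis order_trans)
  have XY': "\<forall>a\<in>#X. length a = d" "\<forall>a\<in>#Y. length a = d" "size X = size Y"
    using XY by (auto simp: EMD_points_def)
  have "\<exists>M. image_mset fst M = X \<and> image_mset snd M = Y \<and>
    (\<Sum>z\<in>#M. l1_dist (rp (J * d) (fst z)) (rp (J * d) (snd z))) \<le> dm (pfeats J X) (pfeats J Y)"
    by (rule coupling_le_dm[OF len N XY' _ order_refl]) (use good' in blast)+
  then obtain M where M: "image_mset fst M = X" "image_mset snd M = Y"
    "(\<Sum>z\<in>#M. l1_dist (rp (J * d) (fst z)) (rp (J * d) (snd z))) \<le> dm (pfeats J X) (pfeats J Y)"
    by blast
  \<comment> \<open>A representative at the last node agrees with the vector on the full prefix,
    hence everywhere; without a sample the vector represents itself.\<close>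
  have "rp (J * d) a = a" if "length a = d" for a
    using nd_full_eq[OF _ that J, of "b (ix (pre (J * d) a))"] ix_props[of "pre (J * d) a"] len
    by (auto simp: rp_eq)
  moreover have "length (fst z) = d" "length (snd z) = d" if "z \<in># M" for z
    using that M XY' by force+
  ultimately have "(\<Sum>z\<in>#M. l1_dist (rp (J * d) (fst z)) (rp (J * d) (snd z))) = (\<Sum>z\<in>#M. l1_dist (fst z) (snd z))"
    by (intro arg_cong[where f = sum_mset] image_mset_cong) simp
  then show ?thesis using emd_le_coupling[OF M(1,2)] M(3) by simp
qed

end

section \<open>Upper bound on the features that two vectors do not share\<close>

context trie begin

lemma nd_cong: "pre m a = pre m a' \<Longrightarrow> nd m a = nd m a'"
proof (induction m)
  case (Suc m)
  then show ?case by (simp add: pre_Suc)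
qed simp

lemma nd_take: "m \<le> n \<Longrightarrow> nd m a = take m (nd n a)"
proof (induction n rule: dec_induct)
  case base
  show ?case using length_nd_le[of m a] by simp
next
  case (step n)
  then show ?case using length_nd[of n a] by simp
qed

lemma feats_eq:
  assumes "nd (Suc j * d) a = nd (Suc j * d) a'" "occ (nd (Suc j * d) a)"
  shows "feats j a = feats j a'"
proof -
  have le: "j * d \<le> Suc j * d" by simp
  have "vfeats j a + feats j a = vfeats j a' + feats j a'"
    using vfeats_eq[OF assms] by (simp only: vfeats_Suc)
  moreover have "vfeats j a = vfeats j a'"
    using node_eq[OF assms le] by (rule vfeats_eq)
  ultimately show ?thesis by simp
qed

text \<open>Earlier blocks count as well: once a revealed coordinate has separated two prefixes,
  they stay different in all later blocks.\<close>

definition hits :: "nat \<Rightarrow> bool list \<Rightarrow> bool list \<Rightarrow> bool" where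
  "hits j a a' \<longleftrightarrow> (\<exists>l\<le>j. \<exists>k<d. a ! k \<noteq> a' ! k \<and> u (l * d + k) < 2 ^ l)"

definition off :: "nat \<Rightarrow> bool list \<Rightarrow> real" where
  "off j a = l1_dist (rp (j * d) a) a"

lemma off_nonneg: "0 \<le> off j a"
  by (simp add: off_def l1_dist_nonneg)

lemma pre_neq_hits:
  assumes "pre (Suc j * d) a \<noteq> pre (Suc j * d) a'"
  shows "hits j a a'"
proof -
  have "\<exists>m<Suc j * d. bitat a m \<noteq> bitat a' m"
    using assms unfolding pre_def map_eq_conv by (auto simp del: mult_Suc)
  then obtain m where m: "m < Suc j * d" "bitat a m \<noteq> bitat a' m" by blast
  have d: "0 < d" using m by (cases d) auto
  have "m div d < Suc j" using m(1) d by (simp add: div_less_iff_less_mult del: mult_Suc)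
  moreover have "m = (m div d) * d + m mod d" "m mod d < d" using d by simp_all
  ultimately show ?thesis using m(2) unfolding hits_def bitat_def
    by (metis less_Suc_eq_le)
qed

text \<open>Different end nodes force a hit, and then all features are charged by way of the
  distances from the vectors to their representatives. With a common occupied node the features are
  equal. With a common unoccupied node, either the path stopped before the block and there are no
  features, or it stops inside it: then the old representative is shared and the new ones are
  \<open>a\<close> and \<open>a'\<close> themselves, so only coordinates in which these differ
  matter.\<close>

lemma dm_feats_le:
  assumes len: "\<And>i. i < N \<Longrightarrow> length (b i) = d" and a: "length a = d" "length a' = d"
  shows "dm (feats j a) (feats j a') \<le> l1_dist a a' +
    of_bool (hits j a a') * (off j a + off (Suc j) a + (off j a' + off (Suc j) a'))"
proof (cases "nd (Suc j * d) a = nd (Suc j * d) a'")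
  case False
  then have h: "hits j a a'" using nd_cong pre_neq_hits by blast
  have "real (size (feats j a)) \<le> off j a + off (Suc j) a" if "length a = d" for a
    using size_feats[OF len that, of j] l1_dist_triangle[of "rp (j * d) a" a "rp (Suc j * d) a"]
      l1_dist_commute[of "rp (Suc j * d) a" a] length_rp[OF len that] that
    by (simp add: off_def del: mult_Suc)
  from this[OF a(1)] this[OF a(2)] dm_le_size[of "feats j a" "feats j a'"] h l1_dist_nonneg[of a a']
  show ?thesis by simp
next
  case True
  note eq = True
  have "dm (feats j a) (feats j a') \<le> l1_dist a a'"
  proof (cases "occ (nd (Suc j * d) a)")
    case True
    then show ?thesis using feats_eq[OF eq] l1_dist_nonneg[of a a'] by simp
  next
    case no: False
    have nj: "nd (j * d) a = nd (j * d) a'"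
      using eq nd_take[of "j * d" "Suc j * d"] by simp
    show ?thesis
    proof (cases "occ (nd (j * d) a)")
      case False
      then have "feats j a = {#}" "feats j a' = {#}"
        using feats_nonempty_length(4)[of _ j a] feats_nonempty_length(4)[of _ j a'] nj
        by (metis multiset_nonemptyE)+
      then show ?thesis using l1_dist_nonneg[of a a'] by simp
    next
      case True
      let ?v = "nd (Suc j * d) a"
      have "\<not> occ (nd (Suc j * d) a')" using no eq by simp
      then have rp: "rp (j * d) a' = rp (j * d) a" "rp (Suc j * d) a = a" "rp (Suc j * d) a' = a'"
        using True nj no by (simp_all add: rp_def del: mult_Suc)
      let ?A = "diffs j a" and ?B = "diffs j a'"
      have split: "image_mset (Pair ?v) (mset_set A) =
          image_mset (Pair ?v) (mset_set (A - B)) + image_mset (Pair ?v) (mset_set (A \<inter> B))"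
        if "finite A" for A B :: "nat set"
      proof -
        have "mset_set A = mset_set (A - B) + mset_set (A \<inter> B)"
          using that by (subst mset_set_Union[symmetric]) (auto intro!: arg_cong[where f = mset_set])
        then show ?thesis by simp
      qed
      have f: "feats j a = image_mset (Pair ?v) (mset_set ?A)" "feats j a' = image_mset (Pair ?v) (mset_set ?B)"
        using eq by (simp_all add: feats_def del: mult_Suc)
      have "dm (feats j a) (feats j a') = dm (image_mset (Pair ?v) (mset_set (?A - ?B)))
          (image_mset (Pair ?v) (mset_set (?B - ?A)))"
        unfolding f split[OF finite_diffs, of j a ?B] split[OF finite_diffs, of j a' ?A]
        by (simp add: Int_commute)
      also have "\<dots> \<le> card (?A - ?B) + card (?B - ?A)"
        using dm_le_size by (metis size_image_mset size_mset_set)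
      also have "\<dots> = card ((?A - ?B) \<union> (?B - ?A))"
        by (rule card_Un_disjoint[symmetric]) auto
      also have "\<dots> \<le> card {k. k < d \<and> a ! k \<noteq> a' ! k}"
        by (rule card_mono) (auto simp: diffs_def rp simp del: mult_Suc)
      finally show ?thesis using l1_dist_card[OF a(1), of a'] by simp
    qed
  qed
  then show ?thesis using off_nonneg[of j a] off_nonneg[of "Suc j" a] off_nonneg[of j a'] off_nonneg[of "Suc j" a']
    by (smt (verit) mult_nonneg_nonneg of_bool_def zero_le_one)
qed

lemma dm_vfeats_le:
  assumes "\<And>i. i < N \<Longrightarrow> length (b i) = d" "length a = d" "length a' = d"
  shows "dm (vfeats J a) (vfeats J a') \<le> (\<Sum>j<J. l1_dist a a' +
    of_bool (hits j a a') * (off j a + off (Suc j) a + (off j a' + off (Suc j) a')))"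
proof -
  have "real (dm (vfeats J a) (vfeats J a')) \<le> real (\<Sum>j<J. dm (feats j a) (feats j a'))"
    unfolding vfeats_def of_nat_le_iff by (rule dm_sum_le)
  also have "\<dots> = (\<Sum>j<J. real (dm (feats j a) (feats j a')))" by (rule of_nat_sum)
  also have "\<dots> \<le> (\<Sum>j<J. l1_dist a a' +
    of_bool (hits j a a') * (off j a + off (Suc j) a + (off j a' + off (Suc j) a')))"
    by (intro sum_mono dm_feats_le assms)
  finally show ?thesis .
qed

text \<open>Which positions are revealed does not depend on the vector, so only a revealed differing
  coordinate can separate two prefixes. For fixed vectors this turns sharing a node into a condition
  on the draws \<open>u\<close>.\<close>

lemma pre_eq_iff_agree:
  assumes "0 < d"
  shows "pre (j * d) x = pre (j * d) a \<longleftrightarrow> (\<forall>l<j. \<forall>k<d. x ! k \<noteq> a ! k \<longrightarrow> \<not> u (l * d + k) < 2 ^ l)"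
proof
  assume *: "pre (j * d) x = pre (j * d) a"
  show "\<forall>l<j. \<forall>k<d. x ! k \<noteq> a ! k \<longrightarrow> \<not> u (l * d + k) < 2 ^ l"
  proof (intro allI impI)
    fix l k assume lk: "l < j" "k < d" "x ! k \<noteq> a ! k"
    have "Suc l * d \<le> j * d" using lk by (intro mult_right_mono) auto
    then have "l * d + k < j * d" using lk by simp
    then have "bitat x (l * d + k) = bitat a (l * d + k)" using * by (auto simp: pre_def)
    then show "\<not> u (l * d + k) < 2 ^ l" using lk by (auto simp: bitat_def)
  qed
next
  assume *: "\<forall>l<j. \<forall>k<d. x ! k \<noteq> a ! k \<longrightarrow> \<not> u (l * d + k) < 2 ^ l"
  show "pre (j * d) x = pre (j * d) a"
    unfolding pre_def
  proof (rule map_cong[OF refl])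
    fix m assume "m \<in> set [0..<j * d]"
    then have m: "m < j * d" by simp
    then have "m div d < j" "m mod d < d" "(m div d) * d + m mod d = m"
      using assms by (simp_all add: div_less_iff_less_mult)
    then have "u m < 2 ^ (m div d) \<Longrightarrow> x ! (m mod d) = a ! (m mod d)" using * by metis
    then show "bitat x m = bitat a m" unfolding bitat_def by blast
  qed
qed

text \<open>The product and the indicator behind it say that sample \<open>n\<close> is the first to
  reach the node. They are kept as factors depending on one sample each, because independence makes
  the expectation of such a product factor.\<close>

lemma off_le:
  "off j a \<le> (\<Sum>n<N. (\<Prod>i<n. of_bool (pre (j * d) (b i) \<noteq> pre (j * d) a)) *
     (of_bool (pre (j * d) (b n) = pre (j * d) a) * l1_dist (b n) a))"
proof (cases "occ (pre (j * d) a)")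
  case False
  then have "off j a = 0" by (simp add: off_def rp_eq l1_dist_refl)
  then show ?thesis by (simp add: sum_nonneg prod_nonneg l1_dist_nonneg)
next
  case True
  let ?n = "ix (pre (j * d) a)"
  have n: "?n < N" "pre (j * d) (b ?n) = pre (j * d) a" using ix_props[OF True] by simp_all
  have "pre (j * d) (b i) \<noteq> pre (j * d) a" if "i < ?n" for i
    using that n(1) not_less_Least[of i] unfolding ix_def by fastforce
  then have "(\<Prod>i<?n. of_bool (pre (j * d) (b i) \<noteq> pre (j * d) a)) *
     (of_bool (pre (j * d) (b ?n) = pre (j * d) a) * l1_dist (b ?n) a) = off j a"
    using n True by (simp add: off_def rp_eq)
  moreover have "(\<Prod>i<?n. of_bool (pre (j * d) (b i) \<noteq> pre (j * d) a)) *
     (of_bool (pre (j * d) (b ?n) = pre (j * d) a) * l1_dist (b ?n) a) \<le>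
     (\<Sum>n<N. (\<Prod>i<n. of_bool (pre (j * d) (b i) \<noteq> pre (j * d) a)) *
     (of_bool (pre (j * d) (b n) = pre (j * d) a) * l1_dist (b n) a))"
    using n(1) by (intro member_le_sum) (auto simp: prod_nonneg l1_dist_nonneg)
  ultimately show ?thesis by simp
qed

end

section \<open>The expected distance of the features\<close>

abbreviation E :: "'a pmf \<Rightarrow> ('a \<Rightarrow> real) \<Rightarrow> real" where
  "E p f \<equiv> measure_pmf.expectation p f"

lemma E_sum: "finite (set_pmf p) \<Longrightarrow> E p f = (\<Sum>x\<in>set_pmf p. pmf p x * f x)"
  using integral_measure_pmf[of "set_pmf p" p f] by simp

lemma E_mono: "finite (set_pmf p) \<Longrightarrow> (\<And>x. x \<in> set_pmf p \<Longrightarrow> f x \<le> g x) \<Longrightarrow> E p f \<le> E p g"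
  by (simp add: E_sum sum_mono mult_left_mono)

lemma E_cong: "(\<And>x. x \<in> set_pmf p \<Longrightarrow> f x = g x) \<Longrightarrow> E p f = E p g"
  by (rule integral_cong_AE) (auto simp: AE_measure_pmf_iff)

lemma E_nonneg: "(\<And>x. x \<in> set_pmf p \<Longrightarrow> 0 \<le> f x) \<Longrightarrow> 0 \<le> E p f"
  by (rule integral_nonneg_AE) (auto simp: AE_measure_pmf_iff)

lemma E_add: "finite (set_pmf p) \<Longrightarrow> E p (\<lambda>x. f x + g x) = E p f + E p g"
  by (simp add: integrable_measure_pmf_finite)

lemma E_diff: "finite (set_pmf p) \<Longrightarrow> E p (\<lambda>x. f x - g x) = E p f - E p g"
  by (simp add: integrable_measure_pmf_finite)

lemma E_sum_fun: "finite (set_pmf p) \<Longrightarrow> E p (\<lambda>x. \<Sum>i\<in>I. f i x) = (\<Sum>i\<in>I. E p (f i))"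
  by (simp add: integrable_measure_pmf_finite)

lemma E_le_const: "finite (set_pmf p) \<Longrightarrow> (\<And>x. x \<in> set_pmf p \<Longrightarrow> f x \<le> c) \<Longrightarrow> E p f \<le> c"
  using E_mono[of p f "\<lambda>_. c"] by simp

lemma E_swap:
  assumes "finite (set_pmf p)" "finite (set_pmf q)"
  shows "E p (\<lambda>x. E q (f x)) = E q (\<lambda>y. E p (\<lambda>x. f x y))"
  using assms by (simp add: E_sum sum_distrib_left mult.left_commute) (rule sum.swap)

lemma E_pair:
  assumes "finite (set_pmf p)" "finite (set_pmf q)"
  shows "E (pair_pmf p q) f = E p (\<lambda>x. E q (\<lambda>y. f (x, y)))"
  using assms by (auto simp: E_sum pmf_pair sum.cartesian_product sum_distrib_left mult.assoc intro!: sum.cong)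

lemma E_of_bool: "E p (\<lambda>x. of_bool (P x)) = measure_pmf.prob p {x. P x}"
proof -
  have "(\<lambda>x. of_bool (P x) :: real) = indicator {x. P x}" by (auto simp: indicator_def)
  then show ?thesis by simp
qed

lemma finite_set_Pi_pmf:
  "finite I \<Longrightarrow> (\<And>i. i \<in> I \<Longrightarrow> finite (set_pmf (p i))) \<Longrightarrow> finite (set_pmf (Pi_pmf I c p))"
  by (simp add: set_Pi_pmf finite_PiE_dflt)

text \<open>The product distribution splits into its parts over \<open>K\<close> and over
  \<open>I - K\<close>, and each function sees only one of them.\<close>

lemma E_Pi_indep:
  assumes I: "finite I" "K \<subseteq> I" "\<And>i. i \<in> I \<Longrightarrow> finite (set_pmf (p i))"
    and f: "\<And>x y. (\<And>i. i \<in> K \<Longrightarrow> x i = y i) \<Longrightarrow> f x = f y"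
    and g: "\<And>x y. (\<And>i. i \<in> I - K \<Longrightarrow> x i = y i) \<Longrightarrow> g x = g y"
  shows "E (Pi_pmf I c p) (\<lambda>x. f x * g x) = E (Pi_pmf I c p) f * E (Pi_pmf I c p) g"
proof -
  let ?A = "Pi_pmf K c p" and ?B = "Pi_pmf (I - K) c p"
  have fin: "finite K" "finite (I - K)" using I finite_subset by auto
  have finA: "finite (set_pmf ?A)" "finite (set_pmf ?B)"
    using I fin by (auto intro!: finite_set_Pi_pmf)
  have eq: "Pi_pmf I c p = map_pmf (\<lambda>(f, g) x. if x \<in> K then f x else g x) (pair_pmf ?A ?B)"
    using Pi_pmf_union[OF fin, of c p] I(2) by (simp add: Un_absorb1)
  have F: "f (\<lambda>i. if i \<in> K then x i else y i) = f x" and G: "g (\<lambda>i. if i \<in> K then x i else y i) = g y" for x y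
    by (rule f, simp) (rule g, simp)
  show ?thesis unfolding eq using finA by (simp add: E_pair case_prod_beta F G)
qed

lemma E_Pi_indep_disjoint:
  assumes I: "finite I" "\<And>i. i \<in> I \<Longrightarrow> finite (set_pmf (p i))"
    and f: "\<And>x y. (\<And>i. i \<in> K \<Longrightarrow> x i = y i) \<Longrightarrow> f x = f y"
    and g: "\<And>x y. (\<And>i. i \<in> K' \<Longrightarrow> x i = y i) \<Longrightarrow> g x = g y"
    and K: "K \<inter> K' = {}" "K \<subseteq> I" "K' \<subseteq> I"
  shows "E (Pi_pmf I c p) (\<lambda>x. f x * g x) = E (Pi_pmf I c p) f * E (Pi_pmf I c p) g"
  by (rule E_Pi_indep[OF I(1) K(2) I(2) f]) (use K in \<open>auto intro!: g\<close>)

section \<open>Charging a distance to the decrease of a logarithmic potential\<close>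

text \<open>With \<open>X = q * q * x\<close> it suffices that
  \<open>min 1 x * ln q \<le> ln ((1 + X) / (1 + x))\<close>; passing to the square root costs the
  factor 2. For \<open>x \<ge> 1\<close> this is \<open>0 \<le> (q - 1) * (q * x - 1)\<close>. For
  \<open>x < 1\<close>, concavity of \<open>ln\<close> gives
  \<open>x * ln q \<le> ln (1 + x * (q - 1))\<close>, and
  \<open>(1 + x * (q - 1)) * (1 + x) \<le> 1 + X\<close>.\<close>

lemma ln_ratio_le:
  fixes x X :: real
  assumes "0 < x" "x \<le> X"
  shows "min 1 x * ln (X / x) \<le> 2 * (ln (1 + X) - ln (1 + x))"
proof -
  define q where "q = sqrt (X / x)"
  have q1: "1 \<le> q" using assms by (simp add: q_def)
  have q2: "X = q * q * x" using assms by (simp add: q_def)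
  have lnq: "ln (X / x) = 2 * ln q" using assms q1 by (simp add: q_def ln_sqrt)
  have "ln (1 + X) - ln (1 + x) = ln ((1 + X) / (1 + x))" using assms by (simp add: ln_div)
  moreover have "min 1 x * ln q \<le> ln ((1 + X) / (1 + x))"
  proof (cases "1 \<le> x")
    case True
    have "0 \<le> (q - 1) * (q * x - 1)" using q1 True by (intro mult_nonneg_nonneg) (auto simp: mult_ge1_I)
    then have "q \<le> (1 + X) / (1 + x)" using assms by (simp add: q2 field_simps)
    then show ?thesis using True q1 by (simp add: ln_mono)
  next
    case False
    have le: "x * ln q \<le> ln (1 + x * (q - 1))"
    proof -
      have conc: "(1 - x) * ln 1 + x * ln q \<le> ln ((1 - x) *\<^sub>R 1 + x *\<^sub>R q)"
        using concave_onD[OF ln_concave, of x 1 q] False assms q1 by simp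
      then show ?thesis by (simp add: algebra_simps)
    qed
    have "x * x * (q - 1) \<le> x * (q - 1)" using False assms q1 by (intro mult_right_mono) auto
    also have "\<dots> \<le> x * (q * (q - 1))" using assms q1 mult_right_mono[of 1 q "q - 1"] by (intro mult_left_mono) auto
    finally have "(1 + x * (q - 1)) * (1 + x) \<le> 1 + X" by (simp add: q2 algebra_simps)
    then have "1 + x * (q - 1) \<le> (1 + X) / (1 + x)" using assms by (simp add: field_simps)
    moreover have "0 < 1 + x * (q - 1)" using assms q1 by (smt (verit) mult_nonneg_nonneg)
    ultimately have "ln (1 + x * (q - 1)) \<le> ln ((1 + X) / (1 + x))" by (simp add: ln_mono)
    with le False show ?thesis by simp
  qed
  ultimately show ?thesis using lnq by simp
qed

text \<open>\<open>geo N x * x\<close> is the probability that one of \<open>N\<close> independent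
  samples falls into a set of mass \<open>x\<close>.\<close>

definition geo :: "nat \<Rightarrow> real \<Rightarrow> real" where
  "geo N x = (\<Sum>n<N. (1 - x) ^ n)"

lemma geo_nonneg: "x \<le> 1 \<Longrightarrow> 0 \<le> geo N x"
  by (simp add: geo_def sum_nonneg)

lemma geo_mult_le:
  assumes "0 \<le> x" "x \<le> 1" shows "geo N x * x \<le> min 1 (N * x)"
proof -
  have "geo N x * x = 1 - (1 - x) ^ N"
    using one_diff_power_eq[of "1 - x" N] by (simp add: geo_def mult.commute)
  moreover have "0 \<le> (1 - x) ^ N" using assms by simp
  moreover have "geo N x \<le> (\<Sum>n<N. 1)"
    unfolding geo_def using assms by (intro sum_mono) (simp add: power_le_one)
  then have "geo N x * x \<le> N * x" using assms by (intro mult_right_mono) auto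
  ultimately show ?thesis by simp
qed

text \<open>From \<open>ln t \<le> t - 1\<close> at \<open>t = \<alpha>' / \<alpha> * exp y\<close>
  one gets \<open>y \<le> ln (\<alpha> / \<alpha>') + \<alpha>' / \<alpha> * exp y\<close>, a
  pointwise form of the Gibbs variational principle. Averaged over \<open>A'\<close> and multiplied
  by \<open>geo N \<alpha>'\<close>, the logarithm is paid by the potential via
  \<open>ln_ratio_le\<close>, since
  \<open>geo N \<alpha>' * \<alpha>' \<le> min 1 (N * \<alpha>')\<close>. What remains is an
  exponential moment relative to the larger set \<open>A\<close>.\<close>

lemma geo_E_le:
  fixes \<nu> :: "'a pmf" and y :: "'a \<Rightarrow> real"
  assumes fin: "finite (set_pmf \<nu>)" and sub: "A' \<subseteq> A" and y: "\<And>x. 0 \<le> y x"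
  defines "\<alpha> \<equiv> measure_pmf.prob \<nu> A" and "\<alpha>' \<equiv> measure_pmf.prob \<nu> A'"
  shows "geo N \<alpha>' * E \<nu> (\<lambda>x. of_bool (x \<in> A') * y x) \<le>
    2 * (ln (1 + N * \<alpha>) - ln (1 + N * \<alpha>')) + E \<nu> (\<lambda>x. of_bool (x \<in> A') * exp (y x)) / \<alpha>"
proof -
  let ?V = "E \<nu> (\<lambda>x. of_bool (x \<in> A') * exp (y x))"
  have V0: "0 \<le> ?V" by (rule E_nonneg) simp
  have le: "\<alpha>' \<le> \<alpha>" unfolding \<alpha>_def \<alpha>'_def using sub by (intro measure_pmf.finite_measure_mono) auto
  have a0: "0 \<le> \<alpha>'" "\<alpha>' \<le> 1" by (simp_all add: \<alpha>'_def)
  have mono: "ln (1 + N * \<alpha>') \<le> ln (1 + N * \<alpha>)"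
    using a0 le by (subst ln_le_cancel_iff) (auto intro!: mult_left_mono add_pos_nonneg)
  show ?thesis
  \<comment> \<open>If \<open>A'\<close> carries no mass or there are no samples, the left side
    vanishes; this is split off because the main case takes the logarithm of
    \<open>\<alpha> / \<alpha>'\<close>.\<close>
  proof (cases "\<alpha>' = 0 \<or> N = 0")
    case True
    have "geo N \<alpha>' * E \<nu> (\<lambda>x. of_bool (x \<in> A') * y x) = 0"
    proof (cases "N = 0")
      case False
      then have "\<alpha>' = 0" using True by simp
      then have "x \<notin> A'" if "x \<in> set_pmf \<nu>" for x
        using that by (metis \<alpha>'_def measure_pmf_zero_iff disjoint_iff)
      then have "E \<nu> (\<lambda>x. of_bool (x \<in> A') * y x) = E \<nu> (\<lambda>x. 0)" by (intro E_cong) simp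
      then show ?thesis by simp
    qed (simp add: geo_def)
    moreover have "0 \<le> 2 * (ln (1 + N * \<alpha>) - ln (1 + N * \<alpha>')) + ?V / \<alpha>"
      using V0 le a0 mono by (intro add_nonneg_nonneg divide_nonneg_nonneg) auto
    ultimately show ?thesis by (simp only:)
  next
    case False
    then have pos: "0 < \<alpha>'" "0 < \<alpha>" "0 < N" using a0 le by auto
    have "E \<nu> (\<lambda>x. of_bool (x \<in> A') * y x) \<le>
       E \<nu> (\<lambda>x. of_bool (x \<in> A') * ln (\<alpha> / \<alpha>') + \<alpha>' / \<alpha> * (of_bool (x \<in> A') * exp (y x)))"
    proof (rule E_mono[OF fin])
      fix x
      have "ln (\<alpha>' / \<alpha> * exp (y x)) \<le> \<alpha>' / \<alpha> * exp (y x)"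
        using pos ln_le_minus_one[of "\<alpha>' / \<alpha> * exp (y x)"] by simp
      then have "y x \<le> ln (\<alpha> / \<alpha>') + \<alpha>' / \<alpha> * exp (y x)"
        using pos by (simp add: ln_mult ln_div)
      then show "of_bool (x \<in> A') * y x \<le> of_bool (x \<in> A') * ln (\<alpha> / \<alpha>') + \<alpha>' / \<alpha> * (of_bool (x \<in> A') * exp (y x))"
        by auto
    qed
    also have "\<dots> = \<alpha>' * ln (\<alpha> / \<alpha>') + \<alpha>' / \<alpha> * ?V"
      using fin by (simp add: E_add E_of_bool \<alpha>'_def)
    finally have "geo N \<alpha>' * E \<nu> (\<lambda>x. of_bool (x \<in> A') * y x) \<le> geo N \<alpha>' * (\<alpha>' * ln (\<alpha> / \<alpha>') + \<alpha>' / \<alpha> * ?V)"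
      using a0 by (intro mult_left_mono geo_nonneg)
    also have "\<dots> = (geo N \<alpha>' * \<alpha>') * ln (\<alpha> / \<alpha>') + (geo N \<alpha>' * \<alpha>') * (?V / \<alpha>)"
      by (simp add: algebra_simps)
    also have "\<dots> \<le> min 1 (N * \<alpha>') * ln (\<alpha> / \<alpha>') + 1 * (?V / \<alpha>)"
      using geo_mult_le[OF a0, of N] pos le V0 by (intro add_mono mult_right_mono) auto
    also have "ln (\<alpha> / \<alpha>') = ln ((N * \<alpha>) / (N * \<alpha>'))" using pos by simp
    also have "min 1 (N * \<alpha>') * ln ((N * \<alpha>) / (N * \<alpha>')) \<le> 2 * (ln (1 + N * \<alpha>) - ln (1 + N * \<alpha>'))"
      using pos le by (intro ln_ratio_le) auto
    finally show ?thesis by simp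
  qed
qed

lemma (in trie) hits_commute: "hits j a a' = hits j a' a"
  by (auto simp: hits_def)

section \<open>Random revelation of coordinates and random samples\<close>

locale random_trie =
  fixes d N J :: nat and \<nu> :: "bool list pmf"
  assumes d: "0 < d" and fin: "finite (set_pmf \<nu>)" and len: "\<And>x. x \<in> set_pmf \<nu> \<Longrightarrow> length x = d"
begin

definition U :: "(nat \<Rightarrow> nat) pmf" where
  "U = Pi_pmf {..<J * d} 0 (\<lambda>_. uniform_below d)"

definition B :: "(nat \<Rightarrow> bool list) pmf" where
  "B = Pi_pmf {..<N} [] (\<lambda>_. \<nu>)"

definition agree :: "bool list \<Rightarrow> nat \<Rightarrow> (nat \<Rightarrow> nat) \<Rightarrow> bool list set" where
  "agree a j u = {x. \<forall>l<j. \<forall>k<d. x ! k \<noteq> a ! k \<longrightarrow> \<not> u (l * d + k) < 2 ^ l}"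

definition mass :: "bool list set \<Rightarrow> bool list \<Rightarrow> nat \<Rightarrow> (nat \<Rightarrow> nat) \<Rightarrow> real" where
  "mass G a j u = measure_pmf.prob \<nu> (G \<inter> agree a j u)"

text \<open>The expected distance of \<open>a\<close> to the first sample in its node: sample \<open>n\<close> is the first one with probability
  \<open>(1 - x)^n * x\<close>, where \<open>x\<close> is the mass of the node.  The restriction to \<open>G = {x. x ! k = a ! k}\<close> makes this
  independent of whether coordinate \<open>k\<close> is revealed.\<close>

definition W :: "bool list set \<Rightarrow> bool list \<Rightarrow> nat \<Rightarrow> (nat \<Rightarrow> nat) \<Rightarrow> real" where
  "W G a j u = geo N (mass G a j u) * E \<nu> (\<lambda>x. of_bool (x \<in> G \<inter> agree a j u) * l1_dist x a)"

text \<open>The potential that pays for the blocks: its decrease over any number of blocks is at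
  most \<open>ln (1 + N)\<close>, by \<open>\<Psi>_nonneg\<close> and
  \<open>\<Psi>_le\<close>.\<close>

definition \<Psi> :: "bool list set \<Rightarrow> bool list \<Rightarrow> nat \<Rightarrow> real" where
  "\<Psi> G a j = E U (\<lambda>u. ln (1 + N * mass G a j u))"

lemma set_uniform_below: "set_pmf (uniform_below d) = {..<d}"
  using d by (auto simp: uniform_below_def set_pmf_of_set lessThan_empty_iff)

lemma finU [simp]: "finite (set_pmf U)"
  unfolding U_def by (intro finite_set_Pi_pmf) (simp_all add: set_uniform_below)

lemma finB [simp]: "finite (set_pmf B)"
  unfolding B_def by (intro finite_set_Pi_pmf) (simp_all add: fin)

lemma prob_uniform: "measure_pmf.prob (uniform_below d) A = card ({..<d} \<inter> A) / d"
  using d by (simp add: uniform_below_def measure_pmf_of_set lessThan_empty_iff)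

lemma prob_miss_le: "measure_pmf.prob (uniform_below d) {v. \<not> v < 2 ^ j} \<le> exp (- (2 ^ j / d))"
proof -
  have "{..<d} \<inter> {v. \<not> v < 2 ^ j} = {2 ^ j..<d}" by auto
  then have *: "measure_pmf.prob (uniform_below d) {v. \<not> v < 2 ^ j} = real (d - 2 ^ j) / d"
    by (simp add: prob_uniform)
  show ?thesis
  proof (cases "2 ^ j < d")
    case True
    then have "real (d - 2 ^ j) / d = 1 + - (2 ^ j / d)"
      using d by (simp add: of_nat_diff field_simps)
    then show ?thesis using * exp_ge_add_one_self[of "- (2 ^ j / d)"] by simp
  qed (simp add: *)
qed

lemma prob_hit_le: "measure_pmf.prob (uniform_below d) {v. v < 2 ^ j} \<le> 2 ^ j / d"
proof -
  have "card ({..<d} \<inter> {v. v < 2 ^ j}) \<le> card {..<(2::nat) ^ j}" by (intro card_mono) auto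
  then have "real (card ({..<d} \<inter> {v. v < 2 ^ j})) \<le> 2 ^ j"
    by (metis card_lessThan of_nat_le_iff of_nat_numeral of_nat_power)
  then show ?thesis using d by (simp add: prob_uniform divide_right_mono)
qed

lemma position_lt: "j < J \<Longrightarrow> k < d \<Longrightarrow> j * d + k < J * d"
proof -
  assume "j < J" "k < d"
  then have "Suc j * d \<le> J * d" by (intro mult_right_mono) auto
  with \<open>k < d\<close> show ?thesis by simp
qed

text \<open>The differing coordinates stay hidden independently, each with probability at most
  \<open>exp (- (2 ^ j / d))\<close>. The resulting exponent is minus the scaled distance that
  enters the exponential moment in \<open>E_ratio_le\<close>.\<close>

lemma E_survive_le:
  assumes j: "j < J" and x: "length x = d"
  shows "E U (\<lambda>u. of_bool (\<forall>k<d. x ! k \<noteq> a ! k \<longrightarrow> \<not> u (j * d + k) < 2 ^ j)) \<le> exp (- (2 ^ j / d * l1_dist x a))"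
proof -
  define D where "D = {k. k < d \<and> x ! k \<noteq> a ! k}"
  define I where "I = (\<lambda>k. j * d + k) ` D"
  have D: "finite D" by (simp add: D_def)
  have I: "I \<subseteq> {..<J * d}" using position_lt[OF j] by (auto simp: I_def D_def)
  have cI: "card I = card D" unfolding I_def by (intro card_image inj_onI) simp
  define f where "f i v = (if i \<in> I then of_bool (\<not> v < 2 ^ j) else (1::real))" for i and v :: nat
  have "of_bool (\<forall>k<d. x ! k \<noteq> a ! k \<longrightarrow> \<not> u (j * d + k) < 2 ^ j) = (\<Prod>i<J * d. f i (u i))" for u
  proof -
    have "(\<Prod>i<J * d. f i (u i)) = (\<Prod>i\<in>I. of_bool (\<not> u i < 2 ^ j))"
      unfolding f_def using I by (subst prod.inter_restrict[symmetric]) (auto simp: Int_absorb1)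
    also have "\<dots> = of_bool (\<forall>i\<in>I. \<not> u i < 2 ^ j)"
    proof (cases "\<forall>i\<in>I. \<not> u i < 2 ^ j")
      case False
      have "finite I" using D by (simp add: I_def)
      moreover have "\<exists>i\<in>I. of_bool (\<not> u i < 2 ^ j) = (0 :: real)" using False by auto
      ultimately show ?thesis using False by (simp only: prod_zero of_bool_eq(1) if_False)
    qed simp
    finally show ?thesis by (auto simp: I_def D_def)
  qed
  then have "E U (\<lambda>u. of_bool (\<forall>k<d. x ! k \<noteq> a ! k \<longrightarrow> \<not> u (j * d + k) < 2 ^ j)) = E U (\<lambda>u. \<Prod>i<J * d. f i (u i))"
    by simp
  also have "\<dots> = (\<Prod>i<J * d. E (uniform_below d) (f i))"
    unfolding U_def by (rule expectation_prod_Pi_pmf)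
      (auto simp: f_def set_uniform_below intro!: integrable_measure_pmf_finite)
  also have "\<dots> = (\<Prod>i\<in>I. E (uniform_below d) (\<lambda>v. of_bool (\<not> v < 2 ^ j)))"
  proof -
    have "f i = (if i \<in> I then (\<lambda>v. of_bool (\<not> v < 2 ^ j)) else (\<lambda>_. 1))" for i
      by (auto simp: f_def)
    then show ?thesis
      using I by (subst prod.mono_neutral_right[of "{..<J * d}" I]) (auto intro!: prod.cong)
  qed
  also have "\<dots> = measure_pmf.prob (uniform_below d) {v. \<not> v < 2 ^ j} ^ card D"
    by (simp only: E_of_bool prod_constant cI)
  also have "\<dots> \<le> exp (- (2 ^ j / d)) ^ card D"
    by (intro power_mono prob_miss_le) simp
  also have "\<dots> = exp (- (2 ^ j / d * l1_dist x a))"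
    by (simp add: l1_dist_card[OF x] D_def exp_of_nat_mult[symmetric] mult.commute)
  finally show ?thesis .
qed

lemma agree_cong: "(\<And>i. i < j * d \<Longrightarrow> u i = u' i) \<Longrightarrow> agree a j u = agree a j u'"
proof -
  assume *: "\<And>i. i < j * d \<Longrightarrow> u i = u' i"
  have "u (l * d + k) = u' (l * d + k)" if "l < j" "k < d" for l k
  proof -
    have "Suc l * d \<le> j * d" using that by (intro mult_right_mono) auto
    then show ?thesis using that by (intro *) simp
  qed
  then show ?thesis by (auto simp: agree_def)
qed

lemma agree_Suc: "agree a (Suc j) u = agree a j u \<inter> {x. \<forall>k<d. x ! k \<noteq> a ! k \<longrightarrow> \<not> u (j * d + k) < 2 ^ j}"
  by (auto simp: agree_def less_Suc_eq)

lemma mass_bounds: "0 \<le> mass G a j u" "mass G a j u \<le> 1"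
  by (simp_all add: mass_def)

text \<open>The membership before block \<open>j\<close> and the mass depend on earlier blocks only,
  while survival of block \<open>j\<close> depends on that block only. By independence the survival
  probability cancels the exponential weight, which leaves the ratio of the mass to itself: 1, or 0
  if the mass is 0.\<close>

lemma E_ratio_le:
  assumes j: "j < J"
  shows "E U (\<lambda>u. E \<nu> (\<lambda>x. of_bool (x \<in> G \<inter> agree a (Suc j) u) * exp (2 ^ j / d * l1_dist x a)) / mass G a j u) \<le> 1"
proof -
  define y where "y x = 2 ^ j / d * l1_dist x a" for x
  define f where "f x u = of_bool (x \<in> G \<inter> agree a j u) / mass G a j u" for x u
  define g where "g x u = (of_bool (\<forall>k<d. (x :: bool list) ! k \<noteq> a ! k \<longrightarrow> \<not> u (j * d + k) < 2 ^ j) :: real)" for x and u :: "nat \<Rightarrow> nat"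
  have "E U (\<lambda>u. E \<nu> (\<lambda>x. of_bool (x \<in> G \<inter> agree a (Suc j) u) * exp (y x)) / mass G a j u)
      = E U (\<lambda>u. E \<nu> (\<lambda>x. f x u * g x u * exp (y x)))"
    by (intro E_cong, subst integral_divide_zero[symmetric], intro E_cong)
      (simp add: f_def g_def agree_Suc of_bool_conj)
  also have "\<dots> = E \<nu> (\<lambda>x. E U (\<lambda>u. f x u * g x u) * exp (y x))"
    by (subst E_swap) (simp_all add: fin)
  also have "\<dots> \<le> E \<nu> (\<lambda>x. E U (f x))"
  proof (rule E_mono[OF fin])
    fix x assume x: "x \<in> set_pmf \<nu>"
    have fu: "f x u = f x u'" if "\<And>i. i \<in> {..<j * d} \<Longrightarrow> u i = u' i" for u u'
      using agree_cong[of j u u' a] that by (simp add: f_def mass_def)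
    have gu: "g x u = g x u'" if "\<And>i. i \<in> {j * d..<Suc j * d} \<Longrightarrow> u i = u' i" for u u'
      using that by (auto simp: g_def intro!: arg_cong[where f = of_bool])
    have "Suc j * d \<le> J * d" using j by (intro mult_right_mono) auto
    then have "E U (\<lambda>u. f x u * g x u) = E U (f x) * E U (g x)"
      unfolding U_def
      by (intro E_Pi_indep_disjoint[where K = "{..<j * d}" and K' = "{j * d..<Suc j * d}", OF _ _ fu gu])
        (use j in \<open>auto simp: set_uniform_below\<close>)
    also have "\<dots> \<le> E U (f x) * exp (- y x)"
      using E_survive_le[OF j len[OF x], of a] unfolding g_def y_def
      by (intro mult_left_mono E_nonneg) (auto simp: f_def mass_bounds)
    finally have "E U (\<lambda>u. f x u * g x u) * exp (y x) \<le> E U (f x) * exp (- y x) * exp (y x)"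
      by (intro mult_right_mono) auto
    also have "\<dots> = E U (f x)" by (simp add: exp_minus)
    finally show "E U (\<lambda>u. f x u * g x u) * exp (y x) \<le> E U (f x)" .
  qed
  also have "\<dots> = E U (\<lambda>u. E \<nu> (\<lambda>x. f x u))"
    by (rule E_swap) (simp_all add: fin)
  also have "\<dots> = E U (\<lambda>u. mass G a j u / mass G a j u)"
    by (intro E_cong) (simp add: f_def E_of_bool mass_def Int_def del: Int_iff)
  also have "\<dots> \<le> 1" by (rule E_le_const) auto
  finally show ?thesis unfolding y_def .
qed

lemma W_nonneg: "0 \<le> W G a j u"
  unfolding W_def by (intro mult_nonneg_nonneg geo_nonneg E_nonneg) (auto simp: mass_bounds l1_dist_nonneg)

text \<open>\<open>geo_E_le\<close> with the node of \<open>a\<close> before and after block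
  \<open>j\<close>, both restricted to \<open>G\<close>, and with the distance scaled by the rate
  \<open>2 ^ j / d\<close> of the block. The exponential moment is at most 1 by
  \<open>E_ratio_le\<close>.\<close>

lemma E_W_Suc_le:
  assumes j: "j < J"
  shows "2 ^ j / d * E U (W G a (Suc j)) \<le> 2 * (\<Psi> G a j - \<Psi> G a (Suc j)) + 1"
proof -
  let ?V = "\<lambda>u. E \<nu> (\<lambda>x. of_bool (x \<in> G \<inter> agree a (Suc j) u) * exp (2 ^ j / d * l1_dist x a)) / mass G a j u"
  have "2 ^ j / d * E U (W G a (Suc j)) = E U (\<lambda>u. 2 ^ j / d * W G a (Suc j) u)" by simp
  also have "\<dots> \<le> E U (\<lambda>u. 2 * (ln (1 + N * mass G a j u) - ln (1 + N * mass G a (Suc j) u)) + ?V u)"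
  proof (rule E_mono[OF finU])
    fix u
    have "2 ^ j / d * W G a (Suc j) u = geo N (mass G a (Suc j) u) *
        E \<nu> (\<lambda>x. of_bool (x \<in> G \<inter> agree a (Suc j) u) * (2 ^ j / d * l1_dist x a))"
    proof -
      have "E \<nu> (\<lambda>x. of_bool (x \<in> G \<inter> agree a (Suc j) u) * (2 ^ j / d * l1_dist x a))
        = E \<nu> (\<lambda>x. 2 ^ j / d * (of_bool (x \<in> G \<inter> agree a (Suc j) u) * l1_dist x a))"
        by (intro E_cong) simp
      also have "\<dots> = 2 ^ j / d * E \<nu> (\<lambda>x. of_bool (x \<in> G \<inter> agree a (Suc j) u) * l1_dist x a)"
        by (rule integral_mult_right_zero)
      finally show ?thesis by (simp only: W_def mult.left_commute)
    qed
    also have "\<dots> \<le> 2 * (ln (1 + N * mass G a j u) - ln (1 + N * mass G a (Suc j) u)) + ?V u"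
      unfolding mass_def
      by (rule geo_E_le[OF fin]) (auto simp: agree_Suc l1_dist_nonneg)
    finally show "2 ^ j / d * W G a (Suc j) u \<le> 2 * (ln (1 + N * mass G a j u) - ln (1 + N * mass G a (Suc j) u)) + ?V u" .
  qed
  also have "\<dots> = 2 * (\<Psi> G a j - \<Psi> G a (Suc j)) + E U ?V"
    unfolding \<Psi>_def by (subst E_add[OF finU], subst integral_mult_right_zero, subst E_diff[OF finU]) simp
  also have "\<dots> \<le> 2 * (\<Psi> G a j - \<Psi> G a (Suc j)) + 1"
    using E_ratio_le[OF j] by simp
  finally show ?thesis .
qed

lemma \<Psi>_nonneg: "0 \<le> \<Psi> G a j"
  unfolding \<Psi>_def by (intro E_nonneg ln_ge_zero) (simp add: mass_bounds)

lemma \<Psi>_le: "\<Psi> G a j \<le> ln (1 + N)"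
  unfolding \<Psi>_def
  by (intro E_le_const finU) (auto simp: mass_bounds mult_left_le intro!: ln_mono add_pos_nonneg)

lemma E_W_0_le: "E U (W G a 0) \<le> d"
proof (rule E_le_const[OF finU])
  fix u
  have l: "l1_dist x a \<le> d" if "length x = d" for x
  proof -
    have "card {k. k < d \<and> x ! k \<noteq> a ! k} \<le> card {..<d}" by (intro card_mono) auto
    then show ?thesis by (simp add: l1_dist_card[OF that])
  qed
  have "E \<nu> (\<lambda>x. of_bool (x \<in> G \<inter> agree a 0 u) * l1_dist x a) \<le> E \<nu> (\<lambda>x. of_bool (x \<in> G \<inter> agree a 0 u) * d)"
    using l len by (intro E_mono[OF fin] mult_left_mono) auto
  also have "\<dots> = mass G a 0 u * d" by (simp add: E_of_bool mass_def Int_def del: Int_iff)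
  finally have "W G a 0 u \<le> geo N (mass G a 0 u) * (mass G a 0 u * d)"
    unfolding W_def by (intro mult_left_mono geo_nonneg) (simp_all add: mass_bounds)
  also have "\<dots> = (geo N (mass G a 0 u) * mass G a 0 u) * d" by simp
  also have "\<dots> \<le> 1 * real d"
    using geo_mult_le[OF mass_bounds, of N G a 0 u] by (intro mult_right_mono) auto
  finally show "W G a 0 u \<le> d" by simp
qed

text \<open>The charge for one differing coordinate: a bound \<open>2 ^ Suc j / d\<close> on the
  chance that it is revealed in blocks up to \<open>j\<close>, times the expected distances to the
  representatives before and after block \<open>j\<close>.\<close>

definition total :: "bool list set \<Rightarrow> bool list \<Rightarrow> real" where
  "total G a = (\<Sum>j<J. 2 ^ Suc j / d * (E U (W G a j) + E U (W G a (Suc j))))"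

text \<open>The sum \<open>S\<close> of the bounds from \<open>E_W_Suc_le\<close> telescopes to at
  most \<open>2 * ln (1 + N) + J\<close>. The terms at \<open>Suc j\<close> carry twice its weights;
  the terms at \<open>j\<close> carry four times them after a shift of the index, apart from
  \<open>j = 0\<close>, which costs at most 2. Altogether this is \<open>2 + 6 * S\<close>.\<close>

lemma total_le: "total G a \<le> 2 + 6 * J + 12 * ln (1 + N)"
proof -
  let ?m = "\<lambda>j. E U (W G a j)"
  have m0: "0 \<le> ?m j" for j by (intro E_nonneg W_nonneg)
  have "n \<le> J \<Longrightarrow> (\<Sum>j<n. 2 ^ j / d * ?m (Suc j)) \<le> 2 * (\<Psi> G a 0 - \<Psi> G a n) + n" for n
  proof (induction n)
    case (Suc n)
    then show ?case using E_W_Suc_le[of n G a] by simp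
  qed simp
  from this[OF order_refl] have s: "(\<Sum>j<J. 2 ^ j / d * ?m (Suc j)) \<le> 2 * ln (1 + N) + J"
    using \<Psi>_nonneg[of G a J] \<Psi>_le[of G a 0] by simp
  have "(\<Sum>j<J. 2 ^ Suc j / d * ?m j) \<le> (\<Sum>j<Suc J. 2 ^ Suc j / d * ?m j)"
    using m0 by simp
  also have "\<dots> = 2 / d * ?m 0 + 4 * (\<Sum>j<J. 2 ^ j / d * ?m (Suc j))"
    by (subst sum.lessThan_Suc_shift) (simp add: sum_distrib_left mult.assoc)
  also have "2 / d * ?m 0 \<le> 2" using E_W_0_le[of G a] d by (simp add: field_simps)
  finally have "(\<Sum>j<J. 2 ^ Suc j / d * ?m j) \<le> 2 + 4 * (\<Sum>j<J. 2 ^ j / d * ?m (Suc j))" by simp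
  moreover have "total G a = (\<Sum>j<J. 2 ^ Suc j / d * ?m j) + 2 * (\<Sum>j<J. 2 ^ j / d * ?m (Suc j))"
    by (simp add: total_def distrib_left sum.distrib sum_distrib_left mult.assoc)
  ultimately show ?thesis using s by simp
qed

lemma E_U_component: "p < J * d \<Longrightarrow> E U (\<lambda>u. f (u p)) = E (uniform_below d) f"
proof -
  assume p: "p < J * d"
  have "E U (\<lambda>u. f (u p)) = E (map_pmf (\<lambda>u. u p) U) f" by simp
  also have "map_pmf (\<lambda>u. u p) U = uniform_below d"
    unfolding U_def using p by (subst Pi_pmf_component) auto
  finally show ?thesis .
qed

text \<open>If \<open>l \<ge> i\<close>, the node after \<open>i\<close> blocks does not depend on
  the draw for coordinate \<open>k\<close> in block \<open>l\<close>, and the expectation factors.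
  If \<open>l < i\<close>, a revealed coordinate \<open>k\<close> confines the node to vectors that
  agree with \<open>a\<close> there, so \<open>W UNIV\<close> may be replaced by \<open>W\<close> on
  that set; the replacement is insensitive to the draw, and the expectation factors again.\<close>

lemma E_hit_W_le:
  assumes lj: "l < J" "i \<le> J" and k: "k < d"
  shows "E U (\<lambda>u. of_bool (u (l * d + k) < 2 ^ l) * W UNIV a i u) \<le>
    2 ^ l / d * (E U (W UNIV a i) + E U (W {x. x ! k = a ! k} a i))"
proof -
  let ?p = "l * d + k" and ?G = "{x. x ! k = a ! k}"
  have p: "?p < J * d" by (rule position_lt[OF lj(1) k])
  have hit: "E U (\<lambda>u. of_bool (u ?p < 2 ^ l)) \<le> 2 ^ l / d"
    using E_U_component[OF p, of "\<lambda>v. of_bool (v < 2 ^ l)"] prob_hit_le[of l] by (simp only: E_of_bool)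
  have m0: "0 \<le> E U (W G a i)" for G by (intro E_nonneg W_nonneg)
  have ind: "E U (\<lambda>u. of_bool (u ?p < 2 ^ l) * W G a i u) \<le> 2 ^ l / d * E U (W G a i)"
    if W: "\<And>u u'. (\<And>q. q \<in> {..<J * d} - {?p} \<Longrightarrow> u q = u' q) \<Longrightarrow> W G a i u = W G a i u'" for G
  proof -
    have "E U (\<lambda>u. of_bool (u ?p < 2 ^ l) * W G a i u) = E U (\<lambda>u. of_bool (u ?p < 2 ^ l)) * E U (W G a i)"
      unfolding U_def
      by (rule E_Pi_indep_disjoint[where K = "{?p}" and K' = "{..<J * d} - {?p}", OF _ _ _ W])
        (use p in \<open>auto simp: set_uniform_below\<close>)
    also have "\<dots> \<le> 2 ^ l / d * E U (W G a i)"
      by (intro mult_right_mono hit m0)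
    finally show ?thesis .
  qed
  show ?thesis
  proof (cases "l < i")
    case True
    have "E U (\<lambda>u. of_bool (u ?p < 2 ^ l) * W UNIV a i u) = E U (\<lambda>u. of_bool (u ?p < 2 ^ l) * W ?G a i u)"
    proof (rule E_cong)
      fix u
      show "of_bool (u ?p < 2 ^ l) * W UNIV a i u = of_bool (u ?p < 2 ^ l) * W ?G a i u"
      proof (cases "u ?p < 2 ^ l")
        case hit: True
        then have "agree a i u \<subseteq> ?G" using True k by (auto simp: agree_def)
        then have "?G \<inter> agree a i u = UNIV \<inter> agree a i u" by auto
        then show ?thesis unfolding W_def mass_def by simp
      qed simp
    qed
    also have "\<dots> \<le> 2 ^ l / d * E U (W ?G a i)"
    proof (rule ind)
      fix u u' :: "nat \<Rightarrow> nat" assume *: "\<And>q. q \<in> {..<J * d} - {?p} \<Longrightarrow> u q = u' q"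
      have eq: "u (l' * d + k') = u' (l' * d + k')" if "l' < i" "k' < d" "k' \<noteq> k" for l' k'
      proof (rule *)
        have "(l' * d + k') mod d \<noteq> (l * d + k) mod d" using that k by simp
        then have "l' * d + k' \<noteq> l * d + k" by metis
        then show "l' * d + k' \<in> {..<J * d} - {?p}" using position_lt[of l' k'] that lj by simp
      qed
      have "x \<in> agree a i u \<longleftrightarrow> x \<in> agree a i u'" if "x \<in> ?G" for x
        using eq that unfolding agree_def by (smt (verit, best) mem_Collect_eq)
      then have "?G \<inter> agree a i u = ?G \<inter> agree a i u'" by blast
      then show "W ?G a i u = W ?G a i u'" unfolding W_def mass_def by simp
    qed
    also have "\<dots> \<le> 2 ^ l / d * (E U (W UNIV a i) + E U (W ?G a i))"
      using m0 by (intro mult_left_mono) auto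
    finally show ?thesis .
  next
    case False
    have "E U (\<lambda>u. of_bool (u ?p < 2 ^ l) * W UNIV a i u) \<le> 2 ^ l / d * E U (W UNIV a i)"
    proof (rule ind)
      fix u u' :: "nat \<Rightarrow> nat" assume *: "\<And>q. q \<in> {..<J * d} - {?p} \<Longrightarrow> u q = u' q"
      have "i * d \<le> l * d" "i * d \<le> J * d" using False lj by (auto intro!: mult_right_mono)
      then have "agree a i u = agree a i u'"
      proof (intro agree_cong *)
        fix q assume "q < i * d"
        then have "q < l * d" "q < J * d" using \<open>i * d \<le> l * d\<close> \<open>i * d \<le> J * d\<close> by linarith+
        then show "q \<in> {..<J * d} - {?p}" by simp
      qed
      then show "W UNIV a i u = W UNIV a i u'" unfolding W_def mass_def by simp
    qed
    also have "\<dots> \<le> 2 ^ l / d * (E U (W UNIV a i) + E U (W ?G a i))"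
      using m0 by (intro mult_left_mono) auto
    finally show ?thesis .
  qed
qed

text \<open>In the expectation of summand \<open>n\<close> of \<open>off_le\<close>, each earlier
  sample contributes \<open>1 - mass\<close>, sample \<open>n\<close> the restricted distance, and
  later samples nothing. Summing the powers gives \<open>geo\<close>.\<close>

lemma E_off_le: "E B (\<lambda>b. trie.off d N u b j a) \<le> W UNIV a j u"
proof -
  define A where "A = agree a j u"
  have pre: "trie.pre d u (j * d) x = trie.pre d u (j * d) a \<longleftrightarrow> x \<in> A" for x
    unfolding A_def agree_def trie.pre_eq_iff_agree[OF d] by simp
  define f where "f n i x = (if i < n then of_bool (x \<notin> A) else if i = n then of_bool (x \<in> A) * l1_dist x a else 1)" for n i :: nat and x
  have prodf: "(\<Prod>i<N. h i) = (\<Prod>i<n. h i) * h n" if "n < N" "\<And>i. n < i \<Longrightarrow> h i = 1" for h :: "nat \<Rightarrow> real" and n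
  proof -
    have "(\<Prod>i<N. h i) = (\<Prod>i<Suc n. h i)"
      using that by (intro prod.mono_neutral_right) auto
    then show ?thesis by simp
  qed
  have "E B (\<lambda>b. trie.off d N u b j a) \<le> E B (\<lambda>b. \<Sum>n<N. \<Prod>i<N. f n i (b i))"
  proof (rule E_mono[OF finB])
    fix b
    have "(\<Prod>i<N. f n i (b i)) = (\<Prod>i<n. of_bool (b i \<notin> A)) * (of_bool (b n \<in> A) * l1_dist (b n) a)" if "n < N" for n
      by (subst prodf[OF that]) (auto simp: f_def)
    then show "trie.off d N u b j a \<le> (\<Sum>n<N. \<Prod>i<N. f n i (b i))"
      using trie.off_le[of d N u b j a] by (simp add: pre)
  qed
  also have "\<dots> = (\<Sum>n<N. E B (\<lambda>b. \<Prod>i<N. f n i (b i)))"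
    by (simp add: E_sum_fun)
  also have "\<dots> = (\<Sum>n<N. \<Prod>i<N. E \<nu> (f n i))"
    unfolding B_def
    by (intro sum.cong[OF refl] expectation_prod_Pi_pmf)
      (auto simp: f_def fin l1_dist_nonneg intro!: integrable_measure_pmf_finite)
  also have "\<dots> = (\<Sum>n<N. (1 - mass UNIV a j u) ^ n * E \<nu> (\<lambda>x. of_bool (x \<in> A) * l1_dist x a))"
  proof (rule sum.cong[OF refl])
    fix n assume "n \<in> {..<N}"
    then have n: "n < N" by simp
    have "E \<nu> (f n i) = 1 - mass UNIV a j u" if "i < n" for i
    proof -
      have "f n i = (\<lambda>x. of_bool (x \<notin> A))" using that by (intro ext) (simp add: f_def)
      then have "E \<nu> (f n i) = measure_pmf.prob \<nu> {x. x \<notin> A}" by (simp only: E_of_bool)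
      also have "{x. x \<notin> A} = space (measure_pmf \<nu>) - A" by auto
      also have "measure_pmf.prob \<nu> (space (measure_pmf \<nu>) - A) = 1 - measure_pmf.prob \<nu> A"
        by (rule measure_pmf.prob_compl) simp
      finally show ?thesis by (simp add: mass_def A_def)
    qed
    then show "(\<Prod>i<N. E \<nu> (f n i)) = (1 - mass UNIV a j u) ^ n * E \<nu> (\<lambda>x. of_bool (x \<in> A) * l1_dist x a)"
    proof -
      have "f n i = (\<lambda>_. 1)" if "n < i" for i using that by (auto simp: f_def)
      moreover have "f n n = (\<lambda>x. of_bool (x \<in> A) * l1_dist x a)" by (auto simp: f_def)
      moreover assume "\<And>i. i < n \<Longrightarrow> E \<nu> (f n i) = 1 - mass UNIV a j u"
      ultimately show ?thesis by (subst prodf[OF n]) auto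
    qed
  qed
  also have "\<dots> = W UNIV a j u" by (simp add: W_def geo_def sum_distrib_right A_def)
  finally show ?thesis .
qed

text \<open>Union bound over the differing coordinates and the blocks up to \<open>j\<close>.
  Because the rates double from block to block, their sum is at most
  \<open>2 ^ Suc j / d\<close>.\<close>

lemma E_hits_off_le:
  assumes j: "j < J" "i \<le> Suc j"
  shows "E U (\<lambda>u. E B (\<lambda>b. of_bool (trie.hits d u j a a') * trie.off d N u b i a)) \<le>
    (\<Sum>k | k < d \<and> a ! k \<noteq> a' ! k. 2 ^ Suc j / d * (E U (W UNIV a i) + E U (W {x. x ! k = a ! k} a i)))"
proof -
  let ?D = "{k. k < d \<and> a ! k \<noteq> a' ! k}"
  have h: "of_bool (trie.hits d u j a a') \<le> (\<Sum>l\<le>j. \<Sum>k\<in>?D. of_bool (u (l * d + k) < 2 ^ l) :: real)" for u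
  proof (cases "trie.hits d u j a a'")
    case True
    then obtain l k where lk: "l \<le> j" "k \<in> ?D" "u (l * d + k) < 2 ^ l" by (auto simp: trie.hits_def)
    have "1 \<le> (\<Sum>k\<in>?D. of_bool (u (l * d + k) < 2 ^ l) :: real)"
      using lk member_le_sum[of k ?D "\<lambda>k. of_bool (u (l * d + k) < 2 ^ l) :: real"] by simp
    also have "\<dots> \<le> (\<Sum>l\<le>j. \<Sum>k\<in>?D. of_bool (u (l * d + k) < 2 ^ l))"
      using lk by (intro member_le_sum) (auto simp: sum_nonneg)
    finally show ?thesis by (simp add: True)
  qed (simp add: sum_nonneg)
  have "E U (\<lambda>u. E B (\<lambda>b. of_bool (trie.hits d u j a a') * trie.off d N u b i a)) \<le>
     E U (\<lambda>u. (\<Sum>l\<le>j. \<Sum>k\<in>?D. of_bool (u (l * d + k) < 2 ^ l) * W UNIV a i u))"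
  proof (rule E_mono[OF finU])
    fix u
    have "E B (\<lambda>b. of_bool (trie.hits d u j a a') * trie.off d N u b i a) \<le> of_bool (trie.hits d u j a a') * W UNIV a i u"
      using E_off_le[of u i a] by (simp add: mult_left_mono)
    also have "\<dots> \<le> (\<Sum>l\<le>j. \<Sum>k\<in>?D. of_bool (u (l * d + k) < 2 ^ l)) * W UNIV a i u"
      using h by (intro mult_right_mono W_nonneg)
    finally show "E B (\<lambda>b. of_bool (trie.hits d u j a a') * trie.off d N u b i a)
      \<le> (\<Sum>l\<le>j. \<Sum>k\<in>?D. of_bool (u (l * d + k) < 2 ^ l) * W UNIV a i u)"
      by (simp only: sum_distrib_right)
  qed
  also have "\<dots> = (\<Sum>l\<le>j. \<Sum>k\<in>?D. E U (\<lambda>u. of_bool (u (l * d + k) < 2 ^ l) * W UNIV a i u))"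
    by (simp only: E_sum_fun[OF finU])
  also have "\<dots> \<le> (\<Sum>l\<le>j. \<Sum>k\<in>?D. 2 ^ l / d * (E U (W UNIV a i) + E U (W {x. x ! k = a ! k} a i)))"
    using j by (intro sum_mono E_hit_W_le) auto
  also have "\<dots> = (\<Sum>k\<in>?D. (\<Sum>l\<le>j. 2 ^ l) / d * (E U (W UNIV a i) + E U (W {x. x ! k = a ! k} a i)))"
    by (subst sum.swap) (simp add: sum_distrib_right sum_divide_distrib)
  also have "\<dots> \<le> (\<Sum>k\<in>?D. 2 ^ Suc j / d * (E U (W UNIV a i) + E U (W {x. x ! k = a ! k} a i)))"
  proof (intro sum_mono mult_right_mono divide_right_mono)
    show "(\<Sum>l\<le>j. 2 ^ l) \<le> (2 ^ Suc j :: real)"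
      by (induction j) auto
  qed (auto intro!: add_nonneg_nonneg E_nonneg W_nonneg)
  finally show ?thesis .
qed

text \<open>Each differing coordinate is charged \<open>total\<close> for both vectors and for both
  sets of \<open>E_hit_W_le\<close>, hence \<open>4 * (2 + 6 * J + 12 * ln (1 + N))\<close>. The
  term without hit adds 1 per block, which makes \<open>25 * J\<close> out of
  \<open>24 * J\<close>.\<close>

theorem E_dm_vfeats_le:
  assumes a: "length a = d" "length a' = d"
  shows "E U (\<lambda>u. E B (\<lambda>b. dm (trie.vfeats d N u b J a) (trie.vfeats d N u b J a'))) \<le>
    l1_dist a a' * (25 * J + 8 + 48 * ln (1 + N))"
proof -
  let ?h = "\<lambda>u j. of_bool (trie.hits d u j a a') :: real"
  let ?o = "\<lambda>u b i a. trie.off d N u b i a"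
  let ?D = "{k. k < d \<and> a ! k \<noteq> a' ! k}"
  have lenB: "length (b i) = d" if "b \<in> set_pmf B" "i < N" for b i
    using that len by (auto simp: B_def set_Pi_pmf PiE_dflt_def)
  define T where "T i j x = E U (\<lambda>u. E B (\<lambda>b. ?h u j * ?o u b i x))" for i j x
  define R where "R x = (\<Sum>k\<in>?D. total UNIV x + total {y. y ! k = x ! k} x)" for x
  have T: "(\<Sum>j<J. T j j x + T (Suc j) j x) \<le> R x" if "x = a \<or> x = a'" for x
  proof -
    have Tij: "T i j x \<le> (\<Sum>k\<in>?D. 2 ^ Suc j / d * (E U (W UNIV x i) + E U (W {y. y ! k = x ! k} x i)))"
      if "j < J" "i \<le> Suc j" for i j
    proof -
      have "?D = {k. k < d \<and> a' ! k \<noteq> a ! k}" by auto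
      then show ?thesis unfolding T_def
        using \<open>x = a \<or> x = a'\<close> E_hits_off_le[OF that, of a a'] E_hits_off_le[OF that, of a' a] trie.hits_commute[of d _ j a' a]
        by auto
    qed
    have "(\<Sum>j<J. T j j x + T (Suc j) j x) \<le> (\<Sum>j<J. \<Sum>k\<in>?D.
       2 ^ Suc j / d * (E U (W UNIV x j) + E U (W {y. y ! k = x ! k} x j))
       + 2 ^ Suc j / d * (E U (W UNIV x (Suc j)) + E U (W {y. y ! k = x ! k} x (Suc j))))"
      unfolding sum.distrib by (intro add_mono sum_mono Tij) auto
    also have "\<dots> = R x" unfolding R_def total_def sum.distrib[symmetric]
      by (subst sum.swap) (simp add: algebra_simps)
    finally show ?thesis .
  qed
  have R: "R x \<le> card ?D * (2 * (2 + 6 * J + 12 * ln (1 + N)))" for x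
  proof -
    have "R x \<le> (\<Sum>k\<in>?D. 2 * (2 + 6 * J + 12 * ln (1 + N)))"
      unfolding R_def using total_le by (intro sum_mono) (smt (verit))
    then show ?thesis by simp
  qed
  have "E U (\<lambda>u. E B (\<lambda>b. dm (trie.vfeats d N u b J a) (trie.vfeats d N u b J a'))) \<le>
    E U (\<lambda>u. E B (\<lambda>b. \<Sum>j<J. l1_dist a a' + ?h u j * (?o u b j a + ?o u b (Suc j) a + (?o u b j a' + ?o u b (Suc j) a'))))"
    by (intro E_mono finU finB trie.dm_vfeats_le lenB a)
  also have "\<dots> = (\<Sum>j<J. l1_dist a a' + ((T j j a + T (Suc j) j a) + (T j j a' + T (Suc j) j a')))"
    unfolding T_def by (simp only: E_sum_fun[OF finU] E_sum_fun[OF finB] E_add[OF finU] E_add[OF finB] distrib_left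
        measure_pmf.prob_space integral_const) simp
  also have "\<dots> = J * l1_dist a a' + ((\<Sum>j<J. T j j a + T (Suc j) j a) + (\<Sum>j<J. T j j a' + T (Suc j) j a'))"
    by (simp add: sum.distrib)
  also have "\<dots> \<le> J * l1_dist a a' + (card ?D * (2 * (2 + 6 * J + 12 * ln (1 + N))) + card ?D * (2 * (2 + 6 * J + 12 * ln (1 + N))))"
    using order_trans[OF T R, of a] order_trans[OF T R, of a'] by (intro add_left_mono add_mono) auto
  also have "\<dots> = l1_dist a a' * (25 * J + 8 + 48 * ln (1 + N))"
    by (simp add: l1_dist_card[OF a(1)] algebra_simps)
  finally show ?thesis .
qed

end

text \<open>Layer-cake decomposition: replacing multiplicities by layers turns differences of
  multisets into differences of sets, which can be sampled elementwise.\<close>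

lemma card_layers:
  "card {(f, t). 1 \<le> t \<and> t \<le> count A f \<and> count B f < t} = size (A - B)"
proof -
  have "{(f, t). 1 \<le> t \<and> t \<le> count A f \<and> count B f < t} = (SIGMA f:set_mset A. {count B f<..count A f})"
    by (auto simp: Suc_le_eq intro!: count_inI)
  then have "card {(f, t). 1 \<le> t \<and> t \<le> count A f \<and> count B f < t} = (\<Sum>f\<in>set_mset A. count A f - count B f)"
    by simp
  also have "\<dots> = (\<Sum>f\<in>set_mset (A - B). count (A - B) f)"
    by (intro sum.mono_neutral_cong_right) (auto simp: in_diff_count dest: in_diffD)
  also have "\<dots> = size (A - B)" by (simp add: size_multiset_overloaded_eq)
  finally show ?thesis .
qed

context trie begin

section \<open>Hashing the features\<close>

text \<open>The group of a feature consists of \<open>s + 1\<close> table entries: the cells \<open>1, \<dots>, s\<close> for its possible multiplicities, and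
  cell 0, which the query program uses as a counter.  As the first \<open>t\<close> cells of a feature of multiplicity \<open>t\<close> are in
  use, the symmetric difference of two sets of cells has as many elements as that of the multisets.\<close>

definition gidx :: "nat \<Rightarrow> nat \<Rightarrow> bool list \<times> nat \<Rightarrow> nat" where
  "gidx s J f = ((((ix (butlast (fst f)) * (J * d) + (length (fst f) - 1)) * 2 + of_bool (last (fst f))) * d + snd f) * (s + 1))"

text \<open>The node of a feature may be unoccupied, but its parent never is. A node is therefore
  numbered by the index of the first sample at its parent, its length and its last bit.\<close>

definition valid :: "nat \<Rightarrow> (bool list \<times> nat) set" where
  "valid J = {(v, k). v \<noteq> [] \<and> length v \<le> J * d \<and> occ (butlast v) \<and> k < d}"

definition cells :: "nat \<Rightarrow> nat \<Rightarrow> point \<Rightarrow> nat set" where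
  "cells s J X = {gidx s J f + t | f t. 1 \<le> t \<and> t \<le> count (pfeats J X) f}"

definition hash :: "nat \<Rightarrow> nat \<Rightarrow> (nat \<Rightarrow> nat) \<Rightarrow> point \<Rightarrow> nat" where
  "hash s J \<tau> X = set_encode {c \<in> cells s J X. \<tau> c = 0}"

lemma nd_butlast_occ: "nd m a \<noteq> [] \<Longrightarrow> occ (butlast (nd m a))"
  by (induction m) (auto split: if_splits)

lemma feats_valid: "f \<in># feats j a \<Longrightarrow> j < J \<Longrightarrow> f \<in> valid J"
proof -
  assume f: "f \<in># feats j a" and j: "j < J"
  have "Suc j * d \<le> J * d" using j by (intro mult_right_mono) auto
  moreover have "fst f = nd (Suc j * d) a" using f by (auto simp: feats_def)
  moreover have ne: "fst f \<noteq> []" using feats_nonempty_length(1)[OF f] by auto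
  moreover have "occ (butlast (fst f))"
    using ne nd_butlast_occ[of "Suc j * d" a] \<open>fst f = nd (Suc j * d) a\<close> by (simp only:) simp
  ultimately show ?thesis
    using feats_nonempty_length[OF f] unfolding valid_def by (cases f) auto
qed

lemma vfeats_valid: "f \<in># vfeats J a \<Longrightarrow> f \<in> valid J"
proof -
  have "f \<in># vfeats n a \<Longrightarrow> n \<le> J \<Longrightarrow> f \<in> valid J" for n
    by (induction n) (auto simp: vfeats_Suc vfeats_def[of 0] intro: feats_valid)
  then show "f \<in># vfeats J a \<Longrightarrow> f \<in> valid J" by blast
qed

lemma pfeats_valid: "f \<in># pfeats J X \<Longrightarrow> f \<in> valid J"
  unfolding pfeats_def by (induction X) (auto dest: vfeats_valid)

lemma count_feats_le: "count (feats j a) f \<le> 1"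
proof -
  have "inj (Pair (nd (Suc j * d) a))" by (rule injI) simp
  then have "feats j a = mset_set (Pair (nd (Suc j * d) a) ` diffs j a)"
    unfolding feats_def by (intro image_mset_mset_set) (auto intro: inj_on_subset)
  then show ?thesis by (simp add: count_mset_set')
qed

text \<open>Features of different blocks are distinct by the lengths of their nodes. A multiplicity
  in a point is then at most the number of its vectors, which is why \<open>s\<close> cells per
  feature suffice.\<close>

lemma count_vfeats_le: "count (vfeats J a) f \<le> 1"
proof (induction J)
  case (Suc J)
  show ?case
  proof (cases "f \<in># feats J a")
    case True
    then have "f \<notin># vfeats J a" using vfeats_length[of f J a] feats_nonempty_length(1)[OF True] by auto
    then show ?thesis using count_feats_le[of J a f] by (simp add: vfeats_Suc not_in_iff)
  next
    case False
    then show ?thesis using Suc by (simp add: vfeats_Suc not_in_iff)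
  qed
qed (simp add: vfeats_def)

lemma count_pfeats_le: "count (pfeats J X) f \<le> size X"
  unfolding pfeats_def
proof (induction X)
  case (add a X)
  then show ?case using count_vfeats_le[of J a f] by simp
qed simp

text \<open>\<open>gidx\<close> is a mixed-radix number whose digits are recovered one after the
  other by uniqueness of quotient and remainder. The sample index and the length determine the
  parent, because the parent is a prefix of that sample.\<close>

lemma gidx_inj:
  assumes f: "f \<in> valid J" "f' \<in> valid J" and t: "t \<le> s" "t' \<le> s"
    and eq: "gidx s J f + t = gidx s J f' + t'"
  shows "f = f'" "t = t'"
proof -
  have dm: "a = a'" "r = r'" if "a * n + r = a' * n + r'" "r < n" "r' < n" for a a' n r r' :: nat
    using that by (metis div_mult_self3 div_less add.commute add_0 less_nat_zero_code mult.commute,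
        metis mod_mult_self3 mod_less)
  obtain v k v' k' where vk: "f = (v, k)" "f' = (v', k')" by fastforce
  have v: "v \<noteq> []" "length v \<le> J * d" "occ (butlast v)" "k < d"
      "v' \<noteq> []" "length v' \<le> J * d" "occ (butlast v')" "k' < d"
    using f vk by (auto simp: valid_def)
  note e1 = dm[OF eq[unfolded gidx_def vk fst_conv snd_conv]]
  show "t = t'" using e1(2) t by simp
  have g1: "((ix (butlast v) * (J * d) + (length v - 1)) * 2 + of_bool (last v)) * d + k =
    ((ix (butlast v') * (J * d) + (length v' - 1)) * 2 + of_bool (last v')) * d + k'"
    using e1(1) t by simp
  note e2 = dm[OF g1 v(4,8)]
  note e3 = dm[OF e2(1)]
  have g3: "ix (butlast v) * (J * d) + (length v - 1) = ix (butlast v') * (J * d) + (length v' - 1)"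
    "of_bool (last v) = (of_bool (last v') :: nat)"
    using e3 by simp_all
  have "length v - 1 < J * d" "length v' - 1 < J * d"
    using v by (cases v; cases v'; simp)+
  note e4 = dm[OF g3(1) this]
  have "butlast v = pre (length v - 1) (b (ix (butlast v)))" "butlast v' = pre (length v' - 1) (b (ix (butlast v')))"
    using ix_props(2)[OF v(3)] ix_props(2)[OF v(7)] by simp_all
  then have "butlast v = butlast v'" using e4 by metis
  moreover have "last v = last v'" using g3(2) by (simp only: of_bool_eq_iff)
  ultimately have "butlast v @ [last v] = butlast v' @ [last v']" by (simp only:)
  then have "v = v'" using append_butlast_last_id[OF v(1)] append_butlast_last_id[OF v(5)] by (simp only:)
  then show "f = f'" using e2(2) vk by simp
qed

lemma gidx_less:
  assumes "f \<in> valid J" "t \<le> s"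
  shows "gidx s J f + t < N * (J * d) * 2 * d * (s + 1)"
proof -
  have mono: "a * n + r < m * n" if "a < m" "r < n" for a m n r :: nat
  proof -
    have "Suc a * n \<le> m * n" using that by (intro mult_right_mono) auto
    then show ?thesis using that by simp
  qed
  obtain v k where f: "f = (v, k)" by fastforce
  have "v \<noteq> []" "length v \<le> J * d" "ix (butlast v) < N" "k < d"
    using assms ix_props(1) by (auto simp: f valid_def)
  moreover from this have "length v - 1 < J * d" by (cases v) auto
  ultimately show ?thesis unfolding gidx_def f fst_conv snd_conv using assms(2)
    by (intro mono) auto
qed

lemma finite_cells: "finite (cells s J X)"
proof -
  have "cells s J X \<subseteq> (\<lambda>(f, t). gidx s J f + t) ` (SIGMA f:set_mset (pfeats J X). {..count (pfeats J X) f})"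
  proof
    fix c assume "c \<in> cells s J X"
    then obtain f t where "c = gidx s J f + t" "1 \<le> t" "t \<le> count (pfeats J X) f"
      unfolding cells_def by blast
    then show "c \<in> (\<lambda>(f, t). gidx s J f + t) ` (SIGMA f:set_mset (pfeats J X). {..count (pfeats J X) f})"
      by (intro image_eqI[of _ _ "(f, t)"]) (auto simp: count_inI)
  qed
  then show ?thesis by (rule finite_subset) auto
qed

lemma card_cells_diff:
  assumes "size X \<le> s" "size Y \<le> s"
  shows "card (cells s J X - cells s J Y) = size (pfeats J X - pfeats J Y)"
proof -
  let ?g = "\<lambda>(f, t). gidx s J f + t"
  let ?L = "{(f, t). 1 \<le> t \<and> t \<le> count (pfeats J X) f \<and> count (pfeats J Y) f < t}"
  have val: "f \<in> valid J" "t \<le> s" if "1 \<le> t" "t \<le> count (pfeats J Z) f" "size Z \<le> s" for f t Z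
    using that pfeats_valid[of f J Z] count_pfeats_le[of J Z f] by (auto simp: count_inI)
  have "cells s J X - cells s J Y = ?g ` ?L"
  proof
    show "cells s J X - cells s J Y \<subseteq> ?g ` ?L"
    proof
      fix c assume c: "c \<in> cells s J X - cells s J Y"
      then obtain f t where f: "c = gidx s J f + t" "1 \<le> t" "t \<le> count (pfeats J X) f"
        unfolding cells_def by blast
      moreover from this have "\<not> t \<le> count (pfeats J Y) f" using c unfolding cells_def by blast
      ultimately show "c \<in> ?g ` ?L" by (intro image_eqI[of _ _ "(f, t)"]) auto
    qed
    show "?g ` ?L \<subseteq> cells s J X - cells s J Y"
    proof (clarify, intro DiffI)
      fix f t assume *: "1 \<le> t" "t \<le> count (pfeats J X) f" "count (pfeats J Y) f < t"
      then show "gidx s J f + t \<in> cells s J X" unfolding cells_def by blast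
      show "gidx s J f + t \<notin> cells s J Y"
      proof
        assume "gidx s J f + t \<in> cells s J Y"
        then obtain f' t' where f': "gidx s J f + t = gidx s J f' + t'" "1 \<le> t'" "t' \<le> count (pfeats J Y) f'"
          unfolding cells_def by blast
        have "f = f'" "t = t'"
          using gidx_inj[OF val(1)[OF *(1,2) assms(1)] val(1)[OF f'(2,3) assms(2)] val(2)[OF *(1,2) assms(1)]
            val(2)[OF f'(2,3) assms(2)] f'(1)] by auto
        then show False using * f' by simp
      qed
    qed
  qed
  moreover have "inj_on ?g ?L"
  proof (rule inj_onI, clarify)
    fix f t f' t'
    assume *: "1 \<le> t" "t \<le> count (pfeats J X) f" "1 \<le> t'" "t' \<le> count (pfeats J X) f'"
      "gidx s J f + t = gidx s J f' + t'"
    show "f = f' \<and> t = t'"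
      using gidx_inj[OF val(1)[OF *(1,2) assms(1)] val(1)[OF *(3,4) assms(1)] val(2)[OF *(1,2) assms(1)]
            val(2)[OF *(3,4) assms(1)] *(5)] by auto
  qed
  ultimately show ?thesis by (simp only: card_image card_layers)
qed

lemma cells_less: "size X \<le> s \<Longrightarrow> c \<in> cells s J X \<Longrightarrow> c < N * (J * d) * 2 * d * (s + 1)"
proof -
  assume X: "size X \<le> s" and c: "c \<in> cells s J X"
  then obtain f t where f: "c = gidx s J f + t" "1 \<le> t" "t \<le> count (pfeats J X) f"
    unfolding cells_def by blast
  have "f \<in> valid J" using f by (intro pfeats_valid[of f J X] count_inI) simp
  moreover have "t \<le> s" using f(3) count_pfeats_le[of J X f] X by simp
  ultimately show ?thesis using f(1) gidx_less by simp
qed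

text \<open>Two hash values agree iff no cell in the symmetric difference of the cell sets is
  selected, and cells are selected independently with probability \<open>1 / G\<close>.\<close>

lemma prob_hash_eq:
  assumes G: "0 < G" and XY: "size X \<le> s" "size Y \<le> s"
  shows "measure_pmf.prob (Pi_pmf {..<N * (J * d) * 2 * d * (s + 1)} 0 (\<lambda>_. uniform_below G))
      {\<tau>. hash s J \<tau> X = hash s J \<tau> Y} = (1 - 1 / G) ^ dm (pfeats J X) (pfeats J Y)"
proof -
  let ?W = "N * (J * d) * 2 * d * (s + 1)"
  let ?D = "(cells s J X - cells s J Y) \<union> (cells s J Y - cells s J X)"
  let ?p = "uniform_below G"
  have filter_eq_iff: "{c \<in> A. P c} = {c \<in> A'. P c} \<longleftrightarrow> (\<forall>c\<in>(A - A') \<union> (A' - A). \<not> P c)" for A A' :: "nat set" and P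
    by blast
  have cD: "card ?D = dm (pfeats J X) (pfeats J Y)"
    unfolding dm_def using XY
    by (subst card_Un_disjoint) (auto simp: finite_cells card_cells_diff)
  have sub: "?D \<subseteq> {..<?W}" using cells_less XY by blast
  have "hash s J \<tau> X = hash s J \<tau> Y \<longleftrightarrow> (\<forall>c\<in>?D. \<tau> c \<noteq> 0)" for \<tau>
  proof -
    have "hash s J \<tau> X = hash s J \<tau> Y \<longleftrightarrow> {c \<in> cells s J X. \<tau> c = 0} = {c \<in> cells s J Y. \<tau> c = 0}"
      unfolding hash_def by (rule set_encode_eq) (auto intro: finite_subset[OF _ finite_cells])
    also have "\<dots> \<longleftrightarrow> (\<forall>c\<in>?D. \<tau> c \<noteq> 0)"
      by (rule filter_eq_iff)
    finally show ?thesis .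
  qed
  then have "{\<tau>. hash s J \<tau> X = hash s J \<tau> Y} = Pi {..<?W} (\<lambda>i. if i \<in> ?D then {v. v \<noteq> 0} else UNIV)"
    using sub by (auto simp: Pi_def)
  then have "measure_pmf.prob (Pi_pmf {..<?W} 0 (\<lambda>_. ?p)) {\<tau>. hash s J \<tau> X = hash s J \<tau> Y}
     = (\<Prod>i<?W. measure_pmf.prob ?p (if i \<in> ?D then {v. v \<noteq> 0} else UNIV))"
    by (simp only: measure_Pi_pmf_Pi finite_lessThan)
  also have "\<dots> = (\<Prod>i\<in>?D. measure_pmf.prob ?p {v. v \<noteq> 0})"
    using sub by (subst prod.mono_neutral_right[of "{..<?W}" ?D]) auto
  also have "measure_pmf.prob ?p {v. v \<noteq> 0} = 1 - 1 / G"
  proof -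
    have "{..<G} \<inter> {v. v \<noteq> 0} = {..<G} - {0}" by auto
    then have "card ({..<G} \<inter> {v. v \<noteq> 0}) = G - 1" using G by simp
    then show ?thesis
      using G by (simp add: uniform_below_def measure_pmf_of_set lessThan_empty_iff of_nat_diff field_simps)
  qed
  finally show ?thesis by (simp only: prod_constant cD)
qed

end

section \<open>Collision probabilities of the hash family\<close>

text \<open>Every term of \<open>geo N \<alpha>\<close> is at least
  \<open>(1 - \<alpha>) ^ N\<close>, and \<open>geo N \<alpha> * \<alpha> \<le> 1\<close>.\<close>

lemma miss_all_le:
  fixes \<alpha> :: real
  assumes "0 \<le> \<alpha>" "\<alpha> \<le> 1" "0 < N"
  shows "\<alpha> * (1 - \<alpha>) ^ N \<le> 1 / N"
proof -
  have "N * (1 - \<alpha>) ^ N = (\<Sum>n<N. (1 - \<alpha>) ^ N)" by simp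
  also have "\<dots> \<le> geo N \<alpha>" unfolding geo_def using assms
    by (intro sum_mono power_decreasing) auto
  finally have "N * (1 - \<alpha>) ^ N * \<alpha> \<le> geo N \<alpha> * \<alpha>" using assms by (intro mult_right_mono) auto
  also have "\<dots> \<le> 1" using geo_mult_le[OF assms(1,2), of N] by simp
  finally show ?thesis using assms by (simp add: field_simps)
qed

text \<open>The samples come from a distribution \<open>\<nu>\<close> that only approximates the
  average marginal of \<open>\<mu>\<close>; the summand \<open>1 / N\<close> in
  \<open>approx\<close> leaves room for the rounding of the weights by the machine.\<close>

locale trie_hashing = random_trie +
  fixes s G :: nat and \<mu> :: "point pmf"
  assumes N: "0 < N" and G: "0 < G" and J: "1 \<le> J" "d \<le> 2 ^ (J - 1)"
    and fin\<mu>: "finite (set_pmf \<mu>)" and sub\<mu>: "set_pmf \<mu> \<subseteq> EMD_points s d"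
    and approx: "\<And>A. E \<mu> (\<lambda>Y. size {#v \<in># Y. v \<in> A#}) \<le> s * (measure_pmf.prob \<nu> A + 1 / N)"
begin

definition T :: "(nat \<Rightarrow> nat) pmf" where
  "T = Pi_pmf {..<N * (J * d) * 2 * d * (s + 1)} 0 (\<lambda>_. uniform_below G)"

definition family :: "(point \<Rightarrow> nat) pmf" where
  "family = map_pmf (\<lambda>(u, b, \<tau>). trie.hash d N u b s J \<tau>) (pair_pmf U (pair_pmf B T))"

lemma finT [simp]: "finite (set_pmf T)"
  using G unfolding T_def
  by (intro finite_set_Pi_pmf) (auto simp: uniform_below_def set_pmf_of_set lessThan_empty_iff)

definition D :: "(nat \<Rightarrow> nat) \<Rightarrow> (nat \<Rightarrow> bool list) \<Rightarrow> point \<Rightarrow> point \<Rightarrow> nat" where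
  "D u b X Y = dm (trie.pfeats d N u b J X) (trie.pfeats d N u b J Y)"

lemma prob_family:
  assumes "X \<in> EMD_points s d" "Y \<in> EMD_points s d"
  shows "measure_pmf.prob family {h. h X = h Y} = E U (\<lambda>u. E B (\<lambda>b. (1 - 1 / G) ^ D u b X Y))"
proof -
  have XY: "size X \<le> s" "size Y \<le> s" using assms by (auto simp: EMD_points_def)
  have "measure_pmf.prob family {h. h X = h Y} = E family (\<lambda>h. of_bool (h X = h Y))"
    by (simp only: E_of_bool)
  also have "\<dots> = E U (\<lambda>u. E B (\<lambda>b. E T (\<lambda>\<tau>. of_bool (trie.hash d N u b s J \<tau> X = trie.hash d N u b s J \<tau> Y))))"
    unfolding family_def by (simp add: E_pair case_prod_beta)
  also have "\<dots> = E U (\<lambda>u. E B (\<lambda>b. (1 - 1 / G) ^ D u b X Y))"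
    unfolding E_of_bool D_def T_def by (simp only: trie.prob_hash_eq[OF G XY])
  finally show ?thesis .
qed

text \<open>The bound for single vectors is added up along an optimal coupling.\<close>

lemma E_D_le:
  assumes "X \<in> EMD_points s d" "Y \<in> EMD_points s d"
  shows "E U (\<lambda>u. E B (\<lambda>b. D u b X Y)) \<le> emd X Y * (25 * J + 8 + 48 * ln (1 + N))"
proof -
  obtain M where M: "image_mset fst M = X" "image_mset snd M = Y"
    "emd X Y = (\<Sum>z\<in>#M. l1_dist (fst z) (snd z))"
    using emd_coupling[OF assms] by blast
  let ?f = "\<lambda>u b z. real (dm (trie.vfeats d N u b J (fst z)) (trie.vfeats d N u b J (snd z)))"
  have swap: "E p (\<lambda>x. \<Sum>z\<in>#M. g z x) = (\<Sum>z\<in>#M. E p (g z))" if "finite (set_pmf p)" for p :: "'c pmf" and g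
    using that by (induction M) (simp_all add: E_add)
  have "E U (\<lambda>u. E B (\<lambda>b. D u b X Y)) \<le> E U (\<lambda>u. E B (\<lambda>b. \<Sum>z\<in>#M. ?f u b z))"
  proof (intro E_mono finU finB)
    fix u b
    have "D u b X Y \<le> (\<Sum>z\<in>#M. dm (trie.vfeats d N u b J (fst z)) (trie.vfeats d N u b J (snd z)))"
      unfolding D_def trie.pfeats_def M(1,2)[symmetric]
      using dm_sum_mset_le[of "\<lambda>z. trie.vfeats d N u b J (fst z)" M "\<lambda>z. trie.vfeats d N u b J (snd z)"]
      by (simp add: image_mset.compositionality o_def)
    then have "real (D u b X Y) \<le> real (\<Sum>z\<in>#M. dm (trie.vfeats d N u b J (fst z)) (trie.vfeats d N u b J (snd z)))"
      by (rule of_nat_mono)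
    also have "\<dots> = (\<Sum>z\<in>#M. ?f u b z)" by (induction M) auto
    finally show "real (D u b X Y) \<le> (\<Sum>z\<in>#M. ?f u b z)" .
  qed
  also have "\<dots> = (\<Sum>z\<in>#M. E U (\<lambda>u. E B (\<lambda>b. ?f u b z)))"
    by (simp only: swap finU finB)
  also have "\<dots> \<le> (\<Sum>z\<in>#M. l1_dist (fst z) (snd z) * (25 * J + 8 + 48 * ln (1 + N)))"
  proof (rule sum_mset_mono)
    fix z assume z: "z \<in># M"
    then have "fst z \<in># X" "snd z \<in># Y" using M by force+
    then show "E U (\<lambda>u. E B (\<lambda>b. ?f u b z)) \<le> l1_dist (fst z) (snd z) * (25 * J + 8 + 48 * ln (1 + N))"
      using assms by (intro E_dm_vfeats_le) (auto simp: EMD_points_def)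
  qed
  also have "\<dots> = emd X Y * (25 * J + 8 + 48 * ln (1 + N))"
    unfolding M(3) by (induction M) (simp_all add: algebra_simps)
  finally show ?thesis .
qed

text \<open>By Bernoulli's inequality \<open>(1 - 1 / G) ^ D\<close> is at least
  \<open>1 - D / G\<close>, so the bound on the expected difference is enough.\<close>

lemma prob_close:
  fixes p :: real
  assumes XY: "X \<in> EMD_points s d" "Y \<in> EMD_points s d" and r: "emd X Y \<le> r"
    and rG: "r * (25 * J + 8 + 48 * ln (1 + N)) \<le> G * (1 - p)"
  shows "p \<le> measure_pmf.prob family {h. h X = h Y}"
proof -
  let ?\<kappa> = "25 * J + 8 + 48 * ln (1 + N)"
  have "emd X Y * ?\<kappa> \<le> r * ?\<kappa>" using r by (intro mult_right_mono) auto
  then have "E U (\<lambda>u. E B (\<lambda>b. D u b X Y)) \<le> G * (1 - p)" using E_D_le[OF XY] rG by linarith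
  then have "E U (\<lambda>u. E B (\<lambda>b. D u b X Y)) / G \<le> 1 - p" using G by (simp add: field_simps)
  moreover have "1 - E U (\<lambda>u. E B (\<lambda>b. D u b X Y)) / G = E U (\<lambda>u. E B (\<lambda>b. 1 - D u b X Y / G))"
    by (simp add: E_diff)
  moreover have "\<dots> \<le> E U (\<lambda>u. E B (\<lambda>b. (1 - 1 / G) ^ D u b X Y))"
  proof (intro E_mono finU finB)
    fix u b
    have "1 + real (D u b X Y) * (- (1 / G)) \<le> (1 + - (1 / G)) ^ D u b X Y"
      using G by (intro Bernoulli_inequality) (simp add: field_simps)
    then show "1 - D u b X Y / G \<le> (1 - 1 / G) ^ D u b X Y" by simp
  qed
  ultimately show ?thesis unfolding prob_family[OF XY] by linarith
qed

definition bad :: "point \<Rightarrow> point \<Rightarrow> (nat \<Rightarrow> nat) \<Rightarrow> (nat \<Rightarrow> bool list) \<Rightarrow> bool" where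
  "bad X Y u b \<longleftrightarrow> (\<exists>a\<in>#X. \<exists>a'\<in>#Y. \<exists>m\<le>J * d. trie.pre d u m a = trie.pre d u m a' \<and> \<not> trie.occ d N u b (trie.pre d u m a))"

text \<open>Union bound over the vectors of \<open>X\<close> and the prefix lengths. For a node of
  mass \<open>\<alpha>\<close>, the expected number of vectors of \<open>Y\<close> in it is at most
  \<open>s * (\<alpha> + 1 / N)\<close>, and independently all samples miss it with probability
  \<open>(1 - \<alpha>) ^ N\<close>. The product is at most \<open>2 * s / N\<close> by
  \<open>miss_all_le\<close>.\<close>

lemma E_bad_le:
  assumes X: "X \<in> EMD_points s d"
  shows "E U (\<lambda>u. E B (\<lambda>b. E \<mu> (\<lambda>Y. of_bool (bad X Y u b)))) \<le> 2 * s\<^sup>2 * (J * d + 1) / N"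
proof (rule E_le_const[OF finU])
  fix u
  let ?A = "\<lambda>m a. {v. trie.pre d u m v = trie.pre d u m a}"
  let ?miss = "\<lambda>m a b. \<Prod>i<N. of_bool (b i \<notin> ?A m a) :: real"
  have swap: "E p (\<lambda>x. \<Sum>z\<in>#M. g z x) = (\<Sum>z\<in>#M. E p (g z))" if "finite (set_pmf p)" for p :: "'c pmf" and g and M :: "bool list multiset"
    using that by (induction M) (simp_all add: E_add)
  have bad: "of_bool (bad X Y u b) \<le> (\<Sum>a\<in>#X. \<Sum>m\<le>J * d. ?miss m a b * size {#v \<in># Y. v \<in> ?A m a#})" for b Y
  proof (cases "bad X Y u b")
    case True
    then obtain a a' m where am: "a \<in># X" "a' \<in># Y" "m \<le> J * d" "trie.pre d u m a = trie.pre d u m a'"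
      "\<not> trie.occ d N u b (trie.pre d u m a)"
      unfolding bad_def by blast
    then have 1: "?miss m a b = 1" by (intro prod.neutral) (auto simp: trie.occ_def trie.length_pre)
    have "a' \<in># {#v \<in># Y. v \<in> ?A m a#}" using am by simp
    then have "1 \<le> size {#v \<in># Y. v \<in> ?A m a#}" by (metis One_nat_def Suc_leI nonempty_has_size empty_iff set_mset_empty)
    then have "1 \<le> ?miss m a b * size {#v \<in># Y. v \<in> ?A m a#}" using 1 by simp
    also have "\<dots> \<le> (\<Sum>m\<le>J * d. ?miss m a b * size {#v \<in># Y. v \<in> ?A m a#})"
      using am by (intro member_le_sum) (auto simp: prod_nonneg)
    also have "\<dots> \<le> (\<Sum>a\<in>#X. \<Sum>m\<le>J * d. ?miss m a b * size {#v \<in># Y. v \<in> ?A m a#})"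
    proof -
      have nn: "0 \<le> (\<Sum>m\<le>J * d. ?miss m a b * size {#v \<in># Y. v \<in> ?A m a#})" for a
        by (intro sum_nonneg mult_nonneg_nonneg prod_nonneg) auto
      obtain X' where "X = add_mset a X'" using am(1) by (metis multi_member_split)
      moreover have "0 \<le> (\<Sum>a\<in>#X'. \<Sum>m\<le>J * d. ?miss m a b * size {#v \<in># Y. v \<in> ?A m a#})"
        using nn by (induction X') (auto intro: add_nonneg_nonneg)
      ultimately show ?thesis by simp
    qed
    finally show ?thesis using True by simp
  next
    case False
    have nn: "0 \<le> (\<Sum>m\<le>J * d. ?miss m a b * size {#v \<in># Y. v \<in> ?A m a#})" for a
      by (intro sum_nonneg mult_nonneg_nonneg prod_nonneg) auto
    have "0 \<le> (\<Sum>a\<in>#X. \<Sum>m\<le>J * d. ?miss m a b * size {#v \<in># Y. v \<in> ?A m a#})"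
      using nn by (induction X) (auto intro: add_nonneg_nonneg)
    then show ?thesis using False by simp
  qed
  have miss: "E B (?miss m a) = (1 - measure_pmf.prob \<nu> (?A m a)) ^ N" for m a
  proof -
    have "E B (?miss m a) = (\<Prod>i<N. E \<nu> (\<lambda>v. of_bool (v \<notin> ?A m a)))"
      unfolding B_def by (rule expectation_prod_Pi_pmf) (auto simp: fin intro!: integrable_measure_pmf_finite)
    also have "E \<nu> (\<lambda>v. of_bool (v \<notin> ?A m a)) = measure_pmf.prob \<nu> (space (measure_pmf \<nu>) - ?A m a)"
      unfolding E_of_bool by (rule arg_cong[where f = "measure_pmf.prob \<nu>"]) auto
    also have "\<dots> = 1 - measure_pmf.prob \<nu> (?A m a)" by (rule measure_pmf.prob_compl) simp
    finally show ?thesis by simp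
  qed
  have term_le: "E B (?miss m a) * E \<mu> (\<lambda>Y. size {#v \<in># Y. v \<in> ?A m a#}) \<le> 2 * s / N" for m a
  proof -
    let ?\<alpha> = "measure_pmf.prob \<nu> (?A m a)"
    have "E B (?miss m a) * E \<mu> (\<lambda>Y. size {#v \<in># Y. v \<in> ?A m a#}) \<le> (1 - ?\<alpha>) ^ N * (s * (?\<alpha> + 1 / N))"
      unfolding miss by (intro mult_left_mono approx) simp
    also have "\<dots> = s * (?\<alpha> * (1 - ?\<alpha>) ^ N + (1 - ?\<alpha>) ^ N * (1 / N))" by (simp add: algebra_simps)
    also have "\<dots> \<le> s * (1 / N + 1 * (1 / N))"
      by (intro mult_left_mono add_mono miss_all_le mult_right_mono) (auto simp: N power_le_one)
    also have "\<dots> = 2 * s / N" by (simp add: algebra_simps)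
    finally show ?thesis .
  qed
  have "E B (\<lambda>b. E \<mu> (\<lambda>Y. of_bool (bad X Y u b)))
    \<le> E B (\<lambda>b. E \<mu> (\<lambda>Y. \<Sum>a\<in>#X. \<Sum>m\<le>J * d. ?miss m a b * size {#v \<in># Y. v \<in> ?A m a#}))"
    by (intro E_mono finB fin\<mu> bad)
  also have "\<dots> = (\<Sum>a\<in>#X. \<Sum>m\<le>J * d. E B (?miss m a) * E \<mu> (\<lambda>Y. size {#v \<in># Y. v \<in> ?A m a#}))"
    by (simp only: swap[OF finB] swap[OF fin\<mu>] E_sum_fun[OF finB] E_sum_fun[OF fin\<mu>]
        integral_mult_right_zero integral_mult_left_zero)
  also have "\<dots> \<le> (\<Sum>a\<in>#X. \<Sum>m\<le>J * d. 2 * s / N)"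
    by (intro sum_mset_mono sum_mono term_le)
  also have "\<dots> = 2 * s\<^sup>2 * (J * d + 1) / N"
    using X by (simp add: EMD_points_def power2_eq_square field_simps)
  finally show "E B (\<lambda>b. E \<mu> (\<lambda>Y. of_bool (bad X Y u b))) \<le> 2 * s\<^sup>2 * (J * d + 1) / N" .
qed

text \<open>Without a bad node, distance above \<open>R\<close> makes a collision at most
  \<open>exp (- 2 * ln (1 / p)) = p\<^sup>2\<close> likely. A target such as \<open>p / 2\<close>
  would require \<open>ln (2 / p)\<close>, which is not proportional to \<open>ln (1 / p)\<close>
  when \<open>p\<close> is near 1. The mixture with a failure probability of at most
  \<open>p / 2\<close> stays below \<open>p\<close> because the gap is
  \<open>p / 2 * (1 - p)\<^sup>2\<close>.\<close>

lemma prob_far: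
  fixes p :: real
  assumes X: "X \<in> EMD_points s d" and p: "0 < p" "p < 1"
    and Np: "4 * s\<^sup>2 * (J * d + 1) \<le> N * p" and R: "2 * ln (1 / p) * G \<le> R"
  shows "measure_pmf.prob (pair_pmf family \<mu>) {(h, Y). R < emd X Y \<and> h X = h Y} \<le> p"
proof -
  have finF: "finite (set_pmf family)" unfolding family_def by simp
  have "measure_pmf.prob (pair_pmf family \<mu>) {(h, Y). R < emd X Y \<and> h X = h Y}
    = E (pair_pmf family \<mu>) (\<lambda>z. of_bool (R < emd X (snd z) \<and> fst z X = fst z (snd z)))"
    unfolding E_of_bool by (rule arg_cong[where f = "measure_pmf.prob _"]) auto
  also have "\<dots> = E \<mu> (\<lambda>Y. of_bool (R < emd X Y) * measure_pmf.prob family {h. h X = h Y})"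
    by (subst E_pair[OF finF fin\<mu>], subst E_swap[OF finF fin\<mu>])
      (simp add: of_bool_conj E_of_bool)
  also have "\<dots> = E \<mu> (\<lambda>Y. of_bool (R < emd X Y) * E U (\<lambda>u. E B (\<lambda>b. (1 - 1 / G) ^ D u b X Y)))"
    using sub\<mu> X by (intro E_cong) (auto simp: prob_family)
  also have "\<dots> = E \<mu> (\<lambda>Y. E U (\<lambda>u. E B (\<lambda>b. of_bool (R < emd X Y) * (1 - 1 / G) ^ D u b X Y)))"
    by simp
  also have "\<dots> \<le> E \<mu> (\<lambda>Y. E U (\<lambda>u. E B (\<lambda>b. p\<^sup>2 + (1 - p\<^sup>2) * of_bool (bad X Y u b))))"
  proof (intro E_mono finU finB fin\<mu>)
    fix Y u b assume Y: "Y \<in> set_pmf \<mu>" and u: "u \<in> set_pmf U" and b: "b \<in> set_pmf B"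
    have p2: "0 \<le> 1 - p\<^sup>2" using p by (simp add: power_le_one)
    have le1: "(1 - 1 / G) ^ D u b X Y \<le> 1" using G by (intro power_le_one) (auto simp: field_simps)
    show "of_bool (R < emd X Y) * (1 - 1 / G) ^ D u b X Y \<le> p\<^sup>2 + (1 - p\<^sup>2) * of_bool (bad X Y u b)"
    proof (cases "R < emd X Y \<and> \<not> bad X Y u b")
      case True
      have "emd X Y \<le> D u b X Y" unfolding D_def
      proof (rule trie.emd_le_dm)
        show "length (b i) = d" if "i < N" for i
          using that b len by (auto simp: B_def set_Pi_pmf PiE_dflt_def)
        show "u m < d" if "m < J * d" for m
          using that u by (auto simp: U_def set_Pi_pmf PiE_dflt_def set_uniform_below)
      qed (use True X Y sub\<mu> N J in \<open>auto simp: bad_def\<close>)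
      then have "R \<le> D u b X Y" using True by simp
      then have le: "2 * ln (1 / p) \<le> D u b X Y * (1 / G)" using R G by (simp add: field_simps)
      have "1 - 1 / G \<le> exp (- (1 / G))" using exp_ge_add_one_self[of "- (1 / real G)"] by simp
      then have "(1 - 1 / G) ^ D u b X Y \<le> exp (- (1 / G)) ^ D u b X Y"
        using G by (intro power_mono) (auto simp: field_simps)
      also have "\<dots> = exp (- (D u b X Y * (1 / G)))" by (simp flip: exp_of_nat_mult)
      also have "\<dots> \<le> exp (- (2 * ln (1 / p)))" using le by simp
      also have "\<dots> = p\<^sup>2" using p by (simp add: ln_div flip: ln_powr powr_numeral ln_realpow)
      finally show ?thesis using True by simp
    next
      case False
      then show ?thesis using le1 p2 by auto
    qed
  qed
  also have "\<dots> = p\<^sup>2 + (1 - p\<^sup>2) * E U (\<lambda>u. E B (\<lambda>b. E \<mu> (\<lambda>Y. of_bool (bad X Y u b))))"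
  proof -
    have "E \<mu> (\<lambda>Y. E U (\<lambda>u. E B (\<lambda>b. of_bool (bad X Y u b)))) = E U (\<lambda>u. E \<mu> (\<lambda>Y. E B (\<lambda>b. of_bool (bad X Y u b))))"
      by (rule E_swap[OF fin\<mu> finU])
    also have "\<dots> = E U (\<lambda>u. E B (\<lambda>b. E \<mu> (\<lambda>Y. of_bool (bad X Y u b))))"
      by (simp only: E_swap[OF fin\<mu> finB])
    finally show ?thesis by (simp add: E_add fin\<mu> del: E_sum)
  qed
  also have "\<dots> \<le> p\<^sup>2 + (1 - p\<^sup>2) * (p / 2)"
  proof (intro add_left_mono mult_left_mono)
    have "2 * s\<^sup>2 * (J * d + 1) / N \<le> p / 2" using Np N by (simp add: field_simps)
    then show "E U (\<lambda>u. E B (\<lambda>b. E \<mu> (\<lambda>Y. of_bool (bad X Y u b)))) \<le> p / 2"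
      using E_bad_le[OF X] by linarith
    show "0 \<le> 1 - p\<^sup>2" using p by (simp add: power_le_one)
  qed
  also have "\<dots> \<le> p"
  proof -
    have "p - (p\<^sup>2 + (1 - p\<^sup>2) * (p / 2)) = p / 2 * (1 - p)\<^sup>2" by (simp add: power2_eq_square field_simps)
    moreover have "0 \<le> p / 2 * (1 - p)\<^sup>2" using p by simp
    ultimately show ?thesis by linarith
  qed
  finally show ?thesis .
qed

theorem sensitive_family:
  fixes p\<^sub>1 p\<^sub>2 r R :: real
  assumes "0 < p\<^sub>2" "p\<^sub>2 < 1"
    and "r * (25 * J + 8 + 48 * ln (1 + N)) \<le> G * (1 - p\<^sub>1)"
    and "4 * s\<^sup>2 * (J * d + 1) \<le> N * p\<^sub>2" and "2 * ln (1 / p\<^sub>2) * G \<le> R"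
  shows "sensitive (EMD_points s d) emd \<mu> r R p\<^sub>1 p\<^sub>2 family"
  unfolding sensitive_def using assms by (auto intro: prob_close prob_far)

end

section \<open>A program logic for the machine\<close>

text \<open>The addresses divisible by 8 are the registers, those with remainder \<open>f\<close> form array \<open>f\<close>: the hash table (1),
  the draws \<open>u\<close> (2), the draws behind the samples (3), the bits of the query vector followed by those of the samples
  (4), and, indexed by the code of a node, the address of its representative in array 4 (6) and of its part of the
  hash table (7); the number 0 marks a node without sample, and also the address of the query vector.\<close>

type_synonym regs = "nat \<Rightarrow> nat"
type_synonym arrays = "nat \<Rightarrow> nat \<Rightarrow> nat"
type_synonym reals = "nat \<Rightarrow> real"
type_synonym assn = "regs \<Rightarrow> arrays \<Rightarrow> reals \<Rightarrow> nat \<Rightarrow> bool"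

definition reg :: "nat \<Rightarrow> nat" where "reg r = 8 * r"

definition adr :: "nat \<Rightarrow> nat \<Rightarrow> nat" where "adr f i = 8 * i + f"

definition mk :: "regs \<Rightarrow> arrays \<Rightarrow> nat \<Rightarrow> nat" where
  "mk \<rho> A a = (if a mod 8 = 0 then \<rho> (a div 8) else A (a mod 8) (a div 8))"

lemma mk_reg [simp]: "mk \<rho> A (reg r) = \<rho> r"
  by (simp add: mk_def reg_def)

lemma mk_adr [simp]: "0 < f \<Longrightarrow> f < 8 \<Longrightarrow> mk \<rho> A (adr f i) = A f i"
  by (simp add: mk_def adr_def)

lemma mk_upd_reg [simp]: "(mk \<rho> A)(reg r := x) = mk (\<rho>(r := x)) A"
  by (auto simp: mk_def reg_def fun_eq_iff)

lemma mk_upd_adr [simp]: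
  assumes "0 < f" "f < 8"
  shows "(mk \<rho> A)(adr f i := x) = mk \<rho> (A(f := (A f)(i := x)))"
proof
  fix a
  show "((mk \<rho> A)(adr f i := x)) a = mk \<rho> (A(f := (A f)(i := x))) a"
    using assms div_mult_mod_eq[of a 8] by (auto simp: mk_def adr_def)
qed

lemma mk_empty: "empty_memory = (mk (\<lambda>_. 0) (\<lambda>_ _. 0), \<lambda>_. 0)"
  by (simp add: empty_memory_def mk_def fun_eq_iff)

text \<open>Total correctness of deterministic code. Quantifying over \<open>rest\<close> builds
  sequential composition into the definition, and the last argument of an assertion counts the
  elapsed steps. Random draws occur only in \<open>fill\<close>, which is treated on the level of
  distributions.\<close>

definition wp :: "input \<Rightarrow> program \<Rightarrow> assn \<Rightarrow> assn" where
  "wp \<iota> cs Q \<rho> A X \<tau> \<longleftrightarrow> (\<exists>t \<rho>' A' X'.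
     (\<forall>rest. run \<iota> t (cs @ rest, (mk \<rho> A, X)) = return_pmf (rest, (mk \<rho>' A', X'))) \<and> Q \<rho>' A' X' (\<tau> + t))"

lemma run_add: "run \<iota> (t + t') \<kappa> = bind_pmf (run \<iota> t \<kappa>) (run \<iota> t')"
proof (induction t arbitrary: \<kappa>)
  case (Suc t)
  then have "run \<iota> (t + t') = (\<lambda>\<kappa>. bind_pmf (run \<iota> t \<kappa>) (run \<iota> t'))" by blast
  then show ?case by (simp add: bind_assoc_pmf)
qed (simp add: bind_return_pmf)

lemma run_halted: "run \<iota> t ([], \<sigma>) = return_pmf ([], \<sigma>)"
  by (induction t) (simp_all add: bind_return_pmf)

lemma wp_nil: "Q \<rho> A X \<tau> \<Longrightarrow> wp \<iota> [] Q \<rho> A X \<tau>"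
  unfolding wp_def by (rule exI[of _ 0]) auto

text \<open>An equation, so that straight-line code is executed symbolically by rewriting. From left
  to right, the run cannot have length 0 because a command is still pending.\<close>

lemma wp_step:
  assumes "\<And>rest. step \<iota> (c # rest, (mk \<rho> A, X)) = return_pmf (ds @ rest, (mk \<rho>' A', X'))"
  shows "wp \<iota> (c # cs) Q \<rho> A X \<tau> = wp \<iota> (ds @ cs) Q \<rho>' A' X' (Suc \<tau>)"
proof
  assume "wp \<iota> (c # cs) Q \<rho> A X \<tau>"
  then obtain t \<rho>'' A'' X'' where t: "\<And>rest. run \<iota> t (c # cs @ rest, (mk \<rho> A, X)) = return_pmf (rest, (mk \<rho>'' A'', X''))"
    and Q: "Q \<rho>'' A'' X'' (\<tau> + t)"
    unfolding wp_def by auto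
  obtain t' where t': "t = Suc t'" using t[of "[]"] by (cases t) auto
  have "run \<iota> t' ((ds @ cs) @ rest, (mk \<rho>' A', X')) = return_pmf (rest, (mk \<rho>'' A'', X''))" for rest
    using t[of rest] assms[of "cs @ rest"] by (simp add: t' bind_return_pmf)
  then show "wp \<iota> (ds @ cs) Q \<rho>' A' X' (Suc \<tau>)" unfolding wp_def using Q t' by fastforce
next
  assume "wp \<iota> (ds @ cs) Q \<rho>' A' X' (Suc \<tau>)"
  then obtain t \<rho>'' A'' X'' where t: "\<And>rest. run \<iota> t ((ds @ cs) @ rest, (mk \<rho>' A', X')) = return_pmf (rest, (mk \<rho>'' A'', X''))"
    and Q: "Q \<rho>'' A'' X'' (Suc \<tau> + t)"
    unfolding wp_def by blast
  have "run \<iota> (Suc t) ((c # cs) @ rest, (mk \<rho> A, X)) = return_pmf (rest, (mk \<rho>'' A'', X''))" for rest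
    using t[of rest] assms[of "cs @ rest"] by (simp add: bind_return_pmf)
  then show "wp \<iota> (c # cs) Q \<rho> A X \<tau>" unfolding wp_def using Q by fastforce
qed

lemma wp_instr:
  assumes "exec \<iota> i (mk \<rho> A, X) = return_pmf (mk \<rho>' A', X')"
  shows "wp \<iota> (Instr i # cs) Q \<rho> A X \<tau> = wp \<iota> cs Q \<rho>' A' X' (Suc \<tau>)"
  using assms by (subst wp_step[where ds = "[]"]) auto

context fixes \<iota> :: input begin

lemma
  wp_Const [simp]: "wp \<iota> (Instr (Const (reg a) n) # cs) Q \<rho> A X \<tau> = wp \<iota> cs Q (\<rho>(a := n)) A X (Suc \<tau>)" and
  wp_Add [simp]: "wp \<iota> (Instr (Add (reg a) (reg b) (reg c)) # cs) Q \<rho> A X \<tau> = wp \<iota> cs Q (\<rho>(a := \<rho> b + \<rho> c)) A X (Suc \<tau>)" and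
  wp_Sub [simp]: "wp \<iota> (Instr (Sub (reg a) (reg b) (reg c)) # cs) Q \<rho> A X \<tau> = wp \<iota> cs Q (\<rho>(a := \<rho> b - \<rho> c)) A X (Suc \<tau>)" and
  wp_Input [simp]: "wp \<iota> (Instr (Input (reg a) (reg b)) # cs) Q \<rho> A X \<tau> = wp \<iota> cs Q (\<rho>(a := tape (fst \<iota>) (\<rho> b))) A X (Suc \<tau>)" and
  wp_Cast [simp]: "wp \<iota> (Instr (Cast x (reg b)) # cs) Q \<rho> A X \<tau> = wp \<iota> cs Q \<rho> A (X(x := real (\<rho> b))) (Suc \<tau>)" and
  wp_RInput [simp]: "wp \<iota> (Instr (RInput x (reg b)) # cs) Q \<rho> A X \<tau> = wp \<iota> cs Q \<rho> A (X(x := tape (snd \<iota>) (\<rho> b))) (Suc \<tau>)" and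
  wp_RAdd [simp]: "wp \<iota> (Instr (RAdd x y z) # cs) Q \<rho> A X \<tau> = wp \<iota> cs Q \<rho> A (X(x := X y + X z)) (Suc \<tau>)" and
  wp_RSub [simp]: "wp \<iota> (Instr (RSub x y z) # cs) Q \<rho> A X \<tau> = wp \<iota> cs Q \<rho> A (X(x := X y - X z)) (Suc \<tau>)" and
  wp_RMul [simp]: "wp \<iota> (Instr (RMul x y z) # cs) Q \<rho> A X \<tau> = wp \<iota> cs Q \<rho> A (X(x := X y * X z)) (Suc \<tau>)"
  by (cases \<iota>; rule wp_instr; simp)+

lemma wp_If [simp]:
  "wp \<iota> (If b as bs # cs) Q \<rho> A X \<tau> =
    (if holds b (mk \<rho> A, X) then wp \<iota> (as @ cs) Q \<rho> A X (Suc \<tau>) else wp \<iota> (bs @ cs) Q \<rho> A X (Suc \<tau>))"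
  using wp_step[of \<iota> "If b as bs" \<rho> A X as \<rho> A X] wp_step[of \<iota> "If b as bs" \<rho> A X bs \<rho> A X] by simp

lemma wp_While:
  "wp \<iota> (While b as # cs) Q \<rho> A X \<tau> =
    (if holds b (mk \<rho> A, X) then wp \<iota> (as @ While b as # cs) Q \<rho> A X (Suc \<tau>) else wp \<iota> cs Q \<rho> A X (Suc \<tau>))"
  using wp_step[of \<iota> "While b as" \<rho> A X "as @ [While b as]" \<rho> A X] wp_step[of \<iota> "While b as" \<rho> A X "[]" \<rho> A X] by simp

lemma wp_mono:
  assumes "wp \<iota> cs Q \<rho> A X \<tau>" "\<And>\<rho> A X \<tau>. Q \<rho> A X \<tau> \<Longrightarrow> Q' \<rho> A X \<tau>"
  shows "wp \<iota> cs Q' \<rho> A X \<tau>"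
  using assms unfolding wp_def by blast

lemma wp_append:
  assumes "wp \<iota> cs (wp \<iota> ds Q) \<rho> A X \<tau>"
  shows "wp \<iota> (cs @ ds) Q \<rho> A X \<tau>"
proof -
  obtain t \<rho>' A' X' where t: "\<And>rest. run \<iota> t (cs @ rest, (mk \<rho> A, X)) = return_pmf (rest, (mk \<rho>' A', X'))"
    and "wp \<iota> ds Q \<rho>' A' X' (\<tau> + t)"
    using assms unfolding wp_def by blast
  then obtain t' \<rho>'' A'' X'' where t': "\<And>rest. run \<iota> t' (ds @ rest, (mk \<rho>' A', X')) = return_pmf (rest, (mk \<rho>'' A'', X''))"
    and Q: "Q \<rho>'' A'' X'' (\<tau> + t + t')"
    unfolding wp_def by blast
  have "run \<iota> (t + t') ((cs @ ds) @ rest, (mk \<rho> A, X)) = return_pmf (rest, (mk \<rho>'' A'', X''))" for rest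
    using t[of "ds @ rest"] t'[of rest] by (simp add: run_add bind_return_pmf)
  then show ?thesis unfolding wp_def using Q by (metis add.assoc)
qed

lemma wp_seq:
  assumes "wp \<iota> cs R \<rho> A X \<tau>" "\<And>\<rho> A X \<tau>. R \<rho> A X \<tau> \<Longrightarrow> wp \<iota> ds Q \<rho> A X \<tau>"
  shows "wp \<iota> (cs @ ds) Q \<rho> A X \<tau>"
  by (rule wp_append, rule wp_mono, rule assms(1), rule assms(2))

text \<open>The invariant is indexed by the completed iterations, whose number is known beforehand
  for every loop here; this settles termination and running time together.\<close>

lemma wp_loop:
  assumes step: "\<And>n \<rho> A X \<tau>. n < len \<Longrightarrow> Inv n \<rho> A X \<tau> \<Longrightarrow>
      holds b (mk \<rho> A, X) \<and> wp \<iota> body (Inv (Suc n)) \<rho> A X (Suc \<tau>)"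
    and exit: "\<And>\<rho> A X \<tau>. Inv len \<rho> A X \<tau> \<Longrightarrow> \<not> holds b (mk \<rho> A, X) \<and> wp \<iota> cs Q \<rho> A X (Suc \<tau>)"
    and init: "Inv 0 \<rho> A X \<tau>"
  shows "wp \<iota> (While b body # cs) Q \<rho> A X \<tau>"
proof -
  have "n \<le> len \<Longrightarrow> Inv (len - n) \<rho> A X \<tau> \<Longrightarrow> wp \<iota> (While b body # cs) Q \<rho> A X \<tau>" for n \<rho> A X \<tau>
  proof (induction n arbitrary: \<rho> A X \<tau>)
    case 0
    then show ?case using exit by (simp add: wp_While)
  next
    case (Suc n)
    then have s: "holds b (mk \<rho> A, X)" "wp \<iota> body (Inv (len - n)) \<rho> A X (Suc \<tau>)"
      using step[of "len - Suc n"] by (auto simp: Suc_diff_Suc)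
    then show ?case using Suc by (auto simp: wp_While intro: wp_seq)
  qed
  from this[of len] init show ?thesis by simp
qed

end

lemma holds_Less [simp]: "holds (Less (reg a) (reg b)) (mk \<rho> A, X) \<longleftrightarrow> \<rho> a < \<rho> b"
  by simp

text \<open>Three doublings multiply the index by 8; registers 60 and 61 are the scratch space of
  every array access.\<close>

definition addr_of :: "nat \<Rightarrow> nat \<Rightarrow> program" where
  "addr_of f i = [Instr (Add (reg 60) (reg i) (reg i)), Instr (Add (reg 60) (reg 60) (reg 60)),
     Instr (Add (reg 60) (reg 60) (reg 60)), Instr (Const (reg 61) f), Instr (Add (reg 60) (reg 60) (reg 61))]"

definition get :: "nat \<Rightarrow> nat \<Rightarrow> nat \<Rightarrow> program" where
  "get x f i = addr_of f i @ [Instr (Load (reg x) (reg 60))]"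

definition put :: "nat \<Rightarrow> nat \<Rightarrow> nat \<Rightarrow> program" where
  "put f i x = addr_of f i @ [Instr (Store (reg 60) (reg x))]"

lemma wp_get [simp]:
  assumes "0 < f" "f < 8"
  shows "wp \<iota> (get x f i @ cs) Q \<rho> A X \<tau> =
    wp \<iota> cs Q (\<rho>(60 := adr f (\<rho> i), 61 := f, x := A f (\<rho> i))) A X (Suc (Suc (Suc (Suc (Suc (Suc \<tau>))))))"
proof -
  have "wp \<iota> (Instr (Load (reg x) (reg 60)) # cs) Q \<rho> A X \<tau> = wp \<iota> cs Q (\<rho>(x := mk \<rho> A (\<rho> 60))) A X (Suc \<tau>)" for \<rho> A X \<tau>
    by (cases \<iota>; rule wp_instr; simp)
  moreover have "\<rho> i + \<rho> i + (\<rho> i + \<rho> i) + (\<rho> i + \<rho> i + (\<rho> i + \<rho> i)) + f = adr f (\<rho> i)"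
    by (simp add: adr_def)
  ultimately show ?thesis
    using assms by (simp add: get_def addr_of_def fun_upd_twist)
qed

lemma wp_put [simp]:
  assumes "0 < f" "f < 8" "x \<noteq> 60" "x \<noteq> 61"
  shows "wp \<iota> (put f i x @ cs) Q \<rho> A X \<tau> =
    wp \<iota> cs Q (\<rho>(60 := adr f (\<rho> i), 61 := f)) (A(f := (A f)(\<rho> i := \<rho> x))) X (Suc (Suc (Suc (Suc (Suc (Suc \<tau>))))))"
proof -
  have "wp \<iota> (Instr (Store (reg 60) (reg x)) # cs) Q \<rho> A X \<tau> = wp \<iota> cs Q \<rho> (A(f := (A f)(j := \<rho> x))) X (Suc \<tau>)"
    if "\<rho> 60 = adr f j" for \<rho> A X \<tau> j
    using that assms by (cases \<iota>; intro wp_instr; simp)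
  moreover have "\<rho> i + \<rho> i + (\<rho> i + \<rho> i) + (\<rho> i + \<rho> i + (\<rho> i + \<rho> i)) + f = adr f (\<rho> i)"
    by (simp add: adr_def)
  ultimately show ?thesis
    using assms by (simp add: put_def addr_of_def fun_upd_twist)
qed

lemma wp_get' [simp]:
  assumes "0 < f" "f < 8"
  shows "wp \<iota> (get x f i) Q \<rho> A X \<tau> =
    wp \<iota> [] Q (\<rho>(60 := adr f (\<rho> i), 61 := f, x := A f (\<rho> i))) A X (Suc (Suc (Suc (Suc (Suc (Suc \<tau>))))))"
  using wp_get[OF assms, of \<iota> x i "[]"] by simp

lemma wp_put' [simp]:
  assumes "0 < f" "f < 8" "x \<noteq> 60" "x \<noteq> 61"
  shows "wp \<iota> (put f i x) Q \<rho> A X \<tau> =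
    wp \<iota> [] Q (\<rho>(60 := adr f (\<rho> i), 61 := f)) (A(f := (A f)(\<rho> i := \<rho> x))) X (Suc (Suc (Suc (Suc (Suc (Suc \<tau>))))))"
  using wp_put[OF assms, of \<iota> i "[]"] by simp

definition same_except :: "nat set \<Rightarrow> regs \<Rightarrow> regs \<Rightarrow> bool" where
  "same_except S \<rho> \<rho>' \<longleftrightarrow> (\<forall>r. r \<notin> S \<longrightarrow> \<rho>' r = \<rho> r)"

lemma same_exceptD: "same_except S \<rho> \<rho>' \<Longrightarrow> r \<notin> S \<Longrightarrow> \<rho>' r = \<rho> r"
  by (simp add: same_except_def)

abbreviation "CST a n \<equiv> Instr (Const (reg a) n)"
abbreviation "ADD a b c \<equiv> Instr (Add (reg a) (reg b) (reg c))"
abbreviation "SUB a b c \<equiv> Instr (Sub (reg a) (reg b) (reg c))"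
abbreviation "INP a b \<equiv> Instr (Input (reg a) (reg b))"
abbreviation "LESS a b \<equiv> Less (reg a) (reg b)"

lemma same_except_upd [simp]: "same_except S \<rho> \<rho>' \<Longrightarrow> r \<in> S \<Longrightarrow> same_except S \<rho> (\<rho>'(r := x))"
  by (simp add: same_except_def)

lemma same_except_refl [simp]: "same_except S \<rho> \<rho>"
  by (simp add: same_except_def)

section \<open>The query program\<close>

definition copy_query :: program where
  "copy_query = [CST 27 0, While (LESS 27 41)
     (INP 28 52 # put 4 27 28 @ [ADD 52 52 2, ADD 27 27 2])]"

text \<open>Register 30 holds the code of the node, 31 the threshold of the block, 32 the position,
  55 the part of the table that belongs to the node. At an occupied node, 55 is reloaded with the
  address for the child with bit \<open>False\<close>, and the bit \<open>True\<close> adds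
  \<open>d * (s + 1)\<close>. An unoccupied node leaves 30 and 55 alone, so the path stops.\<close>

definition walk_query :: program where
  "walk_query = [CST 27 0, While (LESS 27 41)
     (get 28 6 30 @
      [If (LESS 1 28)
         (get 55 7 30 @ ADD 30 30 30 # get 28 2 32 @
          [If (LESS 28 31) (get 29 4 27 @ [If (LESS 1 29) [ADD 30 30 2, ADD 55 55 11] []]) []])
         [],
       ADD 32 32 2, ADD 27 27 2])]"

text \<open>Registers 54 and 56 point to the representatives before and after the block, 57 to the
  group of the current coordinate. As subtraction is truncated, two bits differ iff one of the two
  differences is nonzero.\<close>

definition visit_query :: program where
  "visit_query = [CST 27 0, ADD 57 55 1, While (LESS 27 41)
     (ADD 28 54 27 # get 28 4 28 @ ADD 29 56 27 # get 29 4 29 @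
      [SUB 58 28 29, SUB 59 29 28, ADD 58 58 59,
       If (LESS 1 58)
         (get 58 1 57 @ If (LESS 1 50) [ADD 58 58 2] [CST 58 0] # put 1 57 58 @
          ADD 58 57 58 # get 58 1 58 @ [ADD 0 0 58])
         [],
       ADD 57 57 10, ADD 27 27 2])]"

definition block_query :: program where
  "block_query = walk_query @ get 56 6 30 @ visit_query @ [ADD 54 56 1, ADD 31 31 31, ADD 33 33 2]"

definition vector_query :: program where
  "vector_query = copy_query @ [CST 30 1, CST 31 1, CST 32 0, CST 33 0] @ get 54 6 30 @
     [ADD 55 1 1, While (LESS 33 8) block_query, ADD 53 53 2]"

text \<open>Register 50 counts the passes: the first pass clears the counters that the query touches, the second one counts
  the multiplicities and sums the selected cells.  A selected cell \<open>c\<close> contains \<open>2 ^ c\<close>, so that the sum encodes the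
  set of selected cells.\<close>

definition Query :: program where
  "Query = [CST 0 0, CST 1 0, CST 2 1, CST 3 2, CST 50 0, While (LESS 50 3)
     [CST 52 0, CST 53 0, While (LESS 53 40) vector_query, ADD 50 50 2]]"

section \<open>Node codes and the effect of a visit\<close>

text \<open>The leading 1 keeps words of different lengths apart, so nodes of all levels can share
  one array.\<close>

definition code :: "bool list \<Rightarrow> nat" where
  "code w = foldl (\<lambda>n b. 2 * n + of_bool b) 1 w"

lemma code_Nil [simp]: "code [] = 1"
  by (simp add: code_def)

lemma code_snoc [simp]: "code (w @ [b]) = 2 * code w + of_bool b"
  by (simp add: code_def)

text \<open>In pass 0 the entry read is the counter that has just been cleared, so the sum stays
  unchanged. In pass 1 the occurrence number \<open>t\<close> of a group reads cell \<open>t\<close>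
  of the group.\<close>

definition visit :: "nat \<Rightarrow> nat \<Rightarrow> (nat \<Rightarrow> nat) \<times> nat \<Rightarrow> (nat \<Rightarrow> nat) \<times> nat" where
  "visit p g S = (let t = (if p = 0 then 0 else fst S g + 1); T = (fst S)(g := t) in (T, snd S + T (g + t)))"

context trie begin

definition chunk_at :: "nat \<Rightarrow> nat \<Rightarrow> bool list \<Rightarrow> nat" where
  "chunk_at s J v = ((ix (butlast v) * (J * d) + (length v - 1)) * 2 + of_bool (last v)) * (d * (s + 1))"

definition groups :: "nat \<Rightarrow> nat \<Rightarrow> nat \<Rightarrow> bool list \<Rightarrow> nat list" where
  "groups s J l a = map (\<lambda>k. gidx s J (nd (Suc l * d) a, k)) (filter (\<lambda>k. rp (l * d) a ! k \<noteq> rp (Suc l * d) a ! k) [0..<d])"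

definition vgroups :: "nat \<Rightarrow> nat \<Rightarrow> nat \<Rightarrow> bool list \<Rightarrow> nat list" where
  "vgroups s J n a = concat (map (\<lambda>l. groups s J l a) [0..<n])"

definition pgroups :: "nat \<Rightarrow> nat \<Rightarrow> bool list list \<Rightarrow> nat list" where
  "pgroups s J xs = concat (map (vgroups s J J) xs)"

lemma gidx_chunk: "gidx s J (v, k) = chunk_at s J v + k * (s + 1)"
  by (simp add: gidx_def chunk_at_def algebra_simps)

text \<open>The tree as it persists between queries. The entries of array 4 below \<open>d\<close>
  are free for the query vector, and the table in array 1 is left to \<open>tinv\<close>.\<close>

definition qinv :: "nat \<Rightarrow> nat \<Rightarrow> regs \<Rightarrow> arrays \<Rightarrow> bool" where
  "qinv s J \<rho> A \<longleftrightarrow> \<rho> 8 = J \<and> \<rho> 10 = s + 1 \<and> \<rho> 11 = d * (s + 1) \<and> \<rho> 40 = s \<and> \<rho> 41 = d \<and>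
     (\<forall>m<J * d. A 2 m = u m) \<and>
     (\<forall>i<N. \<forall>k<d. A 4 (Suc i * d + k) = of_bool (b i ! k)) \<and>
     (\<forall>w. length w \<le> J * d \<longrightarrow> A 6 (code w) = (if occ w then Suc (ix w) * d else 0)) \<and>
     (\<forall>w. length w < J * d \<longrightarrow> occ w \<longrightarrow> A 7 (code w) = (ix w * (J * d) + length w) * (2 * (d * (s + 1))))"

definition qconst :: "regs \<Rightarrow> bool" where
  "qconst \<rho> \<longleftrightarrow> \<rho> 1 = 0 \<and> \<rho> 2 = 1 \<and> \<rho> 3 = 2"

lemma wp_copy_query:
  assumes a: "\<And>k. k < d \<Longrightarrow> tape (fst \<iota>) (o' + k) = of_bool (a ! k)"
    and q: "qinv s J \<rho> A" "qconst \<rho>" "\<rho> 52 = o'"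
  shows "wp \<iota> copy_query (\<lambda>\<rho>' A' X' \<tau>'. same_except {27, 28, 52, 60, 61} \<rho> \<rho>' \<and> \<rho>' 52 = o' + d \<and>
      (\<exists>f. A' = A(4 := f)) \<and> (\<forall>k<d. A' 4 k = of_bool (a ! k)) \<and> (\<forall>k\<ge>d. A' 4 k = A 4 k) \<and> \<tau>' \<le> \<tau> + 12 * d + 5) \<rho> A X \<tau>"
proof -
  let ?Inv = "\<lambda>n \<rho>' A' X' \<tau>'. same_except {27, 28, 52, 60, 61} \<rho> \<rho>' \<and> \<rho>' 27 = n \<and> \<rho>' 52 = o' + n \<and>
      (\<exists>f. A' = A(4 := f)) \<and> (\<forall>k<n. A' 4 k = of_bool (a ! k)) \<and> (\<forall>k\<ge>n. A' 4 k = A 4 k) \<and> \<tau>' \<le> \<tau> + 12 * n + 2"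
  have "wp \<iota> [While (LESS 27 41) (INP 28 52 # put 4 27 28 @ [ADD 52 52 2, ADD 27 27 2])]
   (\<lambda>\<rho>' A' X' \<tau>'. same_except {27, 28, 52, 60, 61} \<rho> \<rho>' \<and> \<rho>' 52 = o' + d \<and>
      (\<exists>f. A' = A(4 := f)) \<and> (\<forall>k<d. A' 4 k = of_bool (a ! k)) \<and> (\<forall>k\<ge>d. A' 4 k = A 4 k) \<and> \<tau>' \<le> \<tau> + 12 * d + 5) (\<rho>(27 := 0)) A X (Suc \<tau>)"
  proof (rule wp_loop[where len = d and Inv = ?Inv])
    fix n \<rho>' A' X' \<tau>'
    assume n: "n < d" and inv: "?Inv n \<rho>' A' X' \<tau>'"
    have r: "\<rho>' 41 = d" "\<rho>' 2 = 1" using inv q by (auto simp: qinv_def qconst_def same_except_def)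
    show "holds (LESS 27 41) (mk \<rho>' A', X') \<and>
      wp \<iota> (INP 28 52 # put 4 27 28 @ [ADD 52 52 2, ADD 27 27 2]) (?Inv (Suc n)) \<rho>' A' X' (Suc \<tau>')"
      using inv r n a[OF n] by (auto simp: less_Suc_eq intro!: wp_nil)
  next
    fix \<rho>' A' X' \<tau>'
    assume inv: "?Inv d \<rho>' A' X' \<tau>'"
    have r: "\<rho>' 41 = d" using inv q by (auto simp: qinv_def qconst_def same_except_def)
    show "\<not> holds (LESS 27 41) (mk \<rho>' A', X') \<and> wp \<iota> []
      (\<lambda>\<rho>' A' X' \<tau>'. same_except {27, 28, 52, 60, 61} \<rho> \<rho>' \<and> \<rho>' 52 = o' + d \<and>
      (\<exists>f. A' = A(4 := f)) \<and> (\<forall>k<d. A' 4 k = of_bool (a ! k)) \<and> (\<forall>k\<ge>d. A' 4 k = A 4 k) \<and> \<tau>' \<le> \<tau> + 12 * d + 5) \<rho>' A' X' (Suc \<tau>')"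
      using inv r by (auto intro!: wp_nil)
  next
    show "?Inv 0 (\<rho>(27 := 0)) A X (Suc \<tau>)"
      using q by (auto intro: exI[of _ "A 4"])
  qed
  then show ?thesis unfolding copy_query_def by simp
qed

lemma wp_walk_query:
  assumes q: "qinv s J \<rho> A" "qconst \<rho>" and l: "l < J"
    and a: "\<forall>k<d. A 4 k = of_bool (a ! k)"
    and r: "\<rho> 30 = code (nd (l * d) a)" "\<rho> 31 = 2 ^ l" "\<rho> 32 = l * d"
      "nd (l * d) a \<noteq> [] \<longrightarrow> \<rho> 55 = chunk_at s J (nd (l * d) a)"
    and d: "0 < d"
  shows "wp \<iota> walk_query (\<lambda>\<rho>' A' X' \<tau>'. same_except {27, 28, 29, 30, 32, 55, 60, 61} \<rho> \<rho>' \<and> A' = A \<and>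
      \<rho>' 30 = code (nd (Suc l * d) a) \<and> \<rho>' 32 = Suc l * d \<and>
      (nd (Suc l * d) a \<noteq> [] \<longrightarrow> \<rho>' 55 = chunk_at s J (nd (Suc l * d) a)) \<and> \<tau>' \<le> \<tau> + 40 * d + 5) \<rho> A X \<tau>"
proof -
  let ?Inv = "\<lambda>n \<rho>' A' X' \<tau>'. same_except {27, 28, 29, 30, 32, 55, 60, 61} \<rho> \<rho>' \<and> A' = A \<and> \<rho>' 27 = n \<and>
      \<rho>' 30 = code (nd (l * d + n) a) \<and> \<rho>' 32 = l * d + n \<and>
      (nd (l * d + n) a \<noteq> [] \<longrightarrow> \<rho>' 55 = chunk_at s J (nd (l * d + n) a)) \<and> \<tau>' \<le> \<tau> + 40 * n + 2"
  let ?body = "(get 28 6 30 @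
      [If (LESS 1 28)
         (get 55 7 30 @ ADD 30 30 30 # get 28 2 32 @
          [If (LESS 28 31) (get 29 4 27 @ [If (LESS 1 29) [ADD 30 30 2, ADD 55 55 11] []]) []])
         [],
       ADD 32 32 2, ADD 27 27 2])"
  have "wp \<iota> [While (LESS 27 41) ?body]
   (\<lambda>\<rho>' A' X' \<tau>'. same_except {27, 28, 29, 30, 32, 55, 60, 61} \<rho> \<rho>' \<and> A' = A \<and>
      \<rho>' 30 = code (nd (Suc l * d) a) \<and> \<rho>' 32 = Suc l * d \<and>
      (nd (Suc l * d) a \<noteq> [] \<longrightarrow> \<rho>' 55 = chunk_at s J (nd (Suc l * d) a)) \<and> \<tau>' \<le> \<tau> + 40 * d + 5) (\<rho>(27 := 0)) A X (Suc \<tau>)"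
  proof (rule wp_loop[where len = d and Inv = ?Inv])
    fix n \<rho>' A' X' \<tau>'
    assume n: "n < d" and inv: "?Inv n \<rho>' A' X' \<tau>'"
    let ?v = "nd (l * d + n) a"
    have r: "\<rho>' 41 = d" "\<rho>' 1 = 0" "\<rho>' 2 = 1" "\<rho>' 31 = 2 ^ l" "\<rho>' 11 = d * (s + 1)"
      using inv q r by (auto simp: qinv_def qconst_def same_except_def)
    have m: "l * d + n < J * d"
    proof -
      have "Suc l * d \<le> J * d" using l by (intro mult_right_mono) auto
      then show ?thesis using n by simp
    qed
    have bit: "bitat a (l * d + n) \<longleftrightarrow> u (l * d + n) < 2 ^ l \<and> a ! n"
      using n by (simp add: bitat_def)
    have A2: "A 2 (l * d + n) = u (l * d + n)" using q m by (simp add: qinv_def)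
    have "length ?v \<le> J * d" using length_nd_le[of "l * d + n" a] m by simp
    then have A6: "A 6 (code ?v) = (if occ ?v then Suc (ix ?v) * d else 0)"
      using q unfolding qinv_def by blast
    have A7: "A 7 (code ?v) = (ix ?v * (J * d) + (l * d + n)) * (2 * (d * (s + 1)))" if "occ ?v"
      using q length_nd[OF that] that m unfolding qinv_def by auto
    have A4: "A 4 n = of_bool (a ! n)" using a n by blast
    have ch: "chunk_at s J (?v @ [c]) = (ix ?v * (J * d) + (l * d + n)) * (2 * (d * (s + 1))) + of_bool c * (d * (s + 1))"
      if "occ ?v" for c using length_nd[OF that] by (simp add: chunk_at_def algebra_simps)
    show "holds (LESS 27 41) (mk \<rho>' A', X') \<and> wp \<iota> ?body (?Inv (Suc n)) \<rho>' A' X' (Suc \<tau>')"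
    proof (cases "occ ?v")
      case False
      then show ?thesis using inv r n A6 by (auto intro!: wp_nil)
    next
      case True
      have i: "same_except {27, 28, 29, 30, 32, 55, 60, 61} \<rho> \<rho>'" "A' = A" "\<rho>' 27 = n" "\<rho>' 30 = code ?v"
        "\<rho>' 32 = l * d + n" "\<tau>' \<le> \<tau> + 40 * n + 2"
        using inv by auto
      show ?thesis using i r n A6 A2 A4 A7[OF True] True ch[OF True] d bit
        by (cases "u (l * d + n) < 2 ^ l"; cases "a ! n") (simp, (intro wp_nil)?, simp?)+
    qed
  next
    fix \<rho>' A' X' \<tau>'
    assume inv: "?Inv d \<rho>' A' X' \<tau>'"
    have "\<rho>' 41 = d" using inv q by (auto simp: qinv_def qconst_def same_except_def)
    then show "\<not> holds (LESS 27 41) (mk \<rho>' A', X') \<and> wp \<iota> []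
      (\<lambda>\<rho>' A' X' \<tau>'. same_except {27, 28, 29, 30, 32, 55, 60, 61} \<rho> \<rho>' \<and> A' = A \<and>
      \<rho>' 30 = code (nd (Suc l * d) a) \<and> \<rho>' 32 = Suc l * d \<and>
      (nd (Suc l * d) a \<noteq> [] \<longrightarrow> \<rho>' 55 = chunk_at s J (nd (Suc l * d) a)) \<and> \<tau>' \<le> \<tau> + 40 * d + 5) \<rho>' A' X' (Suc \<tau>')"
      using inv by (auto intro!: wp_nil simp: add.commute)
  next
    show "?Inv 0 (\<rho>(27 := 0)) A X (Suc \<tau>)"
      using r by auto
  qed
  then show ?thesis unfolding walk_query_def by simp
qed

lemma wp_visit_query:
  assumes q: "qinv s J \<rho> A" "qconst \<rho>"
    and c: "\<forall>k<d. A 4 (\<rho> 54 + k) = of_bool (c ! k)" "\<forall>k<d. A 4 (\<rho> 56 + k) = of_bool (c' ! k)"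
    and ch: "\<And>k. k < d \<Longrightarrow> c ! k \<noteq> c' ! k \<Longrightarrow> \<rho> 55 = chunk_at s J v"
  shows "wp \<iota> visit_query (\<lambda>\<rho>' A' X' \<tau>'. same_except {0, 27, 28, 29, 57, 58, 59, 60, 61} \<rho> \<rho>' \<and> (\<exists>f. A' = A(1 := f)) \<and>
      (A' 1, \<rho>' 0) = fold (visit (\<rho> 50)) (map (\<lambda>k. gidx s J (v, k)) (filter (\<lambda>k. c ! k \<noteq> c' ! k) [0..<d])) (A 1, \<rho> 0) \<and> \<tau>' \<le> \<tau> + 50 * d + 5) \<rho> A X \<tau>"
proof -
  let ?g = "\<lambda>n. map (\<lambda>k. gidx s J (v, k)) (filter (\<lambda>k. c ! k \<noteq> c' ! k) [0..<n])"
  define F where "F n = fold (visit (\<rho> 50)) (?g n) (A 1, \<rho> 0)" for n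
  let ?Inv = "\<lambda>n \<rho>' A' X' \<tau>'. same_except {0, 27, 28, 29, 57, 58, 59, 60, 61} \<rho> \<rho>' \<and> (\<exists>f. A' = A(1 := f)) \<and>
      \<rho>' 27 = n \<and> \<rho>' 57 = \<rho> 55 + n * (s + 1) \<and>
      (A' 1, \<rho>' 0) = F n \<and> \<tau>' \<le> \<tau> + 50 * n + 3"
  let ?body = "(ADD 28 54 27 # get 28 4 28 @ ADD 29 56 27 # get 29 4 29 @
      [SUB 58 28 29, SUB 59 29 28, ADD 58 58 59,
       If (LESS 1 58)
         (get 58 1 57 @ If (LESS 1 50) [ADD 58 58 2] [CST 58 0] # put 1 57 58 @
          ADD 58 57 58 # get 58 1 58 @ [ADD 0 0 58])
         [],
       ADD 57 57 10, ADD 27 27 2])"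
  let ?Q = "\<lambda>\<rho>' A' X' \<tau>'. same_except {0, 27, 28, 29, 57, 58, 59, 60, 61} \<rho> \<rho>' \<and> (\<exists>f. A' = A(1 := f)) \<and>
      (A' 1, \<rho>' 0) = fold (visit (\<rho> 50)) (map (\<lambda>k. gidx s J (v, k)) (filter (\<lambda>k. c ! k \<noteq> c' ! k) [0..<d])) (A 1, \<rho> 0) \<and> \<tau>' \<le> \<tau> + 50 * d + 5"
  have "wp \<iota> [While (LESS 27 41) ?body] ?Q (\<rho>(27 := 0, 57 := \<rho> 55 + \<rho> 1)) A X (Suc (Suc \<tau>))"
  proof (rule wp_loop[where len = d and Inv = ?Inv])
    fix n \<rho>' A' X' \<tau>'
    assume n: "n < d" and inv: "?Inv n \<rho>' A' X' \<tau>'"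
    have r: "\<rho>' 41 = d" "\<rho>' 1 = 0" "\<rho>' 2 = 1" "\<rho>' 10 = s + 1" "\<rho>' 54 = \<rho> 54" "\<rho>' 56 = \<rho> 56" "\<rho>' 50 = \<rho> 50"
      using inv q by (auto simp: qinv_def qconst_def same_except_def)
    have A4: "A' 4 (\<rho> 54 + n) = of_bool (c ! n)" "A' 4 (\<rho> 56 + n) = of_bool (c' ! n)"
      using inv c n by auto
    have S: "F n = (A' 1, \<rho>' 0)" using inv by simp
    show "holds (LESS 27 41) (mk \<rho>' A', X') \<and> wp \<iota> ?body (?Inv (Suc n)) \<rho>' A' X' (Suc \<tau>')"
    proof (cases "c ! n = c' ! n")
      case True
      then have "F (Suc n) = F n" by (simp add: F_def)
      then show ?thesis using True inv r n A4 by (auto intro!: wp_nil)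
    next
      case False
      then have g: "?g (Suc n) = ?g n @ [\<rho> 55 + n * (s + 1)]"
        using ch[OF n] by (simp add: gidx_chunk)
      have fg: "F (Suc n) = visit (\<rho> 50) (\<rho> 55 + n * (s + 1)) (A' 1, \<rho>' 0)"
        unfolding S[symmetric] unfolding F_def g fold_append by simp
      show ?thesis using fg S False inv r n A4
        by (cases "c ! n"; cases "c' ! n"; cases "\<rho> 50 = 0")
          (auto simp: visit_def Let_def intro!: wp_nil)
    qed
  next
    fix \<rho>' A' X' \<tau>'
    assume inv: "?Inv d \<rho>' A' X' \<tau>'"
    have "\<rho>' 41 = d" using inv q by (auto simp: qinv_def qconst_def same_except_def)
    then show "\<not> holds (LESS 27 41) (mk \<rho>' A', X') \<and> wp \<iota> [] ?Q \<rho>' A' X' (Suc \<tau>')"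
      using inv unfolding F_def by (auto intro!: wp_nil)
  next
    show "?Inv 0 (\<rho>(27 := 0, 57 := \<rho> 55 + \<rho> 1)) A X (Suc (Suc \<tau>))"
      using q by (auto simp: qconst_def F_def intro: exI[of _ "A 1"])
  qed
  then show ?thesis unfolding visit_query_def by simp
qed

end

section \<open>The two passes over the counters\<close>

lemma same_except_trans: "same_except S \<rho> \<rho>' \<Longrightarrow> same_except S' \<rho>' \<rho>'' \<Longrightarrow> same_except (S \<union> S') \<rho> \<rho>''"
  by (simp add: same_except_def)

lemma same_except_mono: "same_except S \<rho> \<rho>' \<Longrightarrow> S \<subseteq> S' \<Longrightarrow> same_except S' \<rho> \<rho>'"
  by (auto simp: same_except_def)

lemma fold_visit_0:
  "fold (visit 0) gs (T, z) = ((\<lambda>x. if x \<in> set gs then 0 else T x), z)"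
  by (induction gs arbitrary: T) (auto simp: visit_def Let_def fun_eq_iff)

definition layers :: "nat list \<Rightarrow> nat set" where
  "layers gs = {g + t | g t. 1 \<le> t \<and> t \<le> count_list gs g}"

lemma finite_layers: "finite (layers gs)"
proof -
  have "layers gs \<subseteq> (\<lambda>(g, t). g + t) ` (SIGMA g:set gs. {..count_list gs g})"
  proof
    fix c assume "c \<in> layers gs"
    then obtain g t where "c = g + t" "1 \<le> t" "t \<le> count_list gs g" unfolding layers_def by blast
    moreover from this have "g \<in> set gs" by (metis count_list_0_iff le_0_eq not_one_le_zero)
    ultimately show "c \<in> (\<lambda>(g, t). g + t) ` (SIGMA g:set gs. {..count_list gs g})"
      by (intro image_eqI[of _ _ "(g, t)"]) auto
  qed
  then show ?thesis by (rule finite_subset) auto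
qed

text \<open>Counters lie at multiples of \<open>Suc s\<close> and counts do not exceed
  \<open>s\<close>. Hence \<open>g + t\<close> with \<open>1 \<le> t \<le> s\<close> is never a
  counter and determines \<open>g\<close> and \<open>t\<close>: updating counters does not disturb
  the entries that are read, and every layer is read exactly once.\<close>

lemma fold_visit_1:
  assumes "\<And>g. g \<in> set gs \<Longrightarrow> T g = 0" "\<And>g. g \<in> set gs \<Longrightarrow> g mod Suc s = 0"
    "\<And>g. count_list gs g \<le> s" "0 < p"
  shows "fold (visit p) gs (T, z) = ((\<lambda>x. if x \<in> set gs then count_list gs x else T x), z + sum T (layers gs))"
  using assms(1-3)
proof (induction gs rule: rev_induct)
  case Nil
  then show ?case by (simp add: layers_def)
next
  case (snoc g gs)
  let ?T = "\<lambda>x. if x \<in> set gs then count_list gs x else T x"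
  let ?n = "Suc (count_list gs g)"
  have le: "count_list gs x \<le> s" for x using snoc.prems(3)[of x] by simp
  have n: "?n \<le> s" using snoc.prems(3)[of g] by simp
  have IH: "fold (visit p) gs (T, z) = (?T, z + sum T (layers gs))"
    by (rule snoc.IH) (use snoc.prems le in auto)
  have Tg: "?T g = count_list gs g" using snoc.prems(1)[of g] by simp
  have gm: "g mod Suc s = 0" using snoc.prems(2) by simp
  have nm: "(g + ?n) mod Suc s = ?n" using gm n by (metis add_0 less_Suc_eq_le mod_add_left_eq mod_less)
  then have notin: "g + ?n \<notin> set gs" using snoc.prems(2)[of "g + ?n"] by auto
  have new: "g + ?n \<notin> layers gs"
  proof
    assume "g + ?n \<in> layers gs"
    then obtain g' t where t: "g + ?n = g' + t" "1 \<le> t" "t \<le> count_list gs g'" unfolding layers_def by blast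
    then have "g' \<in> set gs" by (metis count_list_0_iff le_0_eq not_one_le_zero)
    then have "g' mod Suc s = 0" using snoc.prems(2) by simp
    then have "(g' + t) mod Suc s = t" using t(3) le[of g']
      by (metis add_0 le_trans less_Suc_eq_le mod_add_left_eq mod_less)
    then have "t = ?n" using nm t(1) by simp
    then show False using t by auto
  qed
  have lay: "layers (gs @ [g]) = insert (g + ?n) (layers gs)"
  proof (intro equalityI subsetI)
    fix c assume "c \<in> layers (gs @ [g])"
    then obtain g' t where t: "c = g' + t" "1 \<le> t" "t \<le> count_list (gs @ [g]) g'"
      unfolding layers_def by blast
    show "c \<in> insert (g + ?n) (layers gs)"
    proof (cases "g' = g \<and> t = ?n")
      case False
      then have "t \<le> count_list gs g'" using t(3) by (auto split: if_splits)
      then show ?thesis unfolding layers_def using t by blast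
    qed (use t in simp)
  next
    fix c assume "c \<in> insert (g + ?n) (layers gs)"
    then consider "c = g + ?n" | g' t where "c = g' + t" "1 \<le> t" "t \<le> count_list gs g'"
      unfolding layers_def by blast
    then show "c \<in> layers (gs @ [g])"
    proof cases
      case 1
      then show ?thesis unfolding layers_def by (intro CollectI exI[of _ g] exI[of _ ?n]) simp
    next
      case (2 g' t)
      then show ?thesis unfolding layers_def by (intro CollectI exI[of _ g'] exI[of _ t]) simp
    qed
  qed
  have "fold (visit p) (gs @ [g]) (T, z) = visit p g (?T, z + sum T (layers gs))"
    by (simp add: IH)
  also have "\<dots> = (?T(g := ?n), z + sum T (layers gs) + T (g + ?n))"
    using Tg notin \<open>0 < p\<close> by (simp add: visit_def Let_def)
  also have "\<dots> = ((\<lambda>x. if x \<in> set (gs @ [g]) then count_list (gs @ [g]) x else T x), z + sum T (layers (gs @ [g])))"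
    using new by (auto simp: lay finite_layers fun_eq_iff)
  finally show ?case .
qed

section \<open>Correctness of a query\<close>

context trie begin

text \<open>Only the multiset of visited groups influences the result, so neither the order of
  coordinates nor the enumeration of the query point matters.\<close>

lemma mset_groups: "mset (groups s J l a) = image_mset (gidx s J) (feats l a)"
proof -
  have "diffs l a = set (filter (\<lambda>k. rp (l * d) a ! k \<noteq> rp (Suc l * d) a ! k) [0..<d])"
    by (auto simp: diffs_def simp del: mult_Suc)
  then have "mset_set (diffs l a) = mset (filter (\<lambda>k. rp (l * d) a ! k \<noteq> rp (Suc l * d) a ! k) [0..<d])"
    using mset_set_set[of "filter (\<lambda>k. rp (l * d) a ! k \<noteq> rp (Suc l * d) a ! k) [0..<d]"] by (simp del: mult_Suc set_filter)
  then show ?thesis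
    by (simp add: groups_def feats_def image_mset.compositionality o_def del: mult_Suc mset_filter)
qed

lemma mset_vgroups: "mset (vgroups s J n a) = image_mset (gidx s J) (vfeats n a)"
  by (induction n) (simp_all add: vgroups_def vfeats_def mset_groups)

lemma mset_pgroups: "mset (pgroups s J xs) = image_mset (gidx s J) (pfeats J (mset xs))"
  by (induction xs) (simp_all add: pgroups_def pfeats_def mset_vgroups)

lemma count_gidx:
  assumes "set_mset F \<subseteq> valid J" "f \<in> valid J"
  shows "count (image_mset (gidx s J) F) (gidx s J f) = count F f"
proof -
  have "gidx s J -` {gidx s J f} \<inter> set_mset F = (if f \<in># F then {f} else {})"
    using gidx_inj(1)[of _ J f 0 s 0] assms by auto
  then show ?thesis by (auto simp: count_image_mset not_in_iff)
qed

lemma layers_pgroups: "layers (pgroups s J xs) = cells s J (mset xs)"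
proof -
  let ?F = "pfeats J (mset xs)"
  have cnt: "count_list (pgroups s J xs) g = count (image_mset (gidx s J) ?F) g" for g
    by (simp only: mset_pgroups[symmetric] count_mset)
  have F: "set_mset ?F \<subseteq> valid J" using pfeats_valid by blast
  show ?thesis
  proof
    show "layers (pgroups s J xs) \<subseteq> cells s J (mset xs)"
    proof
      fix c assume "c \<in> layers (pgroups s J xs)"
      then obtain g t where t: "c = g + t" "1 \<le> t" "t \<le> count (image_mset (gidx s J) ?F) g"
        unfolding layers_def cnt by blast
      then have "g \<in># image_mset (gidx s J) ?F" by (intro count_inI) simp
      then obtain f where f: "f \<in># ?F" "g = gidx s J f" by auto
      then have "t \<le> count ?F f" using t F count_gidx[of ?F J f s] by auto
      then show "c \<in> cells s J (mset xs)" unfolding cells_def using t f by blast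
    qed
    show "cells s J (mset xs) \<subseteq> layers (pgroups s J xs)"
    proof
      fix c assume "c \<in> cells s J (mset xs)"
      then obtain f t where t: "c = gidx s J f + t" "1 \<le> t" "t \<le> count ?F f"
        unfolding cells_def by blast
      then have "f \<in># ?F" by (intro count_inI) simp
      then have "count (image_mset (gidx s J) ?F) (gidx s J f) = count ?F f"
        using F by (intro count_gidx) auto
      then show "c \<in> layers (pgroups s J xs)" unfolding layers_def cnt
        using t by (intro CollectI exI[of _ "gidx s J f"] exI[of _ t]) simp
    qed
  qed
qed

text \<open>Counters are left unconstrained: whatever one query leaves in them is cleared by the
  first pass of a later query that touches them.\<close>

definition tinv :: "nat \<Rightarrow> nat \<Rightarrow> (nat \<Rightarrow> nat) \<Rightarrow> (nat \<Rightarrow> nat) \<Rightarrow> bool" where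
  "tinv s J sel T \<longleftrightarrow> (\<forall>c<N * (J * d) * 2 * d * (s + 1). c mod (s + 1) \<noteq> 0 \<longrightarrow> T c = (if sel c = 0 then 2 ^ c else 0))"

text \<open>The second pass sums the table over the cells of the point. These entries are distinct
  powers of two or 0, so the sum is the \<open>set_encode\<close> of the selected cells.\<close>

lemma fold_visit_hash:
  assumes T: "tinv s J sel T" and xs: "length xs \<le> s"
  defines "S \<equiv> fold (visit 1) (pgroups s J xs) (fold (visit 0) (pgroups s J xs) (T, 0))"
  shows "snd S = hash s J sel (mset xs)" "tinv s J sel (fst S)"
proof -
  let ?gs = "pgroups s J xs" and ?F = "pfeats J (mset xs)"
  let ?T = "\<lambda>x. if x \<in> set ?gs then 0 else T x"
  have sub: "set_mset ?F \<subseteq> valid J" using pfeats_valid by blast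
  have set_gs: "set ?gs = gidx s J ` set_mset ?F"
    using arg_cong[OF mset_pgroups[of s J xs], of set_mset] by simp
  have mod0: "g mod Suc s = 0" if "g \<in> set ?gs" for g
    using that unfolding set_gs gidx_def by (auto simp del: mult_Suc_right)
  have cnt: "count_list ?gs g \<le> s" for g
  proof (cases "g \<in> set ?gs")
    case True
    then obtain f where f: "f \<in># ?F" "g = gidx s J f" unfolding set_gs by blast
    have "count_list ?gs g = count (image_mset (gidx s J) ?F) g"
      by (simp only: mset_pgroups[symmetric] count_mset)
    also have "\<dots> = count ?F f" using f sub by (auto intro: count_gidx)
    also have "\<dots> \<le> s" using count_pfeats_le[of J "mset xs" f] xs by simp
    finally show ?thesis .
  qed (simp add: count_notin)
  have S: "S = ((\<lambda>x. if x \<in> set ?gs then count_list ?gs x else ?T x), sum ?T (layers ?gs))"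
    unfolding S_def fold_visit_0 by (subst fold_visit_1[where s = s]) (use mod0 cnt in auto)
  show "tinv s J sel (fst S)" using T mod0 unfolding tinv_def S by auto
  have "snd S = (\<Sum>c\<in>cells s J (mset xs). if sel c = 0 then 2 ^ c else 0)"
    unfolding S snd_conv layers_pgroups
  proof (rule sum.cong[OF refl])
    fix c assume c: "c \<in> cells s J (mset xs)"
    then obtain f t where t: "c = gidx s J f + t" "1 \<le> t" "t \<le> count ?F f"
      unfolding cells_def by blast
    have "t \<le> s" using t count_pfeats_le[of J "mset xs" f] xs by simp
    then have "c mod Suc s = t" unfolding t(1) gidx_def by (simp del: mult_Suc_right)
    then have "c mod (s + 1) \<noteq> 0" using t by simp
    moreover from this have "c \<notin> set ?gs" using mod0 by auto
    moreover have "c < N * (J * d) * 2 * d * (s + 1)" using cells_less[OF _ c] xs by simp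
    ultimately show "?T c = (if sel c = 0 then 2 ^ c else 0)" using T unfolding tinv_def by simp
  qed
  also have "\<dots> = (\<Sum>c\<in>{c \<in> cells s J (mset xs). sel c = 0}. 2 ^ c)"
    by (rule sum.inter_filter[symmetric]) (rule finite_cells)
  finally show "snd S = hash s J sel (mset xs)" by (simp add: hash_def set_encode_def)
qed

lemma qinv_cong:
  assumes "qinv s J \<rho> A" "same_except S \<rho> \<rho>'" "S \<inter> {8, 10, 11, 40, 41} = {}"
    "A' 2 = A 2" "A' 6 = A 6" "A' 7 = A 7" "\<forall>k\<ge>d. A' 4 k = A 4 k"
  shows "qinv s J \<rho>' A'"
proof -
  have "\<rho>' 8 = \<rho> 8" "\<rho>' 10 = \<rho> 10" "\<rho>' 11 = \<rho> 11" "\<rho>' 40 = \<rho> 40" "\<rho>' 41 = \<rho> 41"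
    using assms(2,3) by (auto simp: same_except_def)
  then show ?thesis using assms(1,4-) unfolding qinv_def by auto
qed

lemma qconst_cong: "qconst \<rho> \<Longrightarrow> same_except S \<rho> \<rho>' \<Longrightarrow> S \<inter> {1, 2, 3} = {} \<Longrightarrow> qconst \<rho>'"
proof -
  assume *: "qconst \<rho>" "same_except S \<rho> \<rho>'" "S \<inter> {1, 2, 3} = {}"
  then have "\<rho>' 1 = \<rho> 1" "\<rho>' 2 = \<rho> 2" "\<rho>' 3 = \<rho> 3" by (auto simp: same_except_def)
  then show ?thesis using *(1) by (simp add: qconst_def)
qed

lemma pointer_rp:
  assumes "qinv s J \<rho> A" "\<forall>k<d. A 4 k = of_bool (a ! k)" "m \<le> J * d"
  shows "\<forall>k<d. A 4 (A 6 (code (nd m a)) + k) = of_bool (rp m a ! k)"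
proof -
  have "length (nd m a) \<le> J * d" using length_nd_le[of m a] assms(3) by simp
  then have "A 6 (code (nd m a)) = (if occ (nd m a) then Suc (ix (nd m a)) * d else 0)"
    using assms(1) unfolding qinv_def by blast
  then show ?thesis
    using assms(1,2) ix_props(1)[of "nd m a"] by (auto simp: rp_def qinv_def simp del: mult_Suc)
qed

definition vstate :: "nat \<Rightarrow> nat \<Rightarrow> bool list \<Rightarrow> nat \<Rightarrow> regs \<Rightarrow> arrays \<Rightarrow> bool" where
  "vstate s J a l \<rho> A \<longleftrightarrow> qinv s J \<rho> A \<and> qconst \<rho> \<and> (\<forall>k<d. A 4 k = of_bool (a ! k)) \<and>
     \<rho> 30 = code (nd (l * d) a) \<and> \<rho> 31 = 2 ^ l \<and> \<rho> 32 = l * d \<and> \<rho> 33 = l \<and>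
     (\<forall>k<d. A 4 (\<rho> 54 + k) = of_bool (rp (l * d) a ! k)) \<and>
     (nd (l * d) a \<noteq> [] \<longrightarrow> \<rho> 55 = chunk_at s J (nd (l * d) a))"

definition scratch :: "nat set" where
  "scratch = {0, 27, 28, 29, 30, 31, 32, 33, 52, 53, 54, 55, 56, 57, 58, 59, 60, 61}"

lemma wp_block_query:
  assumes v: "vstate s J a l \<rho> A" and l: "l < J" and d: "0 < d"
  shows "wp \<iota> block_query (\<lambda>\<rho>' A' X' \<tau>'. vstate s J a (Suc l) \<rho>' A' \<and> same_except (scratch - {52, 53}) \<rho> \<rho>' \<and>
     (A' 1, \<rho>' 0) = fold (visit (\<rho> 50)) (groups s J l a) (A 1, \<rho> 0) \<and> \<tau>' \<le> \<tau> + 90 * d + 30) \<rho> A X \<tau>"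
  unfolding block_query_def
proof (rule wp_seq)
  let ?m = "Suc l * d" and ?S = "{27, 28, 29, 30, 32, 55, 60, 61} :: nat set"
  have m: "?m \<le> J * d" using l by (intro mult_right_mono) auto
  let ?R1 = "\<lambda>\<rho>' A' X' \<tau>'. same_except ?S \<rho> \<rho>' \<and> A' = A \<and>
      \<rho>' 30 = code (nd ?m a) \<and> \<rho>' 32 = ?m \<and>
      (nd ?m a \<noteq> [] \<longrightarrow> \<rho>' 55 = chunk_at s J (nd ?m a)) \<and> \<tau>' \<le> \<tau> + 40 * d + 5"
  show "wp \<iota> walk_query ?R1 \<rho> A X \<tau>"
    by (rule wp_walk_query) (use v l d in \<open>auto simp: vstate_def\<close>)
  fix \<rho>1 A1 X1 \<tau>1
  assume R1: "?R1 \<rho>1 A1 X1 \<tau>1"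
  define \<rho>2 where "\<rho>2 = \<rho>1(60 := adr 6 (\<rho>1 30), 61 := 6, 56 := A 6 (\<rho>1 30))"
  have s2: "same_except (insert 56 ?S) \<rho> \<rho>2"
    using same_except_mono[of ?S \<rho> \<rho>1 "insert 56 ?S"] R1 by (auto simp: \<rho>2_def)
  have q2: "qinv s J \<rho>2 A" "qconst \<rho>2"
    using v by (auto simp: vstate_def intro: qinv_cong[OF _ s2] qconst_cong[OF _ s2])
  have r2: "\<rho>2 30 = code (nd ?m a)" "\<rho>2 32 = ?m" "\<rho>2 56 = A 6 (code (nd ?m a))"
    "nd ?m a \<noteq> [] \<longrightarrow> \<rho>2 55 = chunk_at s J (nd ?m a)"
    using R1 by (auto simp: \<rho>2_def)
  have r2': "\<rho>2 54 = \<rho> 54" "\<rho>2 31 = 2 ^ l" "\<rho>2 33 = l" "\<rho>2 50 = \<rho> 50" "\<rho>2 0 = \<rho> 0"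
    using v same_exceptD[OF s2] by (auto simp: vstate_def)
  let ?S3 = "{0, 27, 28, 29, 57, 58, 59, 60, 61} :: nat set"
  let ?R3 = "\<lambda>\<rho>' A' X' \<tau>'. same_except ?S3 \<rho>2 \<rho>' \<and> (\<exists>f. A' = A(1 := f)) \<and>
      (A' 1, \<rho>' 0) = fold (visit (\<rho>2 50)) (map (\<lambda>k. gidx s J (nd ?m a, k)) (filter (\<lambda>k. rp (l * d) a ! k \<noteq> rp ?m a ! k) [0..<d])) (A 1, \<rho>2 0) \<and> \<tau>' \<le> Suc (Suc (Suc (Suc (Suc (Suc \<tau>1))))) + 50 * d + 5"
  let ?Q = "\<lambda>\<rho>' A' X' \<tau>'. vstate s J a (Suc l) \<rho>' A' \<and> same_except (scratch - {52, 53}) \<rho> \<rho>' \<and>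
     (A' 1, \<rho>' 0) = fold (visit (\<rho> 50)) (groups s J l a) (A 1, \<rho> 0) \<and> \<tau>' \<le> \<tau> + 90 * d + 30"
  have "wp \<iota> (visit_query @ [ADD 54 56 1, ADD 31 31 31, ADD 33 33 2]) ?Q \<rho>2 A X1 (Suc (Suc (Suc (Suc (Suc (Suc \<tau>1))))))"
  proof (rule wp_seq)
    show "wp \<iota> visit_query ?R3 \<rho>2 A X1 (Suc (Suc (Suc (Suc (Suc (Suc \<tau>1))))))"
    proof (rule wp_visit_query[OF q2])
      show "\<forall>k<d. A 4 (\<rho>2 54 + k) = of_bool (rp (l * d) a ! k)" using v r2' by (simp add: vstate_def)
      show "\<forall>k<d. A 4 (\<rho>2 56 + k) = of_bool (rp ?m a ! k)"
        unfolding r2 using v by (intro pointer_rp[OF q2(1) _ m]) (simp add: vstate_def)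
      fix k assume k: "k < d" "rp (l * d) a ! k \<noteq> rp ?m a ! k"
      then have "(nd ?m a, k) \<in># feats l a" by (simp add: feats_def diffs_def del: mult_Suc)
      then have "nd ?m a \<noteq> []" using feats_nonempty_length(1) by fastforce
      then show "\<rho>2 55 = chunk_at s J (nd ?m a)" using r2 by blast
    qed
    fix \<rho>3 A3 X3 \<tau>3
    assume R3: "?R3 \<rho>3 A3 X3 \<tau>3"
    define \<rho>4 where "\<rho>4 = \<rho>3(54 := \<rho>3 56 + \<rho>3 1, 31 := \<rho>3 31 + \<rho>3 31, 33 := \<rho>3 33 + \<rho>3 2)"
    have s3: "same_except ?S3 \<rho>2 \<rho>3" using R3 by blast
    have s4: "same_except (scratch - {52, 53}) \<rho> \<rho>4"
    proof -
      have "same_except (scratch - {52, 53}) \<rho> \<rho>3"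
        using same_except_mono[OF same_except_trans[OF s2 s3], of "scratch - {52, 53}"] by (simp add: scratch_def)
      then show ?thesis by (simp add: \<rho>4_def scratch_def)
    qed
    have q4: "qinv s J \<rho>4 A3" "qconst \<rho>4"
      using v R3 by (auto simp: vstate_def scratch_def intro: qinv_cong[OF _ s4] qconst_cong[OF _ s4])
    have r4: "\<rho>3 30 = \<rho>2 30" "\<rho>3 31 = \<rho>2 31" "\<rho>3 32 = \<rho>2 32" "\<rho>3 33 = \<rho>2 33" "\<rho>3 56 = \<rho>2 56" "\<rho>3 55 = \<rho>2 55" "\<rho>3 1 = 0" "\<rho>3 2 = 1"
      using same_exceptD[OF s3] q2(2) by (auto simp: qconst_def)
    have a3: "\<forall>k<d. A3 4 k = of_bool (a ! k)" "A3 6 = A 6" "A3 4 = A 4" using v R3 by (auto simp: vstate_def)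
    have p4: "\<forall>k<d. A3 4 (\<rho>4 54 + k) = of_bool (rp ?m a ! k)"
      using pointer_rp[OF q2(1) _ m] v r2(3) r4 a3 by (simp add: \<rho>4_def vstate_def del: mult_Suc)
    have "vstate s J a (Suc l) \<rho>4 A3"
      using q4 a3(1) p4 r4 r2 r2' by (simp add: vstate_def \<rho>4_def del: mult_Suc) simp?
    moreover have "(A3 1, \<rho>4 0) = fold (visit (\<rho> 50)) (groups s J l a) (A 1, \<rho> 0)"
      using R3 r2' by (simp add: groups_def \<rho>4_def del: mult_Suc)
    moreover have "\<tau>3 + 3 \<le> \<tau> + 90 * d + 30" using R1 R3 by simp
    ultimately have "?Q \<rho>4 A3 X3 (Suc (Suc (Suc \<tau>3)))" using s4 by simp
    then have "wp \<iota> [] ?Q \<rho>4 A3 X3 (Suc (Suc (Suc \<tau>3)))"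
      by (rule wp_nil[of ?Q \<rho>4 A3 X3 "Suc (Suc (Suc \<tau>3))"])
    then show "wp \<iota> [ADD 54 56 1, ADD 31 31 31, ADD 33 33 2] ?Q \<rho>3 A3 X3 \<tau>3"
      by (simp add: \<rho>4_def)
  qed
  then show "wp \<iota> (get 56 6 30 @ visit_query @ [ADD 54 56 1, ADD 31 31 31, ADD 33 33 2]) ?Q \<rho>1 A1 X1 \<tau>1"
    using R1 by (simp add: \<rho>2_def)
qed

lemma wp_vector_query:
  assumes q: "qinv s J \<rho> A" "qconst \<rho>" and d: "0 < d"
    and a: "\<And>k. k < d \<Longrightarrow> tape (fst \<iota>) (\<rho> 52 + k) = of_bool (a ! k)"
  shows "wp \<iota> vector_query (\<lambda>\<rho>' A' X' \<tau>'. qinv s J \<rho>' A' \<and> same_except scratch \<rho> \<rho>' \<and>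
     \<rho>' 52 = \<rho> 52 + d \<and> \<rho>' 53 = \<rho> 53 + 1 \<and>
     (A' 1, \<rho>' 0) = fold (visit (\<rho> 50)) (vgroups s J J a) (A 1, \<rho> 0) \<and> \<tau>' \<le> \<tau> + J * (90 * d + 31) + 12 * d + 30) \<rho> A X \<tau>"
  unfolding vector_query_def
proof (rule wp_seq)
  let ?S1 = "{27, 28, 52, 60, 61} :: nat set"
  let ?R1 = "\<lambda>\<rho>' A' X' \<tau>'. same_except ?S1 \<rho> \<rho>' \<and> \<rho>' 52 = \<rho> 52 + d \<and>
      (\<exists>f. A' = A(4 := f)) \<and> (\<forall>k<d. A' 4 k = of_bool (a ! k)) \<and> (\<forall>k\<ge>d. A' 4 k = A 4 k) \<and> \<tau>' \<le> \<tau> + 12 * d + 5"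
  let ?Q = "\<lambda>\<rho>' A' X' \<tau>'. qinv s J \<rho>' A' \<and> same_except scratch \<rho> \<rho>' \<and>
     \<rho>' 52 = \<rho> 52 + d \<and> \<rho>' 53 = \<rho> 53 + 1 \<and>
     (A' 1, \<rho>' 0) = fold (visit (\<rho> 50)) (vgroups s J J a) (A 1, \<rho> 0) \<and> \<tau>' \<le> \<tau> + J * (90 * d + 31) + 12 * d + 30"
  show "wp \<iota> copy_query ?R1 \<rho> A X \<tau>"
    by (rule wp_copy_query[OF a q refl])
  fix \<rho>1 A1 X1 \<tau>1
  assume R1: "?R1 \<rho>1 A1 X1 \<tau>1"
  define \<rho>2 where "\<rho>2 = \<rho>1(30 := 1, 31 := 1, 32 := 0, 33 := 0, 60 := adr 6 1, 61 := 6, 54 := A1 6 1, 55 := \<rho>1 1 + \<rho>1 1)"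
  have s1: "same_except (scratch - {53}) \<rho> \<rho>1"
    using R1 same_except_mono[of ?S1 \<rho> \<rho>1] by (auto simp: scratch_def)
  have s2: "same_except (scratch - {53}) \<rho> \<rho>2"
    using s1 by (simp add: \<rho>2_def scratch_def)
  have q2: "qinv s J \<rho>2 A1" "qconst \<rho>2"
    using q R1 by (auto simp: scratch_def intro: qinv_cong[OF _ s2] qconst_cong[OF _ s2])
  have p2: "\<forall>k<d. A1 4 (A1 6 (code (nd 0 a)) + k) = of_bool (rp 0 a ! k)"
    using R1 by (intro pointer_rp[OF q2(1)]) auto
  have v2: "vstate s J a 0 \<rho>2 A1"
    using q2 p2 R1 by (simp add: vstate_def \<rho>2_def)
  have r2: "\<rho>2 52 = \<rho> 52 + d" "\<rho>2 53 = \<rho> 53" "\<rho>2 50 = \<rho> 50" "\<rho>2 0 = \<rho> 0" "A1 1 = A 1"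
    using R1 by (auto simp: \<rho>2_def same_except_def)
  let ?Inv = "\<lambda>l \<rho>' A' X' \<tau>'. vstate s J a l \<rho>' A' \<and> same_except (scratch - {52, 53}) \<rho>2 \<rho>' \<and>
     (A' 1, \<rho>' 0) = fold (visit (\<rho> 50)) (vgroups s J l a) (A 1, \<rho> 0) \<and> \<tau>' \<le> \<tau>1 + 11 + l * (90 * d + 31)"
  have "wp \<iota> [While (LESS 33 8) block_query, ADD 53 53 2] ?Q \<rho>2 A1 X1 (\<tau>1 + 11)"
  proof (rule wp_loop[where len = J and Inv = ?Inv])
    fix l \<rho>' A' X' \<tau>'
    assume l: "l < J" and inv: "?Inv l \<rho>' A' X' \<tau>'"
    have "\<rho>' 8 = J" "\<rho>' 33 = l" using inv by (auto simp: vstate_def qinv_def)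
    moreover have "wp \<iota> block_query (?Inv (Suc l)) \<rho>' A' X' (Suc \<tau>')"
    proof (rule wp_mono[OF wp_block_query[OF _ l d]])
      show "vstate s J a l \<rho>' A'" using inv by blast
      fix \<rho>'' A'' X'' \<tau>''
      assume *: "vstate s J a (Suc l) \<rho>'' A'' \<and> same_except (scratch - {52, 53}) \<rho>' \<rho>'' \<and>
        (A'' 1, \<rho>'' 0) = fold (visit (\<rho>' 50)) (groups s J l a) (A' 1, \<rho>' 0) \<and> \<tau>'' \<le> Suc \<tau>' + 90 * d + 30"
      have "\<rho>' 50 = \<rho> 50" using inv r2 by (auto simp: same_except_def scratch_def)
      then show "?Inv (Suc l) \<rho>'' A'' X'' \<tau>''"
        using inv * same_except_trans[of "scratch - {52, 53}" \<rho>2 \<rho>' "scratch - {52, 53}" \<rho>'']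
        by (simp add: vgroups_def)
    qed
    ultimately show "holds (LESS 33 8) (mk \<rho>' A', X') \<and> wp \<iota> block_query (?Inv (Suc l)) \<rho>' A' X' (Suc \<tau>')"
      using l by simp
  next
    fix \<rho>' A' X' \<tau>'
    assume inv: "?Inv J \<rho>' A' X' \<tau>'"
    have r: "\<rho>' 8 = J" "\<rho>' 33 = J" "\<rho>' 2 = 1" using inv by (auto simp: vstate_def qinv_def qconst_def)
    have r': "\<rho>' 52 = \<rho> 52 + d" "\<rho>' 53 = \<rho> 53"
      using inv r2 by (auto simp: same_except_def scratch_def)
    have "same_except scratch \<rho> \<rho>'"
    proof (rule same_except_mono[OF same_except_trans[OF s2]])
      show "same_except (scratch - {52, 53}) \<rho>2 \<rho>'" using inv by blast
    qed auto
    then have s: "same_except scratch \<rho> (\<rho>'(53 := \<rho>' 53 + \<rho>' 2))" by (simp add: scratch_def)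
    have "qinv s J (\<rho>'(53 := \<rho>' 53 + \<rho>' 2)) A'"
      using inv by (auto simp: vstate_def qinv_def)
    then have "?Q (\<rho>'(53 := \<rho>' 53 + \<rho>' 2)) A' X' (Suc (Suc \<tau>'))"
      using s inv r r' R1 by simp
    then have "wp \<iota> [] ?Q (\<rho>'(53 := \<rho>' 53 + \<rho>' 2)) A' X' (Suc (Suc \<tau>'))"
      by (rule wp_nil[of ?Q "\<rho>'(53 := \<rho>' 53 + \<rho>' 2)" A' X' "Suc (Suc \<tau>')"])
    then show "\<not> holds (LESS 33 8) (mk \<rho>' A', X') \<and> wp \<iota> [ADD 53 53 2] ?Q \<rho>' A' X' (Suc \<tau>')"
      using r by simp
  next
    show "?Inv 0 \<rho>2 A1 X1 (\<tau>1 + 11)" using v2 r2 by (simp add: vgroups_def)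
  qed
  then show "wp \<iota> ([CST 30 1, CST 31 1, CST 32 0, CST 33 0] @ get 54 6 30 @ [ADD 55 1 1, While (LESS 33 8) block_query, ADD 53 53 2]) ?Q \<rho>1 A1 X1 \<tau>1"
    by (simp add: \<rho>2_def eval_nat_numeral)
qed

end

lemma nth_concat_uniform:
  assumes "\<forall>x\<in>set xs. length x = d" "i < length xs" "k < d"
  shows "i * d + k < length (concat xs)" "concat xs ! (i * d + k) = xs ! i ! k"
proof -
  have "i * d + k < length (concat xs) \<and> concat xs ! (i * d + k) = xs ! i ! k"
    using assms
  proof (induction xs arbitrary: i)
    case (Cons x xs)
    show ?case
    proof (cases i)
      case 0
      then show ?thesis using Cons.prems by (simp add: nth_append)
    next
      case (Suc j)
      then have "j * d + k < length (concat xs) \<and> concat xs ! (j * d + k) = xs ! j ! k"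
        using Cons.prems by (intro Cons.IH) auto
      then show ?thesis using Suc Cons.prems by (simp add: nth_append)
    qed
  qed simp
  then show "i * d + k < length (concat xs)" "concat xs ! (i * d + k) = xs ! i ! k" by auto
qed

lemma wp_halts:
  assumes "wp \<iota> cs Q \<rho> A X 0" "\<And>\<rho> A X \<tau>. Q \<rho> A X \<tau> \<Longrightarrow> \<tau> \<le> T"
  obtains \<rho>' A' X' \<tau>' where "run \<iota> T (cs, (mk \<rho> A, X)) = return_pmf ([], (mk \<rho>' A', X'))" "Q \<rho>' A' X' \<tau>'"
proof -
  obtain t \<rho>' A' X' where t: "\<And>rest. run \<iota> t (cs @ rest, (mk \<rho> A, X)) = return_pmf (rest, (mk \<rho>' A', X'))"
    and Q: "Q \<rho>' A' X' (0 + t)"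
    using assms(1) unfolding wp_def by blast
  have "t \<le> T" using assms(2)[OF Q] by simp
  then have "run \<iota> T (cs, (mk \<rho> A, X)) = bind_pmf (run \<iota> t (cs, (mk \<rho> A, X))) (run \<iota> (T - t))"
    by (simp flip: run_add)
  also have "\<dots> = return_pmf ([], (mk \<rho>' A', X'))"
    using t[of "[]"] by (simp add: bind_return_pmf run_halted)
  finally show ?thesis using that Q by blast
qed

lemma hash_output_mk: "hash_output (mk \<rho> A, X) = \<rho> 0"
  using mk_reg[of \<rho> A 0] by (simp add: hash_output_def reg_def)

lemma maintainsI:
  assumes init: "(mk \<rho> A, X) = \<sigma>" "Inv \<rho> A"
    and step: "\<And>\<rho> A X xs. Inv \<rho> A \<Longrightarrow> mset xs \<in> EMD_points s d \<Longrightarrow>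
      wp (query_input xs) Query (\<lambda>\<rho>' A' X' \<tau>'. Inv \<rho>' A' \<and> \<rho>' 0 = h (mset xs) \<and> \<tau>' \<le> T) \<rho> A X 0"
  shows "maintains s d Query T h \<sigma>"
proof -
  let ?I = "{(mk \<rho> A, X) | \<rho> A X. Inv \<rho> A}"
  have "halts_within T (query_input xs) Query \<tau> \<and>
      (\<forall>\<tau>'\<in>set_pmf (final_memory T (query_input xs) Query \<tau>). \<tau>' \<in> ?I \<and> hash_output \<tau>' = h (mset xs))"
    if "\<tau> \<in> ?I" and xs: "mset xs \<in> EMD_points s d" for \<tau> xs
  proof -
    obtain \<rho> A X where \<tau>: "\<tau> = (mk \<rho> A, X)" "Inv \<rho> A" using \<open>\<tau> \<in> ?I\<close> by blast
    obtain \<rho>' A' X' \<tau>' where "run (query_input xs) T (Query, (mk \<rho> A, X)) = return_pmf ([], (mk \<rho>' A', X'))"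
      "Inv \<rho>' A' \<and> \<rho>' 0 = h (mset xs) \<and> \<tau>' \<le> T"
      using wp_halts[OF step[OF \<tau>(2) xs]] by blast
    then show ?thesis
      unfolding \<tau>(1) halts_within_def final_memory_def by (auto simp: hash_output_mk)
  qed
  then show ?thesis unfolding maintains_def
    using init by (intro exI[of _ ?I]) blast
qed

text \<open>Register 40 is the number of vectors to be scanned. It is still 0 if no tree was built,
  and the same query program then answers 0.\<close>

lemma maintains_trivial:
  assumes "\<rho> 40 = 0" "50 \<le> T"
  shows "maintains s d Query T (\<lambda>_. 0) (mk \<rho> A, X)"
proof (rule maintainsI[OF refl, where Inv = "\<lambda>\<rho> A. \<rho> 40 = 0"])
  fix \<rho> :: regs and A X xs
  assume 0: "\<rho> 40 = 0"
  show "wp (query_input xs) Query (\<lambda>\<rho>' A' X' \<tau>'. \<rho>' 40 = 0 \<and> \<rho>' 0 = 0 \<and> \<tau>' \<le> T) \<rho> A X 0"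
    using 0 assms(2) by (simp add: Query_def wp_While wp_nil)
qed (use assms in auto)

context trie begin

definition vector_time :: "nat \<Rightarrow> nat" where
  "vector_time J = J * (90 * d + 31) + 12 * d + 31"

lemma wp_Query:
  assumes q: "qinv s J \<rho> A" and xs: "length xs = s" "\<forall>x\<in>set xs. length x = d" and d: "0 < d"
  shows "wp (query_input xs) Query (\<lambda>\<rho>' A' X' \<tau>'. qinv s J \<rho>' A' \<and>
     (A' 1, \<rho>' 0) = fold (visit 1) (pgroups s J xs) (fold (visit 0) (pgroups s J xs) (A 1, 0)) \<and>
     \<tau>' \<le> \<tau> + 2 * (s * vector_time J) + 20) \<rho> A X \<tau>"
proof -
  let ?\<iota> = "query_input xs"
  have tape: "tape (fst ?\<iota>) (i * d + k) = of_bool (xs ! i ! k)" if "i < s" "k < d" for i k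
    using nth_concat_uniform[OF xs(2), of i k] that xs(1)
    by (simp add: query_input_def encode_point_def tape_def)
  \<comment> \<open>The table and the sum before pass \<open>p\<close>; here \<open>G\<close> is not
    the sampling rate.\<close>
  define G where "G = rec_nat (A 1, 0) (\<lambda>p. fold (visit p) (pgroups s J xs))"
  have G: "G 0 = (A 1, 0)" "G (Suc p) = fold (visit p) (pgroups s J xs) (G p)" for p
    by (simp_all add: G_def)
  have G2: "G 2 = fold (visit 1) (pgroups s J xs) (fold (visit 0) (pgroups s J xs) (A 1, 0))"
    by (simp only: numeral_2_eq_2 One_nat_def G)
  define \<rho>0 where "\<rho>0 = \<rho>(0 := 0, Suc 0 := 0, 2 := Suc 0, 3 := 2, 50 := 0)"
  have q0: "qinv s J \<rho>0 A" "qconst \<rho>0" using q by (simp_all add: qinv_def qconst_def \<rho>0_def)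
  let ?O = "\<lambda>p \<rho>' A' X' \<tau>'. qinv s J \<rho>' A' \<and> qconst \<rho>' \<and> \<rho>' 50 = p \<and> (A' 1, \<rho>' 0) = G p \<and>
     \<tau>' \<le> \<tau> + 5 + p * (s * vector_time J + 5)"
  let ?Q = "\<lambda>\<rho>' A' X' \<tau>'. qinv s J \<rho>' A' \<and>
     (A' 1, \<rho>' 0) = fold (visit 1) (pgroups s J xs) (fold (visit 0) (pgroups s J xs) (A 1, 0)) \<and>
     \<tau>' \<le> \<tau> + 2 * (s * vector_time J) + 20"
  have "wp ?\<iota> [While (LESS 50 3) [CST 52 0, CST 53 0, While (LESS 53 40) vector_query, ADD 50 50 2]]
     ?Q \<rho>0 A X (\<tau> + 5)"
  proof (rule wp_loop[where len = 2 and Inv = ?O])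
    fix p \<rho>1 A1 X1 \<tau>1
    assume p: "p < 2" and o: "?O p \<rho>1 A1 X1 \<tau>1"
    let ?I = "\<lambda>i \<rho>' A' X' \<tau>'. qinv s J \<rho>' A' \<and> qconst \<rho>' \<and> \<rho>' 50 = p \<and> \<rho>' 52 = i * d \<and> \<rho>' 53 = i \<and>
      (A' 1, \<rho>' 0) = fold (visit p) (pgroups s J (take i xs)) (G p) \<and> \<tau>' \<le> \<tau>1 + 3 + i * vector_time J"
    have "wp ?\<iota> [While (LESS 53 40) vector_query, ADD 50 50 2] (?O (Suc p)) (\<rho>1(52 := 0, 53 := 0)) A1 X1 (\<tau>1 + 3)"
    proof (rule wp_loop[where len = s and Inv = ?I])
      fix i \<rho>2 A2 X2 \<tau>2
      assume i: "i < s" and I: "?I i \<rho>2 A2 X2 \<tau>2"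
      have "\<rho>2 53 < \<rho>2 40" using I i by (simp add: qinv_def)
      moreover have "wp ?\<iota> vector_query (?I (Suc i)) \<rho>2 A2 X2 (Suc \<tau>2)"
      proof (rule wp_mono[OF wp_vector_query[where a = "xs ! i", OF _ _ d]])
        show "qinv s J \<rho>2 A2" "qconst \<rho>2" using I by auto
        show "tape (fst ?\<iota>) (\<rho>2 52 + k) = of_bool (xs ! i ! k)" if "k < d" for k
          using tape[OF i that] I by simp
        fix \<rho>3 A3 X3 \<tau>3
        assume *: "qinv s J \<rho>3 A3 \<and> same_except scratch \<rho>2 \<rho>3 \<and> \<rho>3 52 = \<rho>2 52 + d \<and> \<rho>3 53 = \<rho>2 53 + 1 \<and>
          (A3 1, \<rho>3 0) = fold (visit (\<rho>2 50)) (vgroups s J J (xs ! i)) (A2 1, \<rho>2 0) \<and>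
          \<tau>3 \<le> Suc \<tau>2 + J * (90 * d + 31) + 12 * d + 30"
        have "qconst \<rho>3" using I * qconst_cong[of \<rho>2 scratch \<rho>3] by (simp add: scratch_def)
        moreover have "\<rho>3 50 = p" using I * by (auto simp: same_except_def scratch_def)
        moreover have "pgroups s J (take (Suc i) xs) = pgroups s J (take i xs) @ vgroups s J J (xs ! i)"
          using i xs(1) by (simp add: take_Suc_conv_app_nth pgroups_def)
        ultimately show "?I (Suc i) \<rho>3 A3 X3 \<tau>3"
          using I * by (simp add: vector_time_def)
      qed
      ultimately show "holds (LESS 53 40) (mk \<rho>2 A2, X2) \<and> wp ?\<iota> vector_query (?I (Suc i)) \<rho>2 A2 X2 (Suc \<tau>2)"
        by simp
    next
      fix \<rho>2 A2 X2 \<tau>2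
      assume I: "?I s \<rho>2 A2 X2 \<tau>2"
      have r: "\<rho>2 53 = \<rho>2 40" "\<rho>2 2 = 1" using I by (simp_all add: qinv_def qconst_def)
      have "?O (Suc p) (\<rho>2(50 := \<rho>2 50 + \<rho>2 2)) A2 X2 (Suc (Suc \<tau>2))"
        using I o xs(1) by (auto simp: G qinv_def qconst_def)
      then have "wp ?\<iota> [] (?O (Suc p)) (\<rho>2(50 := \<rho>2 50 + \<rho>2 2)) A2 X2 (Suc (Suc \<tau>2))"
        by (rule wp_nil[of "?O (Suc p)" "\<rho>2(50 := \<rho>2 50 + \<rho>2 2)" A2 X2 "Suc (Suc \<tau>2)"])
      then show "\<not> holds (LESS 53 40) (mk \<rho>2 A2, X2) \<and> wp ?\<iota> [ADD 50 50 2] (?O (Suc p)) \<rho>2 A2 X2 (Suc \<tau>2)"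
        using r by simp
    next
      show "?I 0 (\<rho>1(52 := 0, 53 := 0)) A1 X1 (\<tau>1 + 3)"
        using o by (auto simp: qinv_def qconst_def pgroups_def)
    qed
    then show "holds (LESS 50 3) (mk \<rho>1 A1, X1) \<and>
      wp ?\<iota> [CST 52 0, CST 53 0, While (LESS 53 40) vector_query, ADD 50 50 2] (?O (Suc p)) \<rho>1 A1 X1 (Suc \<tau>1)"
      using o p by (simp add: qconst_def eval_nat_numeral)
  next
    fix \<rho>1 A1 X1 \<tau>1
    assume o: "?O 2 \<rho>1 A1 X1 \<tau>1"
    have "?Q \<rho>1 A1 X1 (Suc \<tau>1)" using o unfolding G2 by auto
    then have "wp ?\<iota> [] ?Q \<rho>1 A1 X1 (Suc \<tau>1)"
      by (rule wp_nil[of ?Q \<rho>1 A1 X1 "Suc \<tau>1"])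
    then show "\<not> holds (LESS 50 3) (mk \<rho>1 A1, X1) \<and> wp ?\<iota> [] ?Q \<rho>1 A1 X1 (Suc \<tau>1)"
      using o by (simp add: qconst_def)
  next
    show "?O 0 \<rho>0 A X (\<tau> + 5)" using q0 by (simp add: G) (simp add: \<rho>0_def)
  qed
  then show ?thesis unfolding Query_def by (simp add: \<rho>0_def eval_nat_numeral)
qed

lemma maintains_hash:
  assumes q: "qinv s J \<rho> A" "tinv s J sel (A 1)" and d: "0 < d" and T: "2 * (s * vector_time J) + 20 \<le> T"
  shows "maintains s d Query T (hash s J sel) (mk \<rho> A, X)"
proof (rule maintainsI[OF refl, where Inv = "\<lambda>\<rho> A. qinv s J \<rho> A \<and> tinv s J sel (A 1)"])
  fix \<rho> :: regs and A X and xs :: "bool list list"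
  assume inv: "qinv s J \<rho> A \<and> tinv s J sel (A 1)" and "mset xs \<in> EMD_points s d"
  then have xs: "length xs = s" "\<forall>x\<in>set xs. length x = d" by (auto simp: EMD_points_def)
  show "wp (query_input xs) Query (\<lambda>\<rho>' A' X' \<tau>'. (qinv s J \<rho>' A' \<and> tinv s J sel (A' 1)) \<and>
    \<rho>' 0 = hash s J sel (mset xs) \<and> \<tau>' \<le> T) \<rho> A X 0"
  proof (rule wp_mono[OF wp_Query[OF conjunct1[OF inv] xs d]])
    fix \<rho>' A' X' \<tau>'
    assume *: "qinv s J \<rho>' A' \<and>
     (A' 1, \<rho>' 0) = fold (visit 1) (pgroups s J xs) (fold (visit 0) (pgroups s J xs) (A 1, 0)) \<and>
     \<tau>' \<le> 0 + 2 * (s * vector_time J) + 20"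
    note h = fold_visit_hash[of s J sel "A 1" xs]
    have "\<rho>' 0 = hash s J sel (mset xs)" "tinv s J sel (A' 1)"
      using h inv xs * by (metis fst_conv snd_conv order_refl)+
    then show "(qinv s J \<rho>' A' \<and> tinv s J sel (A' 1)) \<and> \<rho>' 0 = hash s J sel (mset xs) \<and> \<tau>' \<le> T"
      using * T by simp
  qed
qed (use q in auto)

end

section \<open>The initialization program\<close>

definition mul :: "nat \<Rightarrow> nat \<Rightarrow> nat \<Rightarrow> program" where
  "mul c a b = [CST c 0, CST 17 0, While (LESS 17 b) [ADD c c a, ADD 17 17 2]]"

definition fill :: "nat \<Rightarrow> nat \<Rightarrow> nat \<Rightarrow> program" where
  "fill f l m = [CST 20 0, While (LESS 20 l) (Instr (Random (reg 21) (reg m)) # put f 20 21 @ [ADD 20 20 2])]"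

definition read_parameters :: program where
  "read_parameters = [CST 1 0, CST 2 1, CST 3 2, INP 4 1, INP 5 2, INP 6 3,
     Instr (RInput 0 (reg 1)), Instr (RInput 1 (reg 2)), Instr (RInput 2 (reg 3)),
     Instr (Cast 3 (reg 4)), Instr (Cast 4 (reg 5)), Instr (RMul 5 3 4)]"

text \<open>The results are \<open>J\<close> in register 8, the size of the table in 13,
  \<open>N\<close> in 14, the range of the draws behind the samples in 16 and \<open>G\<close> in
  18. Quantities with a factor \<open>N\<close> are doubled along with it, since multiplication by
  repeated addition would take time \<open>N\<close>.\<close>

definition choose_sizes :: program where
  "choose_sizes = CST 7 1 # CST 8 1 # While (LESS 7 5) [ADD 7 7 7, ADD 8 8 2] #
     mul 9 8 5 @ ADD 10 4 2 # mul 11 5 10 @ ADD 12 11 11 # mul 13 9 12 @ mul 16 4 6 @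
     [CST 14 1, CST 15 0, ADD 17 9 2, Instr (Cast 7 (reg 17)), Instr (RMul 7 7 3), Instr (RMul 7 7 3),
      Instr (RAdd 7 7 7), Instr (RAdd 7 7 7),
      While (RLess 2 7) [Instr (RAdd 2 2 2), ADD 14 14 14, ADD 15 15 2, ADD 16 16 16, ADD 13 13 13, ADD 6 6 6],
      CST 18 1, CST 17 256, Instr (Cast 9 (reg 17)), Instr (RMul 9 9 0), Instr (Cast 10 (reg 15)),
      Instr (RMul 9 9 10), Instr (Cast 8 (reg 2)), Instr (RSub 8 8 1),
      While (RLess 8 9) [Instr (RAdd 8 8 8), ADD 18 18 18]]"

lemma wp_mul:
  assumes "wp \<iota> cs Q (\<rho>(c := \<rho> a * \<rho> b, 17 := \<rho> b)) A X (Suc (Suc (Suc (\<tau> + 3 * \<rho> b))))"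
    and "\<rho> 2 = 1" "c \<noteq> 2" "c \<noteq> 17" "a \<noteq> 17" "b \<noteq> 17" "a \<noteq> c" "b \<noteq> c"
  shows "wp \<iota> (mul c a b @ cs) Q \<rho> A X \<tau>"
proof -
  let ?Inv = "\<lambda>n \<rho>' A' X' \<tau>'. \<rho>' = \<rho>(c := n * \<rho> a, 17 := n) \<and> A' = A \<and> X' = X \<and> \<tau>' = \<tau> + 2 + 3 * n"
  have "wp \<iota> (While (LESS 17 b) [ADD c c a, ADD 17 17 2] # cs) Q (\<rho>(c := 0, 17 := 0)) A X (\<tau> + 2)"
  proof (rule wp_loop[where len = "\<rho> b" and Inv = ?Inv])
    fix n \<rho>' A' X' \<tau>'
    assume n: "n < \<rho> b" and inv: "?Inv n \<rho>' A' X' \<tau>'"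
    then show "holds (LESS 17 b) (mk \<rho>' A', X') \<and> wp \<iota> [ADD c c a, ADD 17 17 2] (?Inv (Suc n)) \<rho>' A' X' (Suc \<tau>')"
      using assms by (auto intro!: wp_nil simp: fun_eq_iff)
  next
    fix \<rho>' A' X' \<tau>'
    assume "?Inv (\<rho> b) \<rho>' A' X' \<tau>'"
    then show "\<not> holds (LESS 17 b) (mk \<rho>' A', X') \<and> wp \<iota> cs Q \<rho>' A' X' (Suc \<tau>')"
      using assms by (simp add: mult.commute)
  qed auto
  then show ?thesis using assms by (simp add: mul_def)
qed

definition blocks :: "nat \<Rightarrow> nat" where
  "blocks d = Suc (LEAST j. d \<le> 2 ^ j)"

text \<open>The number of doublings up to the least power of two \<open>N\<close> for which the
  bound of \<open>E_bad_le\<close> is at most \<open>p / 2\<close>.\<close>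

definition levels :: "nat \<Rightarrow> nat \<Rightarrow> real \<Rightarrow> nat" where
  "levels s d p = (LEAST i. 4 * real s ^ 2 * (blocks d * d + 1) \<le> 2 ^ i * p)"

text \<open>The factor \<open>256 * levels\<close> is a bound, free of logarithms, for
  \<open>25 * J + 8 + 48 * ln (1 + N)\<close> from the estimate of the expected difference.\<close>

definition rate :: "nat \<Rightarrow> nat \<Rightarrow> real \<Rightarrow> real \<Rightarrow> real \<Rightarrow> nat" where
  "rate s d r p\<^sub>1 p\<^sub>2 = (LEAST g. 256 * r * levels s d p\<^sub>2 \<le> 2 ^ g * (1 - p\<^sub>1))"

lemma ex_power_ge:
  fixes a p :: real assumes "0 < p" shows "\<exists>i. a \<le> 2 ^ i * p"
proof -
  obtain i where "a / p < 2 ^ i" using real_arch_pow[of 2 "a / p"] by auto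
  then show ?thesis using assms by (intro exI[of _ i]) (simp add: field_simps)
qed

lemma blocks_props:
  "1 \<le> blocks d" "d \<le> 2 ^ (blocks d - 1)" "blocks d \<le> d + 1" "2 \<le> blocks d \<Longrightarrow> 2 ^ (blocks d - 2) < d"
proof -
  have ex: "d \<le> 2 ^ d" using less_exp[of d] by simp
  show "1 \<le> blocks d" by (simp add: blocks_def)
  show "d \<le> 2 ^ (blocks d - 1)" unfolding blocks_def using LeastI[of "\<lambda>j. d \<le> 2 ^ j", OF ex] by simp
  show "blocks d \<le> d + 1" unfolding blocks_def using Least_le[of "\<lambda>j. d \<le> 2 ^ j", OF ex] by simp
  assume "2 \<le> blocks d"
  then have "blocks d - 2 < (LEAST j. d \<le> 2 ^ j)" unfolding blocks_def by simp
  then show "2 ^ (blocks d - 2) < d" using not_less_Least not_less by blast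
qed

lemma wp_choose_sizes:
  assumes n: "1 \<le> n" and p: "0 < p\<^sub>2" "p\<^sub>1 < 1"
    and \<rho>: "\<rho> 2 = 1" "\<rho> 4 = s" "\<rho> 5 = d" "\<rho> 6 = n"
    and X: "X 0 = r" "X 1 = p\<^sub>1" "X 2 = p\<^sub>2" "X 3 = real s"
  defines "J \<equiv> blocks d" and "L \<equiv> levels s d p\<^sub>2" and "g \<equiv> rate s d r p\<^sub>1 p\<^sub>2"
  shows "wp \<iota> choose_sizes (\<lambda>\<rho>' A' X' \<tau>'. same_except {6, 7, 8, 9, 10, 11, 12, 13, 14, 15, 16, 17, 18} \<rho> \<rho>' \<and>
    \<rho>' 6 = n * 2 ^ L \<and> \<rho>' 8 = J \<and> \<rho>' 9 = J * d \<and> \<rho>' 10 = s + 1 \<and> \<rho>' 11 = d * (s + 1) \<and> \<rho>' 12 = 2 * (d * (s + 1)) \<and>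
    \<rho>' 13 = 2 ^ L * (J * d) * 2 * d * (s + 1) \<and> \<rho>' 14 = 2 ^ L \<and> \<rho>' 16 = s * n * 2 ^ L \<and> \<rho>' 18 = 2 ^ g \<and> A' = A \<and>
    \<tau>' \<le> \<tau> + 3 * J + 3 * d + 3 * (s + 1) + 6 * (d * (s + 1)) + 3 * n + 7 * L + 3 * g + 50) \<rho> A X \<tau>"
    (is "wp _ _ ?Q _ _ _ _")
proof -
  have loop1: "wp \<iota> (While (LESS 7 5) [ADD 7 7 7, ADD 8 8 2] # cs) Q \<rho>1 A X1 \<tau>1"
    if "wp \<iota> cs Q (\<rho>1(7 := 2 ^ (J - 1), 8 := J)) A X1 (Suc (\<tau>1 + 3 * (J - 1)))"
      and r: "\<rho>1 7 = 1" "\<rho>1 8 = 1" "\<rho>1 5 = d" "\<rho>1 2 = 1" for cs Q \<rho>1 X1 \<tau>1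
  proof (rule wp_loop[where len = "J - 1" and Inv = "\<lambda>i \<rho>' A' X' \<tau>'. \<rho>' = \<rho>1(7 := 2 ^ i, 8 := Suc i) \<and> A' = A \<and> X' = X1 \<and> \<tau>' = \<tau>1 + 3 * i"])
    fix i \<rho>' A' X' \<tau>'
    assume i: "i < J - 1" and inv: "\<rho>' = \<rho>1(7 := 2 ^ i, 8 := Suc i) \<and> A' = A \<and> X' = X1 \<and> \<tau>' = \<tau>1 + 3 * i"
    have "2 ^ i < d" using not_less_Least[of i "\<lambda>j. d \<le> 2 ^ j"] i by (simp add: J_def blocks_def)
    then show "holds (LESS 7 5) (mk \<rho>' A', X') \<and> wp \<iota> [ADD 7 7 7, ADD 8 8 2]
       (\<lambda>\<rho>' A' X' \<tau>'. \<rho>' = \<rho>1(7 := 2 ^ Suc i, 8 := Suc (Suc i)) \<and> A' = A \<and> X' = X1 \<and> \<tau>' = \<tau>1 + 3 * Suc i) \<rho>' A' X' (Suc \<tau>')"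
      using inv r by (auto intro!: wp_nil simp: fun_eq_iff)
  next
    fix \<rho>' A' X' \<tau>'
    assume inv: "\<rho>' = \<rho>1(7 := 2 ^ (J - 1), 8 := Suc (J - 1)) \<and> A' = A \<and> X' = X1 \<and> \<tau>' = \<tau>1 + 3 * (J - 1)"
    have "Suc (J - 1) = J" using blocks_props(1)[of d] by (simp add: J_def)
    then show "\<not> holds (LESS 7 5) (mk \<rho>' A', X') \<and> wp \<iota> cs Q \<rho>' A' X' (Suc \<tau>')"
      using inv r that(1) blocks_props(2)[of d] by (simp add: J_def)
  next
    show "\<rho>1 = \<rho>1(7 := 2 ^ 0, 8 := Suc 0) \<and> A = A \<and> X1 = X1 \<and> \<tau>1 = \<tau>1 + 3 * 0"
      using r by (auto simp: fun_eq_iff)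
  qed
  have loop2: "wp \<iota> (While (RLess 2 7) [Instr (RAdd 2 2 2), ADD 14 14 14, ADD 15 15 2, ADD 16 16 16, ADD 13 13 13, ADD 6 6 6] # cs) Q \<rho>1 A X1 \<tau>1"
    if "wp \<iota> cs Q (\<rho>1(14 := 2 ^ L, 15 := L, 16 := \<rho>1 16 * 2 ^ L, 13 := \<rho>1 13 * 2 ^ L, 6 := \<rho>1 6 * 2 ^ L)) A (X1(2 := 2 ^ L * p\<^sub>2)) (Suc (\<tau>1 + 7 * L))"
      and r: "\<rho>1 14 = 1" "\<rho>1 15 = 0" "\<rho>1 2 = 1" "X1 2 = p\<^sub>2" "X1 7 = 4 * real s ^ 2 * (J * d + 1)" for cs Q \<rho>1 X1 \<tau>1
  proof (rule wp_loop[where len = L and Inv = "\<lambda>i \<rho>' A' X' \<tau>'. \<rho>' = \<rho>1(14 := 2 ^ i, 15 := i, 16 := \<rho>1 16 * 2 ^ i, 13 := \<rho>1 13 * 2 ^ i, 6 := \<rho>1 6 * 2 ^ i) \<and>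
      A' = A \<and> X' = X1(2 := 2 ^ i * p\<^sub>2) \<and> \<tau>' = \<tau>1 + 7 * i"])
    fix i \<rho>' A' X' \<tau>'
    assume i: "i < L" and inv: "\<rho>' = \<rho>1(14 := 2 ^ i, 15 := i, 16 := \<rho>1 16 * 2 ^ i, 13 := \<rho>1 13 * 2 ^ i, 6 := \<rho>1 6 * 2 ^ i) \<and>
      A' = A \<and> X' = X1(2 := 2 ^ i * p\<^sub>2) \<and> \<tau>' = \<tau>1 + 7 * i"
    have "2 ^ i * p\<^sub>2 < 4 * real s ^ 2 * (J * d + 1)"
      using not_less_Least[of i "\<lambda>i. 4 * real s ^ 2 * (blocks d * d + 1) \<le> 2 ^ i * p\<^sub>2"] i unfolding L_def levels_def J_def by simp
    then show "holds (RLess 2 7) (mk \<rho>' A', X') \<and> wp \<iota> [Instr (RAdd 2 2 2), ADD 14 14 14, ADD 15 15 2, ADD 16 16 16, ADD 13 13 13, ADD 6 6 6]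
       (\<lambda>\<rho>' A' X' \<tau>'. \<rho>' = \<rho>1(14 := 2 ^ Suc i, 15 := Suc i, 16 := \<rho>1 16 * 2 ^ Suc i, 13 := \<rho>1 13 * 2 ^ Suc i, 6 := \<rho>1 6 * 2 ^ Suc i) \<and>
      A' = A \<and> X' = X1(2 := 2 ^ Suc i * p\<^sub>2) \<and> \<tau>' = \<tau>1 + 7 * Suc i) \<rho>' A' X' (Suc \<tau>')"
      using inv r by (auto intro!: wp_nil simp: fun_eq_iff)
  next
    fix \<rho>' A' X' \<tau>'
    assume inv: "\<rho>' = \<rho>1(14 := 2 ^ L, 15 := L, 16 := \<rho>1 16 * 2 ^ L, 13 := \<rho>1 13 * 2 ^ L, 6 := \<rho>1 6 * 2 ^ L) \<and>
      A' = A \<and> X' = X1(2 := 2 ^ L * p\<^sub>2) \<and> \<tau>' = \<tau>1 + 7 * L"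
    have "4 * real s ^ 2 * (J * d + 1) \<le> 2 ^ L * p\<^sub>2"
      unfolding L_def levels_def J_def by (rule LeastI_ex[OF ex_power_ge[OF p(1)]])
    then show "\<not> holds (RLess 2 7) (mk \<rho>' A', X') \<and> wp \<iota> cs Q \<rho>' A' X' (Suc \<tau>')"
      using inv r that(1) by simp
  next
    show "\<rho>1 = \<rho>1(14 := 2 ^ 0, 15 := 0, 16 := \<rho>1 16 * 2 ^ 0, 13 := \<rho>1 13 * 2 ^ 0, 6 := \<rho>1 6 * 2 ^ 0) \<and>
      A = A \<and> X1 = X1(2 := 2 ^ 0 * p\<^sub>2) \<and> \<tau>1 = \<tau>1 + 7 * 0"
      using r by (auto simp: fun_eq_iff)
  qed
  have loop3: "wp \<iota> (While (RLess 8 9) [Instr (RAdd 8 8 8), ADD 18 18 18] # cs) Q \<rho>1 A X1 \<tau>1"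
    if "wp \<iota> cs Q (\<rho>1(18 := 2 ^ g)) A (X1(8 := 2 ^ g * (1 - p\<^sub>1))) (Suc (\<tau>1 + 3 * g))"
      and r: "\<rho>1 18 = 1" "X1 8 = 1 - p\<^sub>1" "X1 9 = 256 * r * L" for cs Q \<rho>1 X1 \<tau>1
  proof (rule wp_loop[where len = g and Inv = "\<lambda>i \<rho>' A' X' \<tau>'. \<rho>' = \<rho>1(18 := 2 ^ i) \<and> A' = A \<and> X' = X1(8 := 2 ^ i * (1 - p\<^sub>1)) \<and> \<tau>' = \<tau>1 + 3 * i"])
    fix i \<rho>' A' X' \<tau>'
    assume i: "i < g" and inv: "\<rho>' = \<rho>1(18 := 2 ^ i) \<and> A' = A \<and> X' = X1(8 := 2 ^ i * (1 - p\<^sub>1)) \<and> \<tau>' = \<tau>1 + 3 * i"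
    have "2 ^ i * (1 - p\<^sub>1) < 256 * r * L"
      using not_less_Least[of i "\<lambda>g. 256 * r * levels s d p\<^sub>2 \<le> 2 ^ g * (1 - p\<^sub>1)"] i
      unfolding g_def rate_def L_def by simp
    then show "holds (RLess 8 9) (mk \<rho>' A', X') \<and> wp \<iota> [Instr (RAdd 8 8 8), ADD 18 18 18]
       (\<lambda>\<rho>' A' X' \<tau>'. \<rho>' = \<rho>1(18 := 2 ^ Suc i) \<and> A' = A \<and> X' = X1(8 := 2 ^ Suc i * (1 - p\<^sub>1)) \<and> \<tau>' = \<tau>1 + 3 * Suc i) \<rho>' A' X' (Suc \<tau>')"
      using inv r by (auto intro!: wp_nil simp: fun_eq_iff)
  next
    fix \<rho>' A' X' \<tau>'
    assume inv: "\<rho>' = \<rho>1(18 := 2 ^ g) \<and> A' = A \<and> X' = X1(8 := 2 ^ g * (1 - p\<^sub>1)) \<and> \<tau>' = \<tau>1 + 3 * g"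
    have "256 * r * L \<le> 2 ^ g * (1 - p\<^sub>1)"
      unfolding g_def rate_def L_def by (rule LeastI_ex[OF ex_power_ge]) (use p in simp)
    then show "\<not> holds (RLess 8 9) (mk \<rho>' A', X') \<and> wp \<iota> cs Q \<rho>' A' X' (Suc \<tau>')"
      using inv r that(1) by simp
  next
    show "\<rho>1 = \<rho>1(18 := 2 ^ 0) \<and> A = A \<and> X1 = X1(8 := 2 ^ 0 * (1 - p\<^sub>1)) \<and> \<tau>1 = \<tau>1 + 3 * 0"
      using r by (auto simp: fun_eq_iff)
  qed
  show ?thesis unfolding choose_sizes_def
    using \<rho> X p
    apply simp
    apply (rule loop1)
       apply (rule wp_mul)
              apply simp
              apply (rule wp_mul)
                     apply simp
                     apply (rule wp_mul)
                            apply (rule wp_mul)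
                                   apply simp
                                   apply (rule loop2)
                                        apply simp
                                        apply (rule loop3)
                                           apply (rule wp_nil)
                                           apply (simp add: algebra_simps)
                                          apply (simp_all add: algebra_simps power2_eq_square)
    done
qed

section \<open>Filling arrays with independent draws\<close>

text \<open>After \<open>j\<close> iterations the configuration is a function of the draws made so
  far, hence its distribution is the image of a product distribution. \<open>R\<close> spells out
  the scratch registers, which remember the last draw.\<close>

lemma run_fill_loop:
  assumes f: "0 < f" "f < 8" and l: "l \<notin> {20, 21, 60, 61}" "m \<notin> {20, 21, 60, 61}" and \<rho>: "\<rho> 2 = 1"
  defines "body \<equiv> Instr (Random (reg 21) (reg m)) # put f 20 21 @ [ADD 20 20 2]"
  defines "R \<equiv> \<lambda>j h. if j = 0 then \<rho>(20 := 0) else \<rho>(20 := j, 21 := h (j - 1), 60 := adr f (j - 1), 61 := f)"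
  shows "j \<le> \<rho> l \<Longrightarrow> run \<iota> (j * 9) (While (LESS 20 l) body # rest, (mk (\<rho>(20 := 0)) A, X)) =
    map_pmf (\<lambda>h. (While (LESS 20 l) body # rest, (mk (R j h) (A(f := \<lambda>i. if i < j then h i else A f i)), X)))
      (Pi_pmf {..<j} 0 (\<lambda>_. uniform_below (\<rho> m)))"
proof (induction j)
  case 0
  then show ?case by (simp add: R_def)
next
  case (Suc j)
  let ?p = "uniform_below (\<rho> m)" and ?w = "While (LESS 20 l) body"
  let ?A = "\<lambda>j h. A(f := \<lambda>i. if i < j then h i else A f i)"
  have step: "run \<iota> 9 (?w # rest, (mk (R j h) (?A j h), X)) =
     map_pmf (\<lambda>v. (?w # rest, (mk (R (Suc j) (h(j := v))) (?A (Suc j) (h(j := v))), X))) ?p" for h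
  proof -
    obtain I K where \<iota>: "\<iota> = (I, K)" by fastforce
    have r: "R j h 20 = j" "R j h l = \<rho> l" "R j h m = \<rho> m" "R j h 2 = 1"
      using l \<rho> by (auto simp: R_def)
    have det: "run \<iota> 7 (put f 20 21 @ ADD 20 20 2 # ?w # rest, (mk ((R j h)(21 := v)) (?A j h), X)) =
        return_pmf (?w # rest, (mk (R (Suc j) (h(j := v))) (?A (Suc j) (h(j := v))), X))" for v
    proof -
      have e1: "adr f j = j + j + (j + j) + (j + j + (j + j)) + f" by (simp add: adr_def)
      have e2: "((R j h)(21 := v, 60 := adr f j, 61 := f, 20 := Suc j)) = R (Suc j) (h(j := v))"
        by (auto simp: R_def fun_eq_iff)
      have e3: "(?A j h)(f := ((?A j h) f)(j := v)) = ?A (Suc j) (h(j := v))"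
        by (auto simp: fun_eq_iff)
      show ?thesis unfolding \<iota>
        using r f by (simp add: put_def addr_of_def eval_nat_numeral bind_return_pmf e1[symmetric] fun_upd_twist
            flip: e2 e3)
    qed
    have "run \<iota> 9 (?w # rest, (mk (R j h) (?A j h), X)) =
      bind_pmf ?p (\<lambda>v. run \<iota> 7 (put f 20 21 @ ADD 20 20 2 # ?w # rest, (mk ((R j h)(21 := v)) (?A j h), X)))"
    proof -
      have "9 = Suc (Suc 7)" by simp
      then show ?thesis unfolding \<open>9 = Suc (Suc 7)\<close> \<iota> using Suc.prems r
        by (simp add: bind_return_pmf body_def map_pmf_def bind_assoc_pmf del: Suc_numeral)
    qed
    then show ?thesis by (simp add: det map_pmf_def)
  qed
  have "run \<iota> (Suc j * 9) (?w # rest, (mk (\<rho>(20 := 0)) A, X)) =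
     bind_pmf (run \<iota> (j * 9) (?w # rest, (mk (\<rho>(20 := 0)) A, X))) (run \<iota> 9)"
    using run_add[of \<iota> "j * 9" 9] by (simp add: add.commute)
  also have "\<dots> = bind_pmf (Pi_pmf {..<j} 0 (\<lambda>_. ?p)) (\<lambda>h. bind_pmf ?p (\<lambda>v. return_pmf
     (?w # rest, (mk (R (Suc j) (h(j := v))) (?A (Suc j) (h(j := v))), X))))"
    unfolding Suc.IH[OF Suc_leD[OF Suc.prems]] bind_map_pmf step
    by (simp only: map_pmf_def)
  also have "\<dots> = map_pmf (\<lambda>h. (?w # rest, (mk (R (Suc j) h) (?A (Suc j) h), X)))
      (Pi_pmf (insert j {..<j}) 0 (\<lambda>_. ?p))"
    by (subst Pi_pmf_insert') (simp_all add: map_bind_pmf, rule bind_commute_pmf)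
  finally show ?case unfolding lessThan_Suc .
qed

lemma run_fill:
  assumes f: "0 < f" "f < 8" and l: "l \<notin> {20, 21, 60, 61}" "m \<notin> {20, 21, 60, 61}" and \<rho>: "\<rho> 2 = 1"
  obtains R where "\<And>h. same_except {20, 21, 60, 61} \<rho> (R h)"
    "\<And>rest. run \<iota> (\<rho> l * 9 + 2) (fill f l m @ rest, (mk \<rho> A, X)) =
      map_pmf (\<lambda>h. (rest, (mk (R h) (A(f := \<lambda>i. if i < \<rho> l then h i else A f i)), X)))
        (Pi_pmf {..<\<rho> l} 0 (\<lambda>_. uniform_below (\<rho> m)))"
proof -
  let ?body = "Instr (Random (reg 21) (reg m)) # put f 20 21 @ [ADD 20 20 2]"
  let ?p = "Pi_pmf {..<\<rho> l} 0 (\<lambda>_. uniform_below (\<rho> m))"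
  define R where "R j h = (if j = 0 then \<rho>(20 := 0) else \<rho>(20 := j, 21 := h (j - 1), 60 := adr f (j - 1), 61 := f))" for j and h :: "nat \<Rightarrow> nat"
  obtain I K where \<iota>: "\<iota> = (I, K)" by fastforce
  show ?thesis
  proof
    fix h show "same_except {20, 21, 60, 61} \<rho> (R (\<rho> l) h)" by (simp add: R_def)
  next
    fix rest
    let ?w = "While (LESS 20 l) ?body"
    have exit: "run \<iota> 1 (?w # rest, (mk (R (\<rho> l) h) A', X)) = return_pmf (rest, (mk (R (\<rho> l) h) A', X))" for h A'
      using l by (simp add: \<iota> R_def bind_return_pmf)
    have "run \<iota> (\<rho> l * 9 + 2) (fill f l m @ rest, (mk \<rho> A, X)) =
       run \<iota> (\<rho> l * 9 + 1) (?w # rest, (mk (\<rho>(20 := 0)) A, X))"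
      by (simp add: fill_def \<iota> bind_return_pmf)
    also have "\<dots> = bind_pmf (run \<iota> (\<rho> l * 9) (?w # rest, (mk (\<rho>(20 := 0)) A, X))) (run \<iota> 1)"
      by (rule run_add)
    also have "\<dots> = map_pmf (\<lambda>h. (rest, (mk (R (\<rho> l) h) (A(f := \<lambda>i. if i < \<rho> l then h i else A f i)), X))) ?p"
      unfolding run_fill_loop[where f = f and l = l and m = m and \<rho> = \<rho> and j = "\<rho> l", OF f l \<rho> order_refl]
        bind_map_pmf R_def[symmetric] exit
      by (simp only: map_pmf_def)
    finally show "run \<iota> (\<rho> l * 9 + 2) (fill f l m @ rest, (mk \<rho> A, X)) =
      map_pmf (\<lambda>h. (rest, (mk (R (\<rho> l) h) (A(f := \<lambda>i. if i < \<rho> l then h i else A f i)), X))) ?p" .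
  qed
qed

section \<open>Building the table and the tree from the draws\<close>

definition convert :: program where
  "convert = [CST 20 0, CST 21 1, While (LESS 20 13)
     (get 22 1 20 @ If (LESS 22 2) (put 1 20 21) (put 1 20 1) # [ADD 21 21 21, ADD 20 20 2])]"

text \<open>Register 24 is the position of a vector on the tape, 25 its index within its point, 26
  the position of the weight; the offset 3 skips the parameters. The draw is increased by 1 so that
  the loop runs at least once, and the final subtraction returns to the vector whose weight reached
  the draw.\<close>

definition find_sample :: program where
  "find_sample = get 23 3 20 @ [ADD 23 23 2, Instr (Cast 13 (reg 23)), CST 24 3, CST 25 0, CST 26 3,
     Instr (Cast 14 (reg 1)), While (RLess 14 13)
       [Instr (RInput 15 (reg 26)), Instr (RMul 15 15 12), Instr (RAdd 14 14 15), ADD 24 24 5, ADD 25 25 2,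
        If (LESS 25 4) [] [CST 25 0, ADD 26 26 2]],
     SUB 24 24 5]"

definition copy_sample :: program where
  "copy_sample = [CST 27 0, While (LESS 27 5)
     (ADD 28 24 27 # INP 28 28 # ADD 29 21 27 # put 4 29 28 @ [ADD 27 27 2])]"

text \<open>An entry is written only if there is none yet, so the first sample to reach a node stays
  its representative. Register 22 advances by one unit per position: parts of the table are numbered
  by the sample that created the node and by its depth.\<close>

definition insert_block :: program where
  "insert_block = [CST 27 0, While (LESS 27 5)
     (get 28 6 30 @ If (LESS 1 28) [] (put 6 30 21 @ put 7 30 22) # ADD 22 22 12 #
      get 28 2 32 @ ADD 29 21 27 # get 29 4 29 @
      [ADD 30 30 30, If (LESS 28 31) [If (LESS 1 29) [ADD 30 30 2] []] [], ADD 32 32 2, ADD 27 27 2])]"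

text \<open>The node after the last position receives a representative but no part of the table,
  since it has no children.\<close>

definition insert_sample :: program where
  "insert_sample = [CST 30 1, CST 31 1, CST 32 0, CST 33 0,
     While (LESS 33 8) (insert_block @ [ADD 31 31 31, ADD 33 33 2])] @
     get 28 6 30 @ [If (LESS 1 28) [] (put 6 30 21)]"

definition build :: program where
  "build = convert @ [CST 20 0, ADD 21 5 1, CST 22 0, Instr (Cast 12 (reg 6)),
     While (LESS 20 14) (find_sample @ copy_sample @ insert_sample @ [ADD 21 21 5, ADD 20 20 2]),
     ADD 40 4 1, ADD 41 5 1]"

lemma wp_convert:
  assumes "\<rho> 1 = 0" "\<rho> 2 = 1"
  shows "wp \<iota> convert (\<lambda>\<rho>' A' X' \<tau>'. same_except {20, 21, 22, 60, 61} \<rho> \<rho>' \<and>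
    A' = A(1 := \<lambda>i. if i < \<rho> 13 then (if A 1 i = 0 then 2 ^ i else 0) else A 1 i) \<and> X' = X \<and> \<tau>' \<le> \<tau> + 20 * \<rho> 13 + 5) \<rho> A X \<tau>"
proof -
  let ?f = "\<lambda>n i. if i < n then (if A 1 i = 0 then 2 ^ i else 0) else A 1 i"
  let ?Inv = "\<lambda>n \<rho>' A' X' \<tau>'. same_except {20, 21, 22, 60, 61} \<rho> \<rho>' \<and> \<rho>' 20 = n \<and> \<rho>' 21 = 2 ^ n \<and>
    A' = A(1 := ?f n) \<and> X' = X \<and> \<tau>' \<le> \<tau> + 20 * n + 2"
  let ?Q = "\<lambda>\<rho>' A' X' \<tau>'. same_except {20, 21, 22, 60, 61} \<rho> \<rho>' \<and>
    A' = A(1 := ?f (\<rho> 13)) \<and> X' = X \<and> \<tau>' \<le> \<tau> + 20 * \<rho> 13 + 5"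
  have "wp \<iota> [While (LESS 20 13)
     (get 22 1 20 @ If (LESS 22 2) (put 1 20 21) (put 1 20 1) # [ADD 21 21 21, ADD 20 20 2])] ?Q
     (\<rho>(20 := 0, 21 := 1)) A X (Suc (Suc \<tau>))"
  proof (rule wp_loop[where len = "\<rho> 13" and Inv = ?Inv])
    fix n \<rho>' A' X' \<tau>'
    assume n: "n < \<rho> 13" and inv: "?Inv n \<rho>' A' X' \<tau>'"
    have r: "\<rho>' 13 = \<rho> 13" "\<rho>' 1 = 0" "\<rho>' 2 = 1" using inv assms by (auto simp: same_except_def)
    have A1: "A' 1 n = A 1 n" using inv by simp
    have upd: "A'(1 := (A' 1)(n := if A 1 n = 0 then 2 ^ n else 0)) = A(1 := ?f (Suc n))"
      using inv by (auto simp: fun_eq_iff)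
    show "holds (LESS 20 13) (mk \<rho>' A', X') \<and> wp \<iota> (get 22 1 20 @ If (LESS 22 2) (put 1 20 21) (put 1 20 1) # [ADD 21 21 21, ADD 20 20 2])
      (?Inv (Suc n)) \<rho>' A' X' (Suc \<tau>')"
    proof (cases "A 1 n = 0")
      case True
      have "wp \<iota> (get 22 1 20 @ If (LESS 22 2) (put 1 20 21) (put 1 20 1) # [ADD 21 21 21, ADD 20 20 2])
        (?Inv (Suc n)) \<rho>' A' X' (Suc \<tau>')"
        using inv n r A1 upd True by (simp add: wp_nil)
      then show ?thesis using inv n r by simp
    next
      case False
      have "wp \<iota> (get 22 1 20 @ If (LESS 22 2) (put 1 20 21) (put 1 20 1) # [ADD 21 21 21, ADD 20 20 2])
        (?Inv (Suc n)) \<rho>' A' X' (Suc \<tau>')"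
        using inv n r A1 upd False by (simp add: wp_nil)
      then show ?thesis using inv n r by simp
    qed
  next
    fix \<rho>' A' X' \<tau>'
    assume inv: "?Inv (\<rho> 13) \<rho>' A' X' \<tau>'"
    have "\<rho>' 13 = \<rho> 13" using inv by (auto simp: same_except_def)
    then show "\<not> holds (LESS 20 13) (mk \<rho>' A', X') \<and> wp \<iota> [] ?Q \<rho>' A' X' (Suc \<tau>')"
      using inv by (simp add: wp_nil)
  next
    show "?Inv 0 (\<rho>(20 := 0, 21 := 1)) A X (Suc (Suc \<tau>))" by simp
  qed
  then show ?thesis unfolding convert_def by simp
qed

text \<open>A sample is found by scanning the vectors of the description until the accumulated weight reaches a uniform
  integer; thereby the probabilities are rounded to multiples of \<open>1 / (n N)\<close>.\<close>

definition cum :: "(nat \<Rightarrow> real) \<Rightarrow> nat \<Rightarrow> real \<Rightarrow> nat \<Rightarrow> real" where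
  "cum w s q t = (\<Sum>e<t. w (e div s) * q)"

definition pick :: "(nat \<Rightarrow> real) \<Rightarrow> nat \<Rightarrow> real \<Rightarrow> nat \<Rightarrow> nat" where
  "pick w s q U = (LEAST t. real (U + 1) \<le> cum w s q t)"

lemma wp_find_sample:
  assumes \<rho>: "\<rho> 1 = 0" "\<rho> 2 = 1" "\<rho> 4 = s" "\<rho> 5 = d" and s: "0 < s"
    and w: "\<And>z. tape (snd \<iota>) (3 + z) = w z" and X: "X 12 = q"
    and t: "real (A 3 (\<rho> 20) + 1) \<le> cum w s q t"
  defines "p \<equiv> pick w s q (A 3 (\<rho> 20))"
  shows "wp \<iota> find_sample (\<lambda>\<rho>' A' X' \<tau>'. same_except {23, 24, 25, 26, 60, 61} \<rho> \<rho>' \<and> A' = A \<and> X' 12 = q \<and>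
    \<rho>' 24 = 3 + (p - 1) * d \<and> \<tau>' \<le> \<tau> + 9 * p + 20) \<rho> A X \<tau>"
proof -
  let ?U = "A 3 (\<rho> 20)"
  have p: "real (?U + 1) \<le> cum w s q p"
    unfolding p_def pick_def by (rule LeastI[where P = "\<lambda>t. real (?U + 1) \<le> cum w s q t", OF t])
  have p0: "0 < p" using p by (cases p) (auto simp: cum_def)
  let ?body = "[Instr (RInput 15 (reg 26)), Instr (RMul 15 15 12), Instr (RAdd 14 14 15), ADD 24 24 5, ADD 25 25 2,
        If (LESS 25 4) [] [CST 25 0, ADD 26 26 2]]"
  let ?Q = "\<lambda>\<rho>' A' X' \<tau>'. same_except {23, 24, 25, 26, 60, 61} \<rho> \<rho>' \<and> A' = A \<and> X' 12 = q \<and>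
    \<rho>' 24 = 3 + (p - 1) * d \<and> \<tau>' \<le> \<tau> + 9 * p + 20"
  let ?Inv = "\<lambda>n \<rho>' A' X' \<tau>'. same_except {23, 24, 25, 26, 60, 61} \<rho> \<rho>' \<and> A' = A \<and> X' 12 = q \<and> X' 13 = real (?U + 1) \<and>
    X' 14 = cum w s q n \<and> \<rho>' 24 = 3 + n * d \<and> \<rho>' 25 = n mod s \<and> \<rho>' 26 = 3 + n div s \<and> \<tau>' \<le> \<tau> + 12 + 9 * n"
  have "wp \<iota> [While (RLess 14 13) ?body, SUB 24 24 5] ?Q
    (\<rho>(60 := adr 3 (\<rho> 20), 61 := 3, 23 := ?U + 1, 24 := 3, 25 := 0, 26 := 3)) A (X(13 := real (?U + 1), 14 := 0)) (\<tau> + 12)"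
  proof (rule wp_loop[where len = p and Inv = ?Inv])
    fix n \<rho>' A' and X' :: reals and \<tau>'
    assume n: "n < p" and inv: "?Inv n \<rho>' A' X' \<tau>'"
    have r: "\<rho>' 1 = 0" "\<rho>' 2 = 1" "\<rho>' 4 = s" "\<rho>' 5 = d" using inv \<rho> by (auto simp: same_except_def)
    have "cum w s q n < real (?U + 1)"
      using not_less_Least[of n "\<lambda>t. real (?U + 1) \<le> cum w s q t"] n unfolding p_def pick_def by simp
    moreover have "Suc (n mod s) < s \<Longrightarrow> Suc n mod s = Suc (n mod s) \<and> Suc n div s = n div s"
      by (simp add: mod_Suc div_Suc)
    moreover have "\<not> Suc (n mod s) < s \<Longrightarrow> Suc n mod s = 0 \<and> Suc n div s = Suc (n div s)"
      using mod_less_divisor[OF s, of n] by (simp add: mod_Suc div_Suc)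
    moreover have "cum w s q (Suc n) = cum w s q n + w (n div s) * q" by (simp add: cum_def)
    ultimately show "holds (RLess 14 13) (mk \<rho>' A', X') \<and> wp \<iota> ?body (?Inv (Suc n)) \<rho>' A' X' (Suc \<tau>')"
      using inv r w by (cases "Suc (n mod s) < s") (simp_all add: wp_nil)
  next
    fix \<rho>' A' and X' :: reals and \<tau>'
    assume inv: "?Inv p \<rho>' A' X' \<tau>'"
    have "\<rho>' 5 = d" using inv \<rho> by (auto simp: same_except_def)
    moreover have "3 + p * d - d = 3 + (p - 1) * d" using p0 by (cases p) simp_all
    ultimately show "\<not> holds (RLess 14 13) (mk \<rho>' A', X') \<and> wp \<iota> [SUB 24 24 5] ?Q \<rho>' A' X' (Suc \<tau>')"
      using inv p by (simp add: wp_nil)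
  next
    show "?Inv 0 (\<rho>(60 := adr 3 (\<rho> 20), 61 := 3, 23 := ?U + 1, 24 := 3, 25 := 0, 26 := 3)) A (X(13 := real (?U + 1), 14 := 0)) (\<tau> + 12)"
      using X by (simp add: cum_def)
  qed
  then show ?thesis unfolding find_sample_def using \<rho> by (simp add: eval_nat_numeral)
qed

lemma wp_copy_sample:
  assumes \<rho>: "\<rho> 2 = 1" "\<rho> 5 = d" and a: "\<And>k. k < d \<Longrightarrow> tape (fst \<iota>) (\<rho> 24 + k) = of_bool (a ! k)"
  shows "wp \<iota> copy_sample (\<lambda>\<rho>' A' X' \<tau>'. same_except {27, 28, 29, 60, 61} \<rho> \<rho>' \<and>
    A' = A(4 := \<lambda>j. if \<rho> 21 \<le> j \<and> j < \<rho> 21 + d then of_bool (a ! (j - \<rho> 21)) else A 4 j) \<and> X' = X \<and> \<tau>' \<le> \<tau> + 15 * d + 5) \<rho> A X \<tau>"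
proof -
  let ?f = "\<lambda>n j. if \<rho> 21 \<le> j \<and> j < \<rho> 21 + n then of_bool (a ! (j - \<rho> 21)) else A 4 j"
  let ?Inv = "\<lambda>n \<rho>' A' X' \<tau>'. same_except {27, 28, 29, 60, 61} \<rho> \<rho>' \<and> \<rho>' 27 = n \<and>
    A' = A(4 := ?f n) \<and> X' = X \<and> \<tau>' \<le> \<tau> + 15 * n + 2"
  let ?Q = "\<lambda>\<rho>' A' X' \<tau>'. same_except {27, 28, 29, 60, 61} \<rho> \<rho>' \<and>
    A' = A(4 := ?f d) \<and> X' = X \<and> \<tau>' \<le> \<tau> + 15 * d + 5"
  let ?body = "(ADD 28 24 27 # INP 28 28 # ADD 29 21 27 # put 4 29 28 @ [ADD 27 27 2])"
  have "wp \<iota> [While (LESS 27 5) ?body] ?Q (\<rho>(27 := 0)) A X (Suc \<tau>)"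
  proof (rule wp_loop[where len = d and Inv = ?Inv])
    fix n \<rho>' A' X' \<tau>'
    assume n: "n < d" and inv: "?Inv n \<rho>' A' X' \<tau>'"
    have r: "\<rho>' 5 = d" "\<rho>' 2 = 1" "\<rho>' 24 = \<rho> 24" "\<rho>' 21 = \<rho> 21" using inv \<rho> by (auto simp: same_except_def)
    have upd: "A'(4 := (A' 4)(\<rho> 21 + n := of_bool (a ! n))) = A(4 := ?f (Suc n))"
      using inv by (auto simp: fun_eq_iff)
    have "wp \<iota> ?body (?Inv (Suc n)) \<rho>' A' X' (Suc \<tau>')"
      using inv n r a[OF n] upd by (simp add: wp_nil)
    then show "holds (LESS 27 5) (mk \<rho>' A', X') \<and> wp \<iota> ?body (?Inv (Suc n)) \<rho>' A' X' (Suc \<tau>')"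
      using inv n r by simp
  next
    fix \<rho>' A' X' \<tau>'
    assume inv: "?Inv d \<rho>' A' X' \<tau>'"
    have "\<rho>' 5 = d" using inv \<rho> by (auto simp: same_except_def)
    then show "\<not> holds (LESS 27 5) (mk \<rho>' A', X') \<and> wp \<iota> [] ?Q \<rho>' A' X' (Suc \<tau>')"
      using inv by (simp add: wp_nil)
  next
    show "?Inv 0 (\<rho>(27 := 0)) A X (Suc \<tau>)" by (auto simp: fun_eq_iff)
  qed
  then show ?thesis unfolding copy_sample_def by simp
qed

lemma code_ge: "1 \<le> code w"
  by (induction w rule: rev_induct) simp_all

lemma code_inj: "code w = code w' \<longleftrightarrow> w = w'"
proof (induction w arbitrary: w' rule: rev_induct)
  case Nil
  then show ?case
  proof (cases w' rule: rev_cases)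
    case (snoc v c)
    then show ?thesis using code_ge[of v] by auto
  qed simp
next
  case (snoc x w)
  show ?case
  proof (cases w' rule: rev_cases)
    case Nil
    then show ?thesis using code_ge[of w] by auto
  next
    case s: (snoc v c)
    have "2 * code w + of_bool x = 2 * code v + of_bool c \<longleftrightarrow> code w = code v \<and> x = c"
      by (auto simp: of_bool_def split: if_splits) presburger+
    then show ?thesis using s snoc.IH[of v] by simp
  qed
qed

section \<open>Inserting the samples one by one\<close>

context trie begin

abbreviation occ_upto :: "nat \<Rightarrow> bool list \<Rightarrow> bool" where
  "occ_upto n \<equiv> trie.occ d n u b"

abbreviation ix_upto :: "nat \<Rightarrow> bool list \<Rightarrow> nat" where
  "ix_upto n \<equiv> trie.ix d n u b"

lemma occ_upto_Suc: "occ_upto (Suc n) w \<longleftrightarrow> occ_upto n w \<or> pre (length w) (b n) = w"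
  by (auto simp: trie.occ_def less_Suc_eq)

lemma ix_upto_Suc: "ix_upto (Suc n) w = (if occ_upto n w then ix_upto n w else if pre (length w) (b n) = w then n else ix_upto (Suc n) w)"
proof (cases "occ_upto n w")
  case True
  have "ix_upto (Suc n) w = ix_upto n w"
    unfolding trie.ix_def[of d "Suc n"]
  proof (rule Least_equality)
    show "ix_upto n w < Suc n \<and> pre (length w) (b (ix_upto n w)) = w"
      using trie.ix_props[OF True] by simp
    fix i assume "i < Suc n \<and> pre (length w) (b i) = w"
    then show "ix_upto n w \<le> i"
      using trie.ix_props(1)[OF True] unfolding trie.ix_def[of d n] by (cases "i = n") (auto intro: Least_le)
  qed
  then show ?thesis using True by simp
next
  case False
  then show ?thesis
    by (auto simp: trie.ix_def[of d "Suc n"] trie.occ_def intro!: Least_equality) (metis less_antisym not_le)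
qed

definition slot :: "nat \<Rightarrow> bool list \<Rightarrow> nat" where
  "slot n w = (if occ_upto n w then Suc (ix_upto n w) * d else 0)"

definition cslot :: "nat \<Rightarrow> nat \<Rightarrow> nat \<Rightarrow> bool list \<Rightarrow> nat" where
  "cslot s J n w = (if occ_upto n w then (ix_upto n w * (J * d) + length w) * (2 * (d * (s + 1))) else 0)"

lemma slot_Suc:
  "slot (Suc n) w = (if occ_upto n w then slot n w else if pre (length w) (b n) = w then Suc n * d else 0)"
  "cslot s J (Suc n) w = (if occ_upto n w then cslot s J n w else
     if pre (length w) (b n) = w then (n * (J * d) + length w) * (2 * (d * (s + 1))) else 0)"
  using ix_upto_Suc[of n w] by (auto simp: slot_def cslot_def occ_upto_Suc)

lemma slot_0: "\<not> occ_upto n w \<Longrightarrow> slot n w = 0" "\<not> occ_upto n w \<Longrightarrow> cslot s J n w = 0"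
  by (simp_all add: slot_def cslot_def)

text \<open>The tree while sample \<open>n\<close> is being inserted: nodes shorter than
  \<open>m\<close> already take it into account, the others only the samples before it.\<close>

definition tstate :: "nat \<Rightarrow> nat \<Rightarrow> nat \<Rightarrow> nat \<Rightarrow> arrays \<Rightarrow> bool" where
  "tstate s J n m A \<longleftrightarrow>
     (\<forall>w. length w \<le> J * d \<longrightarrow> A 6 (code w) = slot (if length w < m then Suc n else n) w) \<and>
     (\<forall>w. length w < J * d \<longrightarrow> A 7 (code w) = cslot s J (if length w < m then Suc n else n) w)"

lemma tstate_cong: "tstate s J n m A \<Longrightarrow> A' 6 = A 6 \<Longrightarrow> A' 7 = A 7 \<Longrightarrow> tstate s J n m A'"
  by (simp add: tstate_def)

lemma tstate_occ:
  assumes "tstate s J n m A" "occ_upto n (pre m (b n))"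
  shows "tstate s J n (Suc m) A"
proof -
  have "slot (Suc n) w = slot n w" "cslot s J (Suc n) w = cslot s J n w" if "length w = m" for w
  proof -
    have "occ_upto n w \<or> pre (length w) (b n) \<noteq> w" using assms(2) that by auto
    then show "slot (Suc n) w = slot n w" "cslot s J (Suc n) w = cslot s J n w"
      using slot_0[of n w] by (auto simp: slot_Suc)
  qed
  then show ?thesis using assms(1) unfolding tstate_def by (auto simp: less_Suc_eq)
qed

lemma tstate_new:
  assumes t: "tstate s J n m A" and o: "\<not> occ_upto n (pre m (b n))"
    and A6: "A' 6 = (A 6)(code (pre m (b n)) := Suc n * d)"
    and A7: "m < J * d \<Longrightarrow> A' 7 = (A 7)(code (pre m (b n)) := (n * (J * d) + m) * (2 * (d * (s + 1))))" "m < J * d \<or> A' 7 = A 7"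
  shows "tstate s J n (Suc m) A'"
proof -
  have 1: "slot (Suc n) w = (if w = pre m (b n) then Suc n * d else slot n w)"
    "cslot s J (Suc n) w = (if w = pre m (b n) then (n * (J * d) + m) * (2 * (d * (s + 1))) else cslot s J n w)"
    if "length w = m" for w
  proof -
    have "w = pre m (b n) \<Longrightarrow> \<not> occ_upto n w" using o by simp
    moreover have "w = pre m (b n) \<longleftrightarrow> pre (length w) (b n) = w" using that by auto
    ultimately show "slot (Suc n) w = (if w = pre m (b n) then Suc n * d else slot n w)"
      "cslot s J (Suc n) w = (if w = pre m (b n) then (n * (J * d) + m) * (2 * (d * (s + 1))) else cslot s J n w)"
      using slot_0[of n w] that by (auto simp: slot_Suc)
  qed
  have 2: "w \<noteq> pre m (b n)" if "length w \<noteq> m" for w using that by auto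
  show ?thesis unfolding tstate_def
  proof (intro conjI allI impI)
    fix w :: "bool list" assume "length w \<le> J * d"
    then have "A 6 (code w) = slot (if length w < m then Suc n else n) w" using t by (simp add: tstate_def)
    then show "A' 6 (code w) = slot (if length w < Suc m then Suc n else n) w"
      using 1(1)[of w] 2[of w] by (auto simp: A6 code_inj less_Suc_eq)
  next
    fix w :: "bool list" assume w: "length w < J * d"
    then have *: "A 7 (code w) = cslot s J (if length w < m then Suc n else n) w" using t by (simp add: tstate_def)
    show "A' 7 (code w) = cslot s J (if length w < Suc m then Suc n else n) w"
    proof (cases "m < J * d")
      case True
      then show ?thesis using * 1(2)[of w] 2[of w] by (auto simp: A7(1) code_inj less_Suc_eq)
    next
      case False
      then show ?thesis using * A7(2) w by auto
    qed
  qed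
qed

lemma wp_insert_block:
  assumes \<rho>: "\<rho> 1 = 0" "\<rho> 2 = 1" "\<rho> 5 = d" "\<rho> 12 = 2 * (d * (s + 1))" "\<rho> 21 = Suc n * d" "\<rho> 31 = 2 ^ l" "\<rho> 32 = l * d"
      "\<rho> 30 = code (pre (l * d) (b n))" "\<rho> 22 = (n * (J * d) + l * d) * (2 * (d * (s + 1)))"
    and l: "l < J" and d: "0 < d"
    and A: "\<forall>m<J * d. A 2 m = u m" "\<forall>k<d. A 4 (Suc n * d + k) = of_bool (b n ! k)" "tstate s J n (l * d) A"
  shows "wp \<iota> insert_block (\<lambda>\<rho>' A' X' \<tau>'. same_except {22, 27, 28, 29, 30, 32, 60, 61} \<rho> \<rho>' \<and>
     \<rho>' 32 = Suc l * d \<and> \<rho>' 30 = code (pre (Suc l * d) (b n)) \<and> \<rho>' 22 = (n * (J * d) + Suc l * d) * (2 * (d * (s + 1))) \<and>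
     (\<forall>f. f \<noteq> 6 \<longrightarrow> f \<noteq> 7 \<longrightarrow> A' f = A f) \<and> tstate s J n (Suc l * d) A' \<and> X' = X \<and> \<tau>' \<le> \<tau> + 50 * d + 5) \<rho> A X \<tau>"
proof -
  define c where "c = 2 * (d * (s + 1))"
  define P where "P = J * d"
  let ?S = "{22, 27, 28, 29, 30, 32, 60, 61} :: nat set"
  let ?Inv = "\<lambda>k \<rho>' A' X' \<tau>'. same_except ?S \<rho> \<rho>' \<and> \<rho>' 27 = k \<and>
     \<rho>' 32 = l * d + k \<and> \<rho>' 30 = code (pre (l * d + k) (b n)) \<and> \<rho>' 22 = (n * P + (l * d + k)) * c \<and>
     (\<forall>f. f \<noteq> 6 \<longrightarrow> f \<noteq> 7 \<longrightarrow> A' f = A f) \<and> tstate s J n (l * d + k) A' \<and> X' = X \<and> \<tau>' \<le> \<tau> + 50 * k + 2"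
  let ?Q = "\<lambda>\<rho>' A' X' \<tau>'. same_except ?S \<rho> \<rho>' \<and>
     \<rho>' 32 = Suc l * d \<and> \<rho>' 30 = code (pre (Suc l * d) (b n)) \<and> \<rho>' 22 = (n * (J * d) + Suc l * d) * (2 * (d * (s + 1))) \<and>
     (\<forall>f. f \<noteq> 6 \<longrightarrow> f \<noteq> 7 \<longrightarrow> A' f = A f) \<and> tstate s J n (Suc l * d) A' \<and> X' = X \<and> \<tau>' \<le> \<tau> + 50 * d + 5"
  define rest where "rest = (ADD 22 22 12 # get 28 2 32 @ ADD 29 21 27 # get 29 4 29 @
      [ADD 30 30 30, If (LESS 28 31) [If (LESS 1 29) [ADD 30 30 2] []] [], ADD 32 32 2, ADD 27 27 2])"
  let ?body = "(get 28 6 30 @ If (LESS 1 28) [] (put 6 30 21 @ put 7 30 22) # rest)"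
  have "wp \<iota> [While (LESS 27 5) ?body] ?Q (\<rho>(27 := 0)) A X (Suc \<tau>)"
  proof (rule wp_loop[where len = d and Inv = ?Inv])
    fix k \<rho>' A' X' \<tau>'
    assume k: "k < d" and inv: "?Inv k \<rho>' A' X' \<tau>'"
    let ?m = "l * d + k"
    let ?v = "pre ?m (b n)"
    have i: "same_except ?S \<rho> \<rho>'" "\<rho>' 27 = k" "\<rho>' 32 = ?m" "\<rho>' 30 = code ?v" "\<rho>' 22 = (n * P + ?m) * c"
      "\<forall>f. f \<noteq> 6 \<longrightarrow> f \<noteq> 7 \<longrightarrow> A' f = A f" "tstate s J n ?m A'" "X' = X" "\<tau>' \<le> \<tau> + 50 * k + 2"
      using inv by blast+
    have r: "\<rho>' 1 = 0" "\<rho>' 2 = 1" "\<rho>' 5 = d" "\<rho>' 12 = c" "\<rho>' 21 = Suc n * d" "\<rho>' 31 = 2 ^ l"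
      using i(1) \<rho> by (auto simp: same_except_def c_def)
    have m: "?m < P"
    proof -
      have "Suc l * d \<le> J * d" using l by (intro mult_right_mono) auto
      then show ?thesis using k by (simp add: P_def)
    qed
    have bit: "bitat (b n) ?m \<longleftrightarrow> u ?m < 2 ^ l \<and> b n ! k"
      using k by (simp add: bitat_def)
    have A2: "A' 2 ?m = u ?m" "A' 4 (Suc n * d + k) = of_bool (b n ! k)" using i(6) A m k by (simp_all add: P_def)
    have A6: "A' 6 (code ?v) = slot n ?v"
    proof -
      have "length ?v \<le> J * d" "\<not> length ?v < ?m" using m by (simp_all add: P_def)
      then show ?thesis using i(7) unfolding tstate_def by (metis (full_types))
    qed
    have pS: "code (pre (Suc ?m) (b n)) = 2 * code ?v + of_bool (u ?m < 2 ^ l \<and> b n ! k)"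
      by (simp add: pre_Suc bit)
    have wp_rest: "wp \<iota> rest (?Inv (Suc k)) \<rho>2 A2 X (\<tau>2)"
      if "same_except {28, 60, 61} \<rho>' \<rho>2" "\<forall>f. f \<noteq> 6 \<longrightarrow> f \<noteq> 7 \<longrightarrow> A2 f = A f" "tstate s J n (Suc ?m) A2" "\<tau>2 \<le> \<tau>' + 20"
      for \<rho>2 A2 \<tau>2
    proof -
      have s2: "same_except ?S \<rho> \<rho>2"
        using same_except_mono[OF same_except_trans[OF i(1) that(1)], of ?S] by simp
      have q: "\<rho>2 27 = k" "\<rho>2 32 = ?m" "\<rho>2 30 = code ?v" "\<rho>2 22 = (n * P + ?m) * c"
        "\<rho>2 1 = 0" "\<rho>2 2 = 1" "\<rho>2 5 = d" "\<rho>2 12 = c" "\<rho>2 21 = Suc n * d" "\<rho>2 31 = 2 ^ l"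
        using that(1) i r by (auto simp: same_except_def)
      have a2: "A2 2 ?m = u ?m" "A2 4 (Suc n * d + k) = of_bool (b n ! k)" using that(2) A m k by (simp_all add: P_def)
      have cc: "(n * P + ?m) * c + c = (n * P + (l * d + Suc k)) * c" by (simp add: algebra_simps)
      show ?thesis unfolding rest_def using s2 q a2 that(2-4) i(9) pS cc
        by (cases "u ?m < 2 ^ l"; cases "b n ! k") (simp_all add: wp_nil)
    qed
    have "wp \<iota> ?body (?Inv (Suc k)) \<rho>' A' X' (Suc \<tau>')"
    proof (cases "occ_upto n ?v")
      case True
      have "0 < slot n ?v" using True d by (simp add: slot_def)
      then show ?thesis
        using A6 i r wp_rest[OF _ i(6) tstate_occ[OF i(7) True]] by simp
    next
      case False
      have s0: "slot n ?v = 0" using False by (simp add: slot_def)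
      have "tstate s J n (Suc ?m) (A'(6 := (A' 6)(code ?v := Suc n * d), 7 := (A' 7)(code ?v := (n * P + ?m) * c)))"
        by (rule tstate_new[OF i(7) False]) (use m in \<open>auto simp: P_def c_def\<close>)
      then show ?thesis
        using A6 s0 i r wp_rest by simp
    qed
    then show "holds (LESS 27 5) (mk \<rho>' A', X') \<and> wp \<iota> ?body (?Inv (Suc k)) \<rho>' A' X' (Suc \<tau>')"
      using i r k by simp
  next
    fix \<rho>' A' X' \<tau>'
    assume inv: "?Inv d \<rho>' A' X' \<tau>'"
    have "\<rho>' 5 = d" using inv \<rho> by (auto simp: same_except_def)
    moreover have "l * d + d = Suc l * d" by simp
    ultimately show "\<not> holds (LESS 27 5) (mk \<rho>' A', X') \<and> wp \<iota> [] ?Q \<rho>' A' X' (Suc \<tau>')"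
      using inv by (simp add: wp_nil c_def P_def add.commute del: mult_Suc)
  next
    show "?Inv 0 (\<rho>(27 := 0)) A X (Suc \<tau>)" using \<rho> A by (simp add: c_def P_def)
  qed
  then show ?thesis unfolding insert_block_def rest_def by simp
qed

end

context trie begin

lemma tstate_full: "tstate s J n (Suc (J * d)) A \<Longrightarrow> tstate s J (Suc n) 0 A"
  by (simp add: tstate_def)

lemma wp_insert_sample:
  assumes \<rho>: "\<rho> 1 = 0" "\<rho> 2 = 1" "\<rho> 5 = d" "\<rho> 8 = J" "\<rho> 12 = 2 * (d * (s + 1))" "\<rho> 21 = Suc n * d"
      "\<rho> 22 = n * (J * d) * (2 * (d * (s + 1)))"
    and d: "0 < d"
    and A: "\<forall>m<J * d. A 2 m = u m" "\<forall>k<d. A 4 (Suc n * d + k) = of_bool (b n ! k)" "tstate s J n 0 A"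
  shows "wp \<iota> insert_sample (\<lambda>\<rho>' A' X' \<tau>'. same_except {22, 27, 28, 29, 30, 31, 32, 33, 60, 61} \<rho> \<rho>' \<and>
     \<rho>' 22 = Suc n * (J * d) * (2 * (d * (s + 1))) \<and>
     (\<forall>f. f \<noteq> 6 \<longrightarrow> f \<noteq> 7 \<longrightarrow> A' f = A f) \<and> tstate s J (Suc n) 0 A' \<and> X' = X \<and> \<tau>' \<le> \<tau> + J * (50 * d + 9) + 25) \<rho> A X \<tau>"
    (is "wp _ _ ?Q _ _ _ _")
proof -
  define c where "c = 2 * (d * (s + 1))"
  define P where "P = J * d"
  let ?S = "{22, 27, 28, 29, 30, 31, 32, 33, 60, 61} :: nat set"
  define last where "last = get 28 6 30 @ [If (LESS 1 28) [] (put 6 30 21)]"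
  let ?Inv = "\<lambda>l \<rho>' A' X' \<tau>'. same_except ?S \<rho> \<rho>' \<and> \<rho>' 33 = l \<and> \<rho>' 31 = 2 ^ l \<and>
     \<rho>' 32 = l * d \<and> \<rho>' 30 = code (pre (l * d) (b n)) \<and> \<rho>' 22 = (n * P + l * d) * c \<and>
     (\<forall>f. f \<noteq> 6 \<longrightarrow> f \<noteq> 7 \<longrightarrow> A' f = A f) \<and> tstate s J n (l * d) A' \<and> X' = X \<and> \<tau>' \<le> \<tau> + 4 + l * (50 * d + 9)"
  have "wp \<iota> (While (LESS 33 8) (insert_block @ [ADD 31 31 31, ADD 33 33 2]) # last) ?Q
    (\<rho>(30 := 1, 31 := 1, 32 := 0, 33 := 0)) A X (Suc (Suc (Suc (Suc \<tau>))))"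
  proof (rule wp_loop[where len = J and Inv = ?Inv])
    fix l \<rho>' A' and X' :: reals and \<tau>'
    assume l: "l < J" and inv: "?Inv l \<rho>' A' X' \<tau>'"
    have r: "\<rho>' 1 = 0" "\<rho>' 2 = 1" "\<rho>' 5 = d" "\<rho>' 8 = J" "\<rho>' 12 = 2 * (d * (s + 1))" "\<rho>' 21 = Suc n * d"
      using inv \<rho> by (auto simp: same_except_def)
    have A': "\<forall>m<J * d. A' 2 m = u m" "\<forall>k<d. A' 4 (Suc n * d + k) = of_bool (b n ! k)"
      using inv A by auto
    have "wp \<iota> (insert_block @ [ADD 31 31 31, ADD 33 33 2]) (?Inv (Suc l)) \<rho>' A' X' (Suc \<tau>')"
    proof (rule wp_seq[OF wp_insert_block])
      show "\<rho>' 1 = 0" "\<rho>' 2 = 1" "\<rho>' 5 = d" "\<rho>' 12 = 2 * (d * (s + 1))" "\<rho>' 21 = Suc n * d" by (fact r)+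
      show "\<rho>' 31 = 2 ^ l" "\<rho>' 32 = l * d" "\<rho>' 30 = code (pre (l * d) (b n))"
        "\<rho>' 22 = (n * (J * d) + l * d) * (2 * (d * (s + 1)))" "tstate s J n (l * d) A'"
        using inv by (simp_all add: P_def c_def)
      show "l < J" "0 < d" "\<forall>m<J * d. A' 2 m = u m" "\<forall>k<d. A' 4 (Suc n * d + k) = of_bool (b n ! k)"
        by (fact l d A')+
    next
      fix \<rho>2 A2 and X2 :: reals and \<tau>2
      let ?S2 = "{22, 27, 28, 29, 30, 32, 60, 61} :: nat set"
      assume a: "same_except ?S2 \<rho>' \<rho>2 \<and>
        \<rho>2 32 = Suc l * d \<and> \<rho>2 30 = code (pre (Suc l * d) (b n)) \<and> \<rho>2 22 = (n * (J * d) + Suc l * d) * (2 * (d * (s + 1))) \<and>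
        (\<forall>f. f \<noteq> 6 \<longrightarrow> f \<noteq> 7 \<longrightarrow> A2 f = A' f) \<and> tstate s J n (Suc l * d) A2 \<and> X2 = X' \<and> \<tau>2 \<le> Suc \<tau>' + 50 * d + 5"
      have s2: "same_except ?S \<rho> \<rho>2"
        by (rule same_except_mono[OF same_except_trans[of ?S \<rho> \<rho>' ?S2]]) (use inv a in auto)
      have r2: "\<rho>2 31 = 2 ^ l" "\<rho>2 33 = l" "\<rho>2 2 = 1" using a inv r by (auto simp: same_except_def)
      show "wp \<iota> [ADD 31 31 31, ADD 33 33 2] (?Inv (Suc l)) \<rho>2 A2 X2 \<tau>2"
        using s2 r2 a inv by (simp add: wp_nil P_def c_def del: mult_Suc) (rule wp_nil, simp)
    qed
    then show "holds (LESS 33 8) (mk \<rho>' A', X') \<and> wp \<iota> (insert_block @ [ADD 31 31 31, ADD 33 33 2]) (?Inv (Suc l)) \<rho>' A' X' (Suc \<tau>')"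
      using l inv r by simp
  next
    fix \<rho>' A' and X' :: reals and \<tau>'
    assume inv: "?Inv J \<rho>' A' X' \<tau>'"
    let ?v = "pre P (b n)"
    have r: "\<rho>' 1 = 0" "\<rho>' 2 = 1" "\<rho>' 8 = J" "\<rho>' 21 = Suc n * d"
      using inv \<rho> by (auto simp: same_except_def)
    have i: "same_except ?S \<rho> \<rho>'" "\<rho>' 33 = J" "\<rho>' 30 = code ?v" "\<rho>' 22 = (n * P + P) * c"
      "\<forall>f. f \<noteq> 6 \<longrightarrow> f \<noteq> 7 \<longrightarrow> A' f = A f" "tstate s J n P A'" "X' = X" "\<tau>' \<le> \<tau> + 4 + J * (50 * d + 9)"
      using inv by (simp_all add: P_def)
    have A6: "A' 6 (code ?v) = slot n ?v"
      using i(6) unfolding tstate_def P_def by (metis (full_types) length_pre less_irrefl order_refl)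
    have cc: "(n * P + P) * c = Suc n * (J * d) * (2 * (d * (s + 1)))" by (simp add: P_def c_def algebra_simps)
    have "wp \<iota> last ?Q \<rho>' A' X' (Suc \<tau>')"
    proof (cases "occ_upto n ?v")
      case True
      have "0 < slot n ?v" using True d by (simp add: slot_def)
      moreover have "tstate s J (Suc n) 0 A'"
        using tstate_occ[OF i(6) True] tstate_full by (simp add: P_def)
      ultimately show ?thesis unfolding last_def using i r A6 cc by (simp add: wp_nil)
    next
      case False
      have "tstate s J n (Suc P) (A'(6 := (A' 6)(code ?v := Suc n * d)))"
        by (rule tstate_new[OF i(6) False]) (auto simp: P_def)
      then have "tstate s J (Suc n) 0 (A'(6 := (A' 6)(code ?v := Suc n * d)))"
        using tstate_full by (simp add: P_def)
      then show ?thesis unfolding last_def using i r A6 cc slot_0(1)[OF False] by (simp add: wp_nil)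
    qed
    then show "\<not> holds (LESS 33 8) (mk \<rho>' A', X') \<and> wp \<iota> last ?Q \<rho>' A' X' (Suc \<tau>')"
      using inv r by simp
  next
    show "?Inv 0 (\<rho>(30 := 1, 31 := 1, 32 := 0, 33 := 0)) A X (Suc (Suc (Suc (Suc \<tau>))))"
      using \<rho> A by (simp add: c_def P_def pre_def)
  qed
  then show ?thesis unfolding insert_sample_def last_def by simp
qed

text \<open>Relates the stored draws \<open>h\<close> to the samples \<open>b\<close> that they
  select; \<open>M\<close> bounds the length of each scan and thereby the running time.\<close>

definition samples_ok :: "input \<Rightarrow> (nat \<Rightarrow> real) \<Rightarrow> nat \<Rightarrow> real \<Rightarrow> nat \<Rightarrow> (nat \<Rightarrow> nat) \<Rightarrow> bool" where
  "samples_ok \<iota> w s q M h \<longleftrightarrow> (\<forall>i<N. real (h i + 1) \<le> cum w s q M \<and>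
     (\<forall>k<d. tape (fst \<iota>) (3 + (pick w s q (h i) - 1) * d + k) = of_bool (b i ! k)))"

definition sample_time :: "nat \<Rightarrow> nat \<Rightarrow> nat" where
  "sample_time J M = 9 * M + 15 * d + J * (50 * d + 9) + 60"

lemma wp_build:
  assumes \<rho>: "\<rho> 1 = 0" "\<rho> 2 = 1" "\<rho> 4 = s" "\<rho> 5 = d" "\<rho> 8 = J" "\<rho> 10 = s + 1" "\<rho> 11 = d * (s + 1)" "\<rho> 12 = 2 * (d * (s + 1))"
      "\<rho> 14 = N"
    and s: "0 < s" and d: "0 < d"
    and w: "\<And>z. tape (snd \<iota>) (3 + z) = w z"
    and ok: "samples_ok \<iota> w s (real (\<rho> 6)) M (A 3)"
    and A: "\<forall>m<J * d. A 2 m = u m" "\<And>i. A 6 i = 0" "\<And>i. A 7 i = 0"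
  shows "wp \<iota> build (\<lambda>\<rho>' A' X' \<tau>'. qinv s J \<rho>' A' \<and>
     A' 1 = (\<lambda>i. if i < \<rho> 13 then (if A 1 i = 0 then 2 ^ i else 0) else A 1 i) \<and>
     \<tau>' \<le> \<tau> + 20 * \<rho> 13 + N * sample_time J M + 30) \<rho> A X \<tau>"
    (is "wp _ _ ?Q _ _ _ _")
  unfolding build_def
proof (rule wp_seq)
  define q where "q = real (\<rho> 6)"
  let ?f = "\<lambda>i. if i < \<rho> 13 then (if A 1 i = 0 then 2 ^ i else 0) else A 1 i"
  let ?Sc = "{20, 21, 22, 60, 61} :: nat set"
  let ?S = "{20, 21, 22, 23, 24, 25, 26, 27, 28, 29, 30, 31, 32, 33, 60, 61} :: nat set"
  let ?T = "sample_time J M"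
  show "wp \<iota> convert (\<lambda>\<rho>1 A1 X1 \<tau>1. same_except ?Sc \<rho> \<rho>1 \<and> A1 = A(1 := ?f) \<and> X1 = X \<and> \<tau>1 \<le> \<tau> + 20 * \<rho> 13 + 5) \<rho> A X \<tau>"
    by (rule wp_convert[OF \<rho>(1,2)])
  fix \<rho>1 A1 and X1 :: reals and \<tau>1
  assume 1: "same_except ?Sc \<rho> \<rho>1 \<and> A1 = A(1 := ?f) \<and> X1 = X \<and> \<tau>1 \<le> \<tau> + 20 * \<rho> 13 + 5"
  have r1: "\<rho>1 1 = 0" "\<rho>1 5 = d" "real (\<rho>1 6) = q" using 1 \<rho> by (auto simp: same_except_def q_def)
  define loop where "loop = find_sample @ copy_sample @ insert_sample @ [ADD 21 21 5, ADD 20 20 2]"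
  let ?Inv = "\<lambda>i \<rho>' A' X' \<tau>'. same_except ?S \<rho> \<rho>' \<and> \<rho>' 20 = i \<and> \<rho>' 21 = Suc i * d \<and>
     \<rho>' 22 = i * (J * d) * (2 * (d * (s + 1))) \<and> A' 1 = ?f \<and> A' 2 = A 2 \<and> A' 3 = A 3 \<and>
     (\<forall>i'<i. \<forall>k<d. A' 4 (Suc i' * d + k) = of_bool (b i' ! k)) \<and> tstate s J i 0 A' \<and> X' 12 = q \<and>
     \<tau>' \<le> \<tau>1 + 4 + i * ?T"
  have "wp \<iota> (While (LESS 20 14) loop # [ADD 40 4 1, ADD 41 5 1]) ?Q
    (\<rho>1(20 := 0, 21 := d, 22 := 0)) A1 (X1(12 := q)) (Suc (Suc (Suc (Suc \<tau>1))))"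
  proof (rule wp_loop[where len = N and Inv = ?Inv])
    fix i \<rho>' A' and X' :: reals and \<tau>'
    assume i: "i < N" and inv: "?Inv i \<rho>' A' X' \<tau>'"
    have r: "\<rho>' 1 = 0" "\<rho>' 2 = 1" "\<rho>' 4 = s" "\<rho>' 5 = d" "\<rho>' 14 = N"
      using inv \<rho> by (auto simp: same_except_def)
    let ?p = "pick w s q (A' 3 (\<rho>' 20))"
    have h: "real (A' 3 (\<rho>' 20) + 1) \<le> cum w s q M"
      "\<And>k. k < d \<Longrightarrow> tape (fst \<iota>) (3 + (?p - 1) * d + k) = of_bool (b i ! k)"
      using ok i inv unfolding samples_ok_def q_def by auto
    have X12: "X' 12 = q" using inv by simp
    have pM: "?p \<le> M" unfolding pick_def by (rule Least_le) (rule h(1))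
    have "wp \<iota> loop (?Inv (Suc i)) \<rho>' A' X' (Suc \<tau>')"
      unfolding loop_def
    proof (rule wp_seq[OF wp_find_sample[where A = A' and \<rho> = \<rho>' and X = X' and w = w and q = q and t = M, OF r(1-4) s w X12 h(1)]])
      fix \<rho>2 A2 and X2 :: reals and \<tau>2
      assume 2: "same_except {23, 24, 25, 26, 60, 61} \<rho>' \<rho>2 \<and> A2 = A' \<and> X2 12 = q \<and>
        \<rho>2 24 = 3 + (?p - 1) * d \<and> \<tau>2 \<le> Suc \<tau>' + 9 * ?p + 20"
      have s2: "same_except ?S \<rho> \<rho>2"
        by (rule same_except_mono[OF same_except_trans[of ?S \<rho> \<rho>' "{23, 24, 25, 26, 60, 61}"]]) (use inv 2 in auto)
      have r2: "\<rho>2 20 = i" "\<rho>2 21 = Suc i * d" "\<rho>2 22 = i * (J * d) * (2 * (d * (s + 1)))"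
        using 2 inv by (auto simp: same_except_def)
      have r2': "\<rho>2 2 = 1" "\<rho>2 5 = d" using s2 \<rho> by (auto simp: same_except_def)
      show "wp \<iota> (copy_sample @ insert_sample @ [ADD 21 21 5, ADD 20 20 2]) (?Inv (Suc i)) \<rho>2 A2 X2 \<tau>2"
      proof (rule wp_seq[OF wp_copy_sample[where a = "b i", OF r2'(1,2)]])
        show "tape (fst \<iota>) (\<rho>2 24 + k) = of_bool (b i ! k)" if "k < d" for k using h(2)[OF that] 2 by simp
        fix \<rho>3 A3 and X3 :: reals and \<tau>3
        assume 3: "same_except {27, 28, 29, 60, 61} \<rho>2 \<rho>3 \<and>
          A3 = A2(4 := \<lambda>j. if \<rho>2 21 \<le> j \<and> j < \<rho>2 21 + d then of_bool (b i ! (j - \<rho>2 21)) else A2 4 j) \<and> X3 = X2 \<and> \<tau>3 \<le> \<tau>2 + 15 * d + 5"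
        have s3: "same_except ?S \<rho> \<rho>3"
          by (rule same_except_mono[OF same_except_trans[of ?S \<rho> \<rho>2 "{27, 28, 29, 60, 61}"]]) (use s2 3 in auto)
        have r3: "\<rho>3 20 = i" "\<rho>3 21 = Suc i * d" "\<rho>3 22 = i * (J * d) * (2 * (d * (s + 1)))"
          using 3 r2 by (auto simp: same_except_def)
        have r3': "\<rho>3 1 = 0" "\<rho>3 2 = 1" "\<rho>3 5 = d" "\<rho>3 8 = J" "\<rho>3 12 = 2 * (d * (s + 1))"
          using s3 \<rho> by (auto simp: same_except_def)
        have bits: "A3 4 (Suc i' * d + k) = of_bool (b i' ! k)" if "i' < Suc i" "k < d" for i' k
        proof (cases "i' = i")
          case True
          then show ?thesis using 3 r2 that by simp
        next
          case False
          then have "Suc i' * d + d \<le> Suc i * d" using that by (metis add.commute less_SucE mult_Suc mult_le_mono1 Suc_leI not_less_eq)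
          then have "\<not> \<rho>2 21 \<le> Suc i' * d + k" using r2 that by simp
          then show ?thesis using 3 2 inv that False by (simp del: mult_Suc)
        qed
        have t3: "tstate s J i 0 A3" by (rule tstate_cong[of s J i 0 A']) (use inv 2 3 in auto)
        show "wp \<iota> (insert_sample @ [ADD 21 21 5, ADD 20 20 2]) (?Inv (Suc i)) \<rho>3 A3 X3 \<tau>3"
        proof (rule wp_seq[OF wp_insert_sample[where n = i, OF r3' r3(2,3) d _ _ t3]])
          show "\<forall>m<J * d. A3 2 m = u m" using 3 2 inv A by auto
          show "\<forall>k<d. A3 4 (Suc i * d + k) = of_bool (b i ! k)" using bits by blast
          fix \<rho>4 A4 and X4 :: reals and \<tau>4
          assume 4: "same_except {22, 27, 28, 29, 30, 31, 32, 33, 60, 61} \<rho>3 \<rho>4 \<and>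
             \<rho>4 22 = Suc i * (J * d) * (2 * (d * (s + 1))) \<and>
             (\<forall>f. f \<noteq> 6 \<longrightarrow> f \<noteq> 7 \<longrightarrow> A4 f = A3 f) \<and> tstate s J (Suc i) 0 A4 \<and> X4 = X3 \<and> \<tau>4 \<le> \<tau>3 + J * (50 * d + 9) + 25"
          have s4: "same_except ?S \<rho> \<rho>4"
            by (rule same_except_mono[OF same_except_trans[of ?S \<rho> \<rho>3 "{22, 27, 28, 29, 30, 31, 32, 33, 60, 61}"]]) (use s3 4 in auto)
          have r4: "\<rho>4 20 = i" "\<rho>4 21 = Suc i * d" "\<rho>4 5 = d" "\<rho>4 2 = 1"
            using 4 r3 r3' by (auto simp: same_except_def)
          have A4: "A4 1 = ?f" "A4 2 = A 2" "A4 3 = A 3" "\<forall>i'<Suc i. \<forall>k<d. A4 4 (Suc i' * d + k) = of_bool (b i' ! k)"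
            using 4 3 2 inv bits by (auto simp del: mult_Suc)
          have time: "Suc (Suc \<tau>4) \<le> \<tau>1 + 4 + Suc i * ?T"
            using 4 3 2 inv pM by (simp add: sample_time_def)
          have "Suc i * d + d = Suc (Suc i) * d" by simp
          then have "?Inv (Suc i) (\<rho>4(21 := Suc i * d + d, 20 := Suc i)) A4 X4 (Suc (Suc \<tau>4))"
            using s4 4 3 2 A4 time by (simp del: mult_Suc)
          then have "wp \<iota> [] (?Inv (Suc i)) (\<rho>4(21 := Suc i * d + d, 20 := Suc i)) A4 X4 (Suc (Suc \<tau>4))"
            by (rule wp_nil[of "?Inv (Suc i)" "\<rho>4(21 := Suc i * d + d, 20 := Suc i)" A4 X4 "Suc (Suc \<tau>4)"])
          then show "wp \<iota> [ADD 21 21 5, ADD 20 20 2] (?Inv (Suc i)) \<rho>4 A4 X4 \<tau>4"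
            using r4 by (simp del: mult_Suc)
        qed
      qed
    qed
    then show "holds (LESS 20 14) (mk \<rho>' A', X') \<and> wp \<iota> loop (?Inv (Suc i)) \<rho>' A' X' (Suc \<tau>')"
      using i inv r by simp
  next
    fix \<rho>' A' and X' :: reals and \<tau>'
    assume inv: "?Inv N \<rho>' A' X' \<tau>'"
    have r: "\<rho>' 1 = 0" "\<rho>' 4 = s" "\<rho>' 5 = d" "\<rho>' 8 = J" "\<rho>' 10 = s + 1" "\<rho>' 11 = d * (s + 1)" "\<rho>' 14 = N"
      using inv \<rho> by (auto simp: same_except_def)
    have t: "A' 6 (code w) = (if occ w then Suc (ix w) * d else 0)" if "length w \<le> J * d" for w
      using inv that unfolding tstate_def by (simp add: slot_def)
    have t': "A' 7 (code w) = (ix w * (J * d) + length w) * (2 * (d * (s + 1)))" if "length w < J * d" "occ w" for w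
      using inv that unfolding tstate_def by (simp add: cslot_def)
    have "qinv s J (\<rho>'(40 := s, 41 := d)) A'"
      using inv r t t' A unfolding qinv_def by (simp del: mult_Suc)
    then have "?Q (\<rho>'(40 := s, 41 := d)) A' X' (Suc (Suc (Suc \<tau>')))"
      using inv 1 by simp
    then have "wp \<iota> [] ?Q (\<rho>'(40 := s, 41 := d)) A' X' (Suc (Suc (Suc \<tau>')))"
      by (rule wp_nil[of ?Q "\<rho>'(40 := s, 41 := d)" A' X' "Suc (Suc (Suc \<tau>'))"])
    then show "\<not> holds (LESS 20 14) (mk \<rho>' A', X') \<and> wp \<iota> [ADD 40 4 1, ADD 41 5 1] ?Q \<rho>' A' X' (Suc \<tau>')"
      using inv r by simp
  next
    have "same_except ?S \<rho> \<rho>1" by (rule same_except_mono[of ?Sc]) (use 1 in auto)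
    moreover have "tstate s J 0 0 A1"
      using 1 A by (simp add: tstate_def slot_def cslot_def trie.occ_def)
    ultimately show "?Inv 0 (\<rho>1(20 := 0, 21 := d, 22 := 0)) A1 (X1(12 := q)) (Suc (Suc (Suc (Suc \<tau>1))))"
      using 1 by simp
  qed
  then show "wp \<iota> [CST 20 0, ADD 21 5 1, CST 22 0, Instr (Cast 12 (reg 6)),
     While (LESS 20 14) (find_sample @ copy_sample @ insert_sample @ [ADD 21 21 5, ADD 20 20 2]),
     ADD 40 4 1, ADD 41 5 1] ?Q \<rho>1 A1 X1 \<tau>1"
    using r1 unfolding loop_def by simp
qed

end

section \<open>Correctness of the initialization\<close>

definition Init :: program where
  "Init = read_parameters @ [If (RLess 0 5)
     (choose_sizes @ fill 2 9 5 @ fill 3 14 16 @ fill 1 13 18 @ build) []]"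

lemma card_nat_between:
  fixes c c' :: real
  assumes "0 \<le> c" "c \<le> c'"
  shows "c' - c - 1 \<le> card {U :: nat. c < real U + 1 \<and> real U + 1 \<le> c'}" "finite {U :: nat. c < real U + 1 \<and> real U + 1 \<le> c'}"
proof -
  have eq: "{U :: nat. c < real U + 1 \<and> real U + 1 \<le> c'} = {nat \<lfloor>c\<rfloor>..<nat \<lfloor>c'\<rfloor>}"
    using assms by (auto simp: floor_le_iff le_floor_iff nat_le_iff zless_nat_eq_int_zless less_floor_iff)
  show "finite {U :: nat. c < real U + 1 \<and> real U + 1 \<le> c'}" unfolding eq by simp
  show "c' - c - 1 \<le> card {U :: nat. c < real U + 1 \<and> real U + 1 \<le> c'}"
    unfolding eq using assms by simp linarith
qed

section \<open>The description of the distribution and the sampler\<close>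

locale described =
  fixes s d :: nat and \<mu> :: "point pmf" and zs :: "(bool list list \<times> real) list"
  assumes s: "0 < s" and d: "0 < d"
    and sub: "set_pmf \<mu> \<subseteq> EMD_points s d" and desc: "describes zs \<mu>"
begin

definition n :: nat where "n = length zs"
definition vecs :: "bool list list" where "vecs = concat (map fst zs)"
definition w :: "nat \<Rightarrow> real" where "w z = tape (map snd zs) z"

lemma zs_props:
  assumes "z < n"
  shows "mset (fst (zs ! z)) \<in> set_pmf \<mu>" "w z = pmf \<mu> (mset (fst (zs ! z)))"
    "length (fst (zs ! z)) = s" "\<forall>v\<in>set (fst (zs ! z)). length v = d"
proof -
  have z: "zs ! z \<in> set zs" using assms by (simp add: n_def)
  have "mset (fst (zs ! z)) \<in> (\<lambda>(xs, w). mset xs) ` set zs"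
    using z by (force simp: case_prod_beta)
  then show m: "mset (fst (zs ! z)) \<in> set_pmf \<mu>" using desc by (simp add: describes_def)
  show "w z = pmf \<mu> (mset (fst (zs ! z)))"
    using desc z assms by (auto simp: describes_def w_def tape_def n_def case_prod_beta)
  show "length (fst (zs ! z)) = s" "\<forall>v\<in>set (fst (zs ! z)). length v = d"
    using m sub by (auto simp: EMD_points_def)
qed

lemma set_zs:
  assumes "x \<in> set zs"
  shows "length (fst x) = s" "\<forall>v\<in>set (fst x). length v = d"
proof -
  obtain z where "z < n" "x = zs ! z" using assms by (auto simp: in_set_conv_nth n_def)
  then show "length (fst x) = s" "\<forall>v\<in>set (fst x). length v = d" using zs_props(3,4) by auto
qed

lemma finite_set_\<mu>: "finite (set_pmf \<mu>)"
proof -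
  have "set_pmf \<mu> = (\<lambda>(xs, w). mset xs) ` set zs" using desc by (simp add: describes_def)
  then show ?thesis by simp
qed

lemma E_\<mu>: "E \<mu> f = (\<Sum>z<n. w z * f (mset (fst (zs ! z))))"
proof -
  let ?g = "\<lambda>z. mset (fst (zs ! z))"
  have "distinct (map (\<lambda>(xs, w). mset xs) zs)" using desc by (simp add: describes_def)
  then have "inj_on (\<lambda>z. map (\<lambda>(xs, w). mset xs) zs ! z) {..<n}"
    by (intro inj_on_nth) (simp_all add: n_def)
  then have inj: "inj_on ?g {..<n}" by (auto simp: inj_on_def n_def case_prod_beta)
  have "set_pmf \<mu> = ?g ` {..<n}"
  proof -
    have "set_pmf \<mu> = (\<lambda>(xs, w). mset xs) ` set zs" using desc by (simp add: describes_def)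
    also have "set zs = (!) zs ` {..<n}" by (auto simp: n_def set_conv_nth)
    finally show ?thesis by (simp add: image_image case_prod_beta)
  qed
  then have "E \<mu> f = (\<Sum>z<n. pmf \<mu> (?g z) * f (?g z))"
    using finite_set_\<mu> inj by (simp add: E_sum sum.reindex)
  then show ?thesis using zs_props(2) by (metis (mono_tags, lifting) lessThan_iff sum.cong)
qed

lemma n_pos: "0 < n"
proof -
  have "set_pmf \<mu> = (\<lambda>(xs, w). mset xs) ` set zs" using desc by (simp add: describes_def)
  then have "set zs \<noteq> {}" using set_pmf_not_empty[of \<mu>] by auto
  then show ?thesis by (simp add: n_def)
qed

lemma w_sum: "(\<Sum>z<n. w z) = 1"
  using E_\<mu>[of "\<lambda>_. 1"] by simp

lemma w_nonneg: "0 \<le> w z"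
proof (cases "z < n")
  case False
  then show ?thesis by (simp add: w_def tape_def n_def)
qed (simp add: zs_props(2))

lemma vecs_props:
  assumes "z < n" "j < s"
  shows "z * s + j < length vecs" "vecs ! (z * s + j) = fst (zs ! z) ! j"
  using nth_concat_uniform[of "map fst zs" s z j] assms set_zs(1)
  by (simp_all add: vecs_def n_def)

lemma length_vecs: "length vecs = s * n"
proof -
  have "length vecs = (\<Sum>x\<leftarrow>zs. length (fst x))" by (simp add: vecs_def length_concat o_def)
  also have "\<dots> = (\<Sum>x\<leftarrow>zs. s)"
    by (rule arg_cong[where f = sum_list], rule map_cong[OF refl]) (rule set_zs(1))
  finally show ?thesis by (simp add: n_def sum_list_triv)
qed

lemma vecs_length: "v \<in> set vecs \<Longrightarrow> length v = d"
  unfolding vecs_def using set_zs(2) by fastforce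

lemma sum_blocks: "(\<Sum>e<s * n. f e) = (\<Sum>z<n. \<Sum>j<s. f (z * s + j))" for f :: "nat \<Rightarrow> real"
proof -
  have "(\<Sum>j<s. f (z * s + j)) = sum f {z * s..<z * s + s}" for z
    by (subst sum.atLeastLessThan_shift_0) (simp add: atLeast0LessThan add.commute)
  then show ?thesis using sum.nat_group[of f s n] by (simp add: mult.commute)
qed

lemma cum_total: "cum w s q (s * n) = s * q" for q :: real
  unfolding cum_def sum_blocks using s w_sum by (simp add: sum_distrib_left[symmetric] sum_distrib_right[symmetric])

lemma cum_mono: "0 \<le> q \<Longrightarrow> t \<le> t' \<Longrightarrow> cum w s q t \<le> cum w s q t'" for q :: real
  unfolding cum_def using w_nonneg by (intro sum_mono2) auto

context
  fixes N :: nat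
  assumes N: "0 < N"
begin

text \<open>Scaled by \<open>q\<close>, the weights of the \<open>s * n\<close> vectors add up to
  \<open>s * n * N\<close>, the range of a draw. The factor \<open>N\<close> in the resolution keeps
  the total rounding error at \<open>1 / N\<close>.\<close>

definition q :: real where "q = real (n * N)"

definition vec :: "nat \<Rightarrow> bool list" where
  "vec U = vecs ! (pick w s q U - 1)"

definition \<nu> :: "bool list pmf" where
  "\<nu> = map_pmf vec (uniform_below (s * n * N))"

lemma q_pos: "0 < q" using n_pos N by (simp add: q_def)

lemma cum_ge: "U < s * n * N \<Longrightarrow> real (U + 1) \<le> cum w s q (s * n)"
proof -
  assume "U < s * n * N"
  then have "real (U + 1) \<le> real (s * n * N)" by (simp only: of_nat_le_iff Suc_leI flip: Suc_eq_plus1)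
  also have "\<dots> = cum w s q (s * n)" using cum_total[of q] by (simp add: q_def)
  finally show ?thesis .
qed

lemma pick_props:
  assumes "U < s * n * N"
  shows "1 \<le> pick w s q U" "pick w s q U \<le> s * n" "vec U \<in> set vecs"
proof -
  let ?P = "\<lambda>t. real (U + 1) \<le> cum w s q t"
  have "?P (pick w s q U)" unfolding pick_def by (rule LeastI[where P = ?P, OF cum_ge[OF assms]])
  then show 1: "1 \<le> pick w s q U" by (cases "pick w s q U") (auto simp: cum_def)
  show 2: "pick w s q U \<le> s * n" unfolding pick_def by (rule Least_le[where P = ?P]) (rule cum_ge[OF assms])
  show "vec U \<in> set vecs" unfolding vec_def using 1 2 by (intro nth_mem) (simp add: length_vecs)
qed

lemma set_uniform: "set_pmf (uniform_below (s * n * N)) = {..<s * n * N}"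
  using s n_pos N by (auto simp: uniform_below_def set_pmf_of_set lessThan_empty_iff)

lemma finite_set_\<nu>: "finite (set_pmf \<nu>)"
  by (simp add: \<nu>_def set_uniform)

lemma length_\<nu>: "x \<in> set_pmf \<nu> \<Longrightarrow> length x = d"
  using pick_props(3) vecs_length by (auto simp: \<nu>_def set_uniform)

text \<open>Vector \<open>e\<close> is selected by the integers in an interval of length
  \<open>w (e div s) * q\<close>, of which there are at least this length minus 1. The vectors in
  \<open>A\<close> lose at most \<open>s * n\<close> integers together, out of
  \<open>s * n * N\<close>.\<close>

lemma sampler_approx: "E \<mu> (\<lambda>Y. size {#v \<in># Y. v \<in> A#}) \<le> s * (measure_pmf.prob \<nu> A + 1 / N)"
proof -
  let ?Q = "s * n * N"
  let ?E = "{e. e < s * n \<and> vecs ! e \<in> A}"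
  let ?c = "cum w s q"
  let ?I = "\<lambda>e. {U :: nat. ?c e < real U + 1 \<and> real U + 1 \<le> ?c (Suc e)}"
  have Q: "0 < ?Q" using s n_pos N by simp
  have "E \<mu> (\<lambda>Y. size {#v \<in># Y. v \<in> A#}) = (\<Sum>z<n. w z * (\<Sum>j<s. of_bool (vecs ! (z * s + j) \<in> A)))"
    unfolding E_\<mu>
  proof (rule sum.cong[OF refl])
    fix z assume z: "z \<in> {..<n}"
    have "real (size {#v \<in># mset (fst (zs ! z)). v \<in> A#}) = (\<Sum>j<s. of_bool (fst (zs ! z) ! j \<in> A))"
      using zs_props(3)[of z] z by (simp add: length_filter_conv_card Int_def lessThan_def flip: mset_filter)
    also have "\<dots> = (\<Sum>j<s. of_bool (vecs ! (z * s + j) \<in> A))"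
      using vecs_props(2) z by simp
    finally show "w z * real (size {#v \<in># mset (fst (zs ! z)). v \<in> A#}) = w z * (\<Sum>j<s. of_bool (vecs ! (z * s + j) \<in> A))"
      by simp
  qed
  also have "\<dots> = (\<Sum>e<s * n. w (e div s) * of_bool (vecs ! e \<in> A))"
    unfolding sum_blocks using s by (simp add: mult.commute)
  also have "\<dots> = (\<Sum>e\<in>?E. w (e div s))"
    by (rule sum.mono_neutral_cong_right) auto
  finally have lhs: "E \<mu> (\<lambda>Y. size {#v \<in># Y. v \<in> A#}) = (\<Sum>e\<in>?E. w (e div s))" .
  have I: "pick w s q U = Suc e" "U < ?Q" if "U \<in> ?I e" "e < s * n" for U e
  proof -
    show "pick w s q U = Suc e" unfolding pick_def
    proof (rule Least_equality)
      show "real (U + 1) \<le> ?c (Suc e)" using that by simp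
      fix t assume "real (U + 1) \<le> ?c t"
      then show "Suc e \<le> t" using cum_mono[of q t e] q_pos that(1) by (cases "t \<le> e") auto
    qed
    have "real U + 1 \<le> ?c (s * n)" using that cum_mono[of q "Suc e" "s * n"] q_pos by simp
    then have "real (U + 1) \<le> real ?Q" using cum_total[of q] by (simp add: q_def)
    then show "U < ?Q" by (simp only: of_nat_le_iff)
  qed
  have c: "0 \<le> ?c e" "?c e \<le> ?c (Suc e)" "?c (Suc e) - ?c e = w (e div s) * q" for e
    using cum_mono[of q 0 e] cum_mono[of q e "Suc e"] q_pos by (simp_all add: cum_def)
  have "(\<Sum>e\<in>?E. w (e div s) * q - 1) \<le> (\<Sum>e\<in>?E. real (card (?I e)))"
    using card_nat_between(1)[OF c(1,2)] c(3) by (intro sum_mono) (smt (verit))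
  also have "\<dots> = card (\<Union>e\<in>?E. ?I e)"
  proof (subst card_UN_disjoint)
    show "\<forall>e\<in>?E. finite (?I e)" using card_nat_between(2)[OF c(1,2)] by blast
    show "\<forall>e\<in>?E. \<forall>e'\<in>?E. e \<noteq> e' \<longrightarrow> ?I e \<inter> ?I e' = {}"
    proof (intro ballI impI equals0I)
      fix e e' U assume "e \<in> ?E" "e' \<in> ?E" "e \<noteq> e'" "U \<in> ?I e \<inter> ?I e'"
      then show False using I(1)[of U e] I(1)[of U e'] by simp
    qed
  qed simp_all
  also have "\<dots> \<le> card {U. U < ?Q \<and> vec U \<in> A}"
    unfolding of_nat_le_iff
  proof (rule card_mono)
    show "(\<Union>e\<in>?E. ?I e) \<subseteq> {U. U < ?Q \<and> vec U \<in> A}"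
      using I by (fastforce simp: vec_def)
  qed simp
  also have "\<dots> = ?Q * measure_pmf.prob \<nu> A"
  proof -
    have "measure_pmf.prob \<nu> A = measure_pmf.prob (uniform_below ?Q) (vec -` A)" by (simp add: \<nu>_def)
    also have "\<dots> = card ({..<?Q} \<inter> vec -` A) / ?Q"
      using Q by (subst uniform_below_def, simp only: if_False neq0_conv[symmetric], subst measure_pmf_of_set) (auto simp: lessThan_empty_iff)
    also have "{..<?Q} \<inter> vec -` A = {U. U < ?Q \<and> vec U \<in> A}" by auto
    finally show ?thesis using Q by (simp add: field_simps)
  qed
  finally have "(\<Sum>e\<in>?E. w (e div s)) * q - card ?E \<le> s * q * measure_pmf.prob \<nu> A"
    by (simp add: sum_subtractf sum_distrib_right q_def)
  moreover have "real (card ?E) \<le> s * n"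
  proof -
    have "card ?E \<le> card {..<s * n}" by (intro card_mono) auto
    then show ?thesis by (simp only: card_lessThan of_nat_le_iff)
  qed
  ultimately have "(\<Sum>e\<in>?E. w (e div s)) * q \<le> (s * (measure_pmf.prob \<nu> A + 1 / N)) * q"
    using N n_pos by (simp add: q_def algebra_simps)
  then show ?thesis unfolding lhs using q_pos by simp
qed

lemma Pi_vec: "Pi_pmf {..<N} [] (\<lambda>_. \<nu>) =
    map_pmf (\<lambda>h i. if i < N then vec (h i) else []) (Pi_pmf {..<N} 0 (\<lambda>_. uniform_below (s * n * N)))"
proof -
  have "Pi_pmf {..<N} (vec 0) (\<lambda>_. \<nu>) = map_pmf (\<lambda>h. vec \<circ> h) (Pi_pmf {..<N} 0 (\<lambda>_. uniform_below (s * n * N)))"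
    unfolding \<nu>_def by (rule Pi_pmf_map) auto
  \<comment> \<open>Mapping a product distribution also maps its default, here to
    \<open>vec 0\<close>; outside \<open>{..<N}\<close> the value is therefore reset to
    \<open>[]\<close>.\<close>
  moreover have "Pi_pmf {..<N} [] (\<lambda>_. \<nu>) = map_pmf (\<lambda>f x. if x \<in> {..<N} then f x else []) (Pi_pmf {..<N} (vec 0) (\<lambda>_. \<nu>))"
    by (rule Pi_pmf_default_swap[symmetric]) simp
  ultimately show ?thesis by (simp add: map_pmf_comp o_def)
qed

end

lemma init_tapes:
  fixes r p\<^sub>1 p\<^sub>2
  defines "\<iota> \<equiv> init_input s d r p\<^sub>1 p\<^sub>2 zs"
  shows "tape (fst \<iota>) 0 = s" "tape (fst \<iota>) 1 = d" "tape (fst \<iota>) 2 = n"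
    "tape (snd \<iota>) 0 = r" "tape (snd \<iota>) 1 = p\<^sub>1" "tape (snd \<iota>) 2 = p\<^sub>2" "tape (snd \<iota>) (3 + z) = w z"
    "e < s * n \<Longrightarrow> k < d \<Longrightarrow> tape (fst \<iota>) (3 + e * d + k) = of_bool (vecs ! e ! k)"
proof -
  have f: "fst \<iota> = [s, d, n] @ map of_bool (concat vecs)"
  proof -
    have "concat (map (\<lambda>(xs, w). encode_point xs) ys) = map of_bool (concat (concat (map fst ys)))"
      for ys :: "(bool list list \<times> real) list"
      by (induction ys) (auto simp: encode_point_def)
    then show ?thesis by (simp add: \<iota>_def init_input_def n_def vecs_def)
  qed
  have g: "snd \<iota> = [r, p\<^sub>1, p\<^sub>2] @ map snd zs" by (simp add: \<iota>_def init_input_def)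
  show "tape (fst \<iota>) 0 = s" "tape (fst \<iota>) 1 = d" "tape (fst \<iota>) 2 = n"
    "tape (snd \<iota>) 0 = r" "tape (snd \<iota>) 1 = p\<^sub>1" "tape (snd \<iota>) 2 = p\<^sub>2"
    by (simp_all add: f g tape_def)
  show "tape (snd \<iota>) (3 + z) = w z" by (simp add: g tape_def w_def nth_append)
  assume e: "e < s * n" "k < d"
  have "e * d + k < length (concat vecs)" "concat vecs ! (e * d + k) = vecs ! e ! k"
    using nth_concat_uniform[of vecs d e k] vecs_length e by (simp_all add: length_vecs)
  then show "tape (fst \<iota>) (3 + e * d + k) = of_bool (vecs ! e ! k)"
    by (simp add: f tape_def nth_append add.assoc)
qed

end

section \<open>From runs of the programs to a sensitive family\<close>

lemma sensitive_cong:
  assumes "sensitive Y \<delta> \<mu> r R p\<^sub>1 p\<^sub>2 (map_pmf f \<Omega>)" "set_pmf \<mu> \<subseteq> Y"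
    and eq: "\<And>\<omega> x. \<omega> \<in> set_pmf \<Omega> \<Longrightarrow> x \<in> Y \<Longrightarrow> g \<omega> x = f \<omega> x"
  shows "sensitive Y \<delta> \<mu> r R p\<^sub>1 p\<^sub>2 (map_pmf g \<Omega>)"
proof -
  have 1: "measure_pmf.prob (map_pmf g \<Omega>) {h. h x = h y} = measure_pmf.prob (map_pmf f \<Omega>) {h. h x = h y}"
    if "x \<in> Y" "y \<in> Y" for x y
    unfolding measure_map_pmf
    by (rule measure_pmf.finite_measure_eq_AE) (use eq that in \<open>auto simp: AE_measure_pmf_iff\<close>)
  have 2: "measure_pmf.prob (pair_pmf (map_pmf g \<Omega>) \<mu>) {(h, y). R < \<delta> x y \<and> h x = h y} =
    measure_pmf.prob (pair_pmf (map_pmf f \<Omega>) \<mu>) {(h, y). R < \<delta> x y \<and> h x = h y}" if "x \<in> Y" for x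
    unfolding pair_map_pmf1 measure_map_pmf
    by (rule measure_pmf.finite_measure_eq_AE)
      (use eq that assms(2) in \<open>auto simp: AE_measure_pmf_iff subset_iff\<close>)
  show ?thesis using assms(1) unfolding sensitive_def by (simp only: 1 2 cong: ball_cong) blast
qed

text \<open>Some final memory of the query exists, and its output is the value of any maintained
  function. So the memory alone fixes the hash function on the metric space.\<close>

lemma maintains_unique:
  assumes h: "maintains s d Query T h \<sigma>" "maintains s d Query T h' \<sigma>" and X: "X \<in> EMD_points s d"
  shows "h X = h' X"
proof -
  obtain xs where xs: "mset xs = X" using ex_mset by blast
  obtain \<tau>' where \<tau>': "\<tau>' \<in> set_pmf (final_memory T (query_input xs) Query \<sigma>)"
    using set_pmf_not_empty[of "final_memory T (query_input xs) Query \<sigma>"] by blast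
  have "hash_output \<tau>' = g X" if "maintains s d Query T g \<sigma>" for g
    using that \<tau>' X xs unfolding maintains_def by blast
  from this[OF h(1)] this[OF h(2)] show ?thesis by simp
qed

lemma emd_le_max:
  assumes "X \<in> EMD_points s d" "Y \<in> EMD_points s d"
  shows "emd X Y \<le> s * d"
proof -
  obtain M where M: "image_mset fst M = X" "emd X Y = (\<Sum>z\<in>#M. l1_dist (fst z) (snd z))"
    using emd_coupling[OF assms] by blast
  have "(\<Sum>z\<in>#M. l1_dist (fst z) (snd z)) \<le> (\<Sum>z\<in>#M. real d)"
  proof (rule sum_mset_mono)
    fix z assume "z \<in># M"
    then have "fst z \<in># X" using M by force
    then have "length (fst z) = d" using assms by (auto simp: EMD_points_def)
    moreover have "card {k. k < d \<and> fst z ! k \<noteq> snd z ! k} \<le> card {..<d}" by (intro card_mono) auto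
    ultimately show "l1_dist (fst z) (snd z) \<le> d" by (simp add: l1_dist_card)
  qed
  also have "\<dots> = s * d" using M(1) assms(1) by (auto simp: EMD_points_def)
  finally show ?thesis using M by simp
qed

text \<open>The hash function is known as a function of the random draws \<open>\<omega>\<close>,
  whereas \<open>H\<close> has to be a function of the memory, and different draws might lead to the
  same memory. Choosing any maintained function is harmless by \<open>maintains_unique\<close>, and
  values outside the metric space do not matter by \<open>sensitive_cong\<close>.\<close>

lemma data_dependent_hashingI:
  assumes "\<And>\<mu> zs. set_pmf \<mu> \<subseteq> EMD_points s d \<Longrightarrow> describes zs \<mu> \<Longrightarrow>
    \<exists>(\<Omega> :: 'o pmf) F g. run (init_input s d r p\<^sub>1 p\<^sub>2 zs) (TI (length zs)) (Init, empty_memory) = map_pmf (\<lambda>\<omega>. ([], F \<omega>)) \<Omega> \<and>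
      (\<forall>\<omega>\<in>set_pmf \<Omega>. maintains s d Query TQ (g \<omega>) (F \<omega>)) \<and>
      sensitive (EMD_points s d) emd \<mu> r (c * r) p\<^sub>1 p\<^sub>2 (map_pmf g \<Omega>)"
  shows "data_dependent_hashing s d r c p\<^sub>1 p\<^sub>2 Init Query TI TQ"
  unfolding data_dependent_hashing_def Let_def
proof (intro allI impI)
  fix \<mu> zs assume \<mu>: "set_pmf \<mu> \<subseteq> EMD_points s d \<and> describes zs \<mu>"
  let ?\<iota> = "init_input s d r p\<^sub>1 p\<^sub>2 zs" and ?T = "TI (length zs)"
  obtain \<Omega> :: "'o pmf" and F g where r: "run ?\<iota> ?T (Init, empty_memory) = map_pmf (\<lambda>\<omega>. ([], F \<omega>)) \<Omega>"
    and m: "\<And>\<omega>. \<omega> \<in> set_pmf \<Omega> \<Longrightarrow> maintains s d Query TQ (g \<omega>) (F \<omega>)"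
    and s: "sensitive (EMD_points s d) emd \<mu> r (c * r) p\<^sub>1 p\<^sub>2 (map_pmf g \<Omega>)"
    using assms \<mu> by blast
  define H where "H \<sigma> = (SOME h. maintains s d Query TQ h \<sigma>)" for \<sigma>
  have H: "maintains s d Query TQ (H (F \<omega>)) (F \<omega>)" if "\<omega> \<in> set_pmf \<Omega>" for \<omega>
    unfolding H_def by (rule someI[of "\<lambda>h. maintains s d Query TQ h (F \<omega>)", OF m[OF that]])
  have fm: "final_memory ?T ?\<iota> Init empty_memory = map_pmf F \<Omega>"
    unfolding final_memory_def r by (simp add: map_pmf_comp)
  have "sensitive (EMD_points s d) emd \<mu> r (c * r) p\<^sub>1 p\<^sub>2 (map_pmf (\<lambda>\<omega>. H (F \<omega>)) \<Omega>)"
    by (rule sensitive_cong[OF s]) (use \<mu> maintains_unique[OF H m] in auto)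
  then have "sensitive (EMD_points s d) emd \<mu> r (c * r) p\<^sub>1 p\<^sub>2 (map_pmf H (final_memory ?T ?\<iota> Init empty_memory))"
    unfolding fm by (simp add: map_pmf_comp)
  moreover have "halts_within ?T ?\<iota> Init empty_memory"
    unfolding halts_within_def r by auto
  moreover have "\<forall>\<sigma>\<in>set_pmf (final_memory ?T ?\<iota> Init empty_memory). maintains s d Query TQ (H \<sigma>) \<sigma>"
    unfolding fm using H by auto
  ultimately show "halts_within ?T ?\<iota> Init empty_memory \<and>
    (\<exists>H. (\<forall>\<sigma>\<in>set_pmf (final_memory ?T ?\<iota> Init empty_memory). maintains s d Query TQ (H \<sigma>) \<sigma>) \<and>
      sensitive (EMD_points s d) emd \<mu> r (c * r) p\<^sub>1 p\<^sub>2 (map_pmf H (final_memory ?T ?\<iota> Init empty_memory)))"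
    by blast
qed

lemma run_fill_fresh:
  assumes f: "0 < f" "f < 8" and l: "l \<notin> {20, 21, 60, 61}" "m \<notin> {20, 21, 60, 61}"
    and \<rho>: "\<rho> 2 = 1" "\<rho> l = a" "\<rho> m = b" and A: "A f = (\<lambda>_. 0)"
  shows "\<exists>R. (\<forall>h. same_except {20, 21, 60, 61} \<rho> (R h)) \<and> (\<forall>rest. run \<iota> (a * 9 + 2) (fill f l m @ rest, (mk \<rho> A, X)) =
    map_pmf (\<lambda>h. (rest, (mk (R h) (A(f := \<lambda>i. if i < a then h i else 0)), X))) (Pi_pmf {..<a} 0 (\<lambda>_. uniform_below b)))"
  by (rule run_fill[where f = f and l = l and m = m and \<rho> = \<rho> and \<iota> = \<iota> and A = A and X = X, OF f l \<rho>(1)]) (unfold \<rho> A, blast)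

section \<open>Running the initialization\<close>

context described
begin

lemma read_parameters_run:
  fixes r p\<^sub>1 p\<^sub>2 :: real
  defines "\<iota> \<equiv> init_input s d r p\<^sub>1 p\<^sub>2 zs"
  obtains t \<rho> X where "t \<le> 12" "\<And>rest. run \<iota> t (read_parameters @ rest, empty_memory) = return_pmf (rest, (mk \<rho> (\<lambda>_ _. 0), X))"
    "\<rho> 1 = 0" "\<rho> 2 = 1" "\<rho> 4 = s" "\<rho> 5 = d" "\<rho> 6 = n" "\<rho> 40 = 0"
    "X 0 = r" "X 1 = p\<^sub>1" "X 2 = p\<^sub>2" "X 3 = real s" "X 5 = real s * real d"
proof -
  note tapes = init_tapes(1-6)[of r p\<^sub>1 p\<^sub>2, folded \<iota>_def]
  have "wp \<iota> read_parameters (\<lambda>\<rho> A X \<tau>. A = (\<lambda>_ _. 0) \<and> \<tau> \<le> 12 \<and> \<rho> 1 = 0 \<and> \<rho> 2 = 1 \<and> \<rho> 4 = s \<and> \<rho> 5 = d \<and> \<rho> 6 = n \<and> \<rho> 40 = 0 \<and>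
    X 0 = r \<and> X 1 = p\<^sub>1 \<and> X 2 = p\<^sub>2 \<and> X 3 = real s \<and> X 5 = real s * real d) (\<lambda>_. 0) (\<lambda>_ _. 0) (\<lambda>_. 0) 0"
    unfolding read_parameters_def using tapes by (simp add: wp_nil)
  then show ?thesis using that unfolding wp_def mk_empty by fastforce
qed

lemma run_Init_trivial:
  fixes r p\<^sub>1 p\<^sub>2 :: real
  assumes "real s * real d \<le> r" "13 \<le> T"
  shows "\<exists>\<rho> A X. run (init_input s d r p\<^sub>1 p\<^sub>2 zs) T (Init, empty_memory) = return_pmf ([], (mk \<rho> A, X)) \<and> \<rho> 40 = 0"
proof -
  obtain t \<rho> X where t: "t \<le> 12" "\<And>rest. run (init_input s d r p\<^sub>1 p\<^sub>2 zs) t (read_parameters @ rest, empty_memory) = return_pmf (rest, (mk \<rho> (\<lambda>_ _. 0), X))"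
    and r: "\<rho> 40 = 0" "X 0 = r" "X 5 = real s * real d"
    using read_parameters_run[of r p\<^sub>1 p\<^sub>2] by metis
  have T: "T = t + Suc (T - t - 1)" using t assms(2) by simp
  have "run (init_input s d r p\<^sub>1 p\<^sub>2 zs) T (Init, empty_memory) = return_pmf ([], (mk \<rho> (\<lambda>_ _. 0), X))"
    unfolding Init_def by (subst T, subst run_add, subst t(2)) (use r assms(1) in \<open>simp add: bind_return_pmf run_halted\<close>)
  then show ?thesis using r by blast
qed

text \<open>All branching over random choices happens in the three fills; the code before and after
  them is deterministic once the draws are given. The run is therefore a nested bind over the draws,
  which is a map over their joint distribution \<open>\<Omega>\<close>.\<close>

lemma run_Init:
  fixes r p\<^sub>1 p\<^sub>2 :: real
  assumes p: "0 < p\<^sub>2" "p\<^sub>1 < 1" and r: "r < real s * real d"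
  defines "J \<equiv> blocks d" and "N \<equiv> 2 ^ levels s d p\<^sub>2" and "G \<equiv> 2 ^ rate s d r p\<^sub>1 p\<^sub>2"
  defines "W \<equiv> N * (J * d) * 2 * d * (s + 1)"
  defines "\<Omega> \<equiv> pair_pmf (Pi_pmf {..<J * d} 0 (\<lambda>_. uniform_below d))
    (pair_pmf (Pi_pmf {..<N} 0 (\<lambda>_. uniform_below (s * n * N))) (Pi_pmf {..<W} 0 (\<lambda>_. uniform_below G)))"
  assumes T: "n * (400 * W + 3 * rate s d r p\<^sub>1 p\<^sub>2) \<le> T"
  shows "\<exists>F. run (init_input s d r p\<^sub>1 p\<^sub>2 zs) T (Init, empty_memory) = map_pmf (\<lambda>\<omega>. ([], F \<omega>)) \<Omega> \<and>
    (\<forall>(u, h, \<tau>)\<in>set_pmf \<Omega>. \<exists>\<rho> A X. F (u, h, \<tau>) = (mk \<rho> A, X) \<and>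
       trie.qinv d N u (\<lambda>i. if i < N then vec N (h i) else []) s J \<rho> A \<and> trie.tinv d N s J \<tau> (A 1))"
proof -
  define \<iota> where "\<iota> = init_input s d r p\<^sub>1 p\<^sub>2 zs"
  define L where "L = levels s d p\<^sub>2"
  define g where "g = rate s d r p\<^sub>1 p\<^sub>2"
  have N: "0 < N" "N = 2 ^ L" and G: "G = 2 ^ g" and J: "1 \<le> J"
    using blocks_props(1)[of d] by (simp_all add: N_def L_def G_def g_def J_def)
  note tapes = init_tapes[where r = r and p\<^sub>1 = p\<^sub>1 and p\<^sub>2 = p\<^sub>2, folded \<iota>_def]
  obtain t1 \<rho>1 X1 where t1: "t1 \<le> 12" "\<And>rest. run \<iota> t1 (read_parameters @ rest, empty_memory) = return_pmf (rest, (mk \<rho>1 (\<lambda>_ _. 0), X1))"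
    and r1: "\<rho>1 1 = 0" "\<rho>1 2 = 1" "\<rho>1 4 = s" "\<rho>1 5 = d" "\<rho>1 6 = n"
      "X1 0 = r" "X1 1 = p\<^sub>1" "X1 2 = p\<^sub>2" "X1 3 = real s" "X1 5 = real s * real d"
    using read_parameters_run[of r p\<^sub>1 p\<^sub>2, folded \<iota>_def] by metis
  let ?c = "3 * J + 3 * d + 3 * (s + 1) + 6 * (d * (s + 1)) + 3 * n + 7 * L + 3 * g + 50"
  obtain t2 \<rho>2 X2 where t2: "t2 \<le> ?c"
    "\<And>rest. run \<iota> t2 (choose_sizes @ rest, (mk \<rho>1 (\<lambda>_ _. 0), X1)) = return_pmf (rest, (mk \<rho>2 (\<lambda>_ _. 0), X2))"
    and r2: "\<rho>2 6 = n * N" "\<rho>2 8 = J" "\<rho>2 9 = J * d" "\<rho>2 10 = s + 1" "\<rho>2 11 = d * (s + 1)" "\<rho>2 12 = 2 * (d * (s + 1))"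
      "\<rho>2 13 = W" "\<rho>2 14 = N" "\<rho>2 16 = s * n * N" "\<rho>2 18 = G"
    and s2: "same_except {6, 7, 8, 9, 10, 11, 12, 13, 14, 15, 16, 17, 18} \<rho>1 \<rho>2"
    using wp_choose_sizes[of n p\<^sub>2 p\<^sub>1 \<rho>1 s d X1 r \<iota> "\<lambda>_ _. 0" 0] n_pos p r1
    unfolding wp_def J_def[symmetric] N_def[symmetric] L_def[symmetric] g_def[symmetric] G[symmetric] N(2)[symmetric]
    unfolding W_def[symmetric] by auto
  have r2': "\<rho>2 1 = 0" "\<rho>2 2 = 1" "\<rho>2 4 = s" "\<rho>2 5 = d" using s2 r1 by (auto simp: same_except_def)
  let ?A1 = "\<lambda>u. (\<lambda>(_ :: nat) _. 0 :: nat)(2 := \<lambda>i. if i < J * d then u i else 0)"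
  let ?A2 = "\<lambda>u h. (?A1 u)(3 := \<lambda>i. if i < N then h i else 0)"
  let ?A3 = "\<lambda>u h \<tau>. (?A2 u h)(1 := \<lambda>i. if i < W then \<tau> i else 0)"
  let ?pU = "Pi_pmf {..<J * d} 0 (\<lambda>_. uniform_below d)"
  let ?pH = "Pi_pmf {..<N} 0 (\<lambda>_. uniform_below (s * n * N))"
  let ?pT = "Pi_pmf {..<W} 0 (\<lambda>_. uniform_below G)"
  let ?S = "{20, 21, 60, 61} :: nat set"
  obtain R1 where R1: "\<And>u. same_except ?S \<rho>2 (R1 u)"
    "\<And>rest. run \<iota> (J * d * 9 + 2) (fill 2 9 5 @ rest, (mk \<rho>2 (\<lambda>_ _. 0), X2)) =
      map_pmf (\<lambda>u. (rest, (mk (R1 u) (?A1 u), X2))) ?pU"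
    using run_fill_fresh[of 2 9 5 \<rho>2 "J * d" d "\<lambda>_ _. 0" \<iota> X2] r2 r2' by auto
  \<comment> \<open>The registers left behind by a fill are only known to exist. The choice made
    after this turns them into functions of the draws, so that the next fill can start from
    them.\<close>
  have "\<forall>u. \<exists>R. (\<forall>h. same_except ?S (R1 u) (R h)) \<and> (\<forall>rest. run \<iota> (N * 9 + 2) (fill 3 14 16 @ rest, (mk (R1 u) (?A1 u), X2)) =
      map_pmf (\<lambda>h. (rest, (mk (R h) (?A2 u h), X2))) ?pH)"
  proof
    fix u
    have "R1 u 14 = N" "R1 u 16 = s * n * N" "R1 u 2 = 1" using R1(1)[of u] r2 r2' by (auto simp: same_except_def)
    then show "\<exists>R. (\<forall>h. same_except ?S (R1 u) (R h)) \<and> (\<forall>rest. run \<iota> (N * 9 + 2) (fill 3 14 16 @ rest, (mk (R1 u) (?A1 u), X2)) =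
      map_pmf (\<lambda>h. (rest, (mk (R h) (?A2 u h), X2))) ?pH)"
      by (intro run_fill_fresh) auto
  qed
  from choice[OF this] obtain R2 where R2: "\<forall>u. (\<forall>h. same_except ?S (R1 u) (R2 u h)) \<and> (\<forall>rest. run \<iota> (N * 9 + 2) (fill 3 14 16 @ rest, (mk (R1 u) (?A1 u), X2)) =
      map_pmf (\<lambda>h. (rest, (mk (R2 u h) (?A2 u h), X2))) ?pH)" by (elim exE) (rule that)
  note R2 = R2[rule_format, THEN conjunct1, rule_format] R2[rule_format, THEN conjunct2, rule_format]

  have "\<forall>u h. \<exists>R. (\<forall>\<tau>. same_except ?S (R2 u h) (R \<tau>)) \<and> (\<forall>rest. run \<iota> (W * 9 + 2) (fill 1 13 18 @ rest, (mk (R2 u h) (?A2 u h), X2)) =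
      map_pmf (\<lambda>\<tau>. (rest, (mk (R \<tau>) (?A3 u h \<tau>), X2))) ?pT)"
  proof (intro allI)
    fix u h
    have "R2 u h 13 = W" "R2 u h 18 = G" "R2 u h 2 = 1" using R1(1)[of u] R2(1)[of u h] r2 r2' by (auto simp: same_except_def)
    then show "\<exists>R. (\<forall>\<tau>. same_except ?S (R2 u h) (R \<tau>)) \<and> (\<forall>rest. run \<iota> (W * 9 + 2) (fill 1 13 18 @ rest, (mk (R2 u h) (?A2 u h), X2)) =
      map_pmf (\<lambda>\<tau>. (rest, (mk (R \<tau>) (?A3 u h \<tau>), X2))) ?pT)"
      by (intro run_fill_fresh) auto
  qed
  from this[unfolded choice_iff] obtain R3 where R3: "\<forall>u h. (\<forall>\<tau>. same_except ?S (R2 u h) (R3 u h \<tau>)) \<and> (\<forall>rest. run \<iota> (W * 9 + 2) (fill 1 13 18 @ rest, (mk (R2 u h) (?A2 u h), X2)) =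
      map_pmf (\<lambda>\<tau>. (rest, (mk (R3 u h \<tau>) (?A3 u h \<tau>), X2))) ?pT)" by (elim exE) (rule that)
  note R3 = R3[rule_format, THEN conjunct1, rule_format] R3[rule_format, THEN conjunct2, rule_format]

  define TB where "TB = 20 * W + N * (9 * (s * n) + 15 * d + J * (50 * d + 9) + 60) + 30"
  define t where "t = t1 + (1 + (t2 + ((J * d * 9 + 2) + ((N * 9 + 2) + (W * 9 + 2)))))"
  define good where "good \<omega> \<sigma> \<longleftrightarrow> (case \<omega> of (u, h, \<tau>) \<Rightarrow> \<exists>\<rho> A X. \<sigma> = (mk \<rho> A, X) \<and>
       trie.qinv d N u (\<lambda>i. if i < N then vec N (h i) else []) s J \<rho> A \<and> trie.tinv d N s J \<tau> (A 1))" for \<omega> and \<sigma> :: memory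
  \<comment> \<open>Every size that occurs is at most the size \<open>W\<close> of the table, apart
    from the factor \<open>n\<close> in the scans, so \<open>n * W\<close> and the number of
    doublings for \<open>G\<close> absorb the whole time.\<close>
  have tTB: "t + TB \<le> T"
  proof -
    have pos: "1 \<le> N" "1 \<le> J" "1 \<le> d" "1 \<le> s" "1 \<le> n" using N J d s n_pos by simp_all
    have le: "a \<le> a * b" if "1 \<le> b" for a b :: nat using that by simp
    have W: "W = 2 * (N * J * d * d * (s + 1))" by (simp add: W_def)
    have "0 < W" using pos unfolding W by simp
    then have dvd_le: "a \<le> W" if "W = a * k" for a k using that by (cases k) auto
    have w1: "d * (s + 1) \<le> W" by (rule dvd_le[of _ "2 * N * J * d"]) (simp add: W algebra_simps)
    have w2: "N * (J * d) \<le> W" by (rule dvd_le[of _ "2 * d * (s + 1)"]) (simp add: W algebra_simps)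
    have w3: "N * (s + 1) \<le> W" by (rule dvd_le[of _ "2 * J * d * d"]) (simp add: W algebra_simps)
    have w4: "N * d \<le> N * (J * d)" "N * J \<le> N * (J * d)" "J * d \<le> N * (J * d)" "N \<le> N * d" "J \<le> N * J" "d \<le> N * d"
      "N * s \<le> N * (s + 1)" using pos by simp_all
    have w5: "s + 1 \<le> d * (s + 1)" using le[of d "s + 1"] pos by (simp add: mult.commute)
    have w: "1 \<le> W" "J \<le> W" "d \<le> W" "s + 1 \<le> W" "d * (s + 1) \<le> W" "N \<le> W" "J * d \<le> W" "N * d \<le> W" "N * J \<le> W" "N * (J * d) \<le> W" "N * s \<le> W"
      using w1 w2 w3 w4 w5 pos by linarith+
    have LW: "L \<le> W" using w(6) less_exp[of L] unfolding N(2) by linarith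
    have nW: "n \<le> n * W" "W \<le> n * W" "g \<le> n * g" "1 \<le> n * W" using pos w(1) by simp_all
    have sn: "N * (s * n) \<le> n * W" using mult_le_mono2[OF w(11), of n] by (simp add: mult_ac)
    have TBe: "TB = 20 * W + (9 * (N * (s * n)) + 15 * (N * d) + 50 * (N * (J * d)) + 9 * (N * J) + 60 * N) + 30"
      by (simp add: TB_def algebra_simps)
    have "t + TB \<le> 400 * (n * W) + 3 * (n * g)"
    proof -
      have t2: "t2 \<le> 22 * W + 3 * n + 3 * g + 50"
      proof -
        define e where "e = s + 1"
        show ?thesis using t2(1) w(2-5) LW unfolding e_def[symmetric] by linarith
      qed
      have "15 * (N * d) + 50 * (N * (J * d)) + 9 * (N * J) + 60 * N \<le> 134 * W" using w(6,8,9,10) by linarith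
      moreover have "J * d * 9 + N * 9 \<le> 18 * W" using w(6,7) by linarith
      ultimately have "t + TB \<le> 203 * W + 9 * (N * (s * n)) + 3 * n + 3 * g + 99"
        unfolding t_def TBe using t1(1) t2 by linarith
      moreover have "203 * W + 9 * (N * (s * n)) + 3 * n \<le> 215 * (n * W)" using nW(1,2) sn by linarith
      ultimately show ?thesis using nW(3,4) by linarith
    qed
    then show ?thesis using T by (simp add: g_def algebra_simps)
  qed
  have build: "\<forall>\<omega>\<in>set_pmf \<Omega>. \<exists>\<sigma>. run \<iota> (T - t) (build, (case \<omega> of (u, h, \<tau>) \<Rightarrow> (mk (R3 u h \<tau>) (?A3 u h \<tau>), X2))) = return_pmf ([], \<sigma>) \<and> good \<omega> \<sigma>"
  proof
    fix \<omega> assume "\<omega> \<in> set_pmf \<Omega>"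
    then obtain u h \<tau> where \<omega>: "\<omega> = (u, h, \<tau>)" "h \<in> set_pmf ?pH" by (auto simp: \<Omega>_def)
    let ?b = "\<lambda>i. if i < N then vec N (h i) else []"
    let ?\<rho> = "R3 u h \<tau>" and ?A = "?A3 u h \<tau>"
    have h: "h i < s * n * N" if "i < N" for i
    proof -
      have "h i \<in> set_pmf (uniform_below (s * n * N))" using \<omega>(2) that by (auto simp: set_Pi_pmf PiE_dflt_def)
      then show ?thesis by (simp add: set_uniform[OF N(1)])
    qed
    have \<rho>: "?\<rho> i = \<rho>2 i" if "i \<notin> ?S" for i
      using same_exceptD[OF R1(1) that] same_exceptD[OF R2(1) that] same_exceptD[OF R3(1) that] by simp
    have ok: "trie.samples_ok d N ?b \<iota> w s (real (?\<rho> 6)) (s * n) (?A 3)"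
      unfolding trie.samples_ok_def
    proof (intro allI impI conjI)
      fix i assume i: "i < N"
      have q: "real (?\<rho> 6) = q N" using \<rho>[of 6] r2 by (simp add: q_def[OF N(1)])
      have Ai: "?A 3 i = h i" using i by simp
      show "real (?A 3 i + 1) \<le> cum w s (real (?\<rho> 6)) (s * n)"
        unfolding q Ai by (rule cum_ge[OF N(1) h[OF i]])
      fix k assume k: "k < d"
      have "pick w s (q N) (h i) - 1 < s * n" using pick_props(1,2)[OF N(1) h[OF i]] by simp
      then show "tape (fst \<iota>) (3 + (pick w s (real (?\<rho> 6)) (?A 3 i) - 1) * d + k) = of_bool (?b i ! k)"
        unfolding q Ai using tapes(8)[OF _ k] i by (simp add: vec_def[OF N(1)])
    qed
    have wp: "wp \<iota> build (\<lambda>\<rho>' A' X' \<tau>'. trie.qinv d N u ?b s J \<rho>' A' \<and>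
       A' 1 = (\<lambda>i. if i < ?\<rho> 13 then (if ?A 1 i = 0 then 2 ^ i else 0) else ?A 1 i) \<and>
       \<tau>' \<le> 0 + 20 * ?\<rho> 13 + N * trie.sample_time d J (s * n) + 30) ?\<rho> ?A X2 0"
    proof (rule trie.wp_build[where w = w])
      show "?\<rho> 1 = 0" "?\<rho> 2 = 1" "?\<rho> 4 = s" "?\<rho> 5 = d" "?\<rho> 8 = J" "?\<rho> 10 = s + 1" "?\<rho> 11 = d * (s + 1)"
        "?\<rho> 12 = 2 * (d * (s + 1))" "?\<rho> 14 = N"
        using \<rho> r2 r2' by simp_all
      show "tape (snd \<iota>) (3 + z) = w z" for z by (rule tapes(7))
      show "trie.samples_ok d N ?b \<iota> w s (real (?\<rho> 6)) (s * n) (?A 3)" by (rule ok)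
    qed (use s d in auto)
    have W13: "?\<rho> 13 = W" using \<rho>[of 13] r2 by simp
    obtain \<rho>' A' X' \<tau>' where fin: "run \<iota> (T - t) (build, (mk ?\<rho> ?A, X2)) = return_pmf ([], (mk \<rho>' A', X'))"
      "trie.qinv d N u ?b s J \<rho>' A'" "A' 1 = (\<lambda>i. if i < ?\<rho> 13 then (if ?A 1 i = 0 then 2 ^ i else 0) else ?A 1 i)"
    proof (rule wp_halts[OF wp, of "T - t"])
      fix \<rho>' A' X' \<tau>'
      assume "trie.qinv d N u ?b s J \<rho>' A' \<and>
       A' 1 = (\<lambda>i. if i < ?\<rho> 13 then (if ?A 1 i = 0 then 2 ^ i else 0) else ?A 1 i) \<and>
       \<tau>' \<le> 0 + 20 * ?\<rho> 13 + N * trie.sample_time d J (s * n) + 30"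
      then have "\<tau>' \<le> TB" using W13 by (simp add: TB_def trie.sample_time_def)
      then show "\<tau>' \<le> T - t" using tTB by linarith
    qed blast
    have "trie.tinv d N s J \<tau> (A' 1)"
      unfolding trie.tinv_def fin(3) W13 W_def[symmetric] by simp
    then show "\<exists>\<sigma>. run \<iota> (T - t) (build, (case \<omega> of (u, h, \<tau>) \<Rightarrow> (mk (R3 u h \<tau>) (?A3 u h \<tau>), X2))) = return_pmf ([], \<sigma>) \<and> good \<omega> \<sigma>"
      unfolding \<omega> good_def prod.case
      by (intro exI[of _ "(mk \<rho>' A', X')"] conjI fin(1) exI[of _ \<rho>'] exI[of _ A'] exI[of _ X'] fin(2) refl)
  qed
  from bchoice[OF build] obtain F where F: "\<forall>\<omega>\<in>set_pmf \<Omega>.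
      run \<iota> (T - t) (build, (case \<omega> of (u, h, \<tau>) \<Rightarrow> (mk (R3 u h \<tau>) (?A3 u h \<tau>), X2))) = return_pmf ([], F \<omega>) \<and> good \<omega> (F \<omega>)"
    by (elim exE) (rule that)
  note F = F[rule_format, THEN conjunct1] F[rule_format, THEN conjunct2]
  let ?main = "choose_sizes @ fill 2 9 5 @ fill 3 14 16 @ fill 1 13 18 @ build"
  have Teq: "T = t1 + (1 + (t2 + ((J * d * 9 + 2) + ((N * 9 + 2) + ((W * 9 + 2) + (T - t))))))"
    using tTB unfolding t_def by linarith
  have If: "run \<iota> 1 ([If (RLess 0 5) ?main []], (mk \<rho>1 (\<lambda>_ _. 0), X1)) = return_pmf (?main, (mk \<rho>1 (\<lambda>_ _. 0), X1))"
    using r r1 by (simp add: bind_return_pmf)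
  have "run \<iota> T (Init, empty_memory) = bind_pmf ?pU (\<lambda>u. bind_pmf ?pH (\<lambda>h. bind_pmf ?pT (\<lambda>\<tau>. run \<iota> (T - t) (build, (mk (R3 u h \<tau>) (?A3 u h \<tau>), X2)))))"
    unfolding Init_def
    by (subst Teq, subst run_add, subst t1(2), unfold bind_return_pmf, subst run_add, subst If, unfold bind_return_pmf,
        subst run_add, subst t2(2), unfold bind_return_pmf, subst run_add, subst R1(2), unfold bind_map_pmf,
        subst run_add, subst R2(2), unfold bind_map_pmf, subst run_add, subst R3(2), unfold bind_map_pmf, rule refl)
  also have "\<dots> = bind_pmf \<Omega> (\<lambda>\<omega>. run \<iota> (T - t) (build, (case \<omega> of (u, h, \<tau>) \<Rightarrow> (mk (R3 u h \<tau>) (?A3 u h \<tau>), X2))))"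
    unfolding \<Omega>_def pair_pmf_def by (simp only: bind_assoc_pmf bind_return_pmf prod.case)
  also have "\<dots> = bind_pmf \<Omega> (\<lambda>\<omega>. return_pmf ([], F \<omega>))"
    by (rule bind_pmf_cong[OF refl]) (rule F(1))
  finally have "run \<iota> T (Init, empty_memory) = map_pmf (\<lambda>\<omega>. ([], F \<omega>)) \<Omega>" by (simp only: map_pmf_def)
  then show ?thesis using F(2) unfolding \<iota>_def good_def by (intro exI[of _ F]) (auto split: prod.splits)
qed

end

section \<open>Bounds on the parameters\<close>

lemma blocks_le_square: "1 \<le> d \<Longrightarrow> blocks d * d + 1 \<le> 3 * d\<^sup>2"
proof -
  assume d: "1 \<le> d"
  have "blocks d * d \<le> (d + 1) * d" by (rule mult_le_mono1) (rule blocks_props(3))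
  then have "blocks d * d \<le> d * d + d" by simp
  moreover have "d \<le> d * d" using d by simp
  ultimately show ?thesis using d unfolding power2_eq_square by linarith
qed

text \<open>The lower bounds come from the defining inequality of \<open>levels\<close>, the upper
  bound from its minimality: half of \<open>2 ^ L\<close> fails the inequality, and the threshold is
  at most \<open>12 * (s * d)\<^sup>2\<close> by \<open>blocks_le_square\<close>.\<close>

lemma levels_props:
  fixes s d :: nat and p :: real
  assumes s: "1 \<le> s" and d: "1 \<le> d" and p: "0 < p" "p < 1"
  defines "L \<equiv> levels s d p"
  shows "4 * real s ^ 2 * (blocks d * d + 1) \<le> 2 ^ L * p" "1 \<le> L" "2 ^ L \<le> 24 * (real s * real d / p)\<^sup>2"
    "25 * real (blocks d) + 8 + 48 * ln (1 + 2 ^ L) \<le> 256 * real L"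
proof -
  define M where "M = 4 * real s ^ 2 * (blocks d * d + 1)"
  have J: "1 \<le> blocks d" by (rule blocks_props(1))
  have s2: "1 \<le> real s ^ 2" using s by simp
  have M: "M \<le> 2 ^ L * p"
    unfolding M_def L_def levels_def by (rule LeastI_ex) (rule ex_power_ge[OF p(1)])
  then show "4 * real s ^ 2 * (blocks d * d + 1) \<le> 2 ^ L * p" by (simp add: M_def)
  have "(1 :: real) \<le> real (blocks d * d)" using J d by (metis One_nat_def mult_le_mono nat_mult_1 of_nat_1 of_nat_mono)
  define K where "K = real (blocks d * d + 1)"
  have "2 \<le> K" using \<open>1 \<le> real (blocks d * d)\<close> by (simp add: K_def)
  moreover have "1 * K \<le> real s ^ 2 * K" using s2 by (intro mult_right_mono) (simp_all add: K_def)
  moreover have "M = 4 * (real s ^ 2 * K)" by (simp add: M_def K_def)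
  ultimately have Jd: "4 * real (blocks d * d + 1) \<le> M" "8 \<le> M" unfolding K_def[symmetric] by linarith+
  have "2 ^ L * p \<le> 2 ^ L * 1" using p by (intro mult_left_mono) auto
  then have M_le: "M \<le> 2 ^ L" using M by linarith
  show L1: "1 \<le> L" by (cases L) (use M_le Jd(2) in auto)
  have "\<not> M \<le> 2 ^ (L - 1) * p"
    unfolding M_def L_def levels_def by (rule not_less_Least) (use L1 in \<open>simp add: L_def levels_def\<close>)
  moreover have "(2 :: real) ^ L = 2 * 2 ^ (L - 1)" using L1 by (cases L) simp_all
  ultimately have upper: "2 ^ L * p \<le> 2 * M" by simp
  have "M \<le> 4 * real s ^ 2 * (3 * real d ^ 2)"
    unfolding M_def using blocks_le_square[OF d]
    by (intro mult_left_mono) (metis of_nat_le_iff of_nat_mult of_nat_numeral of_nat_power, simp)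
  then have "2 ^ L * p \<le> 24 * (real s * real d)\<^sup>2" using upper by (simp add: power_mult_distrib)
  then have "2 ^ L \<le> 24 * (real s * real d)\<^sup>2 / p" using p by (simp add: field_simps)
  also have "\<dots> \<le> 24 * (real s * real d)\<^sup>2 / p\<^sup>2"
    using p by (intro divide_left_mono) (auto simp: power2_eq_square mult_le_one)
  finally show "2 ^ L \<le> 24 * (real s * real d / p)\<^sup>2" by (simp add: power_divide)
  \<comment> \<open>Minimality of \<open>blocks\<close> gives \<open>2 ^ blocks d < 4 * d\<close>,
    and \<open>4 * d\<close> is below the threshold that \<open>2 ^ L\<close> exceeds.\<close>
  have JL: "blocks d \<le> L"
  proof (cases "blocks d = 1")
    case False
    then have J2: "2 \<le> blocks d" using J by simp
    then have "blocks d = Suc (Suc (blocks d - 2))" by simp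
    then have "(2 :: real) ^ blocks d = 2 ^ Suc (Suc (blocks d - 2))" by (rule arg_cong)
    also have "\<dots> = 4 * real (2 ^ (blocks d - 2))" by simp
    also have "\<dots> < 4 * real d"
      using blocks_props(4)[OF J2] unfolding of_nat_less_iff[where 'a = real, symmetric] by linarith
    also have "\<dots> \<le> 4 * real (blocks d * d + 1)"
      using mult_le_mono1[OF J, of d] by (intro mult_left_mono of_nat_mono) linarith+
    also have "\<dots> \<le> 2 ^ L" using Jd M_le by simp
    finally have "blocks d < L" by simp
    then show ?thesis by simp
  qed (use L1 in simp)
  have "(1 :: real) \<le> 2 ^ L" by simp
  then have "ln (1 + 2 ^ L :: real) \<le> ln (2 ^ (L + 1))" by (subst ln_le_cancel_iff) (simp_all add: add_pos_pos)
  also have "\<dots> = (real L + 1) * ln 2" by (subst ln_realpow) simp_all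
  \<comment> \<open>With this bound on \<open>ln 2\<close>, with \<open>blocks d \<le> L\<close> and
    \<open>1 \<le> L\<close>, the left side of the claim is below \<open>100 * L\<close>; the factor
    256 is a larger power of two.\<close>
  also have "\<dots> \<le> (real L + 1) * (25 / 36)" using ln2_le_25_over_36 by (intro mult_left_mono) auto
  finally show "25 * real (blocks d) + 8 + 48 * ln (1 + 2 ^ L) \<le> 256 * real L" using JL L1 by (simp add: field_simps)
qed

text \<open>From \<open>2 ^ L \<le> 32 * y\<^sup>2\<close> one gets
  \<open>L * ln 2 \<le> 5 * ln 2 + 2 * ln y \<le> 7 * ln y\<close>, using \<open>y \<ge> 2\<close>.
  Dividing by \<open>ln 2 \<ge> 2 / 3\<close> gives the factor \<open>21 / 2\<close>, rounded up to
  11.\<close>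

lemma levels_le_ln:
  fixes s d :: nat and p :: real
  assumes "1 \<le> s" "1 \<le> d" "0 < p" "p < 1" and y: "2 \<le> real s * real d / p"
  shows "real (levels s d p) \<le> 11 * ln (real s * real d / p)"
proof -
  define y where "y = real s * real d / p"
  have "real (levels s d p) * ln 2 = ln (2 ^ levels s d p)" by (subst ln_realpow) simp_all
  also have "\<dots> \<le> ln (2 ^ 5 * y\<^sup>2)"
    using levels_props(3)[OF assms(1-4)] y unfolding y_def[symmetric]
    by (subst ln_le_cancel_iff) (auto intro: order_trans[where y = "24 * y\<^sup>2"])
  also have "\<dots> = 5 * ln 2 + 2 * ln y"
    using y unfolding y_def[symmetric] by (subst ln_mult) (simp_all add: ln_realpow del: power_numeral)
  also have "\<dots> \<le> 7 * ln y" using y unfolding y_def[symmetric] by simp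
  finally have "real (levels s d p) * ln 2 \<le> 7 * ln y" .
  moreover have "real (levels s d p) * (2 / 3) \<le> real (levels s d p) * ln 2"
    using ln2_ge_two_thirds by (intro mult_left_mono) auto
  moreover have "0 \<le> ln y" using y unfolding y_def[symmetric] by simp
  ultimately show ?thesis unfolding y_def by linarith
qed

text \<open>The upper bound is minimality at \<open>g - 1\<close>, which requires
  \<open>g \<noteq> 0\<close>: this holds because the threshold is at least 256 while
  \<open>1 - p\<^sub>1 < 1\<close>.\<close>

lemma rate_props:
  fixes r p\<^sub>1 p\<^sub>2 :: real
  assumes "p\<^sub>1 < 1" "0 < p\<^sub>1" "1 \<le> r" "1 \<le> levels s d p\<^sub>2"
  defines "g \<equiv> rate s d r p\<^sub>1 p\<^sub>2"
  shows "256 * r * levels s d p\<^sub>2 \<le> 2 ^ g * (1 - p\<^sub>1)" "2 ^ g * (1 - p\<^sub>1) \<le> 512 * r * levels s d p\<^sub>2"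
proof -
  let ?M = "256 * r * levels s d p\<^sub>2"
  show M: "?M \<le> 2 ^ g * (1 - p\<^sub>1)"
    unfolding g_def rate_def by (rule LeastI_ex) (use ex_power_ge[of "1 - p\<^sub>1"] assms(1) in simp)
  have "1 \<le> r * levels s d p\<^sub>2" using assms(3,4) by (metis mult_mono of_nat_1 of_nat_mono mult_1 zero_le_one order_trans)
  moreover have "256 * (r * levels s d p\<^sub>2) \<le> 1 - p\<^sub>1" if "g = 0" using M that by simp
  ultimately have "g \<noteq> 0" using assms(2) by fastforce
  then have g: "1 \<le> g" by simp
  have "\<not> ?M \<le> 2 ^ (g - 1) * (1 - p\<^sub>1)"
    unfolding g_def rate_def by (rule not_less_Least) (use g in \<open>simp add: g_def rate_def\<close>)
  moreover have "(2 :: real) ^ g = 2 * 2 ^ (g - 1)" using g by (cases g) simp_all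
  ultimately show "2 ^ g * (1 - p\<^sub>1) \<le> 512 * r * levels s d p\<^sub>2" by (simp only: mult.assoc not_le)
qed

text \<open>The logarithmic factor is at least 1; the construction attains the bound on
  \<open>c\<close> without it.\<close>

lemma soft_O_bound_ge:
  assumes "c \<le> C * max 1 f" "0 \<le> C"
  shows "c \<le> soft_O_bound C k f"
proof -
  have "C * max 1 f * 1 \<le> C * max 1 f * (1 + ln (max 1 f)) ^ k"
    using assms(2) by (intro mult_left_mono one_le_power) auto
  then show ?thesis using assms(1) by (simp add: soft_O_bound_def)
qed

section \<open>Assembling the data structure\<close>

text \<open>No two points are farther apart than \<open>s * d \<le> r\<close>, so a constant hash
  function satisfies both requirements even with \<open>c = 1\<close>.\<close>

lemma trivial_hashing:
  assumes sd: "1 \<le> s" "1 \<le> d" and p: "p\<^sub>1 < 1" "0 < p\<^sub>2" and r: "real s * real d \<le> r"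
    and T: "50 \<le> TQ" "\<And>n. 1 \<le> n \<Longrightarrow> 13 \<le> TI n"
  shows "data_dependent_hashing s d r 1 p\<^sub>1 p\<^sub>2 Init Query TI TQ"
proof (rule data_dependent_hashingI)
  fix \<mu> zs assume \<mu>: "set_pmf \<mu> \<subseteq> EMD_points s d" "describes zs \<mu>"
  interpret described s d \<mu> zs by unfold_locales (use sd \<mu> in auto)
  have len: "1 \<le> length zs" using n_pos unfolding n_def by linarith
  obtain \<rho> A X where 1: "run (init_input s d r p\<^sub>1 p\<^sub>2 zs) (TI (length zs)) (Init, empty_memory) = return_pmf ([], (mk \<rho> A, X))" "\<rho> 40 = 0"
    using run_Init_trivial[OF r T(2)[OF len]] by blast
  have "{(h :: point \<Rightarrow> nat, y). r < emd x y \<and> h x = h y} \<inter> set_pmf (pair_pmf (return_pmf (\<lambda>_. 0)) \<mu>) = {}" if "x \<in> EMD_points s d" for x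
    using emd_le_max[OF that] \<mu>(1) r by fastforce
  then have far: "measure_pmf.prob (pair_pmf (return_pmf (\<lambda>_. 0 :: nat)) \<mu>) {(h, y). r < emd x y \<and> h x = h y} = 0"
    if "x \<in> EMD_points s d" for x
    using that by (subst measure_Int_set_pmf[symmetric]) simp
  have sens: "sensitive (EMD_points s d) emd \<mu> r r p\<^sub>1 p\<^sub>2 (return_pmf (\<lambda>_. 0 :: nat))"
    unfolding sensitive_def
  proof (intro conjI ballI impI)
    fix x :: point assume "x \<in> EMD_points s d"
    from far[OF this] show "measure_pmf.prob (pair_pmf (return_pmf (\<lambda>_. 0 :: nat)) \<mu>) {(h, y). r < emd x y \<and> h x = h y} \<le> p\<^sub>2"
      using p(2) by linarith
  qed (use p in simp)
  show "\<exists>(\<Omega> :: unit pmf) F g. run (init_input s d r p\<^sub>1 p\<^sub>2 zs) (TI (length zs)) (Init, empty_memory) = map_pmf (\<lambda>\<omega>. ([], F \<omega>)) \<Omega> \<and>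
      (\<forall>\<omega>\<in>set_pmf \<Omega>. maintains s d Query TQ (g \<omega>) (F \<omega>)) \<and>
      sensitive (EMD_points s d) emd \<mu> r (1 * r) p\<^sub>1 p\<^sub>2 (map_pmf g \<Omega>)"
  proof (intro exI conjI)
    show "run (init_input s d r p\<^sub>1 p\<^sub>2 zs) (TI (length zs)) (Init, empty_memory) =
      map_pmf (\<lambda>_. ([], (mk \<rho> A, X))) (return_pmf ())" using 1 by simp
    show "\<forall>\<omega>\<in>set_pmf (return_pmf ()). maintains s d Query TQ (\<lambda>_. 0) (mk \<rho> A, X)"
      using maintains_trivial[of \<rho> TQ s d A X] 1(2) T(1) by simp
    show "sensitive (EMD_points s d) emd \<mu> r (1 * r) p\<^sub>1 p\<^sub>2 (map_pmf (\<lambda>_ _. 0 :: nat) (return_pmf ()))"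
      using sens by simp
  qed
qed

lemma trie_data_structure:
  fixes r p\<^sub>1 p\<^sub>2 c :: real
  assumes sd: "1 \<le> s" "1 \<le> d" and p: "0 < p\<^sub>2" "p\<^sub>2 < p\<^sub>1" "p\<^sub>1 < 1" and r: "1 \<le> r" "r < real s * real d"
  defines "J \<equiv> blocks d" and "N \<equiv> (2 :: nat) ^ levels s d p\<^sub>2" and "G \<equiv> (2 :: nat) ^ rate s d r p\<^sub>1 p\<^sub>2"
  assumes TQ: "2 * (s * trie.vector_time d J) + 20 \<le> TQ"
    and TI: "\<And>n. n * (400 * (N * (J * d) * 2 * d * (s + 1)) + 3 * rate s d r p\<^sub>1 p\<^sub>2) \<le> TI n"
    and c: "2 * ln (1 / p\<^sub>2) * G \<le> c * r"
  shows "data_dependent_hashing s d r c p\<^sub>1 p\<^sub>2 Init Query TI TQ"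
proof (rule data_dependent_hashingI)
  fix \<mu> zs assume \<mu>: "set_pmf \<mu> \<subseteq> EMD_points s d" "describes zs \<mu>"
  interpret described s d \<mu> zs by unfold_locales (use sd \<mu> in auto)
  let ?W = "N * (J * d) * 2 * d * (s + 1)" and ?L = "levels s d p\<^sub>2"
  let ?bv = "\<lambda>h i. if i < N then vec N (h i) else []"
  have N: "0 < N" and G: "0 < G" by (simp_all add: N_def G_def)
  have p2: "p\<^sub>2 < 1" using p by simp
  note L = levels_props[OF sd p(1) p2]
  note R = rate_props[OF p(3) _ r(1) L(2)]
  interpret H: trie_hashing d N J "\<nu> N" s G \<mu>
    by unfold_locales
      (use sd(2) N G blocks_props(1,2)[of d] finite_set_\<nu>[OF N] length_\<nu>[OF N] finite_set_\<mu> \<mu>(1) sampler_approx[OF N] in \<open>auto simp: J_def\<close>)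
  let ?pH = "Pi_pmf {..<N} 0 (\<lambda>_. uniform_below (s * n * N))"
  let ?\<Omega> = "pair_pmf H.U (pair_pmf ?pH H.T)"
  obtain F where F: "run (init_input s d r p\<^sub>1 p\<^sub>2 zs) (TI (length zs)) (Init, empty_memory) = map_pmf (\<lambda>\<omega>. ([], F \<omega>)) ?\<Omega>"
    "\<forall>(u, h, \<tau>)\<in>set_pmf ?\<Omega>. \<exists>\<rho> A X. F (u, h, \<tau>) = (mk \<rho> A, X) \<and>
       trie.qinv d N u (?bv h) s J \<rho> A \<and> trie.tinv d N s J \<tau> (A 1)"
    using run_Init[OF p(1,3) r(2), folded J_def N_def G_def] TI[of "length zs"]
    unfolding H.U_def H.T_def n_def[symmetric] by blast
  let ?g = "\<lambda>(u, h, \<tau>). trie.hash d N u (?bv h) s J \<tau>"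
  \<comment> \<open>The machine draws integers and the family draws samples; \<open>Pi_vec\<close>
    identifies the distributions.\<close>
  have "H.family = map_pmf ?g ?\<Omega>"
    unfolding H.family_def H.B_def Pi_vec[OF N] pair_map_pmf1 pair_map_pmf2 map_pmf_comp
    by (rule map_pmf_cong[OF refl]) (auto split: prod.splits)
  moreover have "sensitive (EMD_points s d) emd \<mu> r (c * r) p\<^sub>1 p\<^sub>2 H.family"
  proof (rule H.sensitive_family[OF p(1) p2 _ _ c])
    have "r * (25 * real J + 8 + 48 * ln (1 + real N)) \<le> r * (256 * real ?L)"
      using L(4) r(1) by (intro mult_left_mono) (simp_all add: J_def N_def)
    also have "\<dots> \<le> G * (1 - p\<^sub>1)" using R(1) p by (simp add: G_def mult_ac)
    finally show "r * (25 * J + 8 + 48 * ln (1 + N)) \<le> G * (1 - p\<^sub>1)" by simp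
    show "4 * s\<^sup>2 * (J * d + 1) \<le> N * p\<^sub>2" using L(1) by (simp add: J_def N_def algebra_simps)
  qed
  moreover have "maintains s d Query TQ (?g \<omega>) (F \<omega>)" if "\<omega> \<in> set_pmf ?\<Omega>" for \<omega>
  proof -
    obtain u h \<tau> where \<omega>: "\<omega> = (u, h, \<tau>)" by (cases \<omega>) auto
    from F(2) that obtain \<rho> A X where "F \<omega> = (mk \<rho> A, X)" "trie.qinv d N u (?bv h) s J \<rho> A" "trie.tinv d N s J \<tau> (A 1)"
      unfolding \<omega> by fast
    then show ?thesis using trie.maintains_hash[OF _ _ _ TQ] d unfolding \<omega> by simp
  qed
  ultimately show "\<exists>(\<Omega> :: ((nat \<Rightarrow> nat) \<times> (nat \<Rightarrow> nat) \<times> (nat \<Rightarrow> nat)) pmf) F g.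
      run (init_input s d r p\<^sub>1 p\<^sub>2 zs) (TI (length zs)) (Init, empty_memory) = map_pmf (\<lambda>\<omega>. ([], F \<omega>)) \<Omega> \<and>
      (\<forall>\<omega>\<in>set_pmf \<Omega>. maintains s d Query TQ (g \<omega>) (F \<omega>)) \<and>
      sensitive (EMD_points s d) emd \<mu> r (c * r) p\<^sub>1 p\<^sub>2 (map_pmf g \<Omega>)"
    using F(1) by (intro exI[of _ ?\<Omega>] exI[of _ F] exI[of _ ?g]) auto
qed

lemma query_time_le:
  assumes "1 \<le> s" "1 \<le> d"
  shows "real (2 * (s * trie.vector_time d (blocks d)) + 70) \<le> poly_bound 200000 5 (real (s * d))"
proof -
  have sd: "1 \<le> s * d" using assms by simp
  have "trie.vector_time d (blocks d) \<le> (2 * d) * (90 * d + 31) + 12 * d + 31"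
    unfolding trie.vector_time_def using blocks_props(3)[of d] assms(2) by (intro add_mono mult_le_mono) auto
  also have "\<dots> \<le> 285 * (d * d)"
  proof -
    have "d \<le> d * d" "1 \<le> d * d" using assms(2) by simp_all
    moreover have "2 * d * (90 * d + 31) = 180 * (d * d) + 62 * d" by (simp add: algebra_simps)
    ultimately show ?thesis by linarith
  qed
  finally have "s * trie.vector_time d (blocks d) \<le> s * (285 * (d * d))" by (rule mult_le_mono2)
  also have "\<dots> \<le> 285 * ((s * d) * (s * d))"
    using assms(1) by (simp add: mult_ac)
  finally have "2 * (s * trie.vector_time d (blocks d)) + 70 \<le> 640 * (s * d)\<^sup>2"
    using mult_le_mono[OF sd sd] unfolding power2_eq_square by linarith
  also have "\<dots> \<le> 200000 * (s * d) ^ 5"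
    using sd by (intro mult_le_mono power_increasing) auto
  finally have "real (2 * (s * trie.vector_time d (blocks d)) + 70) \<le> real (200000 * (s * d) ^ 5)" by (rule of_nat_mono)
  then show ?thesis by (simp add: poly_bound_def)
qed

text \<open>The exponent 5 arises as follows: \<open>N\<close> contributes at most
  \<open>24 * x\<^sup>2\<close>, the rest of the table size at most \<open>8 * x ^ 3\<close>. With
  the bound \<open>12288 * x ^ 5\<close> for the rate, the total coefficient is
  \<open>400 * 192 + 3 * 12288 = 113664\<close>.\<close>

lemma init_time_le:
  fixes r p\<^sub>1 p\<^sub>2 :: real
  assumes s: "1 \<le> s" and d: "1 \<le> d" and p: "0 < p\<^sub>2" "p\<^sub>2 < p\<^sub>1" "p\<^sub>1 < 1" and r: "1 \<le> r" "r < real s * real d"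
  shows "real (400 * (2 ^ levels s d p\<^sub>2 * (blocks d * d) * 2 * d * (s + 1)) + 3 * rate s d r p\<^sub>1 p\<^sub>2)
    \<le> poly_bound 200000 5 (real (s * d) / ((1 - p\<^sub>1) * p\<^sub>2))"
proof -
  let ?L = "levels s d p\<^sub>2" and ?g = "rate s d r p\<^sub>1 p\<^sub>2"
  define z where "z = real s * real d"
  define x where "x = z / ((1 - p\<^sub>1) * p\<^sub>2)"
  have p2: "p\<^sub>2 < 1" "0 < p\<^sub>1" using p by simp_all
  have z: "1 \<le> z" using r by (simp add: z_def)
  have q: "0 < (1 - p\<^sub>1) * p\<^sub>2" "(1 - p\<^sub>1) * p\<^sub>2 \<le> p\<^sub>2" "(1 - p\<^sub>1) * p\<^sub>2 \<le> 1 - p\<^sub>1" "(1 - p\<^sub>1) * p\<^sub>2 \<le> 1"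
    using p by (auto simp: mult_le_cancel_right1 mult_le_cancel_left1 mult_le_one)
  have x: "z / p\<^sub>2 \<le> x" "z / (1 - p\<^sub>1) \<le> x" "z \<le> x"
    unfolding x_def using divide_left_mono[OF q(2)] divide_left_mono[OF q(3)] divide_left_mono[OF q(4)] q z p
    by (auto simp: zero_le_divide_iff)
  then have x1: "1 \<le> x" using z by simp
  have z0: "0 \<le> z" "0 \<le> z / p\<^sub>2" "0 \<le> z / (1 - p\<^sub>1)" using z p by auto
  note L = levels_props[OF s d p(1) p2(1), folded z_def]
  have N: "2 ^ ?L \<le> 24 * x\<^sup>2"
    using L(3) power_mono[OF x(1) z0(2), of 2] by linarith
  have "real (blocks d * d * 2 * d * (s + 1)) \<le> real (2 * d * d * 2 * d * (2 * s))"
    using blocks_props(3)[of d] d s by (intro of_nat_mono mult_le_mono) auto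
  also have "\<dots> \<le> 8 * z ^ 3"
  proof -
    have "real s * real d ^ 3 \<le> real s ^ 3 * real d ^ 3" using s by (intro mult_right_mono self_le_power) auto
    then show ?thesis by (simp add: z_def power_mult_distrib power3_eq_cube mult_ac)
  qed
  also have "\<dots> \<le> 8 * x ^ 3" using power_mono[OF x(3) z0(1)] by simp
  finally have "2 ^ ?L * real (blocks d * d * 2 * d * (s + 1)) \<le> 24 * x\<^sup>2 * (8 * x ^ 3)"
    using N by (intro mult_mono) auto
  moreover have "24 * x\<^sup>2 * (8 * x ^ 3) = 192 * x ^ 5" by (simp flip: power_add)
  moreover have "real (2 ^ ?L * (blocks d * d) * 2 * d * (s + 1)) = 2 ^ ?L * real (blocks d * d * 2 * d * (s + 1))"
    by (simp only: of_nat_mult of_nat_power of_nat_numeral mult.assoc)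
  ultimately have W: "real (2 ^ ?L * (blocks d * d) * 2 * d * (s + 1)) \<le> 192 * x ^ 5" by linarith
  have "real ?g \<le> 2 ^ ?g" using less_exp[of ?g] by (metis less_imp_le of_nat_le_iff of_nat_numeral of_nat_power)
  also have "\<dots> \<le> 512 * r * ?L / (1 - p\<^sub>1)"
    using rate_props(2)[OF p(3) p2(2) r(1) L(2)] p by (simp add: field_simps)
  also have "\<dots> = 512 * (r / (1 - p\<^sub>1)) * ?L" by simp
  also have "\<dots> \<le> 512 * x * (24 * x\<^sup>2)"
  proof (intro mult_mono)
    show "r / (1 - p\<^sub>1) \<le> x" using divide_right_mono[of r z "1 - p\<^sub>1"] r p x(2) by (simp add: z_def)
    have "real ?L \<le> 2 ^ ?L" using less_exp[of ?L] by (metis less_imp_le of_nat_le_iff of_nat_numeral of_nat_power)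
    then show "real ?L \<le> 24 * x\<^sup>2" using N by linarith
  qed (use x1 r p in auto)
  also have "\<dots> = 12288 * x ^ 3" by (simp add: power2_eq_square power3_eq_cube)
  also have "\<dots> \<le> 12288 * x ^ 5" using x1 by (intro mult_left_mono power_increasing) auto
  finally have "400 * real (2 ^ ?L * (blocks d * d) * 2 * d * (s + 1)) + 3 * real ?g \<le> 113664 * x ^ 5"
    using W by linarith
  also have "\<dots> \<le> 200000 * x ^ 5" using x1 by simp
  finally show ?thesis unfolding poly_bound_def x_def z_def by simp
qed

text \<open>The coefficient is \<open>2 * 512 * 11 = 11264\<close>: the 2 of
  \<open>prob_far\<close>, the upper bound on the sampling rate, and the bound on the number of
  levels.\<close>

lemma approximation_le:
  fixes r p\<^sub>1 p\<^sub>2 :: real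
  assumes s: "1 \<le> s" and d: "1 \<le> d" and p: "0 < p\<^sub>2" "p\<^sub>2 < p\<^sub>1" "p\<^sub>1 < 1" and r: "1 \<le> r" and y: "2 \<le> real s * real d / p\<^sub>2"
  shows "2 * ln (1 / p\<^sub>2) * 2 ^ rate s d r p\<^sub>1 p\<^sub>2 / r \<le> 200000 * (1 / (1 - p\<^sub>1) * ln (1 / p\<^sub>2) * ln (real (s * d) / p\<^sub>2))"
proof -
  let ?L = "real (levels s d p\<^sub>2)" and ?y = "real s * real d / p\<^sub>2"
  have p2: "p\<^sub>2 < 1" "0 < p\<^sub>1" using p by simp_all
  have l: "0 \<le> ln (1 / p\<^sub>2)" using p by simp
  have "2 ^ rate s d r p\<^sub>1 p\<^sub>2 / r \<le> 512 * ?L / (1 - p\<^sub>1)"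
    using rate_props(2)[OF p(3) p2(2) r levels_props(2)[OF s d p(1) p2(1)]] p r by (simp add: field_simps)
  also have "\<dots> \<le> 512 * (11 * ln ?y) / (1 - p\<^sub>1)"
    using levels_le_ln[OF s d p(1) p2(1) y] p by (intro divide_right_mono mult_left_mono) auto
  finally have "2 * ln (1 / p\<^sub>2) * (2 ^ rate s d r p\<^sub>1 p\<^sub>2 / r) \<le> 2 * ln (1 / p\<^sub>2) * (512 * (11 * ln ?y) / (1 - p\<^sub>1))"
    using l by (intro mult_left_mono) auto
  also have "\<dots> = 11264 * (1 / (1 - p\<^sub>1) * ln (1 / p\<^sub>2) * ln ?y)" by simp
  also have "\<dots> \<le> 200000 * (1 / (1 - p\<^sub>1) * ln (1 / p\<^sub>2) * ln ?y)"
    using p by (intro mult_right_mono mult_nonneg_nonneg l ln_ge_zero order_trans[OF _ y]) auto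
  finally show ?thesis by simp
qed

theorem theorem5p12:
  shows "\<exists>(Init :: program) (Query :: program) (C :: real) (k :: nat).
    \<forall>(p\<^sub>1 :: real) (p\<^sub>2 :: real) (s :: nat) (d :: nat) (r :: real).
      0 < p\<^sub>2 \<and> p\<^sub>2 < p\<^sub>1 \<and> p\<^sub>1 < 1 \<and> 1 \<le> s \<and> 1 \<le> d \<and> real s < r \<longrightarrow>
      (\<exists>(c :: real) (TI :: nat \<Rightarrow> nat) (TQ :: nat).
         1 \<le> c \<and>
         c \<le> soft_O_bound C k (1 / (1 - p\<^sub>1) * ln (1 / p\<^sub>2) * ln (real (s * d) / p\<^sub>2)) \<and>
         (\<forall>n. real (TI n) \<le> real n * poly_bound C k (real (s * d) / ((1 - p\<^sub>1) * p\<^sub>2))) \<and>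
         real TQ \<le> poly_bound C k (real (s * d)) \<and>
         data_dependent_hashing s d r c p\<^sub>1 p\<^sub>2 Init Query TI TQ)"
proof (rule exI[of _ Init], rule exI[of _ Query], rule exI[of _ 200000], rule exI[of _ 5], intro allI impI)
  fix p\<^sub>1 p\<^sub>2 :: real and s d :: nat and r :: real
  assume "0 < p\<^sub>2 \<and> p\<^sub>2 < p\<^sub>1 \<and> p\<^sub>1 < 1 \<and> 1 \<le> s \<and> 1 \<le> d \<and> real s < r"
  then have p: "0 < p\<^sub>2" "p\<^sub>2 < p\<^sub>1" "p\<^sub>1 < 1" and sd: "1 \<le> s" "1 \<le> d" and r: "real s < r" by auto
  then have r1: "1 \<le> r" by simp
  let ?f = "1 / (1 - p\<^sub>1) * ln (1 / p\<^sub>2) * ln (real (s * d) / p\<^sub>2)"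
  let ?x = "real (s * d) / ((1 - p\<^sub>1) * p\<^sub>2)"
  let ?TQ = "2 * (s * trie.vector_time d (blocks d)) + 70"
  show "\<exists>(c :: real) (TI :: nat \<Rightarrow> nat) (TQ :: nat). 1 \<le> c \<and> c \<le> soft_O_bound 200000 5 ?f \<and>
    (\<forall>n. real (TI n) \<le> real n * poly_bound 200000 5 ?x) \<and> real TQ \<le> poly_bound 200000 5 (real (s * d)) \<and>
    data_dependent_hashing s d r c p\<^sub>1 p\<^sub>2 Init Query TI TQ"
  \<comment> \<open>This is the comparison on which the initialization program itself
    branches.\<close>
  proof (cases "real s * real d \<le> r")
    case True
    have "(1 - p\<^sub>1) * p\<^sub>2 \<le> 1" "0 < (1 - p\<^sub>1) * p\<^sub>2" using p by (auto intro!: mult_le_one)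
    moreover have "1 \<le> real (s * d)" using sd by (metis mult_le_mono nat_mult_1 of_nat_1 of_nat_mono)
    ultimately have "1 \<le> ?x" by (simp add: le_divide_eq)
    then have "1 \<le> ?x ^ 5" by (rule one_le_power)
    then have "real (n * 20) \<le> real n * poly_bound 200000 5 ?x" for n
      unfolding poly_bound_def of_nat_mult by (intro mult_left_mono) auto
    moreover have "data_dependent_hashing s d r 1 p\<^sub>1 p\<^sub>2 Init Query (\<lambda>n. n * 20) ?TQ"
      by (rule trivial_hashing[OF sd p(3,1) True]) auto
    moreover have "1 \<le> soft_O_bound 200000 5 ?f" by (rule soft_O_bound_ge) auto
    ultimately show ?thesis using query_time_le[OF sd] by (intro exI[of _ 1] exI[of _ "\<lambda>n. n * 20"] exI[of _ ?TQ]) simp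
  next
    case False
    then have r2: "r < real s * real d" by simp
    let ?c = "max 1 (2 * ln (1 / p\<^sub>2) * 2 ^ rate s d r p\<^sub>1 p\<^sub>2 / r)"
    let ?t = "400 * (2 ^ levels s d p\<^sub>2 * (blocks d * d) * 2 * d * (s + 1)) + 3 * rate s d r p\<^sub>1 p\<^sub>2"
    \<comment> \<open>Here the threshold \<open>r > s\<close> excludes \<open>d = 1\<close>; hence
      \<open>s * d / p\<^sub>2 \<ge> 2\<close>, so that its logarithm can absorb additive
      constants.\<close>
    have "s < s * d" using r r2 by (metis less_trans of_nat_less_iff of_nat_mult)
    then have "2 \<le> d" by (cases d rule: nat.exhaust) auto
  then have "2 \<le> s * d" using mult_le_mono[OF sd(1), of 2 d] by simp
    then have "2 \<le> real s * real d" by (metis of_nat_le_iff of_nat_mult of_nat_numeral)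
    moreover have "real s * real d * p\<^sub>2 \<le> real s * real d * 1" using p by (intro mult_left_mono) auto
    ultimately have y: "2 \<le> real s * real d / p\<^sub>2" using p by (simp add: le_divide_eq)
    have "2 * ln (1 / p\<^sub>2) * 2 ^ rate s d r p\<^sub>1 p\<^sub>2 / r \<le> 200000 * ?f"
      by (rule approximation_le[OF sd p r1 y])
    then have "?c \<le> 200000 * max 1 ?f" by (auto simp: max_def)
    then have "?c \<le> soft_O_bound 200000 5 ?f" by (rule soft_O_bound_ge) simp
    moreover have "real (n * ?t) \<le> real n * poly_bound 200000 5 ?x" for n
      unfolding of_nat_mult[of n] by (rule mult_left_mono[OF init_time_le[OF sd p r1 r2]]) simp
    moreover have "2 * ln (1 / p\<^sub>2) * real (2 ^ rate s d r p\<^sub>1 p\<^sub>2) \<le> ?c * r"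
    proof -
      have "2 * ln (1 / p\<^sub>2) * real (2 ^ rate s d r p\<^sub>1 p\<^sub>2) = 2 * ln (1 / p\<^sub>2) * 2 ^ rate s d r p\<^sub>1 p\<^sub>2 / r * r" using r1 by simp
      also have "\<dots> \<le> ?c * r" using r1 by (intro mult_right_mono) auto
      finally show ?thesis .
    qed
    then have "data_dependent_hashing s d r ?c p\<^sub>1 p\<^sub>2 Init Query (\<lambda>n. n * ?t) ?TQ"
      by (intro trie_data_structure[OF sd p r1 r2]) simp_all
    ultimately show ?thesis
      using query_time_le[OF sd] by (intro exI[of _ ?c] exI[of _ "\<lambda>n. n * ?t"] exI[of _ ?TQ]) simp
  qed
qed

end
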